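(* Let $X,Y,A,B,Z,W$ be finite sets, let $\varphi_1$ be a quantum non-local game from $XY$ to $AB$, let $\varphi_2$ be a quantum non-local game from $AB$ to $ZW$, and let $\mathrm x\in\{\mathrm{loc},\mathrm q,\mathrm{qa},\mathrm{qc},\mathrm{ns}\}$. (i) If $\Gamma_i$ is a perfect strategy for $\varphi_i$ from the class $\mathcal Q_{\mathrm x}$, $i=1,2$, then $\Gamma_2\circ\Gamma_1$ is a perfect strategy for $\varphi_2\circ\varphi_1$ from the class $\mathcal Q_{\mathrm x}$. (ii) Assume that $X=Y$, $A=B$ and $Z=W$. If $\Gamma_i$ is a perfect tracial (resp. quantum tracial, locally tracial) strategy for $\varphi_i$, $i=1,2$, then $\Gamma_2\circ\Gamma_1$ is a perfect tracial (resp. quantum tracial, locally tracial) strategy for $\varphi_2\circ\varphi_1$.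
   Context: Notation: $M_X=\mathcal L(\mathbb C^X)$, $M_{XY}=M_X\otimes M_Y$, $(e_x)$ canonical basis, $\xi\eta^*$ the rank one operator $\zeta\mapsto\langle\zeta,\eta\rangle\xi$. $\mathcal P_{\mathcal M}$ is the projection lattice of a von Neumann algebra $\mathcal M$. Games: a quantum non-local game from $XY$ to $AB$ is a map $\varphi:\mathcal P_{M_{XY}}\to\mathcal P_{M_{AB}}$ with $\varphi(0)=0$ that is join continuous: $\varphi(\vee_iP_i)=\vee_i\varphi(P_i)$ for every family $(P_i)$. A QNS correlation $\Lambda:M_{XY}\to M_{AB}$ is a perfect strategy for $\varphi$ if $\langle\Lambda(P),\varphi(P)_\perp\rangle=0$ for all $P\in\mathcal P_{M_{XY}}$, where $Q_\perp=(I-Q)^{\mathrm d}$ is the projection onto the annihilator of $\mathrm{ran}\,Q$ in the dual space and $\langle\rho,\omega^{\mathrm d}\rangle=\mathrm{Tr}(\rho\omega)$; i.e. $\mathrm{Tr}(\Lambda(P)(I-\varphi(P)))=0$ for all $P$. The composition of games is composition of maps. QNS correlations: a completely positive trace preserving map $\Gamma:M_{XY}\to M_{AB}$ is a QNS correlation if $\mathrm{Tr}_A\Gamma(\rho_X\otimes\rho_Y)=0$ whenever $\mathrm{Tr}\rho_X=0$ and $\mathrm{Tr}_B\Gamma(\rho_X\otimes\rho_Y)=0$ whenever $\mathrm{Tr}\rho_Y=0$. A stochastic operator matrix over $(X,A)$ acting on $H$ is a positive $E=(E_{x,x',a,a'})=\sum e_xe_{x'}^*\otimes e_ae_{a'}^*\otimes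 E_{x,x',a,a'}\in M_X\otimes M_A\otimes\mathcal B(H)$ with $\sum_aE_{x,x',a,a}=\delta_{x,x'}I_H$ for all $x,x'$. Classes (for each choice of input and output sets): - $\mathcal Q_{\mathrm{ns}}$: all QNS correlations. - $\mathcal Q_{\mathrm{qc}}$: $\Gamma(e_xe_{x'}^*\otimes e_ye_{y'}^* )=\sum_{a,a',b,b'}\langle E_{x,x',a,a'}F_{y,y',b,b'}\xi,\xi\rangle e_ae_{a'}^*\otimes e_be_{b'}^*$ with $E$ over $(X,A)$, $F$ over $(Y,B)$ stochastic operator matrices on one Hilbert space $H$ with mutually commuting entries and $\xi\in H$ a unit vector. - $\mathcal Q_{\mathrm q}$: $\Gamma(e_xe_{x'}^*\otimes e_ye_{y'}^* )=\sum\langle(E_{x,x',a,a'}\otimes F_{y,y',b,b'})\xi,\xi\rangle e_ae_{a'}^*\otimes e_be_{b'}^*$ with $E,F$ stochastic operator matrices on finite dimensional $H_A$, $H_B$ and $\xi\in H_A\otimes H_B$ a unit vector. - $\mathcal Q_{\mathrm{qa}}$: limits of sequences from $\mathcal Q_{\mathrm q}$. - $\mathcal Q_{\mathrm{loc}}$: convex combinations of $\Phi\otimes\Psi$ with $\Phi:M_X\to M_A$, $\Psi:M_Y\to M_B$ quantum channels. Tracial correlations ($X=Y$, $A=B$): $\Gamma:M_{XX}\to M_{AA}$ is tracial if there exist a unital C*-algebra $\mathcal A$, a tracial state $\tau$ on $\mathcal A$ and a positive $(g_{x,x',a,a'})\in M_X\otimes M_A\otimes\mathcal A$ with $\sum_ag_{x,x',a,a}=\delta_{x,x'}1$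 for all $x,x'$, such that $\Gamma(e_xe_{x'}^*\otimes e_ye_{y'}^* )=\sum_{a,a',b,b'}\tau(g_{x,x',a,a'}g_{y',y,b',b})\,e_ae_{a'}^*\otimes e_be_{b'}^*$ (equivalently, $\Gamma$ arises in this way from a trace on the universal C*-algebra of a stochastic operator matrix); it is quantum tracial (resp. locally tracial) if $\mathcal A$ can be chosen finite dimensional (resp. abelian). *)

theory Defs
  imports "HOL-Analysis.Analysis" "HOL-Algebra.Module" "HOL-Algebra.Lattice"
begin

section \<open>Matrices\<close>

text \<open>Finite (non-empty) sets are finite types; \<open>M\<^sub>X\<close> is \<open>'x cmat\<close> and
  \<open>M\<^sub>X\<^sub>Y = M\<^sub>X \<otimes> M\<^sub>Y\<close> is \<open>('x \<times> 'y) cmat\<close>. The entry \<open>M $ i $ j\<close> is the coefficient of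
  \<open>e\<^sub>i e\<^sub>j\<^sup>*\<close>.\<close>

type_synonym 'm cmat = "complex^'m^'m"

definition cscale :: "complex \<Rightarrow> 'm cmat \<Rightarrow> 'm::finite cmat" where
  "cscale c M = (\<chi> i j. c * M $ i $ j)"

definition adj :: "'m cmat \<Rightarrow> 'm::finite cmat" where
  "adj M = (\<chi> i j. cnj (M $ j $ i))"

definition munit :: "'m \<Rightarrow> 'm \<Rightarrow> 'm::finite cmat" where
  "munit i j = (\<chi> k l. if k = i \<and> l = j then 1 else 0)"

definition kron :: "'m cmat \<Rightarrow> 'n cmat \<Rightarrow> ('m::finite \<times> 'n::finite) cmat" where
  "kron R S = (\<chi> p q. R $ fst p $ fst q * S $ snd p $ snd q)"

definition ptrace_fst :: "('m::finite \<times> 'n::finite) cmat \<Rightarrow> 'n cmat" where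
  "ptrace_fst M = (\<chi> b b'. \<Sum>a\<in>UNIV. M $ (a, b) $ (a, b'))"

definition ptrace_snd :: "('m::finite \<times> 'n::finite) cmat \<Rightarrow> 'm cmat" where
  "ptrace_snd M = (\<chi> a a'. \<Sum>b\<in>UNIV. M $ (a, b) $ (a', b))"

definition cdot :: "complex^'m::finite \<Rightarrow> complex^'m \<Rightarrow> complex" where
  "cdot u v = (\<Sum>k\<in>UNIV. u $ k * cnj (v $ k))"

section \<open>Quantum channels and no-signalling correlations\<close>

definition clinear_map :: "('m::finite cmat \<Rightarrow> 'n::finite cmat) \<Rightarrow> bool" where
  "clinear_map \<Gamma> \<longleftrightarrow> Vector_Spaces.linear cscale cscale \<Gamma>"

text \<open>Positivity of the block matrix \<open>(A i j)\<^bsub>i,j<n\<^esub>\<close> in \<open>M\<^sub>n \<otimes> \<L>(\<complex>\<^sup>m)\<close>.\<close>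

definition block_positive :: "nat \<Rightarrow> (nat \<Rightarrow> nat \<Rightarrow> 'm::finite cmat) \<Rightarrow> bool" where
  "block_positive n A \<longleftrightarrow>
     (\<forall>v :: nat \<Rightarrow> complex^'m. (\<Sum>i<n. \<Sum>j<n. cdot (A i j *v v j) (v i)) \<in> \<real>\<^sub>\<ge>\<^sub>0)"

definition completely_positive :: "('m::finite cmat \<Rightarrow> 'n::finite cmat) \<Rightarrow> bool" where
  "completely_positive \<Gamma> \<longleftrightarrow>
     clinear_map \<Gamma> \<and> (\<forall>n A. block_positive n A \<longrightarrow> block_positive n (\<lambda>i j. \<Gamma> (A i j)))"

definition quantum_channel :: "('m::finite cmat \<Rightarrow> 'n::finite cmat) \<Rightarrow> bool" where
  "quantum_channel \<Gamma> \<longleftrightarrow> completely_positive \<Gamma> \<and> (\<forall>M. trace (\<Gamma> M) = trace M)"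

definition qns :: "(('x::finite \<times> 'y::finite) cmat \<Rightarrow> ('a::finite \<times> 'b::finite) cmat) \<Rightarrow> bool" where
  "qns \<Gamma> \<longleftrightarrow> quantum_channel \<Gamma> \<and>
     (\<forall>\<rho> \<sigma>. trace \<rho> = 0 \<longrightarrow> ptrace_fst (\<Gamma> (kron \<rho> \<sigma>)) = 0) \<and>
     (\<forall>\<rho> \<sigma>. trace \<sigma> = 0 \<longrightarrow> ptrace_snd (\<Gamma> (kron \<rho> \<sigma>)) = 0)"

section \<open>Quantum non-local games\<close>

definition projections :: "'m::finite cmat set" where
  "projections = {P. P ** P = P \<and> adj P = P}"

definition proj_lattice :: "('m::finite cmat) gorder" where
  "proj_lattice = \<lparr>carrier = projections, eq = (=), le = (\<lambda>P Q. Q ** P = P)\<rparr>"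

definition qgame :: "('m::finite cmat \<Rightarrow> 'n::finite cmat) \<Rightarrow> bool" where
  "qgame \<phi> \<longleftrightarrow> (\<forall>P\<in>projections. \<phi> P \<in> projections) \<and> \<phi> 0 = 0 \<and>
     (\<forall>S\<subseteq>projections. \<phi> (\<Squnion>\<^bsub>proj_lattice\<^esub> S) = \<Squnion>\<^bsub>proj_lattice\<^esub> (\<phi> ` S))"

definition perfect_strategy ::
  "(('x::finite \<times> 'y::finite) cmat \<Rightarrow> ('a::finite \<times> 'b::finite) cmat) \<Rightarrow>
   (('x \<times> 'y) cmat \<Rightarrow> ('a \<times> 'b) cmat) \<Rightarrow> bool" where
  "perfect_strategy \<phi> \<Lambda> \<longleftrightarrow> qgame \<phi> \<and> qns \<Lambda> \<and>
     (\<forall>P\<in>projections. trace (\<Lambda> P ** (mat 1 - \<phi> P)) = 0)"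

section \<open>Hilbert spaces and C*-algebras\<close>

text \<open>The definitions below quantify existentially over Hilbert spaces and C*-algebras of arbitrary
  size, so these are structures on a carrier set inside a type. An existential quantifier over
  structures needs a fixed ambient type: we use \<open>'u universe\<close>, where \<open>'u\<close> is an arbitrary type, so
  that structures of any cardinality are covered; the second summand only ensures that the
  universe is never too small to hold the separable ones.\<close>

type_synonym 'u universe = "'u + (nat \<Rightarrow> complex)"

definition complex_scalars :: "complex ring" where
  "complex_scalars = \<lparr>carrier = UNIV, mult = (*), one = 1, zero = 0, add = (+)\<rparr>"

text \<open>As usual for vector spaces in HOL-Algebra, the fields \<open>mult\<close> and \<open>one\<close> inherited from
  \<open>ring\<close> play no role in a Hilbert space. Inner products are linear in the first variable.\<close>

record 'v inner_space = "(complex, 'v) module" +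
  ip :: "'v \<Rightarrow> 'v \<Rightarrow> complex"

definition ip_norm :: "('v, 'm) inner_space_scheme \<Rightarrow> 'v \<Rightarrow> real" where
  "ip_norm H u = sqrt (Re (ip H u u))"

locale complex_hilbert_space = Module.module complex_scalars H
  for H :: "('v, 'm) inner_space_scheme" (structure) +
  assumes ip_add: "\<lbrakk>u \<in> carrier H; v \<in> carrier H; w \<in> carrier H\<rbrakk> \<Longrightarrow> ip H (u \<oplus> v) w = ip H u w + ip H v w"
    and ip_smult: "\<lbrakk>u \<in> carrier H; v \<in> carrier H\<rbrakk> \<Longrightarrow> ip H (c \<odot> u) v = c * ip H u v"
    and ip_cnj: "\<lbrakk>u \<in> carrier H; v \<in> carrier H\<rbrakk> \<Longrightarrow> ip H v u = cnj (ip H u v)"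
    and ip_nonneg: "u \<in> carrier H \<Longrightarrow> ip H u u \<in> \<real>\<^sub>\<ge>\<^sub>0"
    and ip_definite: "\<lbrakk>u \<in> carrier H; ip H u u = 0\<rbrakk> \<Longrightarrow> u = \<zero>"
    and ip_complete:
      "\<lbrakk>\<forall>n. s n \<in> carrier H; \<forall>e>0. \<exists>N::nat. \<forall>m\<ge>N. \<forall>n\<ge>N. ip_norm H (s m \<ominus> s n) < e\<rbrakk>
       \<Longrightarrow> \<exists>l\<in>carrier H. (\<lambda>n. ip_norm H (s n \<ominus> l)) \<longlonglongrightarrow> 0"

definition bounded_operators :: "('v, 'm) inner_space_scheme \<Rightarrow> ('v \<Rightarrow> 'v) set" where
  "bounded_operators H = {T. (\<forall>u\<in>carrier H. T u \<in> carrier H) \<and>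
     (\<forall>u\<in>carrier H. \<forall>v\<in>carrier H. T (u \<oplus>\<^bsub>H\<^esub> v) = T u \<oplus>\<^bsub>H\<^esub> T v) \<and>
     (\<forall>c. \<forall>u\<in>carrier H. T (c \<odot>\<^bsub>H\<^esub> u) = c \<odot>\<^bsub>H\<^esub> T u) \<and>
     (\<exists>K. \<forall>u\<in>carrier H. ip_norm H (T u) \<le> K * ip_norm H u)}"

record 'v star_algebra = "(complex, 'v) module" +
  star :: "'v \<Rightarrow> 'v"
  anorm :: "'v \<Rightarrow> real"

locale unital_cstar_algebra = Ring.ring A + Module.module complex_scalars A
  for A :: "('v, 'm) star_algebra_scheme" (structure) +
  assumes smult_mult_left: "\<lbrakk>a \<in> carrier A; b \<in> carrier A\<rbrakk> \<Longrightarrow> (c \<odot> a) \<otimes> b = c \<odot> (a \<otimes> b)"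
    and smult_mult_right: "\<lbrakk>a \<in> carrier A; b \<in> carrier A\<rbrakk> \<Longrightarrow> a \<otimes> (c \<odot> b) = c \<odot> (a \<otimes> b)"
    and star_closed: "a \<in> carrier A \<Longrightarrow> star A a \<in> carrier A"
    and star_star: "a \<in> carrier A \<Longrightarrow> star A (star A a) = a"
    and star_add: "\<lbrakk>a \<in> carrier A; b \<in> carrier A\<rbrakk> \<Longrightarrow> star A (a \<oplus> b) = star A a \<oplus> star A b"
    and star_smult: "a \<in> carrier A \<Longrightarrow> star A (c \<odot> a) = cnj c \<odot> star A a"
    and star_mult: "\<lbrakk>a \<in> carrier A; b \<in> carrier A\<rbrakk> \<Longrightarrow> star A (a \<otimes> b) = star A b \<otimes> star A a"
    and anorm_nonneg: "a \<in> carrier A \<Longrightarrow> 0 \<le> anorm A a"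
    and anorm_definite: "\<lbrakk>a \<in> carrier A; anorm A a = 0\<rbrakk> \<Longrightarrow> a = \<zero>"
    and anorm_add: "\<lbrakk>a \<in> carrier A; b \<in> carrier A\<rbrakk> \<Longrightarrow> anorm A (a \<oplus> b) \<le> anorm A a + anorm A b"
    and anorm_smult: "a \<in> carrier A \<Longrightarrow> anorm A (c \<odot> a) = cmod c * anorm A a"
    and anorm_mult: "\<lbrakk>a \<in> carrier A; b \<in> carrier A\<rbrakk> \<Longrightarrow> anorm A (a \<otimes> b) \<le> anorm A a * anorm A b"
    and cstar_identity: "a \<in> carrier A \<Longrightarrow> anorm A (star A a \<otimes> a) = (anorm A a)\<^sup>2"
    and anorm_complete:
      "\<lbrakk>\<forall>n. s n \<in> carrier A; \<forall>e>0. \<exists>N::nat. \<forall>m\<ge>N. \<forall>n\<ge>N. anorm A (s m \<ominus> s n) < e\<rbrakk>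
       \<Longrightarrow> \<exists>l\<in>carrier A. (\<lambda>n. anorm A (s n \<ominus> l)) \<longlonglongrightarrow> 0"

definition finite_dimensional :: "('v, 'm) star_algebra_scheme \<Rightarrow> bool" where
  "finite_dimensional A \<longleftrightarrow> (\<exists>S. finite S \<and> S \<subseteq> carrier A \<and>
     (\<forall>a\<in>carrier A. \<exists>c. a = (\<Oplus>\<^bsub>A\<^esub>s\<in>S. c s \<odot>\<^bsub>A\<^esub> s)))"

definition abelian :: "('v, 'm) star_algebra_scheme \<Rightarrow> bool" where
  "abelian A \<longleftrightarrow> (\<forall>a\<in>carrier A. \<forall>b\<in>carrier A. a \<otimes>\<^bsub>A\<^esub> b = b \<otimes>\<^bsub>A\<^esub> a)"

definition tracial_state :: "('v, 'm) star_algebra_scheme \<Rightarrow> ('v \<Rightarrow> complex) \<Rightarrow> bool" where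
  "tracial_state A \<tau> \<longleftrightarrow>
     (\<forall>a\<in>carrier A. \<forall>b\<in>carrier A. \<tau> (a \<oplus>\<^bsub>A\<^esub> b) = \<tau> a + \<tau> b) \<and>
     (\<forall>c. \<forall>a\<in>carrier A. \<tau> (c \<odot>\<^bsub>A\<^esub> a) = c * \<tau> a) \<and>
     (\<forall>a\<in>carrier A. \<tau> (star A a \<otimes>\<^bsub>A\<^esub> a) \<in> \<real>\<^sub>\<ge>\<^sub>0) \<and>
     \<tau> \<one>\<^bsub>A\<^esub> = 1 \<and>
     (\<forall>a\<in>carrier A. \<forall>b\<in>carrier A. \<tau> (a \<otimes>\<^bsub>A\<^esub> b) = \<tau> (b \<otimes>\<^bsub>A\<^esub> a))"

section \<open>Stochastic operator matrices\<close>

text \<open>A block matrix \<open>E = (E x x' a a')\<close> has block row \<open>(x, a)\<close> and block column \<open>(x', a')\<close>.\<close>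

definition stochastic_operator_matrix ::
  "('v, 'm) inner_space_scheme \<Rightarrow>
   ('x::finite \<Rightarrow> 'x \<Rightarrow> 'a::finite \<Rightarrow> 'a \<Rightarrow> 'v \<Rightarrow> 'v) \<Rightarrow> bool" where
  "stochastic_operator_matrix H E \<longleftrightarrow>
     (\<forall>x x' a a'. E x x' a a' \<in> bounded_operators H) \<and>
     (\<forall>v. (\<forall>x a. v x a \<in> carrier H) \<longrightarrow>
        (\<Sum>x\<in>UNIV. \<Sum>x'\<in>UNIV. \<Sum>a\<in>UNIV. \<Sum>a'\<in>UNIV. ip H (E x x' a a' (v x' a')) (v x a)) \<in> \<real>\<^sub>\<ge>\<^sub>0) \<and>
     (\<forall>x x'. \<forall>u\<in>carrier H.
        (\<Oplus>\<^bsub>H\<^esub>a\<in>UNIV. E x x' a a u) = (if x = x' then u else \<zero>\<^bsub>H\<^esub>))"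

text \<open>The same notion on \<open>H = \<complex>\<^sup>d\<close>, with the operators given by their \<open>d \<times> d\<close> matrices
  (entries with an index \<open>\<ge> d\<close> are irrelevant).\<close>

definition stochastic_matrix_fin ::
  "nat \<Rightarrow> ('x::finite \<Rightarrow> 'x \<Rightarrow> 'a::finite \<Rightarrow> 'a \<Rightarrow> nat \<Rightarrow> nat \<Rightarrow> complex) \<Rightarrow> bool" where
  "stochastic_matrix_fin d E \<longleftrightarrow>
     (\<forall>v :: 'x \<Rightarrow> 'a \<Rightarrow> nat \<Rightarrow> complex.
        (\<Sum>x\<in>UNIV. \<Sum>x'\<in>UNIV. \<Sum>a\<in>UNIV. \<Sum>a'\<in>UNIV. \<Sum>i<d. \<Sum>j<d.
           E x x' a a' i j * v x' a' j * cnj (v x a i)) \<in> \<real>\<^sub>\<ge>\<^sub>0) \<and>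
     (\<forall>x x'. \<forall>i<d. \<forall>j<d. (\<Sum>a\<in>UNIV. E x x' a a i j) = (if x = x' \<and> i = j then 1 else 0))"

text \<open>Stochastic matrices over a C*-algebra \<open>\<A>\<close>. Positivity in \<open>M\<^sub>X \<otimes> M\<^sub>A \<otimes> \<A>\<close> is
  \<open>g = h\<^sup>* h\<close> for some \<open>h\<close> in the same algebra, written out in blocks.\<close>

definition stochastic_algebra_matrix ::
  "('v, 'm) star_algebra_scheme \<Rightarrow> ('x::finite \<Rightarrow> 'x \<Rightarrow> 'a::finite \<Rightarrow> 'a \<Rightarrow> 'v) \<Rightarrow> bool" where
  "stochastic_algebra_matrix A g \<longleftrightarrow>
     (\<exists>h :: 'x \<Rightarrow> 'x \<Rightarrow> 'a \<Rightarrow> 'a \<Rightarrow> 'v. (\<forall>x x' a a'. h x x' a a' \<in> carrier A) \<and>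
        (\<forall>x x' a a'. g x x' a a' =
           (\<Oplus>\<^bsub>A\<^esub>p\<in>UNIV. star A (h (fst p) x (snd p) a) \<otimes>\<^bsub>A\<^esub> h (fst p) x' (snd p) a'))) \<and>
     (\<forall>x x'. (\<Oplus>\<^bsub>A\<^esub>a\<in>UNIV. g x x' a a) = (if x = x' then \<one>\<^bsub>A\<^esub> else \<zero>\<^bsub>A\<^esub>))"

section \<open>Classes of correlations\<close>

definition tensor_map ::
  "('x::finite cmat \<Rightarrow> 'a::finite cmat) \<Rightarrow> ('y::finite cmat \<Rightarrow> 'b::finite cmat) \<Rightarrow>
   ('x \<times> 'y) cmat \<Rightarrow> ('a \<times> 'b) cmat" where
  "tensor_map \<Phi> \<Psi> M = (\<Sum>x\<in>UNIV. \<Sum>x'\<in>UNIV. \<Sum>y\<in>UNIV. \<Sum>y'\<in>UNIV.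
     cscale (M $ (x, y) $ (x', y')) (kron (\<Phi> (munit x x')) (\<Psi> (munit y y'))))"

definition Q_loc :: "(('x::finite \<times> 'y::finite) cmat \<Rightarrow> ('a::finite \<times> 'b::finite) cmat) set" where
  "Q_loc = {\<Gamma>. \<exists>(n::nat) (p :: nat \<Rightarrow> real) \<Phi> \<Psi>.
     (\<forall>k<n. 0 \<le> p k \<and> quantum_channel (\<Phi> k) \<and> quantum_channel (\<Psi> k)) \<and> (\<Sum>k<n. p k) = 1 \<and>
     (\<forall>M. \<Gamma> M = (\<Sum>k<n. p k *\<^sub>R tensor_map (\<Phi> k) (\<Psi> k) M))}"

text \<open>Finite dimensional Hilbert spaces are \<open>\<complex>\<^sup>d\<close> and \<open>\<complex>\<^sup>e\<close>; a vector of the tensor product is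
  given by its coefficients \<open>\<xi> i j\<close>, \<open>i < d\<close>, \<open>j < e\<close>.\<close>

definition Q_q :: "(('x::finite \<times> 'y::finite) cmat \<Rightarrow> ('a::finite \<times> 'b::finite) cmat) set" where
  "Q_q = {\<Gamma>. clinear_map \<Gamma> \<and> (\<exists>(d::nat) (e::nat) E F (\<xi> :: nat \<Rightarrow> nat \<Rightarrow> complex).
     stochastic_matrix_fin d E \<and> stochastic_matrix_fin e F \<and>
     (\<Sum>i<d. \<Sum>j<e. (cmod (\<xi> i j))\<^sup>2) = 1 \<and>
     (\<forall>x x' y y' a a' b b'. \<Gamma> (kron (munit x x') (munit y y')) $ (a, b) $ (a', b') =
        (\<Sum>i<d. \<Sum>j<e. (\<Sum>i'<d. \<Sum>j'<e. E x x' a a' i i' * F y y' b b' j j' * \<xi> i' j') * cnj (\<xi> i j))))}"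

definition Q_qa :: "(('x::finite \<times> 'y::finite) cmat \<Rightarrow> ('a::finite \<times> 'b::finite) cmat) set" where
  "Q_qa = {\<Gamma>. \<exists>G. (\<forall>n::nat. G n \<in> Q_q) \<and> (\<forall>M. (\<lambda>n. G n M) \<longlonglongrightarrow> \<Gamma> M)}"

definition Q_qc ::
  "'u itself \<Rightarrow> (('x::finite \<times> 'y::finite) cmat \<Rightarrow> ('a::finite \<times> 'b::finite) cmat) set" where
  "Q_qc U = {\<Gamma>. clinear_map \<Gamma> \<and> (\<exists>(H :: 'u universe inner_space) E F \<xi>.
     complex_hilbert_space H \<and>
     stochastic_operator_matrix H E \<and> stochastic_operator_matrix H F \<and>
     (\<forall>x x' a a' y y' b b'. \<forall>u\<in>carrier H.
        E x x' a a' (F y y' b b' u) = F y y' b b' (E x x' a a' u)) \<and>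
     \<xi> \<in> carrier H \<and> ip H \<xi> \<xi> = 1 \<and>
     (\<forall>x x' y y' a a' b b'. \<Gamma> (kron (munit x x') (munit y y')) $ (a, b) $ (a', b') =
        ip H (E x x' a a' (F y y' b b' \<xi>)) \<xi>))}"

definition Q_ns :: "(('x::finite \<times> 'y::finite) cmat \<Rightarrow> ('a::finite \<times> 'b::finite) cmat) set" where
  "Q_ns = {\<Gamma>. qns \<Gamma>}"

datatype corr_type = C_loc | C_q | C_qa | C_qc | C_ns

primrec Q_class :: "'u itself \<Rightarrow> corr_type \<Rightarrow>
    (('x::finite \<times> 'y::finite) cmat \<Rightarrow> ('a::finite \<times> 'b::finite) cmat) set" where
  "Q_class U C_loc = Q_loc"
| "Q_class U C_q = Q_q"
| "Q_class U C_qa = Q_qa"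
| "Q_class U C_qc = Q_qc U"
| "Q_class U C_ns = Q_ns"

section \<open>Tracial correlations\<close>

definition tracial_over :: "('v, 'm) star_algebra_scheme \<Rightarrow>
    (('x::finite \<times> 'x) cmat \<Rightarrow> ('a::finite \<times> 'a) cmat) \<Rightarrow> bool" where
  "tracial_over A \<Gamma> \<longleftrightarrow> clinear_map \<Gamma> \<and> (\<exists>\<tau> g.
     tracial_state A \<tau> \<and> stochastic_algebra_matrix A g \<and>
     (\<forall>x x' y y' a a' b b'. \<Gamma> (kron (munit x x') (munit y y')) $ (a, b) $ (a', b') =
        \<tau> (g x x' a a' \<otimes>\<^bsub>A\<^esub> g y' y b' b)))"

definition tracial ::
  "'u itself \<Rightarrow> (('x::finite \<times> 'x) cmat \<Rightarrow> ('a::finite \<times> 'a) cmat) \<Rightarrow> bool" where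
  "tracial U \<Gamma> \<longleftrightarrow> (\<exists>A :: 'u universe star_algebra. unital_cstar_algebra A \<and> tracial_over A \<Gamma>)"

definition quantum_tracial ::
  "'u itself \<Rightarrow> (('x::finite \<times> 'x) cmat \<Rightarrow> ('a::finite \<times> 'a) cmat) \<Rightarrow> bool" where
  "quantum_tracial U \<Gamma> \<longleftrightarrow> (\<exists>A :: 'u universe star_algebra.
     unital_cstar_algebra A \<and> finite_dimensional A \<and> tracial_over A \<Gamma>)"

definition locally_tracial ::
  "'u itself \<Rightarrow> (('x::finite \<times> 'x) cmat \<Rightarrow> ('a::finite \<times> 'a) cmat) \<Rightarrow> bool" where
  "locally_tracial U \<Gamma> \<longleftrightarrow> (\<exists>A :: 'u universe star_algebra.
     unital_cstar_algebra A \<and> abelian A \<and> tracial_over A \<Gamma>)"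

end

theory Submission
  imports Defs
begin

text \<open>Perfectness: \<open>\<Gamma>\<^sub>1(P)\<close> is supported on the range of \<open>\<phi>\<^sub>1(P)\<close>, hence \<open>\<Gamma>\<^sub>1(P) \<le> c \<phi>\<^sub>1(P)\<close> for some \<open>c\<close>,
  and \<open>\<Gamma>\<^sub>2\<close> preserves this inequality.

  Classes: the composition of two correlations is represented by the tensor product of their models,
  with the stochastic operator matrix \<open>\<Sum>\<^sub>a\<^sub>,\<^sub>a\<^sub>' E\<^sub>1(x,x',a,a') \<otimes> E\<^sub>2(a,a',z,z')\<close>. To stay within a given
  universe of carriers, Hilbert spaces and algebras are first cut down to countably generated ones
  and, by Gram-Schmidt (for a trace, applied to its GNS form), moved to \<open>\<ell>\<^sup>2\<close>. No C*-tensor product is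
  needed for the tracial classes: the algebra of a composition is the commutant of the right
  multiplications on the tensor product of the GNS spaces, on which the vector state of the trace
  vector is automatically tracial.\<close>

section \<open>The Hilbert space of square-summable families\<close>

text \<open>An existential over Hilbert spaces or C*-algebras ranges over carriers in one fixed type
  \<open>'u universe\<close>, so a composed model has to be injected into that type. Cardinal
  arithmetic for tensor products and commutants is avoided by working over countable index types,
  where a vector is determined by a sequence of coordinates and an operator by a sequence of matrix
  entries. Gram-Schmidt meets dependent vectors, and the resulting null vectors leave coordinates to
  be discarded. The model space is therefore the range of an idempotent \<open>P\<close> on l^2, and
  \<open>P\<close> replaces the identity. Positivity of a tracial stochastic matrix is asked for as
  h^* h with the same index set for the rows and columns of h, while composing two factorizations
  gives more rows. Making the factor square takes a square root inside the algebra. In a commutant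
  it exists: it is a limit of polynomials and commutes with whatever its square commutes with. The
  trace comes from an antiunitary flip, which sends R \<Omega> to R^* \<Omega> for right
  multiplications R and T \<Omega> to T^* \<Omega> for T in the commutant.\<close>

typedef 'i ell2 = "{f :: 'i \<Rightarrow> complex. (\<lambda>i. (cmod (f i))\<^sup>2) summable_on UNIV}"
  morphisms coef Abs_ell2
  by (rule exI[of _ "\<lambda>_. 0"]) simp

setup_lifting type_definition_ell2

lemma coef_inject_ext: "(\<And>i. coef f i = coef g i) \<Longrightarrow> f = g"
  by (metis coef_inject ext)

lemma mult_cnj_cmod: "z * cnj z = complex_of_real ((cmod z)\<^sup>2)"
  by (simp only: complex_norm_square)

lemma square_sum_add_le: "(cmod (a + b))\<^sup>2 \<le> 2 * (cmod a)\<^sup>2 + 2 * (cmod b)\<^sup>2"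
proof -
  have "(cmod (a + b))\<^sup>2 \<le> (cmod a + cmod b)\<^sup>2"
    by (intro power_mono norm_triangle_ineq norm_ge_zero)
  also have "\<dots> \<le> 2 * (cmod a)\<^sup>2 + 2 * (cmod b)\<^sup>2"
    using sum_squares_bound[of "cmod a" "cmod b"] by (simp add: power2_sum)
  finally show ?thesis .
qed

lemma square_summable_add:
  assumes "(\<lambda>i. (cmod (f i))\<^sup>2) summable_on UNIV" "(\<lambda>i. (cmod (g i))\<^sup>2) summable_on UNIV"
  shows "(\<lambda>i. (cmod (f i + g i))\<^sup>2) summable_on UNIV"
proof (rule summable_on_comparison_test)
  show "(\<lambda>i. 2 * (cmod (f i))\<^sup>2 + 2 * (cmod (g i))\<^sup>2) summable_on UNIV"
    by (intro summable_on_add summable_on_cmult_right assms)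
qed (auto simp: square_sum_add_le)

lemma square_summable_scale:
  assumes "(\<lambda>i. (cmod (f i))\<^sup>2) summable_on UNIV"
  shows "(\<lambda>i. (cmod (c * f i))\<^sup>2) summable_on UNIV"
  using summable_on_cmult_right[OF assms, of "(cmod c)\<^sup>2"]
  by (simp add: norm_mult power_mult_distrib)

instantiation ell2 :: (type) real_vector
begin

lift_definition zero_ell2 :: "'a ell2" is "\<lambda>_. 0" by simp

lift_definition plus_ell2 :: "'a ell2 \<Rightarrow> 'a ell2 \<Rightarrow> 'a ell2" is "\<lambda>f g i. f i + g i"
  using square_summable_add by auto

lift_definition uminus_ell2 :: "'a ell2 \<Rightarrow> 'a ell2" is "\<lambda>f i. - f i" by simp

lift_definition minus_ell2 :: "'a ell2 \<Rightarrow> 'a ell2 \<Rightarrow> 'a ell2" is "\<lambda>f g i. f i - g i"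
  using square_summable_add square_summable_scale[of _ "-1"] by fastforce

lift_definition scaleR_ell2 :: "real \<Rightarrow> 'a ell2 \<Rightarrow> 'a ell2" is "\<lambda>r f i. complex_of_real r * f i"
  using square_summable_scale by auto

instance
  by standard
    (auto intro!: coef_inject_ext
      simp: plus_ell2.rep_eq zero_ell2.rep_eq uminus_ell2.rep_eq minus_ell2.rep_eq scaleR_ell2.rep_eq
        algebra_simps)

end

lift_definition cs :: "complex \<Rightarrow> 'i ell2 \<Rightarrow> 'i ell2" is "\<lambda>c f i. c * f i"
  using square_summable_scale by auto

lemma coef_simps [simp]:
  "coef 0 i = 0" "coef (f + g) i = coef f i + coef g i" "coef (- f) i = - coef f i"
  "coef (f - g) i = coef f i - coef g i" "coef (r *\<^sub>R f) i = complex_of_real r * coef f i"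
  "coef (cs c f) i = c * coef f i"
  by (auto simp: zero_ell2.rep_eq plus_ell2.rep_eq uminus_ell2.rep_eq minus_ell2.rep_eq
      scaleR_ell2.rep_eq cs.rep_eq)

lemma coef_sum [simp]: "coef (\<Sum>x\<in>A. f x) i = (\<Sum>x\<in>A. coef (f x) i)"
  by (induction A rule: infinite_finite_induct) auto

lemma coef_square_summable: "(\<lambda>i. (cmod (coef f i))\<^sup>2) summable_on UNIV"
  using coef[of f] by simp

lemma coef_mult_summable: "(\<lambda>i. coef f i * cnj (coef g i)) summable_on UNIV"
proof -
  have "(\<lambda>i. norm (coef f i * cnj (coef g i))) summable_on UNIV"
    by (rule abs_summable_product)
      (use coef_square_summable[of f] coef_square_summable[of g]
        in \<open>simp_all add: norm_mult power2_eq_square\<close>)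
  then show ?thesis by (rule abs_summable_summable)
qed

section \<open>The complex inner product\<close>

definition cip :: "'i ell2 \<Rightarrow> 'i ell2 \<Rightarrow> complex" where
  "cip f g = infsum (\<lambda>i. coef f i * cnj (coef g i)) UNIV"

lemma cip_has_sum: "((\<lambda>i. coef f i * cnj (coef g i)) has_sum cip f g) UNIV"
  unfolding cip_def by (rule has_sum_infsum[OF coef_mult_summable])

lemma cip_commute: "cnj (cip f g) = cip g f"
  unfolding cip_def by (simp add: infsum_cnj[symmetric] mult.commute del: infsum_cnj)

lemma cip_add_left: "cip (f + g) h = cip f h + cip g h"
proof -
  have "((\<lambda>i. coef f i * cnj (coef h i) + coef g i * cnj (coef h i)) has_sum cip f h + cip g h) UNIV"
    by (intro has_sum_add cip_has_sum)
  then show ?thesis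
    using cip_has_sum[of "f + g" h] by (auto simp: algebra_simps dest: has_sum_unique)
qed

lemma cip_cs_left: "cip (cs c f) h = c * cip f h"
proof -
  have "((\<lambda>i. c * (coef f i * cnj (coef h i))) has_sum c * cip f h) UNIV"
    by (intro has_sum_cmult_right cip_has_sum)
  then show ?thesis
    using cip_has_sum[of "cs c f" h] by (auto simp: algebra_simps dest: has_sum_unique)
qed

lemma scaleR_cs: "r *\<^sub>R f = cs (complex_of_real r) f"
  by (rule coef_inject_ext) simp

lemma cip_self_has_sum: "((\<lambda>i. (cmod (coef f i))\<^sup>2) has_sum Re (cip f f)) UNIV"
  using has_sum_Re[OF cip_has_sum[of f f]]
  by (simp add: mult_cnj_cmod del: of_real_power)

lemma cip_self_real: "cip f f = complex_of_real (Re (cip f f))"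
proof (rule complex_eqI)
  have "cnj (cip f f) = cip f f" by (rule cip_commute)
  then show "Im (cip f f) = Im (complex_of_real (Re (cip f f)))"
    by (simp add: complex_eq_iff)
qed simp

lemma cip_self_eq_0: "Re (cip f f) = 0 \<Longrightarrow> f = 0"
proof -
  assume "Re (cip f f) = 0"
  then have "(cmod (coef f i))\<^sup>2 = 0" for i
    using nonneg_has_sum_le_0D[OF cip_self_has_sum[of f]] by simp
  then show "f = 0" by (intro coef_inject_ext) simp
qed

instantiation ell2 :: (type) real_inner
begin

definition inner_ell2 :: "'a ell2 \<Rightarrow> 'a ell2 \<Rightarrow> real" where "inner_ell2 f g = Re (cip f g)"
definition norm_ell2 :: "'a ell2 \<Rightarrow> real" where "norm_ell2 f = sqrt (inner f f)"
definition dist_ell2 :: "'a ell2 \<Rightarrow> 'a ell2 \<Rightarrow> real" where "dist_ell2 f g = norm (f - g)"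
definition sgn_ell2 :: "'a ell2 \<Rightarrow> 'a ell2" where "sgn_ell2 f = inverse (norm f) *\<^sub>R f"
definition uniformity_ell2 :: "('a ell2 \<times> 'a ell2) filter" where
  "uniformity_ell2 = (INF e\<in>{0<..}. principal {(x, y). dist x y < e})"
definition open_ell2 :: "'a ell2 set \<Rightarrow> bool" where
  "open_ell2 S = (\<forall>x\<in>S. \<forall>\<^sub>F (x', y) in uniformity. x' = x \<longrightarrow> y \<in> S)"

instance
proof
  fix x y z :: "'a ell2" and r :: real
  show "dist x y = norm (x - y)" by (simp add: dist_ell2_def)
  show "sgn x = inverse (norm x) *\<^sub>R x" by (simp add: sgn_ell2_def)
  show "norm x = sqrt (inner x x)" by (simp add: norm_ell2_def)
  show "inner x y = inner y x"
    using cip_commute[of x y] by (metis cnj.simps(1) inner_ell2_def)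
  show "inner (x + y) z = inner x z + inner y z" by (simp add: inner_ell2_def cip_add_left)
  show "inner (r *\<^sub>R x) y = r * inner x y" by (simp add: inner_ell2_def scaleR_cs cip_cs_left)
  show "0 \<le> inner x x"
    unfolding inner_ell2_def by (rule has_sum_nonneg[OF cip_self_has_sum]) simp
  show "inner x x = 0 \<longleftrightarrow> x = 0"
    using cip_self_eq_0[of x] by (auto simp: inner_ell2_def cip_def)
qed (auto simp: uniformity_ell2_def open_ell2_def)

end

lemma Re_cip_self: "Re (cip f f) = (norm f)\<^sup>2"
  by (simp add: inner_ell2_def[symmetric] power2_norm_eq_inner)

lemma cip_self: "cip f f = complex_of_real ((norm f)\<^sup>2)"
  using cip_self_real[of f] by (simp add: Re_cip_self)

lemma norm_square_has_sum: "((\<lambda>i. (cmod (coef f i))\<^sup>2) has_sum (norm f)\<^sup>2) UNIV"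
  using cip_self_has_sum[of f] by (simp add: Re_cip_self)

lemma sum_coef_square_le: "finite F \<Longrightarrow> (\<Sum>i\<in>F. (cmod (coef f i))\<^sup>2) \<le> (norm f)\<^sup>2"
  by (rule finite_sum_le_has_sum[OF norm_square_has_sum]) auto

lemma coef_le_norm: "cmod (coef f i) \<le> norm f"
  using sum_coef_square_le[of "{i}" f] by (simp add: power2_le_iff_abs_le)

lemma norm_ell2_le:
  assumes "\<And>F. finite F \<Longrightarrow> (\<Sum>i\<in>F. (cmod (coef f i))\<^sup>2) \<le> B\<^sup>2" "0 \<le> B"
  shows "norm f \<le> B"
  using has_sum_le_finite_sums[OF norm_square_has_sum assms(1)] assms(2)
  by (simp add: power2_le_iff_abs_le)

lemma square_summableI:
  assumes "\<And>F. finite F \<Longrightarrow> (\<Sum>i\<in>F. (cmod (f i))\<^sup>2) \<le> B"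
  shows "(\<lambda>i. (cmod (f i))\<^sup>2) summable_on UNIV"
  by (rule nonneg_bdd_above_summable_on) (auto intro!: bdd_aboveI2 assms)

lemma norm_cs [simp]: "norm (cs c f) = cmod c * norm f"
proof -
  have "(norm (cs c f))\<^sup>2 = (cmod c * norm f)\<^sup>2"
  proof -
    have "cip (cs c f) (cs c f) = c * cnj c * cip f f"
      by (metis cip_commute cip_cs_left complex_cnj_mult mult.assoc)
    then have "complex_of_real ((norm (cs c f))\<^sup>2) = complex_of_real ((cmod c * norm f)\<^sup>2)"
      unfolding cip_self mult_cnj_cmod by (simp add: power_mult_distrib)
    then show ?thesis using of_real_eq_iff by blast
  qed
  then show ?thesis by (simp add: power2_eq_iff_nonneg)
qed

lemma cip_add_right: "cip f (g + h) = cip f g + cip f h"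
  by (metis cip_add_left cip_commute complex_cnj_add)

lemma cip_cs_right: "cip f (cs c g) = cnj c * cip f g"
  by (metis cip_commute cip_cs_left complex_cnj_mult)

lemma cip_zero [simp]: "cip 0 f = 0" "cip f 0 = 0"
  by (simp_all add: cip_def)

lemma cip_minus_left: "cip (f - g) h = cip f h - cip g h"
  by (metis cip_add_left diff_add_cancel add_diff_cancel_right')

lemma cip_minus_right: "cip h (f - g) = cip h f - cip h g"
  by (metis cip_add_right diff_add_cancel add_diff_cancel_right')

lemma cip_sum_left: "cip (\<Sum>x\<in>A. f x) g = (\<Sum>x\<in>A. cip (f x) g)"
  by (induction A rule: infinite_finite_induct) (auto simp: cip_add_left)

lemma cip_sum_right: "cip g (\<Sum>x\<in>A. f x) = (\<Sum>x\<in>A. cip g (f x))"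
  by (induction A rule: infinite_finite_induct) (auto simp: cip_add_right)

lemma cmod_cip_le: "cmod (cip f g) \<le> norm f * norm g"
proof (cases "cip f g = 0")
  case False
  \<comment> \<open>The phase \<open>u\<close> rotates \<open>cip f g\<close> onto its modulus, so
    the complex inequality reduces to Cauchy-Schwarz for the real inner product.\<close>
  define u where "u = cnj (cip f g) / complex_of_real (cmod (cip f g))"
  have "cmod u = 1" using False by (simp add: u_def norm_divide)
  have "cip (cs u f) g = complex_of_real (cmod (cip f g))"
    using False
    by (simp add: u_def cip_cs_left mult.commute[of "cnj _"] mult_cnj_cmod power2_eq_square
        del: of_real_power)
  then have "cmod (cip f g) = inner (cs u f) g" by (simp add: inner_ell2_def)
  also have "\<dots> \<le> norm (cs u f) * norm g" by (rule norm_cauchy_schwarz)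
  finally show ?thesis using \<open>cmod u = 1\<close> by simp
qed simp

lemma bounded_linear_cs: "bounded_linear (cs c)"
  by (rule bounded_linear_intro[of _ "cmod c"])
    (auto intro!: coef_inject_ext simp: algebra_simps)

lemma bounded_bilinear_cip: "bounded_bilinear cip"
  by (rule bounded_bilinear.intro)
    (auto simp: cip_add_left cip_add_right scaleR_cs cip_cs_left cip_cs_right scaleR_conv_of_real
      intro!: exI[of _ 1] cmod_cip_le)

lemma bounded_linear_coef: "bounded_linear (\<lambda>f. coef f i)"
  by (rule bounded_linear_intro[of _ 1]) (auto simp: coef_le_norm scaleR_conv_of_real)

lemmas tendsto_cip = bounded_bilinear.tendsto[OF bounded_bilinear_cip]

instance ell2 :: (type) complete_space
proof
  fix X :: "nat \<Rightarrow> 'a ell2"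
  assume X: "Cauchy X"
  have "convergent (\<lambda>n. coef (X n) i)" for i
    using bounded_linear.Cauchy[OF bounded_linear_coef X] by (rule Cauchy_convergent)
  then obtain g where g: "\<And>i. (\<lambda>n. coef (X n) i) \<longlonglongrightarrow> g i"
    unfolding convergent_def by metis
  \<comment> \<open>Finitely many coordinates pass to the limit, which yields a bound uniform in
    \<open>F\<close>. It serves twice: for the square-summability of \<open>g\<close> and for
    convergence in norm.\<close>
  have close: "(\<Sum>i\<in>F. (cmod (coef (X n) i - g i))\<^sup>2) \<le> e\<^sup>2"
    if "finite F" and N: "\<And>m n. m \<ge> N \<Longrightarrow> n \<ge> N \<Longrightarrow> norm (X m - X n) < e" and "n \<ge> N" "0 < e" for F N e n
  proof (rule tendsto_le)
    show "(\<lambda>m. \<Sum>i\<in>F. (cmod (coef (X n) i - coef (X m) i))\<^sup>2)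
            \<longlonglongrightarrow> (\<Sum>i\<in>F. (cmod (coef (X n) i - g i))\<^sup>2)"
      by (intro tendsto_intros g)
    show "(\<lambda>m. e\<^sup>2) \<longlonglongrightarrow> e\<^sup>2" by simp
    show "\<forall>\<^sub>F m in sequentially. (\<Sum>i\<in>F. (cmod (coef (X n) i - coef (X m) i))\<^sup>2) \<le> e\<^sup>2"
      unfolding eventually_sequentially
    proof (intro exI allI impI)
      fix m assume "m \<ge> N"
      have "(\<Sum>i\<in>F. (cmod (coef (X n) i - coef (X m) i))\<^sup>2) \<le> (norm (X n - X m))\<^sup>2"
        using sum_coef_square_le[OF \<open>finite F\<close>, of "X n - X m"] by simp
      also have "\<dots> \<le> e\<^sup>2" using N[OF \<open>n \<ge> N\<close> \<open>m \<ge> N\<close>] by (intro power_mono) auto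
      finally show "(\<Sum>i\<in>F. (cmod (coef (X n) i - coef (X m) i))\<^sup>2) \<le> e\<^sup>2" .
    qed
  qed simp
  have Cau: "\<exists>N. \<forall>m\<ge>N. \<forall>n\<ge>N. norm (X m - X n) < e" if "e > 0" for e
    using X that unfolding Cauchy_def dist_norm by blast
  obtain N1 where N1: "\<And>m n. m \<ge> N1 \<Longrightarrow> n \<ge> N1 \<Longrightarrow> norm (X m - X n) < 1"
    using Cau[of 1] by auto
  have "(\<lambda>i. (cmod (coef (X N1) i - g i))\<^sup>2) summable_on UNIV"
    using close[OF _ N1, of _ N1] by (intro square_summableI[of _ "1\<^sup>2"]) auto
  \<comment> \<open>\<open>g\<close> is the difference of \<open>X N1\<close> and
    \<open>X N1 - g\<close>, both square-summable.\<close>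
  then have "(\<lambda>i. (cmod (coef (X N1) i + - 1 * (coef (X N1) i - g i)))\<^sup>2) summable_on UNIV"
    by (intro square_summable_add square_summable_scale coef_square_summable)
  then have "(\<lambda>i. (cmod (g i))\<^sup>2) summable_on UNIV" by simp
  then have cg: "coef (Abs_ell2 g) = g" by (simp add: Abs_ell2_inverse)
  have "X \<longlonglongrightarrow> Abs_ell2 g"
  proof (rule LIMSEQ_I)
    fix r :: real assume "0 < r"
    obtain N where N: "\<And>m n. m \<ge> N \<Longrightarrow> n \<ge> N \<Longrightarrow> norm (X m - X n) < r / 2"
      using Cau[of "r / 2"] \<open>0 < r\<close> by auto
    have "norm (X n - Abs_ell2 g) < r" if "n \<ge> N" for n
    proof -
      have "norm (X n - Abs_ell2 g) \<le> r / 2"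
        using close[OF _ N that] \<open>0 < r\<close> by (intro norm_ell2_le) (auto simp: cg)
      then show ?thesis using \<open>0 < r\<close> by simp
    qed
    then show "\<exists>N. \<forall>n\<ge>N. norm (X n - Abs_ell2 g) < r" by blast
  qed
  then show "convergent X" unfolding convergent_def by blast
qed

instance ell2 :: (type) banach ..

subsection \<open>The canonical basis\<close>

lemma indicator_square_summable:
  "(\<lambda>j. (cmod (if j = i then 1 else 0))\<^sup>2) summable_on UNIV"
proof (rule square_summableI[of _ 1])
  fix F :: "'a set" assume "finite F"
  have "(\<Sum>j\<in>F. (cmod (if j = i then 1 else 0))\<^sup>2) = (\<Sum>j\<in>F. if j = i then 1 else 0)"
    by (intro sum.cong) auto
  then show "(\<Sum>j\<in>F. (cmod (if j = i then 1 else 0))\<^sup>2) \<le> 1" using \<open>finite F\<close> by simp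
qed

lift_definition ket :: "'i \<Rightarrow> 'i ell2" is "\<lambda>i j. if j = i then 1 else 0"
  by (rule indicator_square_summable)

lemma coef_ket [simp]: "coef (ket i) j = (if j = i then 1 else 0)"
  by (simp add: ket.rep_eq)

lemma cip_ket_right [simp]: "cip f (ket i) = coef f i"
proof -
  have "((\<lambda>j. coef f j * cnj (coef (ket i) j)) has_sum coef f i) UNIV"
    by (rule has_sum_finite_neutralI[of "{i}"]) auto
  then show ?thesis using cip_has_sum has_sum_unique by blast
qed

lemma cip_ket_left [simp]: "cip (ket i) f = cnj (coef f i)"
  by (metis cip_commute cip_ket_right)

lemma norm_ket [simp]: "norm (ket i) = 1"
proof -
  have "(norm (ket i))\<^sup>2 = Re (cip (ket i) (ket i))" by (rule Re_cip_self[symmetric])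
  then show ?thesis by (simp add: power2_eq_1_iff) (use norm_ge_zero[of "ket i"] in linarith)
qed

lemma norm_sum_ket:
  assumes "finite F"
  shows "(norm (\<Sum>i\<in>F. cs (a i) (ket i)))\<^sup>2 = (\<Sum>i\<in>F. (cmod (a i))\<^sup>2)"
proof -
  have "complex_of_real ((norm (\<Sum>i\<in>F. cs (a i) (ket i)))\<^sup>2) = complex_of_real (\<Sum>i\<in>F. (cmod (a i))\<^sup>2)"
    unfolding cip_self[symmetric]
    by (simp add: cip_sum_right cip_cs_right assms sum.delta if_distrib[of "(*) _"]
        mult_cnj_cmod mult.commute del: of_real_power cong: if_cong)
  then show ?thesis using of_real_eq_iff by blast
qed

text \<open>By orthonormality the squared distance from \<open>f\<close> to a partial sum over
  \<open>F\<close> is \<open>(norm f)\<^sup>2\<close> minus the sum of the squared moduli over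
  \<open>F\<close>, so convergence of the expansion is convergence of a sum of real numbers.\<close>

lemma ket_expansion: "((\<lambda>i. cs (coef f i) (ket i)) has_sum f) UNIV"
  unfolding has_sum_def
proof (rule tendstoI)
  fix e :: real assume "e > 0"
  have "((\<lambda>F. \<Sum>i\<in>F. (cmod (coef f i))\<^sup>2) \<longlongrightarrow> (norm f)\<^sup>2) (finite_subsets_at_top UNIV)"
    using norm_square_has_sum[of f] by (simp add: has_sum_def)
  then have "\<forall>\<^sub>F F in finite_subsets_at_top UNIV. dist (\<Sum>i\<in>F. (cmod (coef f i))\<^sup>2) ((norm f)\<^sup>2) < e\<^sup>2"
    by (rule tendstoD) (use \<open>e > 0\<close> in simp)
  moreover have "\<forall>\<^sub>F F in finite_subsets_at_top (UNIV :: 'a set). finite F"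
    by (simp add: eventually_finite_subsets_at_top_weakI)
  ultimately show "\<forall>\<^sub>F F in finite_subsets_at_top UNIV. dist (\<Sum>i\<in>F. cs (coef f i) (ket i)) f < e"
  proof eventually_elim
    case (elim F)
    let ?s = "\<Sum>i\<in>F. cs (coef f i) (ket i)"
    have "complex_of_real ((norm (?s - f))\<^sup>2) = complex_of_real ((norm f)\<^sup>2 - (\<Sum>i\<in>F. (cmod (coef f i))\<^sup>2))"
    proof -
      have 1: "cip ?s f = complex_of_real (\<Sum>i\<in>F. (cmod (coef f i))\<^sup>2)"
        by (simp add: cip_sum_left cip_cs_left mult_cnj_cmod del: of_real_power)
      have 2: "cip ?s ?s = complex_of_real (\<Sum>i\<in>F. (cmod (coef f i))\<^sup>2)"
        unfolding cip_self norm_sum_ket[OF elim(2)] ..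
      have 3: "cip f ?s = complex_of_real (\<Sum>i\<in>F. (cmod (coef f i))\<^sup>2)"
        by (subst cip_commute[symmetric]) (simp only: 1 complex_cnj_complex_of_real)
      show ?thesis
        unfolding cip_self[symmetric] of_real_diff
        by (simp only: cip_minus_left cip_minus_right 1 2 3) simp
    qed
    then have "(norm (?s - f))\<^sup>2 = (norm f)\<^sup>2 - (\<Sum>i\<in>F. (cmod (coef f i))\<^sup>2)"
      using of_real_eq_iff by blast
    then have "(norm (?s - f))\<^sup>2 < e\<^sup>2" using elim(1) by (simp add: dist_real_def)
    then show ?case using \<open>e > 0\<close> by (simp add: dist_norm power2_less_imp_less)
  qed
qed

section \<open>Operators\<close>

definition clin :: "('i ell2 \<Rightarrow> 'j ell2) \<Rightarrow> bool" where
  "clin T \<longleftrightarrow> (\<forall>c f. T (cs c f) = cs c (T f))"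

definition bclin :: "('i ell2 \<Rightarrow> 'j ell2) \<Rightarrow> bool" where
  "bclin T \<longleftrightarrow> bounded_linear T \<and> clin T"

text \<open>The main means of proving operator identities: by continuity and the basis expansion,
  only values on basis vectors have to be compared.\<close>

lemma bclin_eqI:
  assumes "bclin S" "bclin T" "\<And>i. S (ket i) = T (ket i)"
  shows "S f = T f"
proof -
  have "((\<lambda>i. S (cs (coef f i) (ket i))) has_sum S f) UNIV"
    by (rule has_sum_bounded_linear[OF _ ket_expansion]) (use assms in \<open>simp add: bclin_def\<close>)
  moreover have "((\<lambda>i. T (cs (coef f i) (ket i))) has_sum T f) UNIV"
    by (rule has_sum_bounded_linear[OF _ ket_expansion]) (use assms in \<open>simp add: bclin_def\<close>)
  ultimately show ?thesis
    using assms by (auto simp: bclin_def clin_def dest: has_sum_unique)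
qed

section \<open>Extension of operators from the canonical basis\<close>

lemma cs_algebra:
  "cs c (f + g) = cs c f + cs c g" "cs (c + d) f = cs c f + cs d f" "cs c (cs d f) = cs (c * d) f"
  "cs 1 f = f" "cs 0 f = 0" "cs c 0 = 0" "cs c (r *\<^sub>R f) = r *\<^sub>R cs c f"
  by (auto intro!: coef_inject_ext simp: algebra_simps)

lemma cs_sum: "cs c (\<Sum>x\<in>A. f x) = (\<Sum>x\<in>A. cs c (f x))"
  by (induction A rule: infinite_finite_induct) (auto simp: cs_algebra)

lemma summable_on_banach_Cauchy:
  fixes f :: "'i \<Rightarrow> 'b :: banach"
  assumes "\<And>e. e > 0 \<Longrightarrow> \<exists>F0. finite F0 \<and> (\<forall>F. finite F \<longrightarrow> F \<inter> F0 = {} \<longrightarrow> norm (sum f F) < e)"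
  shows "f summable_on UNIV"
proof -
  have "\<exists>P. eventually P (finite_subsets_at_top UNIV) \<and>
              (\<forall>F F'. P F \<and> P F' \<longrightarrow> dist (sum f F) (sum f F') < e)" if "e > 0" for e
  proof -
    obtain F0 where F0: "finite F0" "\<And>F. finite F \<Longrightarrow> F \<inter> F0 = {} \<Longrightarrow> norm (sum f F) < e / 2"
      using assms[of "e / 2"] \<open>e > 0\<close> by auto
    have near: "dist (sum f F) (sum f F0) < e / 2" if "finite F" "F0 \<subseteq> F" for F
    proof -
      have "sum f F - sum f F0 = sum f (F - F0)" using that by (simp add: sum_diff)
      then show ?thesis using F0(2)[of "F - F0"] that by (auto simp: dist_norm)
    qed
    show ?thesis
    proof (intro exI conjI allI impI)
      show "\<forall>\<^sub>F F in finite_subsets_at_top UNIV. finite F \<and> F0 \<subseteq> F"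
        unfolding eventually_finite_subsets_at_top using F0(1) by auto
      fix F F' assume "(finite F \<and> F0 \<subseteq> F) \<and> (finite F' \<and> F0 \<subseteq> F')"
      then show "dist (sum f F) (sum f F') < e"
        using near[of F] near[of F'] dist_triangle_half_l by blast
    qed
  qed
  then have "cauchy_filter (filtermap (sum f) (finite_subsets_at_top UNIV))"
    by (simp add: cauchy_filter_metric_filtermap)
  moreover have "complete (UNIV::'b set)"
    by (meson Cauchy_convergent UNIV_I complete_def convergent_def)
  ultimately obtain L where "(sum f \<longlongrightarrow> L) (finite_subsets_at_top UNIV)"
    using complete_uniform[where S = UNIV] by (force simp add: filterlim_def)
  then show ?thesis using summable_on_def has_sum_def by blast
qed

lemma square_sum_tail:
  assumes "e > 0"
  shows "\<exists>F0. finite F0 \<and> (\<forall>F. finite F \<longrightarrow> F \<inter> F0 = {} \<longrightarrow> (\<Sum>i\<in>F. (cmod (coef f i))\<^sup>2) < e)"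
proof -
  have "((\<lambda>F. \<Sum>i\<in>F. (cmod (coef f i))\<^sup>2) \<longlongrightarrow> (norm f)\<^sup>2) (finite_subsets_at_top UNIV)"
    using norm_square_has_sum[of f] by (simp add: has_sum_def)
  then have "\<forall>\<^sub>F F in finite_subsets_at_top UNIV. dist (\<Sum>i\<in>F. (cmod (coef f i))\<^sup>2) ((norm f)\<^sup>2) < e"
    using \<open>e > 0\<close> by (rule tendstoD)
  then obtain F0 where F0: "finite F0" "dist (\<Sum>i\<in>F0. (cmod (coef f i))\<^sup>2) ((norm f)\<^sup>2) < e"
    unfolding eventually_finite_subsets_at_top by blast
  show ?thesis
  proof (intro exI[of _ F0] conjI allI impI)
    show "finite F0" by (rule F0(1))
    fix F assume "finite F" "F \<inter> F0 = {}"
    then have "(\<Sum>i\<in>F. (cmod (coef f i))\<^sup>2) + (\<Sum>i\<in>F0. (cmod (coef f i))\<^sup>2) \<le> (norm f)\<^sup>2"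
      using sum_coef_square_le[of "F \<union> F0" f] F0(1) by (simp add: sum.union_disjoint)
    then show "(\<Sum>i\<in>F. (cmod (coef f i))\<^sup>2) < e" using F0(2) by (simp add: dist_real_def)
  qed
qed

text \<open>The condition says that \<open>ket i \<mapsto> y i\<close>, extended linearly, has norm
  at most \<open>C\<close> on finite combinations. Tensor amplifications, block projections and the
  operators \<open>hat T\<close> are all defined by their values on the basis and bounded in this
  form.\<close>

definition bessel_bound :: "real \<Rightarrow> ('i \<Rightarrow> 'j ell2) \<Rightarrow> bool" where
  "bessel_bound C y \<longleftrightarrow> 0 \<le> C \<and>
     (\<forall>F a. finite F \<longrightarrow> (norm (\<Sum>i\<in>F. cs (a i) (y i)))\<^sup>2 \<le> C\<^sup>2 * (\<Sum>i\<in>F. (cmod (a i))\<^sup>2))"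

definition ext :: "('i \<Rightarrow> 'j ell2) \<Rightarrow> 'i ell2 \<Rightarrow> 'j ell2" where
  "ext y f = infsum (\<lambda>i. cs (coef f i) (y i)) UNIV"

lemma ext_has_sum:
  assumes "bessel_bound C y"
  shows "((\<lambda>i. cs (coef f i) (y i)) has_sum ext y f) UNIV"
  unfolding ext_def
proof (rule has_sum_infsum, rule summable_on_banach_Cauchy)
  fix e :: real assume "e > 0"
  have C: "0 \<le> C" and B: "\<And>F. finite F \<Longrightarrow>
    (norm (\<Sum>i\<in>F. cs (coef f i) (y i)))\<^sup>2 \<le> C\<^sup>2 * (\<Sum>i\<in>F. (cmod (coef f i))\<^sup>2)"
    using assms by (auto simp: bessel_bound_def)
  \<comment> \<open>The summand 1 in the denominator keeps the quotient meaningful for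
    \<open>C = 0\<close>.\<close>
  obtain F0 where F0: "finite F0" and
    tail: "\<And>F. finite F \<Longrightarrow> F \<inter> F0 = {} \<Longrightarrow> (\<Sum>i\<in>F. (cmod (coef f i))\<^sup>2) < e\<^sup>2 / (C\<^sup>2 + 1)"
    using square_sum_tail[of "e\<^sup>2 / (C\<^sup>2 + 1)" f] \<open>e > 0\<close> by (auto simp: add_nonneg_pos)
  have "norm (\<Sum>i\<in>F. cs (coef f i) (y i)) < e" if "finite F" "F \<inter> F0 = {}" for F
  proof -
    have "(C\<^sup>2 + 1) * (\<Sum>i\<in>F. (cmod (coef f i))\<^sup>2) < e\<^sup>2"
      using tail[OF that] by (simp add: pos_less_divide_eq add_nonneg_pos mult.commute)
    moreover have "C\<^sup>2 * (\<Sum>i\<in>F. (cmod (coef f i))\<^sup>2) \<le> (C\<^sup>2 + 1) * (\<Sum>i\<in>F. (cmod (coef f i))\<^sup>2)"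
      by (intro mult_right_mono sum_nonneg) auto
    ultimately have "(norm (\<Sum>i\<in>F. cs (coef f i) (y i)))\<^sup>2 < e\<^sup>2" using B[OF that(1)] by linarith
    then show ?thesis using \<open>e > 0\<close> by (simp add: power2_less_imp_less)
  qed
  then show "\<exists>F0. finite F0 \<and>
      (\<forall>F. finite F \<longrightarrow> F \<inter> F0 = {} \<longrightarrow> norm (\<Sum>i\<in>F. cs (coef f i) (y i)) < e)"
    using F0 by blast
qed

lemma ext_norm:
  assumes "bessel_bound C y"
  shows "norm (ext y f) \<le> C * norm f"
proof -
  have C: "0 \<le> C" and B: "\<And>F. finite F \<Longrightarrow>
    (norm (\<Sum>i\<in>F. cs (coef f i) (y i)))\<^sup>2 \<le> C\<^sup>2 * (\<Sum>i\<in>F. (cmod (coef f i))\<^sup>2)"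
    using assms by (auto simp: bessel_bound_def)
  have "norm (\<Sum>i\<in>F. cs (coef f i) (y i)) \<le> C * norm f" if "finite F" for F
  proof (rule power2_le_imp_le)
    show "(norm (\<Sum>i\<in>F. cs (coef f i) (y i)))\<^sup>2 \<le> (C * norm f)\<^sup>2"
      using B[OF that] mult_left_mono[OF sum_coef_square_le[OF that, of f], of "C\<^sup>2"]
      by (simp add: power_mult_distrib)
  qed (use C in simp)
  then show ?thesis
    using tendsto_norm[OF ext_has_sum[OF assms, of f, unfolded has_sum_def]]
    by (intro tendsto_upperbound[of _ _ "finite_subsets_at_top UNIV"])
      (auto simp: eventually_finite_subsets_at_top_weakI)
qed

lemma bclin_ext:
  assumes "bessel_bound C y"
  shows "bclin (ext y)"
  unfolding bclin_def clin_def
proof (intro conjI allI bounded_linear_intro[of _ C])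
  fix f g :: "'a ell2"
  have "((\<lambda>i. cs (coef f i) (y i) + cs (coef g i) (y i)) has_sum ext y f + ext y g) UNIV"
    by (intro has_sum_add ext_has_sum[OF assms])
  then show "ext y (f + g) = ext y f + ext y g"
    using ext_has_sum[OF assms, of "f + g"] by (auto simp: cs_algebra dest: has_sum_unique)
next
  have cs: "ext y (cs c f) = cs c (ext y f)" for c f
  proof -
    have "((\<lambda>i. cs c (cs (coef f i) (y i))) has_sum cs c (ext y f)) UNIV"
      by (rule has_sum_bounded_linear[OF bounded_linear_cs ext_has_sum[OF assms]])
    then show ?thesis
      using ext_has_sum[OF assms, of "cs c f"] by (auto simp: cs_algebra dest: has_sum_unique)
  qed
  show "ext y (cs c f) = cs c (ext y f)" for c f by (rule cs)
  show "ext y (r *\<^sub>R f) = r *\<^sub>R ext y f" for r f by (simp add: scaleR_cs cs)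
  show "norm (ext y f) \<le> norm f * C" for f using ext_norm[OF assms, of f] by (simp add: mult.commute)
qed

lemma ext_ket:
  assumes "bessel_bound C y"
  shows "ext y (ket i) = y i"
proof -
  have "((\<lambda>j. cs (coef (ket i) j) (y j)) has_sum y i) UNIV"
    by (rule has_sum_finite_neutralI[of "{i}"]) (auto simp: cs_algebra)
  then show ?thesis using ext_has_sum[OF assms, of "ket i"] by (auto dest: has_sum_unique)
qed

section \<open>Algebra of bounded operators and adjoint pairs\<close>

lemma bclin_compose: "bclin S \<Longrightarrow> bclin T \<Longrightarrow> bclin (\<lambda>f. S (T f))"
  by (auto simp: bclin_def clin_def intro: bounded_linear_compose)

lemma bclin_add: "bclin S \<Longrightarrow> bclin T \<Longrightarrow> bclin (\<lambda>f. S f + T f)"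
  by (auto simp: bclin_def clin_def cs_algebra intro: bounded_linear_add)

lemma bclin_sum: "(\<And>x. x \<in> A \<Longrightarrow> bclin (S x)) \<Longrightarrow> bclin (\<lambda>f. \<Sum>x\<in>A. S x f)"
  by (auto simp: bclin_def clin_def cs_sum intro: bounded_linear_sum)

lemma bclin_cs: "bclin T \<Longrightarrow> bclin (\<lambda>f. cs c (T f))"
  by (auto simp: bclin_def clin_def cs_algebra mult.commute
      intro: bounded_linear_compose[OF bounded_linear_cs])

lemma bclin_ident: "bclin (\<lambda>f. f)"
  by (simp add: bclin_def clin_def bounded_linear_ident)

lemma bclin_zero: "bclin (\<lambda>f. 0)"
  by (simp add: bclin_def clin_def bounded_linear_zero cs_algebra)

lemma bclinD:
  assumes "bclin T"
  shows "T (f + g) = T f + T g" "T (f - g) = T f - T g" "T 0 = 0" "T (cs c f) = cs c (T f)"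
    "T (- f) = - T f" "T (r *\<^sub>R f) = r *\<^sub>R T f"
    "T (sum h A) = (\<Sum>x\<in>A. T (h x))" "bounded_linear T"
  using assms linear_simps(1-5)[of T] bounded_linear.linear[of T] linear_sum[of T h A]
  by (auto simp: bclin_def clin_def)

lemma bclin_has_sum: "bclin T \<Longrightarrow> (f has_sum s) A \<Longrightarrow> ((\<lambda>x. T (f x)) has_sum T s) A"
  by (auto simp: bclin_def intro: has_sum_bounded_linear)

text \<open>Adjoints are carried along as a second operator instead of being obtained from the Riesz
  theorem; every construction below supplies its adjoint explicitly.\<close>

definition adjoint_pair :: "('i ell2 \<Rightarrow> 'j ell2) \<Rightarrow> ('j ell2 \<Rightarrow> 'i ell2) \<Rightarrow> bool" where
  "adjoint_pair S T \<longleftrightarrow> (\<forall>f g. cip (S f) g = cip f (T g))"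

lemma adjoint_pairD: "adjoint_pair S T \<Longrightarrow> cip (S f) g = cip f (T g)"
  by (simp add: adjoint_pair_def)

text \<open>Conjugate transposed matrices suffice: continuity extends the identity to all vectors in
  the first argument, and then, by the basis expansion of the second, to all pairs.\<close>

lemma adjoint_pair_ket:
  assumes "bclin S" "bclin T" "\<And>i j. coef (S (ket i)) j = cnj (coef (T (ket j)) i)"
  shows "adjoint_pair S T"
  unfolding adjoint_pair_def
proof (intro allI)
  fix f g
  have 1: "cip (S f) (ket j) = cip f (T (ket j))" for j
  proof -
    have "((\<lambda>i. coef (S (cs (coef f i) (ket i))) j) has_sum coef (S f) j) UNIV"
      by (intro has_sum_bounded_linear[OF bounded_linear_coef] bclin_has_sum[OF assms(1)]
          ket_expansion)
    then have "((\<lambda>i. coef f i * cnj (coef (T (ket j)) i)) has_sum coef (S f) j) UNIV"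
      by (simp add: bclinD[OF assms(1)] assms(3))
    from has_sum_unique[OF this cip_has_sum] show ?thesis by simp
  qed
  have "((\<lambda>j. cip (S f) (cs (coef g j) (ket j))) has_sum cip (S f) g) UNIV"
    by (rule has_sum_bounded_linear[OF bounded_bilinear.bounded_linear_right[OF bounded_bilinear_cip]
          ket_expansion])
  moreover have "((\<lambda>j. cip f (T (cs (coef g j) (ket j)))) has_sum cip f (T g)) UNIV"
    by (intro has_sum_bounded_linear[OF bounded_bilinear.bounded_linear_right[OF bounded_bilinear_cip]]
        bclin_has_sum[OF assms(2)] ket_expansion)
  ultimately show "cip (S f) g = cip f (T g)"
    unfolding bclinD[OF assms(2)] cip_cs_right 1 by (rule has_sum_unique)
qed

lemma adjoint_pair_sym: "adjoint_pair S T \<Longrightarrow> adjoint_pair T S"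
  unfolding adjoint_pair_def by (metis cip_commute)

lemma cip_eqI: "(\<And>g. cip f g = cip f' g) \<Longrightarrow> f = f'"
  by (metis cip_ket_right coef_inject_ext)

lemma adjoint_unique: "adjoint_pair S T \<Longrightarrow> adjoint_pair S T' \<Longrightarrow> T f = T' f"
  by (rule cip_eqI) (metis adjoint_pair_def adjoint_pair_sym)

text \<open>Having an adjoint forces complex linearity. This recovers linearity for limits taken in
  a type of merely real-linear operators.\<close>

lemma adjoint_pair_clin: "adjoint_pair S T \<Longrightarrow> clin S"
  unfolding clin_def by (intro allI cip_eqI) (simp add: adjoint_pair_def cip_cs_left)

lemma adjoint_pair_compose:
  "adjoint_pair S S' \<Longrightarrow> adjoint_pair T T' \<Longrightarrow> adjoint_pair (\<lambda>f. S (T f)) (\<lambda>f. T' (S' f))"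
  by (simp add: adjoint_pair_def)

lemma adjoint_pair_sum:
  "(\<And>x. x \<in> A \<Longrightarrow> adjoint_pair (S x) (S' x)) \<Longrightarrow> adjoint_pair (\<lambda>f. \<Sum>x\<in>A. S x f) (\<lambda>f. \<Sum>x\<in>A. S' x f)"
  by (simp add: adjoint_pair_def cip_sum_left cip_sum_right)

subsection \<open>Tensor products\<close>

lemma coef_mult_square_summable:
  "(\<lambda>p. (cmod (coef f (fst p) * coef g (snd p)))\<^sup>2) summable_on UNIV"
proof (rule square_summableI[of _ "(norm f)\<^sup>2 * (norm g)\<^sup>2"])
  fix F :: "('a \<times> 'b) set" assume "finite F"
  have "(\<Sum>p\<in>F. (cmod (coef f (fst p) * coef g (snd p)))\<^sup>2)
      \<le> (\<Sum>p\<in>fst ` F \<times> snd ` F. (cmod (coef f (fst p) * coef g (snd p)))\<^sup>2)"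
    using \<open>finite F\<close> by (intro sum_mono2) (auto simp: rev_image_eqI)
  also have "\<dots> = (\<Sum>i\<in>fst ` F. (cmod (coef f i))\<^sup>2) * (\<Sum>j\<in>snd ` F. (cmod (coef g j))\<^sup>2)"
    by (simp add: sum_product sum.cartesian_product norm_mult power_mult_distrib case_prod_beta)
  also have "\<dots> \<le> (norm f)\<^sup>2 * (norm g)\<^sup>2"
    using \<open>finite F\<close> by (intro mult_mono sum_coef_square_le sum_nonneg) auto
  finally show "(\<Sum>p\<in>F. (cmod (coef f (fst p) * coef g (snd p)))\<^sup>2) \<le> (norm f)\<^sup>2 * (norm g)\<^sup>2" .
qed

lift_definition ten :: "'i ell2 \<Rightarrow> 'j ell2 \<Rightarrow> ('i \<times> 'j) ell2" is
  "\<lambda>f g p. f (fst p) * g (snd p)"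
proof -
  fix f :: "'i \<Rightarrow> complex" and g :: "'j \<Rightarrow> complex"
  assume "(\<lambda>i. (cmod (f i))\<^sup>2) summable_on UNIV" "(\<lambda>i. (cmod (g i))\<^sup>2) summable_on UNIV"
  then show "(\<lambda>p. (cmod (f (fst p) * g (snd p)))\<^sup>2) summable_on UNIV"
    using coef_mult_square_summable[of "Abs_ell2 f" "Abs_ell2 g"] by (simp add: Abs_ell2_inverse)
qed

lemma coef_ten [simp]: "coef (ten f g) p = coef f (fst p) * coef g (snd p)"
  by (simp add: ten.rep_eq)

lemma ten_ket: "ten (ket i) (ket j) = ket (i, j)"
  by (rule coef_inject_ext) auto

lemma norm_ten_le: "norm (ten f g) \<le> norm f * norm g"
proof (rule norm_ell2_le)
  fix F :: "('a \<times> 'b) set" assume "finite F"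
  have "(\<Sum>p\<in>F. (cmod (coef (ten f g) p))\<^sup>2)
      \<le> (\<Sum>p\<in>fst ` F \<times> snd ` F. (cmod (coef f (fst p) * coef g (snd p)))\<^sup>2)"
    unfolding coef_ten using \<open>finite F\<close> by (intro sum_mono2) (auto simp: rev_image_eqI)
  also have "\<dots> = (\<Sum>i\<in>fst ` F. (cmod (coef f i))\<^sup>2) * (\<Sum>j\<in>snd ` F. (cmod (coef g j))\<^sup>2)"
    by (simp add: sum_product sum.cartesian_product norm_mult power_mult_distrib case_prod_beta)
  also have "\<dots> \<le> (norm f)\<^sup>2 * (norm g)\<^sup>2"
    using \<open>finite F\<close> by (intro mult_mono sum_coef_square_le sum_nonneg) auto
  finally show "(\<Sum>p\<in>F. (cmod (coef (ten f g) p))\<^sup>2) \<le> (norm f * norm g)\<^sup>2"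
    by (simp add: power_mult_distrib)
qed simp

lemma bclin_ten_left: "bclin (\<lambda>f. ten f g)"
  unfolding bclin_def clin_def
  by (intro conjI bounded_linear_intro[of _ "norm g"])
    (auto intro!: coef_inject_ext norm_ten_le simp: algebra_simps)

lemma bclin_ten_right: "bclin (\<lambda>g. ten f g)"
  unfolding bclin_def clin_def
  by (intro conjI bounded_linear_intro[of _ "norm f"])
    (auto intro!: coef_inject_ext order_trans[OF norm_ten_le] simp: algebra_simps)

lemmas ten_left = bclinD[OF bclin_ten_left]
lemmas ten_right = bclinD[OF bclin_ten_right]

lemma cip_ten: "cip (ten f g) (ten f' g') = cip f f' * cip g g'"
proof -
  have 1: "cip (ten f g) (ket (i, j)) = cip f (ket i) * cip g (ket j)" for i j by simp
  have r: "bounded_linear (cip h)" for h :: "'k ell2"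
    by (rule bounded_bilinear.bounded_linear_right[OF bounded_bilinear_cip])
  have 2: "cip (ten f g) (ten f' (ket j)) = cip f f' * cip g (ket j)" for j
  proof -
    have "((\<lambda>i. cip (ten f g) (ten (cs (coef f' i) (ket i)) (ket j))) has_sum
        cip (ten f g) (ten f' (ket j))) UNIV"
      by (intro has_sum_bounded_linear[OF r] bclin_has_sum[OF bclin_ten_left] ket_expansion)
    moreover have "((\<lambda>i. cip f (cs (coef f' i) (ket i)) * cip g (ket j)) has_sum
        cip f f' * cip g (ket j)) UNIV"
      by (intro has_sum_cmult_left has_sum_bounded_linear[OF r] ket_expansion)
    ultimately show ?thesis
      unfolding ten_left ten_ket cip_cs_right 1 mult.assoc by (rule has_sum_unique)
  qed
  have "((\<lambda>j. cip (ten f g) (ten f' (cs (coef g' j) (ket j)))) has_sum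
        cip (ten f g) (ten f' g')) UNIV"
    by (intro has_sum_bounded_linear[OF r] bclin_has_sum[OF bclin_ten_right] ket_expansion)
  moreover have "((\<lambda>j. cip f f' * cip g (cs (coef g' j) (ket j))) has_sum cip f f' * cip g g') UNIV"
    by (intro has_sum_cmult_right has_sum_bounded_linear[OF r] ket_expansion)
  ultimately show ?thesis
    unfolding ten_right cip_cs_right 2 mult.left_commute[of "cip f f'"] by (rule has_sum_unique)
qed

lemma norm_sum_ten_ket:
  assumes "finite B"
  shows "(norm (\<Sum>j\<in>B. ten (u j) (ket j)))\<^sup>2 = (\<Sum>j\<in>B. (norm (u j))\<^sup>2)"
proof -
  have "complex_of_real ((norm (\<Sum>j\<in>B. ten (u j) (ket j)))\<^sup>2) = complex_of_real (\<Sum>j\<in>B. (norm (u j))\<^sup>2)"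
    unfolding cip_self[symmetric] of_real_sum
    by (simp add: cip_sum_left cip_sum_right cip_ten assms sum.delta if_distrib[of "(*) _"] cong: if_cong)
  then show ?thesis using of_real_eq_iff by blast
qed

lemma norm_sum_ket_ten:
  assumes "finite A"
  shows "(norm (\<Sum>i\<in>A. ten (ket i) (u i)))\<^sup>2 = (\<Sum>i\<in>A. (norm (u i))\<^sup>2)"
proof -
  have "complex_of_real ((norm (\<Sum>i\<in>A. ten (ket i) (u i)))\<^sup>2) = complex_of_real (\<Sum>i\<in>A. (norm (u i))\<^sup>2)"
    unfolding cip_self[symmetric] of_real_sum
    by (simp add: cip_sum_left cip_sum_right cip_ten assms sum.delta if_distrib[of "\<lambda>x. x * _"] cong: if_cong)
  then show ?thesis using of_real_eq_iff by blast
qed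

lemma bclin_norm_le:
  assumes "bclin T"
  obtains C where "0 \<le> C" "\<And>f. norm (T f) \<le> C * norm f"
  using bounded_linear.nonneg_bounded[OF bclinD(8)[OF assms]] by (metis mult.commute)

text \<open>A finite set of pairs is completed to a rectangle, so that a sum over it can be grouped
  by one coordinate.\<close>

lemma sum_box:
  assumes "finite F"
  shows "(\<Sum>p\<in>F. (h p :: 'b :: comm_monoid_add)) =
    (\<Sum>i\<in>fst ` F. \<Sum>j\<in>snd ` F. if (i, j) \<in> F then h (i, j) else 0)"
proof -
  have "(\<Sum>p\<in>F. h p) = (\<Sum>p\<in>fst ` F \<times> snd ` F. if p \<in> F then h p else 0)"
    using assms by (intro sum.mono_neutral_cong_left) (auto simp: rev_image_eqI)
  then show ?thesis by (simp only: sum.cartesian_product case_prod_unfold prod.collapse)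
qed

text \<open>Grouping by the second index turns the sum into a sum of
  \<open>ten (T (u j)) (ket j)\<close> over \<open>j\<close>. These summands are mutually
  orthogonal, so the bound \<open>C\<close> for \<open>T\<close> applies to each of them separately
  and adds up in squares.\<close>

lemma bessel_bound_amplify_left:
  assumes "bclin T" and C: "0 \<le> C" "\<And>f. norm (T f) \<le> C * norm f"
  shows "bessel_bound C (\<lambda>p. ten (T (ket (fst p))) (ket (snd p)))"
  unfolding bessel_bound_def
proof (intro conjI allI impI C(1))
  fix F :: "('a \<times> 'c) set" and a assume F: "finite F"
  define u where "u j = (\<Sum>i\<in>fst ` F. cs (if (i, j) \<in> F then a (i, j) else 0) (ket i))" for j
  have "(\<Sum>p\<in>F. cs (a p) (ten (T (ket (fst p))) (ket (snd p)))) = (\<Sum>j\<in>snd ` F. ten (T (u j)) (ket j))"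
    unfolding sum_box[OF F] u_def
    by (subst sum.swap) (auto simp: bclinD[OF assms(1)] ten_left cs_algebra intro!: sum.cong)
  then have "(norm (\<Sum>p\<in>F. cs (a p) (ten (T (ket (fst p))) (ket (snd p)))))\<^sup>2 = (\<Sum>j\<in>snd ` F. (norm (T (u j)))\<^sup>2)"
    using F by (simp add: norm_sum_ten_ket)
  also have "\<dots> \<le> (\<Sum>j\<in>snd ` F. C\<^sup>2 * (norm (u j))\<^sup>2)"
    using C by (intro sum_mono) (metis norm_ge_zero power_mono power_mult_distrib)
  also have "\<dots> = C\<^sup>2 * (\<Sum>j\<in>snd ` F. \<Sum>i\<in>fst ` F. (cmod (if (i, j) \<in> F then a (i, j) else 0))\<^sup>2)"
    unfolding u_def using F by (simp only: norm_sum_ket finite_imageI sum_distrib_left)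
  also have "\<dots> = C\<^sup>2 * (\<Sum>p\<in>F. (cmod (a p))\<^sup>2)"
    unfolding sum_box[OF F] by (subst sum.swap) (auto intro!: arg_cong[of _ _ "(*) _"] sum.cong)
  finally show "(norm (\<Sum>p\<in>F. cs (a p) (ten (T (ket (fst p))) (ket (snd p)))))\<^sup>2
      \<le> C\<^sup>2 * (\<Sum>p\<in>F. (cmod (a p))\<^sup>2)" .
qed

lemma bessel_bound_amplify_right:
  assumes "bclin T" and C: "0 \<le> C" "\<And>f. norm (T f) \<le> C * norm f"
  shows "bessel_bound C (\<lambda>p. ten (ket (fst p)) (T (ket (snd p))))"
  unfolding bessel_bound_def
proof (intro conjI allI impI C(1))
  fix F :: "('c \<times> 'a) set" and a assume F: "finite F"
  define u where "u i = (\<Sum>j\<in>snd ` F. cs (if (i, j) \<in> F then a (i, j) else 0) (ket j))" for i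
  have "(\<Sum>p\<in>F. cs (a p) (ten (ket (fst p)) (T (ket (snd p))))) = (\<Sum>i\<in>fst ` F. ten (ket i) (T (u i)))"
    unfolding sum_box[OF F] u_def
    by (auto simp: bclinD[OF assms(1)] ten_right cs_algebra intro!: sum.cong)
  then have "(norm (\<Sum>p\<in>F. cs (a p) (ten (ket (fst p)) (T (ket (snd p))))))\<^sup>2 = (\<Sum>i\<in>fst ` F. (norm (T (u i)))\<^sup>2)"
    using F by (simp add: norm_sum_ket_ten)
  also have "\<dots> \<le> (\<Sum>i\<in>fst ` F. C\<^sup>2 * (norm (u i))\<^sup>2)"
    using C by (intro sum_mono) (metis norm_ge_zero power_mono power_mult_distrib)
  also have "\<dots> = C\<^sup>2 * (\<Sum>i\<in>fst ` F. \<Sum>j\<in>snd ` F. (cmod (if (i, j) \<in> F then a (i, j) else 0))\<^sup>2)"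
    unfolding u_def using F by (simp only: norm_sum_ket finite_imageI sum_distrib_left)
  also have "\<dots> = C\<^sup>2 * (\<Sum>p\<in>F. (cmod (a p))\<^sup>2)"
    unfolding sum_box[OF F] by (auto intro!: arg_cong[of _ _ "(*) _"] sum.cong)
  finally show "(norm (\<Sum>p\<in>F. cs (a p) (ten (ket (fst p)) (T (ket (snd p))))))\<^sup>2
      \<le> C\<^sup>2 * (\<Sum>p\<in>F. (cmod (a p))\<^sup>2)" .
qed

definition ampl :: "('i ell2 \<Rightarrow> 'k ell2) \<Rightarrow> ('i \<times> 'j) ell2 \<Rightarrow> ('k \<times> 'j) ell2" where
  "ampl S = ext (\<lambda>p. ten (S (ket (fst p))) (ket (snd p)))"

definition ampr :: "('j ell2 \<Rightarrow> 'l ell2) \<Rightarrow> ('i \<times> 'j) ell2 \<Rightarrow> ('i \<times> 'l) ell2" where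
  "ampr T = ext (\<lambda>p. ten (ket (fst p)) (T (ket (snd p))))"

text \<open>Factored as (S \<otimes> 1)(1 \<otimes> T) because orthogonality in the other leg bounds
  each amplification, whereas the images of basis vectors under S \<otimes> T itself need not be
  orthogonal in either leg.\<close>

definition tenop :: "('i ell2 \<Rightarrow> 'k ell2) \<Rightarrow> ('j ell2 \<Rightarrow> 'l ell2) \<Rightarrow> ('i \<times> 'j) ell2 \<Rightarrow> ('k \<times> 'l) ell2" where
  "tenop S T f = ampl S (ampr T f)"

lemma ampl:
  assumes "bclin S"
  shows "bclin (ampl S)" "ampl S (ten (ket i) (ket j)) = ten (S (ket i)) (ket j)"
proof -
  obtain C where "0 \<le> C" "\<And>f. norm (S f) \<le> C * norm f" using bclin_norm_le[OF assms] by blast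
  note B = bessel_bound_amplify_left[OF assms this]
  show "bclin (ampl S)" unfolding ampl_def by (rule bclin_ext[OF B])
  show "ampl S (ten (ket i) (ket j)) = ten (S (ket i)) (ket j)"
    unfolding ampl_def ten_ket ext_ket[OF B] by simp
qed

lemma ampr:
  assumes "bclin T"
  shows "bclin (ampr T)" "ampr T (ten (ket i) (ket j)) = ten (ket i) (T (ket j))"
proof -
  obtain C where "0 \<le> C" "\<And>f. norm (T f) \<le> C * norm f" using bclin_norm_le[OF assms] by blast
  note B = bessel_bound_amplify_right[OF assms this]
  show "bclin (ampr T)" unfolding ampr_def by (rule bclin_ext[OF B])
  show "ampr T (ten (ket i) (ket j)) = ten (ket i) (T (ket j))"
    unfolding ampr_def ten_ket ext_ket[OF B] by simp
qed

lemma bclin_tenop: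
  assumes "bclin S" "bclin T"
  shows "bclin (tenop S T)"
  unfolding tenop_def[abs_def] by (rule bclin_compose[OF ampl(1)[OF assms(1)] ampr(1)[OF assms(2)]])

lemma bclin2_eqI:
  assumes "bclin S" "bclin T" "\<And>i j. S (ten (ket i) (ket j)) = T (ten (ket i) (ket j))"
  shows "S f = T f"
  by (rule bclin_eqI[OF assms(1,2)]) (metis assms(3) surj_pair ten_ket)

lemma tenop_ten:
  assumes "bclin S" "bclin T"
  shows "tenop S T (ten f g) = ten (S f) (T g)"
proof -
  have 2: "ampl S (ten (ket i) g) = ten (S (ket i)) g" for i and g :: "'x ell2"
    by (rule bclin_eqI[OF bclin_compose[OF ampl(1)[OF assms(1)] bclin_ten_right] bclin_ten_right])
      (rule ampl(2)[OF assms(1)])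
  have 3: "tenop S T (ten (ket i) (ket j)) = ten (S (ket i)) (T (ket j))" for i j
    unfolding tenop_def ampr(2)[OF assms(2)] 2 ..
  have 4: "tenop S T (ten (ket i) g) = ten (S (ket i)) (T g)" for i g
    by (rule bclin_eqI[OF bclin_compose[OF bclin_tenop[OF assms] bclin_ten_right]
          bclin_compose[OF bclin_ten_right assms(2)]]) (rule 3)
  show ?thesis
    by (rule bclin_eqI[OF bclin_compose[OF bclin_tenop[OF assms] bclin_ten_left]
          bclin_compose[OF bclin_ten_left assms(1)]]) (rule 4)
qed

lemma tenop_compose:
  assumes "bclin S" "bclin T" "bclin S'" "bclin T'"
  shows "tenop S T (tenop S' T' f) = tenop (\<lambda>f. S (S' f)) (\<lambda>f. T (T' f)) f"
proof (rule bclin2_eqI[where f = f])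
  show "bclin (\<lambda>f. tenop S T (tenop S' T' f))"
    by (intro bclin_compose[OF bclin_tenop bclin_tenop] assms)
  show "bclin (tenop (\<lambda>f. S (S' f)) (\<lambda>f. T (T' f)))"
    by (intro bclin_tenop bclin_compose[OF assms(1,3)] bclin_compose[OF assms(2,4)])
qed (simp add: tenop_ten assms bclin_compose[OF assms(1,3)] bclin_compose[OF assms(2,4)])

lemma adjoint_pair_tenop:
  assumes "bclin S" "bclin T" "bclin S'" "bclin T'" "adjoint_pair S S'" "adjoint_pair T T'"
  shows "adjoint_pair (tenop S T) (tenop S' T')"
proof (rule adjoint_pair_ket)
  fix p q :: "'a \<times> 'c"
  show "coef (tenop S T (ket i)) j = cnj (coef (tenop S' T' (ket j)) i)" for i j
    using adjoint_pairD[OF assms(5), of "ket (fst i)" "ket (fst j)"]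
      adjoint_pairD[OF assms(6), of "ket (snd i)" "ket (snd j)"]
    by (cases i; cases j) (simp add: ten_ket[symmetric] tenop_ten assms)
qed (intro bclin_tenop assms)+

section \<open>Gram-Schmidt coordinates of a semi-inner product\<close>

text \<open>No vector space axioms are needed on the carrier, since all equalities between vectors are
  only used modulo the null space of the form.\<close>

locale semi_inner =
  fixes V :: "'v set" and add :: "'v \<Rightarrow> 'v \<Rightarrow> 'v" and sm :: "complex \<Rightarrow> 'v \<Rightarrow> 'v"
    and form :: "'v \<Rightarrow> 'v \<Rightarrow> complex" and s :: "nat \<Rightarrow> 'v"
  assumes add_closed [simp]: "u \<in> V \<Longrightarrow> v \<in> V \<Longrightarrow> add u v \<in> V"
    and sm_closed [simp]: "u \<in> V \<Longrightarrow> sm c u \<in> V"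
    and form_add: "u \<in> V \<Longrightarrow> v \<in> V \<Longrightarrow> w \<in> V \<Longrightarrow> form (add u v) w = form u w + form v w"
    and form_sm: "u \<in> V \<Longrightarrow> w \<in> V \<Longrightarrow> form (sm c u) w = c * form u w"
    and form_herm: "u \<in> V \<Longrightarrow> v \<in> V \<Longrightarrow> form v u = cnj (form u v)"
    and form_nonneg: "u \<in> V \<Longrightarrow> form u u \<in> \<real>\<^sub>\<ge>\<^sub>0"
    and s_closed [simp]: "s n \<in> V"
begin

lemma form_self: "u \<in> V \<Longrightarrow> form u u = complex_of_real (Re (form u u))"
  and form_self_nonneg: "u \<in> V \<Longrightarrow> 0 \<le> Re (form u u)"
  using form_nonneg[of u] by (auto simp: complex_nonneg_Reals_iff complex_eq_iff)

lemma form_add_right: "u \<in> V \<Longrightarrow> v \<in> V \<Longrightarrow> w \<in> V \<Longrightarrow> form w (add u v) = form w u + form w v"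
  by (metis add_closed complex_cnj_add form_add form_herm)

lemma form_sm_right: "u \<in> V \<Longrightarrow> w \<in> V \<Longrightarrow> form w (sm c u) = cnj c * form w u"
  by (metis sm_closed complex_cnj_mult form_sm form_herm)

text \<open>If the value were non-zero, adding a large multiple of the null vector \<open>u\<close>
  to \<open>v\<close> would make the form negative; \<open>r\<close> is chosen so that
  \<open>Re (form w w)\<close> equals -1.\<close>

lemma null_left:
  assumes "u \<in> V" "v \<in> V" "form u u = 0"
  shows "form u v = 0"
proof (rule ccontr)
  assume "form u v \<noteq> 0"
  define c where "c = form u v"
  define r where "r = (Re (form v v) + 1) / (2 * (cmod c)\<^sup>2)"
  define w where "w = add (sm (- complex_of_real r * cnj c) u) v"
  have "form w w = - complex_of_real r * cnj c * c - complex_of_real r * c * cnj c + form v v"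
    using assms by (simp add: w_def form_add form_add_right form_sm form_sm_right c_def
        form_herm[OF assms(1,2)] algebra_simps)
  also have "\<dots> = complex_of_real (- 2 * r * (cmod c)\<^sup>2) + form v v"
    using mult_cnj_cmod[of c] by (simp add: algebra_simps)
  finally have "Re (form w w) = - 2 * r * (cmod c)\<^sup>2 + Re (form v v)" by simp
  moreover have "2 * r * (cmod c)\<^sup>2 = Re (form v v) + 1"
    using \<open>form u v \<noteq> 0\<close> by (simp add: r_def c_def)
  moreover have "0 \<le> Re (form w w)" using assms by (intro form_self_nonneg) (simp add: w_def)
  ultimately show False by simp
qed

lemma null_right: "u \<in> V \<Longrightarrow> v \<in> V \<Longrightarrow> form u u = 0 \<Longrightarrow> form v u = 0"
  using null_left[of u v] form_herm[of u v] by simp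

section \<open>Finite linear combinations and the Gram-Schmidt recursion\<close>

primrec lc :: "nat \<Rightarrow> (nat \<Rightarrow> complex) \<Rightarrow> (nat \<Rightarrow> 'v) \<Rightarrow> 'v" where
  "lc 0 a f = sm 0 (s 0)"
| "lc (Suc n) a f = add (lc n a f) (sm (a n) (f n))"

lemma lc_closed: "(\<And>k. k < n \<Longrightarrow> f k \<in> V) \<Longrightarrow> lc n a f \<in> V"
  by (induction n) auto

lemma form_lc:
  "(\<And>k. k < n \<Longrightarrow> f k \<in> V) \<Longrightarrow> v \<in> V \<Longrightarrow> form (lc n a f) v = (\<Sum>k<n. a k * form (f k) v)"
  by (induction n) (auto simp: form_add form_sm lc_closed)

lemma lc_cong: "(\<And>k. k < n \<Longrightarrow> f k = g k) \<Longrightarrow> lc n a f = lc n a g"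
  by (induction n) auto

definition residual :: "nat \<Rightarrow> (nat \<Rightarrow> 'v) \<Rightarrow> 'v" where
  "residual n f = add (s n) (lc n (\<lambda>k. - form (s n) (f k)) f)"

text \<open>A null residual is scaled by \<open>1 / 0 = 0\<close>, so it contributes a null vector.\<close>

definition normalize :: "'v \<Rightarrow> 'v" where
  "normalize r = sm (complex_of_real (1 / sqrt (Re (form r r)))) r"

text \<open>\<open>gs n\<close> is a table whose first \<open>n\<close> entries are final and whose
  other entries are the filler \<open>s 0\<close>; a table is kept because each new vector depends
  on all earlier ones.\<close>

primrec gs :: "nat \<Rightarrow> nat \<Rightarrow> 'v" where
  "gs 0 = (\<lambda>_. s 0)"
| "gs (Suc n) = (gs n)(n := normalize (residual n (gs n)))"

definition b :: "nat \<Rightarrow> 'v" where "b n = gs (Suc n) n"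

lemma gs_eq_b: "k < n \<Longrightarrow> gs n k = b k"
  by (induction n) (auto simp: b_def less_Suc_eq)

lemma b_unfold: "b n = normalize (residual n b)"
proof -
  have l: "lc n a (gs n) = lc n a b" for a by (rule lc_cong) (simp add: gs_eq_b)
  have "lc n (\<lambda>k. - form (s n) (gs n k)) f = lc n (\<lambda>k. - form (s n) (b k)) f" for f
  proof -
    have "m \<le> n \<Longrightarrow> lc m (\<lambda>k. - form (s n) (gs n k)) f = lc m (\<lambda>k. - form (s n) (b k)) f" for m
      by (induction m) (auto simp: gs_eq_b)
    then show ?thesis by simp
  qed
  then show ?thesis by (simp add: b_def residual_def l)
qed

lemma gs_closed: "gs n k \<in> V"
  by (induction n arbitrary: k) (auto simp: normalize_def residual_def lc_closed)

lemma b_closed [simp]: "b n \<in> V"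
  by (simp only: b_def gs_closed)

lemma residual_closed [simp]: "residual n b \<in> V"
  by (simp add: residual_def lc_closed)

lemma form_b_self: "form (b n) (b n) = (if form (residual n b) (residual n b) = 0 then 0 else 1)"
proof -
  let ?r = "residual n b"
  define q where "q = Re (form ?r ?r)"
  have q: "form ?r ?r = complex_of_real q" "0 \<le> q"
    using form_self[of ?r] form_self_nonneg[of ?r] by (simp_all add: q_def)
  have "form (b n) (b n) = complex_of_real (1 / sqrt q) * (cnj (complex_of_real (1 / sqrt q)) * form ?r ?r)"
    by (subst (1 2) b_unfold)
      (simp only: normalize_def form_sm form_sm_right q_def[symmetric] residual_closed sm_closed
        mult.left_commute)
  also have "\<dots> = complex_of_real (1 / sqrt q * (1 / sqrt q * q))"
    by (simp only: q(1) of_real_mult complex_cnj_complex_of_real)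
  also have "1 / sqrt q * (1 / sqrt q * q) = (if q = 0 then 0 else 1)"
    using q(2) by (simp add: real_div_sqrt)
  finally show ?thesis using q(1) by (simp split: if_splits)
qed

text \<open>True for unit and null \<open>b k\<close> alike, so the projection formulas below need
  no case distinction on which Gram-Schmidt vectors vanish.\<close>

lemma form_u_b_b: "u \<in> V \<Longrightarrow> form u (b k) * form (b k) (b k) = form u (b k)"
  using null_right[of "b k" u] form_b_self[of k] by (auto split: if_splits)

lemma form_b_b_u: "u \<in> V \<Longrightarrow> form (b k) (b k) * form (b k) u = form (b k) u"
  using null_left[of "b k" u] form_b_self[of k] by (auto split: if_splits)

lemma form_residual: "v \<in> V \<Longrightarrow> form (residual n b) v = form (s n) v - (\<Sum>k<n. form (s n) (b k) * form (b k) v)"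
  by (simp add: residual_def form_add lc_closed form_lc sum_negf)

lemma orthogonal_less: "j < n \<Longrightarrow> form (b n) (b j) = 0"
proof (induction n arbitrary: j rule: less_induct)
  case (less n)
  have orth: "form (b k) (b j) = 0" if "k < n" "k \<noteq> j" for k
    using less.IH[of k j] less.IH[of j k] that less.prems form_herm[of "b j" "b k"]
    by (cases "k < j") auto
  have "(\<Sum>k<n. form (s n) (b k) * form (b k) (b j)) = (\<Sum>k\<in>{j}. form (s n) (b k) * form (b k) (b j))"
    using less.prems orth by (intro sum.mono_neutral_right) auto
  then have "form (residual n b) (b j) = 0"
    by (simp add: form_residual form_u_b_b)
  then show ?case
    by (subst b_unfold) (simp add: normalize_def form_sm)
qed

lemma orthogonal: "j \<noteq> n \<Longrightarrow> form (b n) (b j) = 0"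
  using orthogonal_less[of j n] orthogonal_less[of n j] form_herm[of "b j" "b n"]
  by (cases "j < n") auto

text \<open>Modulo null vectors, \<open>u\<close> belongs to the linear span of the first
  \<open>n\<close> Gram-Schmidt vectors. This is tested against all of \<open>V\<close>, since
  vectors are known only up to the null space.\<close>

definition inM :: "'v \<Rightarrow> bool" where
  "inM u \<longleftrightarrow> u \<in> V \<and> (\<exists>n. \<forall>v\<in>V. form u v = (\<Sum>k<n. form u (b k) * form (b k) v))"

lemma inM_closed: "inM u \<Longrightarrow> u \<in> V"
  by (simp add: inM_def)

lemma inM_bound:
  assumes "inM u"
  obtains n where "\<And>m v. m \<ge> n \<Longrightarrow> v \<in> V \<Longrightarrow> form u v = (\<Sum>k<m. form u (b k) * form (b k) v)"
    "\<And>k. k \<ge> n \<Longrightarrow> form u (b k) = 0"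
proof -
  obtain n where n: "\<And>v. v \<in> V \<Longrightarrow> form u v = (\<Sum>k<n. form u (b k) * form (b k) v)"
    using assms by (auto simp: inM_def)
  have z: "form u (b k) = 0" if "k \<ge> n" for k
    using n[of "b k"] that orthogonal by auto
  moreover have "form u v = (\<Sum>k<m. form u (b k) * form (b k) v)" if "m \<ge> n" "v \<in> V" for m v
  proof -
    have "(\<Sum>k<n. form u (b k) * form (b k) v) = (\<Sum>k<m. form u (b k) * form (b k) v)"
      using that(1) z by (intro sum.mono_neutral_left) auto
    then show ?thesis using n[OF that(2)] by simp
  qed
  ultimately show ?thesis using that by blast
qed

lemma inM_equiv:
  assumes "inM u" "u' \<in> V" "\<And>v. v \<in> V \<Longrightarrow> form u' v = form u v"
  shows "inM u'"
  using assms unfolding inM_def by simp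

lemma inM_add:
  assumes "inM u" "inM v"
  shows "inM (add u v)"
proof -
  obtain m where m: "\<And>k w. k \<ge> m \<Longrightarrow> w \<in> V \<Longrightarrow> form u w = (\<Sum>j<k. form u (b j) * form (b j) w)"
    using inM_bound[OF assms(1)] by metis
  obtain n where n: "\<And>k w. k \<ge> n \<Longrightarrow> w \<in> V \<Longrightarrow> form v w = (\<Sum>j<k. form v (b j) * form (b j) w)"
    using inM_bound[OF assms(2)] by metis
  note c = inM_closed[OF assms(1)] inM_closed[OF assms(2)]
  show ?thesis
    unfolding inM_def using m[of "max m n"] n[of "max m n"] c
    by (auto simp: form_add algebra_simps sum.distrib intro!: exI[of _ "max m n"])
qed

lemma inM_sm: "inM u \<Longrightarrow> inM (sm c u)"
  unfolding inM_def by (auto simp: form_sm sum_distrib_left mult.assoc)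

lemma inM_b: "inM (b n)"
  unfolding inM_def
proof (intro conjI exI[of _ "Suc n"] ballI)
  fix v assume v: "v \<in> V"
  have "(\<Sum>k<Suc n. form (b n) (b k) * form (b k) v) = form (b n) (b n) * form (b n) v"
    using orthogonal_less[of _ n] by simp
  then show "form (b n) v = (\<Sum>k<Suc n. form (b n) (b k) * form (b k) v)"
    by (simp add: form_b_b_u v)
qed simp

lemma inM_lc: "inM (s 0) \<Longrightarrow> (\<And>k. k < n \<Longrightarrow> inM (f k)) \<Longrightarrow> inM (lc n a f)"
  by (induction n) (auto intro: inM_add inM_sm)

text \<open>\<open>s n\<close> is the sum of its projections on the earlier \<open>b k\<close> and
  of the residual, and modulo null vectors the residual is \<open>form (s n) (b n)\<close> times
  \<open>b n\<close>, because that coefficient is the norm of the residual.\<close>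

lemma inM_s: "inM (s n)"
  unfolding inM_def
proof (intro conjI exI[of _ "Suc n"] ballI)
  let ?r = "residual n b"
  fix v assume v: "v \<in> V"
  have "form ?r v = form (s n) (b n) * form (b n) v"
  proof (cases "form ?r ?r = 0")
    case True
    then show ?thesis using null_left[of ?r v] null_left[of "b n" v] form_b_self[of n] v by simp
  next
    case False
    define q where "q = Re (form ?r ?r)"
    have q: "form ?r ?r = complex_of_real q" "0 < q"
      using form_self[of ?r] form_self_nonneg[of ?r] False by (auto simp: q_def less_le)
    have "form (s n) (b n) = form ?r (b n)"
      using orthogonal[of n] by (simp add: form_residual)
    also have "\<dots> = complex_of_real (1 / sqrt q * q)"
      by (subst b_unfold) (simp add: normalize_def form_sm_right q_def[symmetric] q(1))
    also have "1 / sqrt q * q = sqrt q" using q(2) by (simp add: real_div_sqrt)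
    finally have 1: "form (s n) (b n) = complex_of_real (sqrt q)" .
    have "form (b n) v = complex_of_real (1 / sqrt q) * form ?r v"
      by (subst b_unfold) (simp add: normalize_def form_sm q_def v)
    with 1 show ?thesis using q(2) by simp
  qed
  then show "form (s n) v = (\<Sum>k<Suc n. form (s n) (b k) * form (b k) v)"
    by (simp add: form_residual v algebra_simps)
qed simp

section \<open>Coordinates in the sequence space\<close>

lemma bessel:
  assumes u: "u \<in> V"
  shows "(\<Sum>k<n. (cmod (form u (b k)))\<^sup>2) \<le> Re (form u u)"
proof -
  define w where "w = add u (lc n (\<lambda>k. - form u (b k)) b)"
  have w: "w \<in> V" using u by (simp add: w_def lc_closed)
  have fw: "form w v = form u v - (\<Sum>k<n. form u (b k) * form (b k) v)" if "v \<in> V" for v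
    using u that by (simp add: w_def form_add lc_closed form_lc sum_negf)
  have wb: "form w (b j) = 0" if "j < n" for j
  proof -
    have "(\<Sum>k<n. form u (b k) * form (b k) (b j)) = (\<Sum>k\<in>{j}. form u (b k) * form (b k) (b j))"
      using that orthogonal by (intro sum.mono_neutral_right) auto
    then show ?thesis by (simp add: fw form_u_b_b u)
  qed
  have "form (b k) w = 0" if "k < n" for k
    using wb[OF that] form_herm[of w "b k"] w by simp
  then have "form w w = form u w"
    unfolding fw[OF w] by simp
  also have "\<dots> = cnj (form w u)" using u w form_herm by blast
  also have "\<dots> = form u u - (\<Sum>k<n. complex_of_real ((cmod (form u (b k)))\<^sup>2))"
    unfolding fw[OF u] form_herm[OF u b_closed] mult_cnj_cmod complex_cnj_diff cnj_sum
      complex_cnj_complex_of_real form_herm[OF u u, symmetric] ..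
  finally have "Re (form w w) = Re (form u u) - (\<Sum>k<n. (cmod (form u (b k)))\<^sup>2)" by simp
  then show ?thesis using form_self_nonneg[OF w] by simp
qed

text \<open>Bessel's inequality makes this a vector of l^2 for every \<open>u\<close> in
  \<open>V\<close>. Inner products are preserved as soon as the first vector satisfies
  \<open>inM\<close> (see \<open>cip_U\<close>); in general only the component in the closed span of
  \<open>s\<close> is recorded.\<close>

definition U :: "'v \<Rightarrow> nat ell2" where "U u = Abs_ell2 (\<lambda>k. form u (b k))"

lemma coef_U [simp]:
  assumes "u \<in> V"
  shows "coef (U u) k = form u (b k)"
proof -
  have "(\<lambda>k. (cmod (form u (b k)))\<^sup>2) summable_on UNIV"
  proof (rule square_summableI)
    fix F :: "nat set" assume "finite F"
    then obtain n where "F \<subseteq> {..<n}" using finite_nat_iff_bounded by blast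
    then have "(\<Sum>k\<in>F. (cmod (form u (b k)))\<^sup>2) \<le> (\<Sum>k<n. (cmod (form u (b k)))\<^sup>2)"
      by (intro sum_mono2) auto
    then show "(\<Sum>k\<in>F. (cmod (form u (b k)))\<^sup>2) \<le> Re (form u u)" using bessel[OF assms, of n] by simp
  qed
  then show ?thesis by (simp add: U_def Abs_ell2_inverse)
qed

lemma U_cong:
  assumes "u \<in> V" "u' \<in> V" "\<And>v. v \<in> V \<Longrightarrow> form u v = form u' v"
  shows "U u = U u'"
  by (rule coef_inject_ext) (simp add: assms)

lemma U_add: "u \<in> V \<Longrightarrow> v \<in> V \<Longrightarrow> U (add u v) = U u + U v"
  by (rule coef_inject_ext) (simp add: form_add)

lemma U_sm: "u \<in> V \<Longrightarrow> U (sm c u) = cs c (U u)"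
  by (rule coef_inject_ext) (simp add: form_sm)

lemma U_lc: "(\<And>k. k < n \<Longrightarrow> f k \<in> V) \<Longrightarrow> U (lc n a f) = (\<Sum>k<n. cs (a k) (U (f k)))"
  by (rule coef_inject_ext) (simp add: form_lc lc_closed)

lemma cip_U:
  assumes "inM u" "v \<in> V"
  shows "cip (U u) (U v) = form u v"
proof -
  note u = inM_closed[OF assms(1)]
  obtain n where n: "form u v = (\<Sum>k<n. form u (b k) * form (b k) v)"
    "\<And>k. k \<ge> n \<Longrightarrow> form u (b k) = 0"
    using inM_bound[OF assms(1)] assms(2) by (metis order_refl)
  have "((\<lambda>k. coef (U u) k * cnj (coef (U v) k)) has_sum form u v) UNIV"
    using u assms(2) n by (intro has_sum_finite_neutralI[of "{..<n}"])
      (auto simp: form_herm[of v "b _"] not_less)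
  then show ?thesis using cip_has_sum has_sum_unique by blast
qed

text \<open>Linearity is asked for modulo null vectors only. The last clause, invariance of the span
  of \<open>s\<close>, is what makes \<open>hat\<close> multiplicative.\<close>

definition good :: "real \<Rightarrow> ('v \<Rightarrow> 'v) \<Rightarrow> bool" where
  "good B T \<longleftrightarrow> 0 \<le> B \<and> (\<forall>u\<in>V. T u \<in> V) \<and>
     (\<forall>u\<in>V. Re (form (T u) (T u)) \<le> B\<^sup>2 * Re (form u u)) \<and>
     (\<forall>u\<in>V. \<forall>v\<in>V. \<forall>w\<in>V. form (T (add u v)) w = form (T u) w + form (T v) w) \<and>
     (\<forall>c. \<forall>u\<in>V. \<forall>w\<in>V. form (T (sm c u)) w = c * form (T u) w) \<and>
     (\<forall>n. inM (T (s n)))"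

lemma good_closed: "good B T \<Longrightarrow> u \<in> V \<Longrightarrow> T u \<in> V"
  by (simp add: good_def)

lemma good_add:
    "good B T \<Longrightarrow> u \<in> V \<Longrightarrow> v \<in> V \<Longrightarrow> w \<in> V \<Longrightarrow> form (T (add u v)) w = form (T u) w + form (T v) w"
  and good_sm: "good B T \<Longrightarrow> u \<in> V \<Longrightarrow> w \<in> V \<Longrightarrow> form (T (sm c u)) w = c * form (T u) w"
  and good_s: "good B T \<Longrightarrow> inM (T (s n))"
  by (simp_all add: good_def)

text \<open>Boundedness sends the null difference of \<open>u\<close> and \<open>u'\<close> to a
  null vector, so \<open>T\<close> descends to the quotient by the null space.\<close>

lemma good_equiv:
  assumes T: "good B T" and "u \<in> V" "u' \<in> V" "\<And>w. w \<in> V \<Longrightarrow> form u w = form u' w" "w \<in> V"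
  shows "form (T u) w = form (T u') w"
proof -
  define d where "d = add u (sm (- 1) u')"
  have d: "d \<in> V" using assms by (simp add: d_def)
  have "form d d = 0" using assms(2,3) d by (simp add: d_def form_add form_sm assms(4))
  then have "Re (form (T d) (T d)) = 0"
    using T d form_self_nonneg[of "T d"] by (auto simp: good_def intro: antisym)
  then have "form (T d) (T d) = 0" using form_self[of "T d"] good_closed[OF T d] by simp
  then have "form (T d) w = 0" using null_left good_closed[OF T d] assms(5) by blast
  moreover have "form (T d) w = form (T u) w - form (T u') w"
    using T assms(2,3,5) by (simp add: d_def good_def)
  ultimately show ?thesis by simp
qed

lemma good_lc:
  assumes T: "good B T" and "\<And>k. k < n \<Longrightarrow> f k \<in> V" "w \<in> V"
  shows "form (T (lc n a f)) w = form (lc n a (\<lambda>k. T (f k))) w"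
proof -
  have "form (T (lc n a f)) w = (\<Sum>k<n. a k * form (T (f k)) w)"
    using assms(2)
  proof (induction n)
    case 0
    then show ?case using T assms(3) by (simp add: good_def)
  next
    case (Suc n)
    then show ?case using T assms(3) by (simp add: good_def lc_closed)
  qed
  then show ?thesis using assms by (simp add: form_lc good_closed[OF T])
qed

text \<open>\<open>b n\<close> is a multiple of \<open>s n\<close> plus a combination of earlier
  Gram-Schmidt vectors; strong induction transfers the invariance assumed for the generators
  \<open>s\<close> to \<open>b\<close>.\<close>

lemma inM_good_b:
  assumes T: "good B T"
  shows "inM (T (b n))"
proof (induction n rule: less_induct)
  case (less n)
  let ?c = "complex_of_real (1 / sqrt (Re (form (residual n b) (residual n b))))"
  let ?a = "\<lambda>k. - form (s n) (b k)"
  let ?x = "sm ?c (add (T (s n)) (lc n ?a (\<lambda>k. T (b k))))"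
  have "inM ?x"
    using less by (intro inM_sm inM_add inM_lc inM_s good_s[OF T])
  then show ?case
  proof (rule inM_equiv)
    show "T (b n) \<in> V" using T by (simp add: good_closed)
    fix v assume v: "v \<in> V"
    note Tv = good_closed[OF T]
    have "form (T (b n)) v = ?c * form (T (residual n b)) v"
      by (subst b_unfold) (simp only: normalize_def good_sm[OF T] residual_closed v)
    also have "form (T (residual n b)) v = form (T (s n)) v + form (T (lc n ?a b)) v"
      unfolding residual_def by (intro good_add[OF T] lc_closed b_closed s_closed v)
    also have "form (T (lc n ?a b)) v = form (lc n ?a (\<lambda>k. T (b k))) v"
      by (intro good_lc[OF T] b_closed v)
    finally show "form (T (b n)) v = form ?x v"
      by (simp only: form_sm form_add lc_closed Tv b_closed s_closed add_closed v)
  qed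
qed

lemma inM_expand:
  assumes "inM u"
  shows "\<exists>n. (\<forall>v\<in>V. form u v = form (lc n (\<lambda>k. form u (b k)) b) v) \<and>
    U u = (\<Sum>k<n. cs (form u (b k)) (ket k))"
proof -
  note u = inM_closed[OF assms]
  obtain n where n: "\<And>v. v \<in> V \<Longrightarrow> form u v = (\<Sum>k<n. form u (b k) * form (b k) v)"
    "\<And>k. k \<ge> n \<Longrightarrow> form u (b k) = 0"
    using inM_bound[OF assms] by (metis order_refl)
  have 1: "U u = (\<Sum>k<n. cs (form u (b k)) (ket k))"
    by (rule coef_inject_ext) (auto simp: u sum.delta if_distrib[of "(*) _"] n(2) cong: if_cong)
  have "\<forall>v\<in>V. form u v = form (lc n (\<lambda>k. form u (b k)) b) v"
  proof
    fix v assume v: "v \<in> V"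
    show "form u v = form (lc n (\<lambda>k. form u (b k)) b) v"
      unfolding form_lc[OF b_closed v] by (rule n(1)[OF v])
  qed
  with 1 show ?thesis by - (rule exI[of _ n], rule conjI)
qed

lemma inM_good:
  assumes T: "good B T" and u: "inM u"
  shows "inM (T u)"
proof -
  obtain n where "\<forall>v\<in>V. form u v = form (lc n (\<lambda>k. form u (b k)) b) v"
    using inM_expand[OF u] by blast
  note n = bspec[OF this]
  have "inM (lc n (\<lambda>k. form u (b k)) (\<lambda>k. T (b k)))"
    by (intro inM_lc inM_s inM_good_b[OF T])
  then show ?thesis
  proof (rule inM_equiv)
    show "T u \<in> V" using T u by (simp add: good_closed inM_closed)
    fix v assume v: "v \<in> V"
    have "form (T u) v = form (T (lc n (\<lambda>k. form u (b k)) b)) v"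
      by (intro good_equiv[OF T] lc_closed b_closed inM_closed[OF u] v n)
    then show "form (T u) v = form (lc n (\<lambda>k. form u (b k)) (\<lambda>k. T (b k))) v"
      using good_lc[OF T _ v, of n b] by simp
  qed
qed

definition hat :: "('v \<Rightarrow> 'v) \<Rightarrow> nat ell2 \<Rightarrow> nat ell2" where
  "hat T = ext (\<lambda>k. U (T (b k)))"

text \<open>A finite combination of the images is \<open>U (T u)\<close> for \<open>u\<close> the
  same combination of the \<open>b k\<close>. Since \<open>U\<close> preserves the form there, the
  bound of \<open>T\<close> carries over, and \<open>form u u\<close> is at most the squared l^2
  norm of the coefficients; it can be smaller, as null \<open>b k\<close> contribute
  nothing.\<close>

lemma bessel_bound_hat:
  assumes T: "good B T"
  shows "bessel_bound B (\<lambda>k. U (T (b k)))"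
  unfolding bessel_bound_def
proof (intro conjI allI impI)
  show "0 \<le> B" using T by (simp add: good_def)
  fix F :: "nat set" and a :: "nat \<Rightarrow> complex" assume "finite F"
  then obtain n where n: "F \<subseteq> {..<n}" using finite_nat_iff_bounded by blast
  define a' where "a' k = (if k \<in> F then a k else 0)" for k
  let ?u = "lc n a' b"
  have M: "inM ?u" by (intro inM_lc inM_s inM_b)
  have "(\<Sum>k\<in>F. cs (a k) (U (T (b k)))) = (\<Sum>k<n. cs (a' k) (U (T (b k))))"
    using n by (intro sum.mono_neutral_cong_left) (auto simp: a'_def cs_algebra)
  also have "\<dots> = U (lc n a' (\<lambda>k. T (b k)))"
    using T by (simp add: U_lc good_closed)
  also have "\<dots> = U (T ?u)"
    using T by (intro U_cong) (auto simp: good_lc intro!: lc_closed good_closed[OF T])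
  finally have "(norm (\<Sum>k\<in>F. cs (a k) (U (T (b k)))))\<^sup>2 = (norm (U (T ?u)))\<^sup>2" by simp
  also have "\<dots> = Re (form (T ?u) (T ?u))"
    using cip_U[OF inM_good[OF T M] inM_closed[OF inM_good[OF T M]]] Re_cip_self by metis
  also have "\<dots> \<le> B\<^sup>2 * Re (form ?u ?u)"
    using T inM_closed[OF M] by (simp add: good_def)
  also have "Re (form ?u ?u) \<le> (\<Sum>k\<in>F. (cmod (a k))\<^sup>2)"
  proof -
    have ub: "form (b k) ?u = cnj (a' k) * form (b k) (b k)" if "k < n" for k
    proof -
      have "form ?u (b k) = (\<Sum>j\<in>{k}. a' j * form (b j) (b k))"
        unfolding form_lc[of n b, OF b_closed b_closed]
        using that orthogonal by (intro sum.mono_neutral_right) auto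
      then show ?thesis
        using form_herm[of ?u "b k"] inM_closed[OF M] form_herm[of "b k" "b k"] by simp
    qed
    have "form ?u ?u = (\<Sum>k<n. a' k * (cnj (a' k) * form (b k) (b k)))"
      using ub inM_closed[OF M] by (subst form_lc) auto
    also have "\<dots> = complex_of_real (\<Sum>k<n. (cmod (a' k))\<^sup>2 * Re (form (b k) (b k)))"
      unfolding of_real_sum
      by (intro sum.cong refl) (auto simp: form_b_self mult_cnj_cmod simp del: of_real_power)
    finally have "Re (form ?u ?u) = (\<Sum>k<n. (cmod (a' k))\<^sup>2 * Re (form (b k) (b k)))" by simp
    also have "\<dots> \<le> (\<Sum>k<n. (cmod (a' k))\<^sup>2)"
      by (intro sum_mono) (auto simp: form_b_self)
    also have "\<dots> = (\<Sum>k\<in>F. (cmod (a k))\<^sup>2)"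
      using n by (intro sum.mono_neutral_cong_right) (auto simp: a'_def)
    finally show ?thesis .
  qed
  finally show "(norm (\<Sum>k\<in>F. cs (a k) (U (T (b k)))))\<^sup>2 \<le> B\<^sup>2 * (\<Sum>k\<in>F. (cmod (a k))\<^sup>2)"
    by (simp add: mult_left_mono)
qed

lemma bclin_hat: "good B T \<Longrightarrow> bclin (hat T)"
  unfolding hat_def by (rule bclin_ext[OF bessel_bound_hat])

lemma hat_ket: "good B T \<Longrightarrow> hat T (ket k) = U (T (b k))"
  unfolding hat_def by (rule ext_ket[OF bessel_bound_hat])

lemma hat_U:
  assumes T: "good B T" and u: "inM u"
  shows "hat T (U u) = U (T u)"
proof -
  obtain n where e: "\<forall>v\<in>V. form u v = form (lc n (\<lambda>k. form u (b k)) b) v"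
    "U u = (\<Sum>k<n. cs (form u (b k)) (ket k))"
    using inM_expand[OF u] by blast
  note n = bspec[OF e(1)] e(2)
  have "hat T (U u) = (\<Sum>k<n. cs (form u (b k)) (U (T (b k))))"
    unfolding n(2) by (simp add: bclinD[OF bclin_hat[OF T]] hat_ket[OF T])
  also have "\<dots> = U (lc n (\<lambda>k. form u (b k)) (\<lambda>k. T (b k)))"
    using T by (simp add: U_lc good_closed)
  also have "\<dots> = U (T u)"
  proof (rule U_cong)
    fix v assume v: "v \<in> V"
    have "form (T u) v = form (T (lc n (\<lambda>k. form u (b k)) b)) v"
      by (intro good_equiv[OF T] lc_closed b_closed inM_closed[OF u] v n(1))
    then show "form (lc n (\<lambda>k. form u (b k)) (\<lambda>k. T (b k))) v = form (T u) v"
      using good_lc[OF T _ v, of n b] by simp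
  qed (intro lc_closed good_closed[OF T] b_closed inM_closed[OF u])+
  finally show ?thesis .
qed

lemma hat_hat_ket: "good B S \<Longrightarrow> good B' T \<Longrightarrow> hat S (hat T (ket k)) = U (S (T (b k)))"
  by (simp add: hat_ket hat_U inM_good_b)

lemma hat_commute:
  assumes "good B S" "good B' T" "\<And>u. u \<in> V \<Longrightarrow> S (T u) = T (S u)"
  shows "hat S (hat T f) = hat T (hat S f)"
proof (rule bclin_eqI[where f = f])
  fix i
  show "hat S (hat T (ket i)) = hat T (hat S (ket i))"
    by (simp only: hat_hat_ket[OF assms(1,2)] hat_hat_ket[OF assms(2,1)] assms(3) b_closed)
qed (rule bclin_compose[OF bclin_hat[OF assms(1)] bclin_hat[OF assms(2)]]
      bclin_compose[OF bclin_hat[OF assms(2)] bclin_hat[OF assms(1)]])+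

lemma good_id: "good 1 (\<lambda>u. u)"
  by (auto simp: good_def form_add form_sm inM_s)

text \<open>\<open>hat (\<lambda>u. u)\<close> is not the identity in general: it annihilates
  \<open>ket k\<close> whenever \<open>b k\<close> is null. It is the projection that appears as
  \<open>P\<close> in the models, and every \<open>hat T\<close> lives on its range.\<close>

lemma hat_id:
  assumes "good B T"
  shows "hat T (hat (\<lambda>u. u) f) = hat T f" "hat (\<lambda>u. u) (hat T f) = hat T f"
proof -
  note T = bclin_hat[OF assms] and I = bclin_hat[OF good_id]
  show "hat T (hat (\<lambda>u. u) f) = hat T f"
    by (rule bclin_eqI[OF bclin_compose[OF T I] T])
      (rule trans[OF hat_hat_ket[OF assms good_id] hat_ket[OF assms, symmetric]])
  show "hat (\<lambda>u. u) (hat T f) = hat T f"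
    by (rule bclin_eqI[OF bclin_compose[OF I T] T])
      (rule trans[OF hat_hat_ket[OF good_id assms] hat_ket[OF assms, symmetric]])
qed

lemma adjoint_pair_hat:
  assumes "good B S" "good B' T" "\<And>u v. u \<in> V \<Longrightarrow> v \<in> V \<Longrightarrow> form (S u) v = form u (T v)"
  shows "adjoint_pair (hat S) (hat T)"
proof (rule adjoint_pair_ket)
  fix i j
  show "coef (hat S (ket i)) j = cnj (coef (hat T (ket j)) i)"
    using assms(3)[of "b i" "b j"] form_herm[of "T (b j)" "b i"] assms(1,2)
    by (simp add: hat_ket good_closed)
qed (use assms bclin_hat in blast)+

end

section \<open>Countable sets closed under operations\<close>

primrec closure_step :: "('v \<Rightarrow> 'v \<Rightarrow> 'v) set \<Rightarrow> 'v set \<Rightarrow> nat \<Rightarrow> 'v set" where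
  "closure_step F S 0 = S"
| "closure_step F S (Suc n) = closure_step F S n \<union>
     (\<Union>f\<in>F. \<Union>x\<in>closure_step F S n. \<Union>y\<in>closure_step F S n. {f x y})"

text \<open>Unary operations enter as binary ones that ignore an argument. Two elements found at
  stages \<open>m\<close> and \<open>n\<close> are both present at stage \<open>m + n\<close>, so
  their value appears one stage later.\<close>

lemma countable_closure:
  fixes F :: "('v \<Rightarrow> 'v \<Rightarrow> 'v) set"
  assumes "countable F" "countable S" "S \<subseteq> C" "\<And>f x y. f \<in> F \<Longrightarrow> x \<in> C \<Longrightarrow> y \<in> C \<Longrightarrow> f x y \<in> C"
  obtains D where "countable D" "S \<subseteq> D" "D \<subseteq> C" "\<And>f x y. f \<in> F \<Longrightarrow> x \<in> D \<Longrightarrow> y \<in> D \<Longrightarrow> f x y \<in> D"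
proof
  let ?D = "\<Union>n. closure_step F S n"
  have "countable (closure_step F S n)" for n
    by (induction n) (use assms(1,2) in \<open>auto intro!: countable_UN\<close>)
  then show "countable ?D" by (intro countable_UN) simp_all
  show "S \<subseteq> ?D" using UN_upper[of 0 UNIV "closure_step F S"] by simp
  have "closure_step F S n \<subseteq> C" for n
    by (induction n) (use assms(3,4) in \<open>auto simp: subset_iff\<close>)
  then show "?D \<subseteq> C" by blast
  have mono: "closure_step F S m \<subseteq> closure_step F S (m + k)" for m k
    by (induction k) auto
  fix f x y assume f: "f \<in> F" and "x \<in> ?D" "y \<in> ?D"
  then obtain m n where "x \<in> closure_step F S m" "y \<in> closure_step F S n" by blast
  then have "x \<in> closure_step F S (m + n)" "y \<in> closure_step F S (m + n)"
    using mono[of m n] mono[of n m] by (auto simp: add.commute)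
  then have "f x y \<in> closure_step F S (Suc (m + n))" using f by auto
  then show "f x y \<in> ?D" by blast
qed

section \<open>Composition of matrix families\<close>

lemma nonneg_Reals_sum: "(\<And>x. x \<in> A \<Longrightarrow> f x \<in> (\<real>\<^sub>\<ge>\<^sub>0 :: complex set)) \<Longrightarrow> sum f A \<in> \<real>\<^sub>\<ge>\<^sub>0"
  by (induction A rule: infinite_finite_induct) auto

lemma mult_cnj_nonneg: "z * cnj z \<in> \<real>\<^sub>\<ge>\<^sub>0"
  by (simp only: mult_cnj_cmod) simp

definition psd_on :: "'k set \<Rightarrow> ('k \<Rightarrow> 'k \<Rightarrow> complex) \<Rightarrow> bool" where
  "psd_on K M \<longleftrightarrow> (\<forall>v. (\<Sum>k\<in>K. \<Sum>l\<in>K. M k l * v l * cnj (v k)) \<in> \<real>\<^sub>\<ge>\<^sub>0)"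

lemma psd_on_mono:
  assumes "psd_on L M" "K \<subseteq> L" "finite L"
  shows "psd_on K M"
  unfolding psd_on_def
proof
  fix v :: "_ \<Rightarrow> complex"
  define w where "w k = (if k \<in> K then v k else 0)" for k
  have "(\<Sum>k\<in>K. \<Sum>l\<in>K. M k l * v l * cnj (v k)) = (\<Sum>k\<in>K. \<Sum>l\<in>K. M k l * w l * cnj (w k))"
    by (simp add: w_def)
  also have "\<dots> = (\<Sum>k\<in>K. \<Sum>l\<in>L. M k l * w l * cnj (w k))"
    using assms(2,3) by (intro sum.cong sum.mono_neutral_left) (auto simp: w_def)
  also have "\<dots> = (\<Sum>k\<in>L. \<Sum>l\<in>L. M k l * w l * cnj (w k))"
    using assms(2,3) by (intro sum.mono_neutral_left) (auto simp: w_def)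
  finally show "(\<Sum>k\<in>K. \<Sum>l\<in>K. M k l * v l * cnj (v k)) \<in> \<real>\<^sub>\<ge>\<^sub>0"
    using assms(1) by (simp add: psd_on_def)
qed

text \<open>Restricted to two coordinates, positivity at the vectors (1,0), (0,1), (1,1) and (1,i)
  makes four imaginary parts vanish, and these relate the real and imaginary parts of the two
  off-diagonal entries.\<close>

lemma psd_on_hermitian:
  assumes "psd_on K M" "finite K" "k \<in> K" "l \<in> K"
  shows "M l k = cnj (M k l)"
proof (cases "k = l")
  case True
  have "psd_on {k} M" using assms by - (rule psd_on_mono[of K], auto)
  from this[unfolded psd_on_def, THEN spec, of "\<lambda>_. 1"] show ?thesis using True by (simp add: complex_nonneg_Reals_iff complex_eq_iff)
next
  case False
  have p: "psd_on {k, l} M" using assms by - (rule psd_on_mono[of K], auto)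
  have q: "M k k * v k * cnj (v k) + M k l * v l * cnj (v k) + (M l k * v k * cnj (v l) + M l l * v l * cnj (v l)) \<in> \<real>\<^sub>\<ge>\<^sub>0" for v
  proof -
    have "(\<Sum>i\<in>{k, l}. f i) = f k + f l" for f :: "'a \<Rightarrow> complex" using False by simp
    from p[unfolded psd_on_def this, THEN spec, of v] show ?thesis .
  qed
  have 1: "Im (M k k) = 0" and 2: "Im (M l l) = 0"
    using q[of "\<lambda>i. if i = k then 1 else 0"] q[of "\<lambda>i. if i = l then 1 else 0"] False
    by (simp_all add: complex_nonneg_Reals_iff)
  have 3: "Im (M k k) + Im (M k l) + (Im (M l k) + Im (M l l)) = 0"
    using q[of "\<lambda>_. 1"] by (simp add: complex_nonneg_Reals_iff)
  have 4: "Im (M k k) + Re (M k l) + (- Re (M l k) + Im (M l l)) = 0"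
    using q[of "\<lambda>i. if i = k then 1 else \<i>"] False by (simp add: complex_nonneg_Reals_iff)
  show ?thesis
    by (rule complex_eqI) (use 1 2 3 4 in simp_all)
qed

text \<open>The matrix is read as a semi-inner product on functions, with
  \<open>form (delta l) (delta k) = M k l\<close>. Gram-Schmidt applied to the coordinate functions
  gives the factorization, without a spectral theorem.\<close>

lemma psd_on_gram:
  assumes "psd_on K M" "finite K"
  obtains n :: nat and v where "\<And>k l. k \<in> K \<Longrightarrow> l \<in> K \<Longrightarrow> M k l = (\<Sum>j<n. v j k * cnj (v j l))"
proof -
  define form where "form u w = (\<Sum>k\<in>K. \<Sum>l\<in>K. M k l * u l * cnj (w k))" for u w :: "'a \<Rightarrow> complex"
  define delta where "delta k = (\<lambda>l. if l = k then 1 else 0 :: complex)" for k :: 'a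
  interpret semi_inner UNIV "\<lambda>u v k. u k + v k" "\<lambda>c u k. c * u k" form "\<lambda>n. delta (from_nat_into K n)"
  proof
    fix u w :: "'a \<Rightarrow> complex"
    have "cnj (form u w) = (\<Sum>k\<in>K. \<Sum>l\<in>K. cnj (M k l) * cnj (u l) * w k)"
      unfolding form_def by (simp add: mult.assoc)
    also have "\<dots> = (\<Sum>k\<in>K. \<Sum>l\<in>K. M l k * cnj (u l) * w k)"
      by (intro sum.cong refl) (simp only: psd_on_hermitian[OF assms, symmetric])
    also have "\<dots> = form w u"
      unfolding form_def by (subst sum.swap) (simp add: algebra_simps)
    finally show "form w u = cnj (form u w)" ..
    show "form u u \<in> \<real>\<^sub>\<ge>\<^sub>0" using assms(1) by (simp add: psd_on_def form_def)
  qed (auto simp: form_def algebra_simps sum.distrib sum_distrib_left)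
  have fd: "form (delta l) (delta k) = M k l" if "k \<in> K" "l \<in> K" for k l
  proof -
    have "form (delta l) (delta k) = (\<Sum>i\<in>K. \<Sum>j\<in>K. if j = l \<and> i = k then M i j else 0)"
      unfolding form_def delta_def by (intro sum.cong) auto
    also have "\<dots> = (\<Sum>i\<in>K. if i = k then M i l else 0)"
      using assms(2) that by (intro sum.cong) (auto simp: sum.delta)
    finally show ?thesis using assms(2) that by (simp add: sum.delta)
  qed
  have M: "inM (delta k)" if "k \<in> K" for k
    using inM_s[of "to_nat_on K k"] that assms(2) by (simp add: countable_finite)
  have "\<forall>k\<in>K. \<exists>n. \<forall>m\<ge>n. \<forall>v. form (delta k) v = (\<Sum>j<m. form (delta k) (b j) * form (b j) v)"
  proof
    fix k assume "k \<in> K"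
    show "\<exists>n. \<forall>m\<ge>n. \<forall>v. form (delta k) v = (\<Sum>j<m. form (delta k) (b j) * form (b j) v)"
      by (rule inM_bound[OF M[OF \<open>k \<in> K\<close>]]) blast
  qed
  from bchoice[OF this] obtain N where
    "\<forall>k\<in>K. \<forall>m\<ge>N k. \<forall>v. form (delta k) v = (\<Sum>j<m. form (delta k) (b j) * form (b j) v)"
    by blast
  note N = this[rule_format]
  show ?thesis
  proof
    fix k l assume kl: "k \<in> K" "l \<in> K"
    \<comment> \<open>One common length for all entries: the sum of the individual lengths dominates
      each of them.\<close>
    have "N l \<le> (\<Sum>k\<in>K. N k)" using kl assms(2) by (intro member_le_sum) auto
    from trans[OF fd[OF kl, symmetric] N[OF kl(2) this]]
    have "M k l = (\<Sum>j<(\<Sum>k\<in>K. N k). form (delta l) (b j) * form (b j) (delta k))" .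
    also have "\<dots> = (\<Sum>j<(\<Sum>k\<in>K. N k). form (b j) (delta k) * cnj (form (b j) (delta l)))"
      by (intro sum.cong refl) (simp add: form_herm[of "b _" "delta l"])
    finally show "M k l = (\<Sum>j<(\<Sum>k\<in>K. N k). form (b j) (delta k) * cnj (form (b j) (delta l)))" .
  qed
qed

lemma psd_on_gramI:
  assumes "\<And>k l. k \<in> K \<Longrightarrow> l \<in> K \<Longrightarrow> M k l = (\<Sum>p\<in>P. w p k * cnj (w p l))"
  shows "psd_on K M"
  unfolding psd_on_def
proof
  fix v
  have "(\<Sum>k\<in>K. \<Sum>l\<in>K. M k l * v l * cnj (v k)) =
      (\<Sum>k\<in>K. \<Sum>l\<in>K. \<Sum>p\<in>P. (w p k * cnj (v k)) * cnj (w p l * cnj (v l)))"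
    using assms by (intro sum.cong refl) (simp add: sum_distrib_left sum_distrib_right algebra_simps)
  also have "\<dots> = (\<Sum>p\<in>P. \<Sum>k\<in>K. \<Sum>l\<in>K. (w p k * cnj (v k)) * cnj (w p l * cnj (v l)))"
    by (subst sum.swap[of _ P]) (intro sum.cong refl sum.swap)
  also have "\<dots> = (\<Sum>p\<in>P. (\<Sum>k\<in>K. w p k * cnj (v k)) * cnj (\<Sum>k\<in>K. w p k * cnj (v k)))"
    by (simp add: sum_product)
  also have "\<dots> \<in> \<real>\<^sub>\<ge>\<^sub>0"
    by (intro nonneg_Reals_sum mult_cnj_nonneg)
  finally show "(\<Sum>k\<in>K. \<Sum>l\<in>K. M k l * v l * cnj (v k)) \<in> \<real>\<^sub>\<ge>\<^sub>0" .
qed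

section \<open>Positive families with blocks (x, a)\<close>

definition pos_on :: "'i set \<Rightarrow> ('x::finite \<Rightarrow> 'x \<Rightarrow> 'a::finite \<Rightarrow> 'a \<Rightarrow> 'i \<Rightarrow> 'i \<Rightarrow> complex) \<Rightarrow> bool" where
  "pos_on I E \<longleftrightarrow> psd_on (UNIV \<times> UNIV \<times> I)
     (\<lambda>k l. E (fst k) (fst l) (fst (snd k)) (fst (snd l)) (snd (snd k)) (snd (snd l)))"

lemma pos_on_iff:
  "pos_on I E \<longleftrightarrow> (\<forall>v.
     (\<Sum>x\<in>UNIV. \<Sum>x'\<in>UNIV. \<Sum>a\<in>UNIV. \<Sum>a'\<in>UNIV. \<Sum>i\<in>I. \<Sum>j\<in>I.
        E x x' a a' i j * v x' a' j * cnj (v x a i)) \<in> \<real>\<^sub>\<ge>\<^sub>0)"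
proof -
  have "(\<Sum>k\<in>UNIV \<times> UNIV \<times> I. \<Sum>l\<in>UNIV \<times> UNIV \<times> I.
          E (fst k) (fst l) (fst (snd k)) (fst (snd l)) (snd (snd k)) (snd (snd l)) * w l * cnj (w k)) =
        (\<Sum>x\<in>UNIV. \<Sum>x'\<in>UNIV. \<Sum>a\<in>UNIV. \<Sum>a'\<in>UNIV. \<Sum>i\<in>I. \<Sum>j\<in>I.
        E x x' a a' i j * w (x', a', j) * cnj (w (x, a, i)))" for w
    unfolding sum.cartesian_product
    by (rule sum.reindex_bij_witness[of _
          "\<lambda>(x, x', a, a', i, j). ((x, a, i), (x', a', j))"
          "\<lambda>((x, a, i), (x', a', j)). (x, x', a, a', i, j)"]) auto
  note e = this
  show ?thesis
  proof
    assume p: "pos_on I E"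
    show "\<forall>v. (\<Sum>x\<in>UNIV. \<Sum>x'\<in>UNIV. \<Sum>a\<in>UNIV. \<Sum>a'\<in>UNIV. \<Sum>i\<in>I. \<Sum>j\<in>I.
        E x x' a a' i j * v x' a' j * cnj (v x a i)) \<in> \<real>\<^sub>\<ge>\<^sub>0"
    proof
      fix v
      show "(\<Sum>x\<in>UNIV. \<Sum>x'\<in>UNIV. \<Sum>a\<in>UNIV. \<Sum>a'\<in>UNIV. \<Sum>i\<in>I. \<Sum>j\<in>I.
        E x x' a a' i j * v x' a' j * cnj (v x a i)) \<in> \<real>\<^sub>\<ge>\<^sub>0"
        using p[unfolded pos_on_def psd_on_def, THEN spec, of "\<lambda>(x, a, i). v x a i"]
        unfolding e by simp
    qed
  next
    assume p: "\<forall>v. (\<Sum>x\<in>UNIV. \<Sum>x'\<in>UNIV. \<Sum>a\<in>UNIV. \<Sum>a'\<in>UNIV. \<Sum>i\<in>I. \<Sum>j\<in>I.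
        E x x' a a' i j * v x' a' j * cnj (v x a i)) \<in> \<real>\<^sub>\<ge>\<^sub>0"
    show "pos_on I E"
      unfolding pos_on_def psd_on_def e using p[THEN spec, of "\<lambda>x a i. w (x, a, i)" for w] by blast
  qed
qed

lemma pos_on_mono: "pos_on J E \<Longrightarrow> I \<subseteq> J \<Longrightarrow> finite J \<Longrightarrow> pos_on I E"
  unfolding pos_on_def by (rule psd_on_mono[of "UNIV \<times> UNIV \<times> J"]) auto

text \<open>Products of a Gram vector of \<open>E1\<close> at (x, a, i) with one of
  \<open>E2\<close> at (a, z, j), summed over a, form a Gram family of the composition: expanding
  the product of two such sums produces exactly the double sum over a and a'.\<close>

lemma pos_on_compose:
  fixes E1 :: "'x::finite \<Rightarrow> 'x \<Rightarrow> 'a::finite \<Rightarrow> 'a \<Rightarrow> 'i \<Rightarrow> 'i \<Rightarrow> complex"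
    and E2 :: "'a \<Rightarrow> 'a \<Rightarrow> 'z::finite \<Rightarrow> 'z \<Rightarrow> 'j \<Rightarrow> 'j \<Rightarrow> complex"
  assumes "pos_on I E1" "pos_on J E2" "finite I" "finite J"
  shows "pos_on (I \<times> J) (\<lambda>x x' z z' p q. \<Sum>a\<in>UNIV. \<Sum>a'\<in>UNIV.
    E1 x x' a a' (fst p) (fst q) * E2 a a' z z' (snd p) (snd q))"
proof -
  obtain m v where v: "\<And>x a i x' a' j. i \<in> I \<Longrightarrow> j \<in> I \<Longrightarrow>
      E1 x x' a a' i j = (\<Sum>n<m::nat. v n (x, a, i) * cnj (v n (x', a', j)))"
    by (rule psd_on_gram[OF assms(1)[unfolded pos_on_def]]) (use assms(3) in auto)
  obtain m' w where w: "\<And>x a i x' a' j. i \<in> J \<Longrightarrow> j \<in> J \<Longrightarrow>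
      E2 x x' a a' i j = (\<Sum>n<m'::nat. w n (x, a, i) * cnj (w n (x', a', j)))"
    by (rule psd_on_gram[OF assms(2)[unfolded pos_on_def]]) (use assms(4) in auto)
  let ?W = "\<lambda>p k. \<Sum>a\<in>UNIV. v (fst p) (fst k, a, fst (snd (snd k))) * w (snd p) (a, fst (snd k), snd (snd (snd k)))"
  show ?thesis
    unfolding pos_on_def
  proof (rule psd_on_gramI[where P = "{..<m} \<times> {..<m'}" and w = ?W])
    fix k l :: "'x \<times> 'z \<times> 'i \<times> 'j"
    assume "k \<in> UNIV \<times> UNIV \<times> I \<times> J" "l \<in> UNIV \<times> UNIV \<times> I \<times> J"
    then obtain x z i j x' z' i' j' where k: "k = (x, z, i, j)" "l = (x', z', i', j')"
      and ij: "i \<in> I" "i' \<in> I" "j \<in> J" "j' \<in> J" by auto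
    have "(\<Sum>p\<in>{..<m} \<times> {..<m'}. ?W p k * cnj (?W p l)) =
      (\<Sum>p\<in>{..<m} \<times> {..<m'}. \<Sum>a\<in>UNIV. \<Sum>a'\<in>UNIV.
         (v (fst p) (x, a, i) * cnj (v (fst p) (x', a', i'))) * (w (snd p) (a, z, j) * cnj (w (snd p) (a', z', j'))))"
      unfolding k by (simp add: sum_product algebra_simps)
    also have "\<dots> = (\<Sum>a\<in>UNIV. \<Sum>p\<in>{..<m} \<times> {..<m'}. \<Sum>a'\<in>UNIV.
         (v (fst p) (x, a, i) * cnj (v (fst p) (x', a', i'))) * (w (snd p) (a, z, j) * cnj (w (snd p) (a', z', j'))))"
      by (rule sum.swap)
    also have "\<dots> = (\<Sum>a\<in>UNIV. \<Sum>a'\<in>UNIV. \<Sum>p\<in>{..<m} \<times> {..<m'}.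
         (v (fst p) (x, a, i) * cnj (v (fst p) (x', a', i'))) * (w (snd p) (a, z, j) * cnj (w (snd p) (a', z', j'))))"
      by (intro sum.cong refl sum.swap)
    also have "\<dots> = (\<Sum>a\<in>UNIV. \<Sum>a'\<in>UNIV. E1 x x' a a' i i' * E2 a a' z z' j j')"
      unfolding v[OF ij(1,2)] w[OF ij(3,4)] sum_product sum.cartesian_product
      by (simp add: case_prod_unfold)
    finally show "(\<Sum>a\<in>UNIV. \<Sum>a'\<in>UNIV.
      E1 (fst k) (fst l) a a' (fst (snd (snd k))) (fst (snd (snd l))) *
      E2 a a' (fst (snd k)) (fst (snd l)) (snd (snd (snd k))) (snd (snd (snd l)))) =
      (\<Sum>p\<in>{..<m} \<times> {..<m'}. ?W p k * cnj (?W p l))"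
      by (simp add: k)
  qed
qed

section \<open>Kernels of correlations\<close>

lemma vec2_eqI: "(\<And>i j. (A :: 'm::finite cmat) $ i $ j = B $ i $ j) \<Longrightarrow> A = B"
  by (simp add: vec_eq_iff)

lemma clinear_mapD:
  assumes "clinear_map \<Gamma>"
  shows "\<Gamma> (M + N) = \<Gamma> M + \<Gamma> N" "\<Gamma> (cscale c M) = cscale c (\<Gamma> M)" "\<Gamma> 0 = 0"
    "\<Gamma> (sum f S) = (\<Sum>x\<in>S. \<Gamma> (f x))" "\<Gamma> (M - N) = \<Gamma> M - \<Gamma> N"
proof -
  interpret L: Vector_Spaces.linear cscale cscale \<Gamma> using assms by (simp add: clinear_map_def)
  show "\<Gamma> (M + N) = \<Gamma> M + \<Gamma> N" "\<Gamma> (cscale c M) = cscale c (\<Gamma> M)" "\<Gamma> 0 = 0"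
    "\<Gamma> (sum f S) = (\<Sum>x\<in>S. \<Gamma> (f x))" "\<Gamma> (M - N) = \<Gamma> M - \<Gamma> N"
    by (simp_all add: L.add L.scale L.zero L.sum L.diff)
qed

lemma clinear_mapI:
  assumes "\<And>M N. \<Gamma> (M + N) = \<Gamma> M + \<Gamma> N" "\<And>c M. \<Gamma> (cscale c M) = cscale c (\<Gamma> M)"
  shows "clinear_map \<Gamma>"
  unfolding clinear_map_def
proof unfold_locales
  show "\<Gamma> (M + N) = \<Gamma> M + \<Gamma> N" for M N by (rule assms)
  show "\<Gamma> (cscale c M) = cscale c (\<Gamma> M)" for c M by (rule assms)
qed (auto intro!: vec2_eqI simp: cscale_def algebra_simps)

lemma clinear_map_compose: "clinear_map \<Gamma>1 \<Longrightarrow> clinear_map \<Gamma>2 \<Longrightarrow> clinear_map (\<Gamma>2 \<circ> \<Gamma>1)"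
  by (rule clinear_mapI) (simp_all add: clinear_mapD)

lemma cmat_sum_component: "(\<Sum>x\<in>S. (f x :: 'm::finite cmat)) $ i $ j = (\<Sum>x\<in>S. f x $ i $ j)"
  by (induction S rule: infinite_finite_induct) auto

lemma cmat_expand:
  fixes M :: "('x::finite \<times> 'y::finite) cmat"
  shows "M = (\<Sum>x\<in>UNIV. \<Sum>x'\<in>UNIV. \<Sum>y\<in>UNIV. \<Sum>y'\<in>UNIV.
     cscale (M $ (x, y) $ (x', y')) (kron (munit x x') (munit y y')))"
proof (rule vec2_eqI)
  fix p q :: "'x \<times> 'y"
  have "(\<Sum>x\<in>UNIV. \<Sum>x'\<in>UNIV. \<Sum>y\<in>UNIV. \<Sum>y'\<in>UNIV.
     cscale (M $ (x, y) $ (x', y')) (kron (munit x x') (munit y y'))) $ p $ q =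
     (\<Sum>x\<in>UNIV. \<Sum>x'\<in>UNIV. \<Sum>y\<in>UNIV. \<Sum>y'\<in>UNIV. if y' = snd q then (if y = snd p then (if x' = fst q then (if x = fst p then
     M $ (x, y) $ (x', y') else 0) else 0) else 0) else 0)"
    unfolding cmat_sum_component
    by (intro sum.cong refl) (auto simp: cscale_def kron_def munit_def)
  also have "\<dots> = M $ p $ q" by (simp add: sum.delta)
  finally show "M $ p $ q = (\<Sum>x\<in>UNIV. \<Sum>x'\<in>UNIV. \<Sum>y\<in>UNIV. \<Sum>y'\<in>UNIV.
     cscale (M $ (x, y) $ (x', y')) (kron (munit x x') (munit y y'))) $ p $ q" ..
qed

lemma clinear_map_expand:
  fixes \<Gamma> :: "('x::finite \<times> 'y::finite) cmat \<Rightarrow> 'm::finite cmat"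
  assumes "clinear_map \<Gamma>"
  shows "\<Gamma> M = (\<Sum>x\<in>UNIV. \<Sum>x'\<in>UNIV. \<Sum>y\<in>UNIV. \<Sum>y'\<in>UNIV.
     cscale (M $ (x, y) $ (x', y')) (\<Gamma> (kron (munit x x') (munit y y'))))"
  by (subst cmat_expand[of M]) (simp add: clinear_mapD[OF assms])

text \<open>On matrix units, composition of correlations is a contraction over a, a', b, b'; the
  composed operator families are built to match this formula.\<close>

lemma kernel_compose:
  fixes \<Gamma>1 :: "('x::finite \<times> 'y::finite) cmat \<Rightarrow> ('a::finite \<times> 'b::finite) cmat"
  assumes "clinear_map \<Gamma>2"
  shows "(\<Gamma>2 \<circ> \<Gamma>1) M $ p $ q = (\<Sum>a\<in>UNIV. \<Sum>a'\<in>UNIV. \<Sum>b\<in>UNIV. \<Sum>b'\<in>UNIV.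
    \<Gamma>1 M $ (a, b) $ (a', b') * \<Gamma>2 (kron (munit a a') (munit b b')) $ p $ q)"
  using clinear_map_expand[OF assms, of "\<Gamma>1 M"] by (simp add: cmat_sum_component cscale_def)

lemma bilinear_sum_swap:
  fixes e :: "'p \<Rightarrow> 't \<Rightarrow> complex"
  shows "(\<Sum>t\<in>T. (\<Sum>p\<in>P. e p t) * (\<Sum>q\<in>Q. f q t) * g t) = (\<Sum>p\<in>P. \<Sum>q\<in>Q. \<Sum>t\<in>T. e p t * f q t * g t)"
proof -
  have "(\<Sum>t\<in>T. (\<Sum>p\<in>P. e p t) * (\<Sum>q\<in>Q. f q t) * g t) = (\<Sum>t\<in>T. \<Sum>p\<in>P. \<Sum>q\<in>Q. e p t * f q t * g t)"
    by (intro sum.cong refl, subst sum_product) (simp add: sum_distrib_right)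
  also have "\<dots> = (\<Sum>p\<in>P. \<Sum>t\<in>T. \<Sum>q\<in>Q. e p t * f q t * g t)" by (rule sum.swap)
  also have "\<dots> = (\<Sum>p\<in>P. \<Sum>q\<in>Q. \<Sum>t\<in>T. e p t * f q t * g t)" by (intro sum.cong refl sum.swap)
  finally show ?thesis .
qed

section \<open>Quantum correlations\<close>

text \<open>Arbitrary finite index sets instead of initial segments of the naturals, so that the
  model of a composition can live on products of index sets.\<close>

definition q_model ::
  "'i set \<Rightarrow> 'j set \<Rightarrow> ('x \<Rightarrow> 'x \<Rightarrow> 'a \<Rightarrow> 'a \<Rightarrow> 'i \<Rightarrow> 'i \<Rightarrow> complex) \<Rightarrow> ('y \<Rightarrow> 'y \<Rightarrow> 'b \<Rightarrow> 'b \<Rightarrow> 'j \<Rightarrow> 'j \<Rightarrow> complex) \<Rightarrow>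
   ('i \<Rightarrow> 'j \<Rightarrow> complex) \<Rightarrow> (('x::finite \<times> 'y::finite) cmat \<Rightarrow> ('a::finite \<times> 'b::finite) cmat) \<Rightarrow> bool" where
  "q_model I J E F \<xi> \<Gamma> \<longleftrightarrow> clinear_map \<Gamma> \<and> finite I \<and> finite J \<and> pos_on I E \<and> pos_on J F \<and>
    (\<forall>x x'. \<forall>i\<in>I. \<forall>j\<in>I. (\<Sum>a\<in>UNIV. E x x' a a i j) = (if x = x' \<and> i = j then 1 else 0)) \<and>
    (\<forall>y y'. \<forall>i\<in>J. \<forall>j\<in>J. (\<Sum>b\<in>UNIV. F y y' b b i j) = (if y = y' \<and> i = j then 1 else 0)) \<and>
    (\<Sum>p\<in>I \<times> J. (cmod (\<xi> (fst p) (snd p)))\<^sup>2) = 1 \<and>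
    (\<forall>x x' y y' a a' b b'. \<Gamma> (kron (munit x x') (munit y y')) $ (a, b) $ (a', b') =
        (\<Sum>t\<in>(I \<times> J) \<times> (I \<times> J). E x x' a a' (fst (fst t)) (fst (snd t)) * F y y' b b' (snd (fst t)) (snd (snd t)) *
          (\<xi> (fst (snd t)) (snd (snd t)) * cnj (\<xi> (fst (fst t)) (snd (fst t))))))"

lemma Q_qI:
  fixes \<Gamma> :: "('x::finite \<times> 'y::finite) cmat \<Rightarrow> ('a::finite \<times> 'b::finite) cmat"
    and I :: "'c set" and J :: "'d set"
  assumes "q_model I J E F \<xi> \<Gamma>"
  shows "\<Gamma> \<in> Q_q"
proof -
  have lin: "clinear_map \<Gamma>" and fin: "finite I" "finite J" and pos: "pos_on I E" "pos_on J F"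
    and E: "\<And>x x' i j. i \<in> I \<Longrightarrow> j \<in> I \<Longrightarrow> (\<Sum>a\<in>UNIV. E x x' a a i j) = (if x = x' \<and> i = j then 1 else 0)"
    and F: "\<And>x x' i j. i \<in> J \<Longrightarrow> j \<in> J \<Longrightarrow> (\<Sum>a\<in>UNIV. F x x' a a i j) = (if x = x' \<and> i = j then 1 else 0)"
    and xi: "(\<Sum>p\<in>I \<times> J. (cmod (\<xi> (fst p) (snd p)))\<^sup>2) = 1"
    and \<Gamma>: "\<And>x x' y y' a a' b b'. \<Gamma> (kron (munit x x') (munit y y')) $ (a, b) $ (a', b') =
        (\<Sum>t\<in>(I \<times> J) \<times> (I \<times> J). E x x' a a' (fst (fst t)) (fst (snd t)) * F y y' b b' (snd (fst t)) (snd (snd t)) *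
          (\<xi> (fst (snd t)) (snd (snd t)) * cnj (\<xi> (fst (fst t)) (snd (fst t)))))"
    using assms unfolding q_model_def by blast+
  obtain g where g: "bij_betw g {0..<card I} I" using ex_bij_betw_nat_finite[OF fin(1)] by blast
  obtain h where h: "bij_betw h {0..<card J} J" using ex_bij_betw_nat_finite[OF fin(2)] by blast
  note g = g[unfolded atLeast0LessThan] and h = h[unfolded atLeast0LessThan]
  have sg: "(\<Sum>i<card I. f (g i)) = sum f I" for f :: "'c \<Rightarrow> 'z::comm_monoid_add"
    by (rule sum.reindex_bij_betw[OF g])
  have sh: "(\<Sum>i<card J. f (h i)) = sum f J" for f :: "'d \<Rightarrow> 'z::comm_monoid_add"
    by (rule sum.reindex_bij_betw[OF h])
  have gI: "g i \<in> I" "g i = g j \<longleftrightarrow> i = j" if "i < card I" "j < card I" for i j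
    using g that by (auto simp: bij_betw_def inj_on_def)
  have hJ: "h i \<in> J" "h i = h j \<longleftrightarrow> i = j" if "i < card J" "j < card J" for i j
    using h that by (auto simp: bij_betw_def inj_on_def)
  have 1: "stochastic_matrix_fin (card I) (\<lambda>x x' a a' i j. E x x' a a' (g i) (g j))"
    unfolding stochastic_matrix_fin_def
  proof (intro conjI allI impI)
    fix v :: "'x \<Rightarrow> 'a \<Rightarrow> nat \<Rightarrow> complex"
    \<comment> \<open>Pulling \<open>v\<close> back along the enumeration turns sums over
      \<open>card I\<close> into sums over \<open>I\<close>.\<close>
    define w where "w x a i = v x a (inv_into {..<card I} g i)" for x a i
    have v: "v x a i = w x a (g i)" if "i < card I" for x a i
      using that g by (simp add: w_def bij_betw_def inv_into_f_f)
    have "(\<Sum>x\<in>UNIV. \<Sum>x'\<in>UNIV. \<Sum>a\<in>UNIV. \<Sum>a'\<in>UNIV. \<Sum>i<card I. \<Sum>j<card I.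
           E x x' a a' (g i) (g j) * v x' a' j * cnj (v x a i)) =
         (\<Sum>x\<in>UNIV. \<Sum>x'\<in>UNIV. \<Sum>a\<in>UNIV. \<Sum>a'\<in>UNIV. \<Sum>i<card I. \<Sum>j<card I.
           E x x' a a' (g i) (g j) * w x' a' (g j) * cnj (w x a (g i)))"
      by (intro sum.cong refl) (simp add: v)
    also have "\<dots> = (\<Sum>x\<in>UNIV. \<Sum>x'\<in>UNIV. \<Sum>a\<in>UNIV. \<Sum>a'\<in>UNIV. \<Sum>i\<in>I. \<Sum>j\<in>I.
           E x x' a a' i j * w x' a' j * cnj (w x a i))"
      by (subst sg)+ (rule refl)
    finally show "(\<Sum>x\<in>UNIV. \<Sum>x'\<in>UNIV. \<Sum>a\<in>UNIV. \<Sum>a'\<in>UNIV. \<Sum>i<card I. \<Sum>j<card I.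
           E x x' a a' (g i) (g j) * v x' a' j * cnj (v x a i)) \<in> \<real>\<^sub>\<ge>\<^sub>0"
      using pos(1)[unfolded pos_on_iff, THEN spec, of w] by simp
  qed (simp add: E gI)
  have 2: "stochastic_matrix_fin (card J) (\<lambda>x x' a a' i j. F x x' a a' (h i) (h j))"
    unfolding stochastic_matrix_fin_def
  proof (intro conjI allI impI)
    fix v :: "'y \<Rightarrow> 'b \<Rightarrow> nat \<Rightarrow> complex"
    define w where "w x a i = v x a (inv_into {..<card J} h i)" for x a i
    have v: "v x a i = w x a (h i)" if "i < card J" for x a i
      using that h by (simp add: w_def bij_betw_def inv_into_f_f)
    have "(\<Sum>x\<in>UNIV. \<Sum>x'\<in>UNIV. \<Sum>a\<in>UNIV. \<Sum>a'\<in>UNIV. \<Sum>i<card J. \<Sum>j<card J.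
           F x x' a a' (h i) (h j) * v x' a' j * cnj (v x a i)) =
         (\<Sum>x\<in>UNIV. \<Sum>x'\<in>UNIV. \<Sum>a\<in>UNIV. \<Sum>a'\<in>UNIV. \<Sum>i<card J. \<Sum>j<card J.
           F x x' a a' (h i) (h j) * w x' a' (h j) * cnj (w x a (h i)))"
      by (intro sum.cong refl) (simp add: v)
    also have "\<dots> = (\<Sum>x\<in>UNIV. \<Sum>x'\<in>UNIV. \<Sum>a\<in>UNIV. \<Sum>a'\<in>UNIV. \<Sum>i\<in>J. \<Sum>j\<in>J.
           F x x' a a' i j * w x' a' j * cnj (w x a i))"
      by (subst sh)+ (rule refl)
    finally show "(\<Sum>x\<in>UNIV. \<Sum>x'\<in>UNIV. \<Sum>a\<in>UNIV. \<Sum>a'\<in>UNIV. \<Sum>i<card J. \<Sum>j<card J.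
           F x x' a a' (h i) (h j) * v x' a' j * cnj (v x a i)) \<in> \<real>\<^sub>\<ge>\<^sub>0"
      using pos(2)[unfolded pos_on_iff, THEN spec, of w] by simp
  qed (simp add: F hJ)
  have 3: "(\<Sum>i<card I. \<Sum>j<card J. (cmod (\<xi> (g i) (h j)))\<^sup>2) = 1"
  proof -
    have "(\<Sum>i<card I. \<Sum>j<card J. (cmod (\<xi> (g i) (h j)))\<^sup>2) = (\<Sum>i\<in>I. \<Sum>j\<in>J. (cmod (\<xi> i j))\<^sup>2)"
      by (subst sg sh)+ (rule refl)
    then show ?thesis using xi by (simp add: sum.cartesian_product')
  qed
  have 4: "\<Gamma> (kron (munit x x') (munit y y')) $ (a, b) $ (a', b') =
      (\<Sum>i<card I. \<Sum>j<card J. (\<Sum>i'<card I. \<Sum>j'<card J.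
        E x x' a a' (g i) (g i') * F y y' b b' (h j) (h j') * \<xi> (g i') (h j')) * cnj (\<xi> (g i) (h j)))"
    for x x' y y' a a' b b'
  proof -
    have "(\<Sum>i<card I. \<Sum>j<card J. (\<Sum>i'<card I. \<Sum>j'<card J.
        E x x' a a' (g i) (g i') * F y y' b b' (h j) (h j') * \<xi> (g i') (h j')) * cnj (\<xi> (g i) (h j))) =
      (\<Sum>i\<in>I. \<Sum>j\<in>J. (\<Sum>i'\<in>I. \<Sum>j'\<in>J.
        E x x' a a' i i' * F y y' b b' j j' * \<xi> i' j') * cnj (\<xi> i j))"
      by (subst sg sh)+ (rule refl)
    also have "\<dots> = (\<Sum>t\<in>(I \<times> J) \<times> (I \<times> J). E x x' a a' (fst (fst t)) (fst (snd t)) * F y y' b b' (snd (fst t)) (snd (snd t)) *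
          (\<xi> (fst (snd t)) (snd (snd t)) * cnj (\<xi> (fst (fst t)) (snd (fst t)))))"
      by (simp add: sum.cartesian_product' sum_distrib_right mult.assoc)
    finally show ?thesis by (simp add: \<Gamma>)
  qed
  show ?thesis
    unfolding Q_q_def
    using lin 1 2 3 4 by (intro CollectI conjI exI[of _ "card I"] exI[of _ "card J"]
      exI[of _ "\<lambda>x x' a a' i j. E x x' a a' (g i) (g j)"] exI[of _ "\<lambda>x x' a a' i j. F x x' a a' (h i) (h j)"]
      exI[of _ "\<lambda>i j. \<xi> (g i) (h j)"]) blast+
qed

lemma Q_qE:
  assumes "\<Gamma> \<in> Q_q"
  shows "\<exists>(d::nat) (e::nat) E F \<xi>. q_model {..<d} {..<e} E F \<xi> \<Gamma>"
proof -
  obtain d e E F \<xi> where \<Gamma>: "clinear_map \<Gamma>" "stochastic_matrix_fin d E" "stochastic_matrix_fin e F"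
     "(\<Sum>i<d. \<Sum>j<e. (cmod (\<xi> i j))\<^sup>2) = 1"
     "\<And>x x' y y' a a' b b'. \<Gamma> (kron (munit x x') (munit y y')) $ (a, b) $ (a', b') =
        (\<Sum>i<d. \<Sum>j<e. (\<Sum>i'<d. \<Sum>j'<e. E x x' a a' i i' * F y y' b b' j j' * \<xi> i' j') * cnj (\<xi> i j))"
    using assms unfolding Q_q_def by blast
  have "q_model {..<d} {..<e} E F \<xi> \<Gamma>"
    unfolding q_model_def
  proof (intro conjI allI)
    show "\<Gamma> (kron (munit x x') (munit y y')) $ (a, b) $ (a', b') =
        (\<Sum>t\<in>({..<d} \<times> {..<e}) \<times> ({..<d} \<times> {..<e}). E x x' a a' (fst (fst t)) (fst (snd t)) * F y y' b b' (snd (fst t)) (snd (snd t)) *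
          (\<xi> (fst (snd t)) (snd (snd t)) * cnj (\<xi> (fst (fst t)) (snd (fst t)))))" for x x' y y' a a' b b'
      unfolding \<Gamma>(5) by (simp add: sum.cartesian_product' sum_distrib_right mult.assoc)
    show "(\<Sum>p\<in>{..<d} \<times> {..<e}. (cmod (\<xi> (fst p) (snd p)))\<^sup>2) = 1"
      using \<Gamma>(4) by (simp add: sum.cartesian_product')
  qed (use \<Gamma>(1-3) in \<open>auto simp: stochastic_matrix_fin_def pos_on_iff\<close>)
  then show ?thesis by blast
qed

text \<open>Summing over z first collapses \<open>E2\<close> to the condition a = a', which leaves
  the trace of \<open>E1\<close>.\<close>

lemma stochastic_compose:
  fixes E1 :: "'x::finite \<Rightarrow> 'x \<Rightarrow> 'a::finite \<Rightarrow> 'a \<Rightarrow> 'i \<Rightarrow> 'i \<Rightarrow> complex"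
    and E2 :: "'a \<Rightarrow> 'a \<Rightarrow> 'z::finite \<Rightarrow> 'z \<Rightarrow> 'j \<Rightarrow> 'j \<Rightarrow> complex"
  assumes E1: "\<And>x x'. (\<Sum>a\<in>UNIV. E1 x x' a a (fst p) (fst q)) = (if x = x' \<and> fst p = fst q then 1 else 0)"
    and E2: "\<And>a a'. (\<Sum>z\<in>UNIV. E2 a a' z z (snd p) (snd q)) = (if a = a' \<and> snd p = snd q then 1 else 0)"
  shows "(\<Sum>z\<in>UNIV. \<Sum>a\<in>UNIV. \<Sum>a'\<in>UNIV. E1 x x' a a' (fst p) (fst q) * E2 a a' z z (snd p) (snd q)) =
    (if x = x' \<and> p = q then 1 else 0)"
proof -
  have "(\<Sum>z\<in>UNIV. \<Sum>a\<in>UNIV. \<Sum>a'\<in>UNIV. E1 x x' a a' (fst p) (fst q) * E2 a a' z z (snd p) (snd q)) =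
    (\<Sum>a\<in>UNIV. \<Sum>z\<in>UNIV. \<Sum>a'\<in>UNIV. E1 x x' a a' (fst p) (fst q) * E2 a a' z z (snd p) (snd q))"
    by (rule sum.swap)
  also have "\<dots> = (\<Sum>a\<in>UNIV. \<Sum>a'\<in>UNIV. E1 x x' a a' (fst p) (fst q) * (\<Sum>z\<in>UNIV. E2 a a' z z (snd p) (snd q)))"
    unfolding sum_distrib_left by (intro sum.cong refl sum.swap)
  also have "\<dots> = (\<Sum>a\<in>UNIV. if snd p = snd q then E1 x x' a a (fst p) (fst q) else 0)"
    unfolding E2 by (intro sum.cong refl) (auto simp: if_distrib[of "(*) _"] sum.delta cong: if_cong)
  also have "\<dots> = (if x = x' \<and> p = q then 1 else 0)"
    by (cases "snd p = snd q") (simp_all add: E1 prod_eq_iff)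
  finally show ?thesis .
qed

lemma Q_q_compose:
  fixes \<Gamma>1 :: "('x::finite \<times> 'y::finite) cmat \<Rightarrow> ('a::finite \<times> 'b::finite) cmat"
    and \<Gamma>2 :: "('a \<times> 'b) cmat \<Rightarrow> ('z::finite \<times> 'w::finite) cmat"
  assumes "\<Gamma>1 \<in> Q_q" "\<Gamma>2 \<in> Q_q"
  shows "\<Gamma>2 \<circ> \<Gamma>1 \<in> Q_q"
proof -
  obtain d1 e1 E1 F1 \<xi>1 where q1: "q_model {..<d1::nat} {..<e1::nat} E1 F1 \<xi>1 \<Gamma>1"
    using Q_qE[OF assms(1)] by blast
  obtain d2 e2 E2 F2 \<xi>2 where q2: "q_model {..<d2::nat} {..<e2::nat} E2 F2 \<xi>2 \<Gamma>2"
    using Q_qE[OF assms(2)] by blast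
  note 1 = q1[unfolded q_model_def, THEN conjunct1] q1[unfolded q_model_def, THEN conjunct2, THEN conjunct2, THEN conjunct2]
  note 2 = q2[unfolded q_model_def, THEN conjunct1] q2[unfolded q_model_def, THEN conjunct2, THEN conjunct2, THEN conjunct2]
  note \<Gamma>1 = 1(2)[THEN conjunct2, THEN conjunct2, THEN conjunct2, THEN conjunct2, THEN conjunct2, rule_format]
  note \<Gamma>2 = 2(2)[THEN conjunct2, THEN conjunct2, THEN conjunct2, THEN conjunct2, THEN conjunct2, rule_format]
  let ?I = "{..<d1} \<times> {..<d2}" and ?J = "{..<e1} \<times> {..<e2}"
  let ?E = "\<lambda>x x' z z' p q. \<Sum>a\<in>UNIV. \<Sum>a'\<in>UNIV. E1 x x' a a' (fst p) (fst q) * E2 a a' z z' (snd p) (snd q)"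
  let ?F = "\<lambda>x x' z z' p q. \<Sum>a\<in>UNIV. \<Sum>a'\<in>UNIV. F1 x x' a a' (fst p) (fst q) * F2 a a' z z' (snd p) (snd q)"
  let ?\<xi> = "\<lambda>p q. \<xi>1 (fst p) (fst q) * \<xi>2 (snd p) (snd q)"
  have "q_model ?I ?J ?E ?F ?\<xi> (\<Gamma>2 \<circ> \<Gamma>1)"
    unfolding q_model_def
  proof (intro conjI allI ballI)
    show "clinear_map (\<Gamma>2 \<circ> \<Gamma>1)" by (rule clinear_map_compose[OF 1(1) 2(1)])
    show "pos_on ?I ?E" by (rule pos_on_compose) (use 1(2) 2(2) in auto)
    show "pos_on ?J ?F" by (rule pos_on_compose) (use 1(2) 2(2) in auto)
    show "(\<Sum>z\<in>UNIV. ?E x x' z z p q) = (if x = x' \<and> p = q then 1 else 0)" if "p \<in> ?I" "q \<in> ?I" for x x' p q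
      by (rule stochastic_compose) (use that 1(2) 2(2) in auto)
    show "(\<Sum>z\<in>UNIV. ?F x x' z z p q) = (if x = x' \<and> p = q then 1 else 0)" if "p \<in> ?J" "q \<in> ?J" for x x' p q
      by (rule stochastic_compose) (use that 1(2) 2(2) in auto)
    have "(\<Sum>p\<in>?I \<times> ?J. (cmod (?\<xi> (fst p) (snd p)))\<^sup>2) =
       (\<Sum>r\<in>({..<d1} \<times> {..<e1}) \<times> ({..<d2} \<times> {..<e2}).
         (cmod (\<xi>1 (fst (fst r)) (snd (fst r))))\<^sup>2 * (cmod (\<xi>2 (fst (snd r)) (snd (snd r))))\<^sup>2)"
      by (rule sum.reindex_bij_witness[of _ "\<lambda>((i, j), (k, l)). ((i, k), (j, l))" "\<lambda>((i, k), (j, l)). ((i, j), (k, l))"])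
        (auto simp: norm_mult power_mult_distrib)
    also have "\<dots> = (\<Sum>p\<in>{..<d1} \<times> {..<e1}. (cmod (\<xi>1 (fst p) (snd p)))\<^sup>2) * (\<Sum>p\<in>{..<d2} \<times> {..<e2}. (cmod (\<xi>2 (fst p) (snd p)))\<^sup>2)"
      unfolding sum_product sum.cartesian_product by (simp add: case_prod_unfold)
    finally show "(\<Sum>p\<in>?I \<times> ?J. (cmod (?\<xi> (fst p) (snd p)))\<^sup>2) = 1" using 1(2) 2(2) by simp
    fix x x' :: 'x and y y' :: 'y and z z' :: 'z and w w' :: 'w
    let ?T = "(?I \<times> ?J) \<times> (?I \<times> ?J)"
    let ?g = "\<lambda>t. ?\<xi> (fst (snd t)) (snd (snd t)) * cnj (?\<xi> (fst (fst t)) (snd (fst t)))"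
    let ?e = "\<lambda>\<alpha> t. E1 x x' (fst \<alpha>) (snd \<alpha>) (fst (fst (fst t))) (fst (fst (snd t))) * E2 (fst \<alpha>) (snd \<alpha>) z z' (snd (fst (fst t))) (snd (fst (snd t)))"
    let ?f = "\<lambda>\<alpha> t. F1 y y' (fst \<alpha>) (snd \<alpha>) (fst (snd (fst t))) (fst (snd (snd t))) * F2 (fst \<alpha>) (snd \<alpha>) w w' (snd (snd (fst t))) (snd (snd (snd t)))"
    \<comment> \<open>Regrouping of tensor legs: in the composed model the legs are sorted by
      player, while \<open>\<Gamma>1\<close> and \<open>\<Gamma>2\<close> are computed with the legs
      sorted by model. The two bijections exchange the inner positions.\<close>
    have inner: "(\<Sum>t\<in>?T. ?e \<alpha> t * ?f \<beta> t * ?g t) =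
       \<Gamma>1 (kron (munit x x') (munit y y')) $ (fst \<alpha>, fst \<beta>) $ (snd \<alpha>, snd \<beta>) *
       \<Gamma>2 (kron (munit (fst \<alpha>) (snd \<alpha>)) (munit (fst \<beta>) (snd \<beta>))) $ (z, w) $ (z', w')" for \<alpha> \<beta>
      unfolding \<Gamma>1 \<Gamma>2 sum_product sum.cartesian_product
      by (rule sum.reindex_bij_witness[of _
        "\<lambda>(((i, j), (i', j')), ((k, l), (k', l'))). (((i, k), (j, l)), ((i', k'), (j', l')))"
        "\<lambda>(((i, k), (j, l)), ((i', k'), (j', l'))). (((i, j), (i', j')), ((k, l), (k', l')))"])
        (auto simp: algebra_simps)
    have "(\<Gamma>2 \<circ> \<Gamma>1) (kron (munit x x') (munit y y')) $ (z, w) $ (z', w') =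
      (\<Sum>\<alpha>\<in>UNIV \<times> UNIV. \<Sum>\<beta>\<in>UNIV \<times> UNIV.
       \<Gamma>1 (kron (munit x x') (munit y y')) $ (fst \<alpha>, fst \<beta>) $ (snd \<alpha>, snd \<beta>) *
       \<Gamma>2 (kron (munit (fst \<alpha>) (snd \<alpha>)) (munit (fst \<beta>) (snd \<beta>))) $ (z, w) $ (z', w'))"
      by (simp only: kernel_compose[OF 2(1)] sum.cartesian_product' fst_conv snd_conv)
    also have "\<dots> = (\<Sum>t\<in>?T. (\<Sum>\<alpha>\<in>UNIV \<times> UNIV. ?e \<alpha> t) * (\<Sum>\<beta>\<in>UNIV \<times> UNIV. ?f \<beta> t) * ?g t)"
      unfolding inner[symmetric] bilinear_sum_swap ..
    finally show "(\<Gamma>2 \<circ> \<Gamma>1) (kron (munit x x') (munit y y')) $ (z, w) $ (z', w') =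
      (\<Sum>t\<in>?T. ?E x x' z z' (fst (fst t)) (fst (snd t)) * ?F y y' w w' (snd (fst t)) (snd (snd t)) *
        (?\<xi> (fst (snd t)) (snd (snd t)) * cnj (?\<xi> (fst (fst t)) (snd (fst t)))))"
      by (simp only: sum.cartesian_product case_prod_unfold)
  qed auto
  then show ?thesis by (rule Q_qI)
qed

text \<open>Both maps vary with \<open>n\<close>, so pointwise convergence does not apply directly
  to \<open>G2 n (G1 n M)\<close>. Expansion separates the entries of \<open>G1 n M\<close> from the
  values of \<open>G2 n\<close> on the fixed matrix units, and finite sums of products
  converge.\<close>

lemma Q_qa_compose:
  fixes \<Gamma>1 :: "('x::finite \<times> 'y::finite) cmat \<Rightarrow> ('a::finite \<times> 'b::finite) cmat"
    and \<Gamma>2 :: "('a \<times> 'b) cmat \<Rightarrow> ('z::finite \<times> 'w::finite) cmat"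
  assumes "\<Gamma>1 \<in> Q_qa" "\<Gamma>2 \<in> Q_qa"
  shows "\<Gamma>2 \<circ> \<Gamma>1 \<in> Q_qa"
proof -
  obtain G1 where G1: "\<And>n. G1 n \<in> Q_q" "\<And>M. (\<lambda>n. G1 n M) \<longlonglongrightarrow> \<Gamma>1 M"
    using assms(1) by (auto simp: Q_qa_def)
  obtain G2 where G2: "\<And>n. G2 n \<in> Q_q" "\<And>M. (\<lambda>n. G2 n M) \<longlonglongrightarrow> \<Gamma>2 M"
    using assms(2) by (auto simp: Q_qa_def)
  have lin: "clinear_map (G2 n)" for n using G2(1)[of n] by (simp add: Q_q_def)
  have comp: "(\<lambda>n. cscale (c n) (M n)) \<longlonglongrightarrow> cscale d N"
    if "c \<longlonglongrightarrow> d" "M \<longlonglongrightarrow> N" for c d and M :: "nat \<Rightarrow> 'm::finite cmat" and N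
    unfolding cscale_def by (intro vec_tendstoI) (simp, intro tendsto_intros that)
  \<comment> \<open>The linearity of \<open>\<Gamma>2\<close> is inherited from the approximants,
    here directly in expanded form.\<close>
  have lin2: "\<Gamma>2 M = (\<Sum>x\<in>UNIV. \<Sum>x'\<in>UNIV. \<Sum>y\<in>UNIV. \<Sum>y'\<in>UNIV.
     cscale (M $ (x, y) $ (x', y')) (\<Gamma>2 (kron (munit x x') (munit y y'))))" for M
  proof (rule LIMSEQ_unique[OF G2(2)])
    show "(\<lambda>n. G2 n M) \<longlonglongrightarrow> (\<Sum>x\<in>UNIV. \<Sum>x'\<in>UNIV. \<Sum>y\<in>UNIV. \<Sum>y'\<in>UNIV.
     cscale (M $ (x, y) $ (x', y')) (\<Gamma>2 (kron (munit x x') (munit y y'))))"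
      unfolding clinear_map_expand[OF lin, of _ M]
      by (intro tendsto_sum comp tendsto_const G2(2))
  qed
  have "(\<lambda>n. (G2 n \<circ> G1 n) M) \<longlonglongrightarrow> (\<Gamma>2 \<circ> \<Gamma>1) M" for M
    unfolding o_def clinear_map_expand[OF lin, of _ "G1 _ M"] lin2[of "\<Gamma>1 M"]
    by (intro tendsto_sum comp tendsto_vec_nth G1(2) G2(2))
  then show ?thesis
    unfolding Q_qa_def using Q_q_compose[OF G1(1) G2(1)]
    by (intro CollectI exI[of _ "\<lambda>n. G2 n \<circ> G1 n"] conjI allI) simp_all
qed

section \<open>No-signalling correlations and perfect strategies\<close>

lemma quantum_channel_compose:
  assumes "quantum_channel \<Phi>" "quantum_channel \<Psi>"
  shows "quantum_channel (\<Psi> \<circ> \<Phi>)"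
  using assms clinear_map_compose[of \<Phi> \<Psi>]
  by (auto simp: quantum_channel_def completely_positive_def)

lemma quantum_channel_clinear: "quantum_channel \<Phi> \<Longrightarrow> clinear_map \<Phi>"
  by (simp add: quantum_channel_def completely_positive_def)

lemma kron_diff_left: "kron (R - R') S = kron R S - kron R' S"
  by (rule vec2_eqI) (simp add: kron_def algebra_simps)

lemma kron_diff_right: "kron R (S - S') = kron R S - kron R S'"
  by (rule vec2_eqI) (simp add: kron_def algebra_simps)

lemma trace_munit: "trace (munit x x') = (if x = x' then 1 else 0)"
  by (cases "x = x'") (auto simp: trace_def munit_def intro: sum.neutral)

lemma trace_diff: "trace (A - B) = trace A - trace (B :: 'm::finite cmat)"
  by (simp add: trace_def sum_subtractf)

lemma ptrace_fst_linear:
  "ptrace_fst (sum f S) = (\<Sum>x\<in>S. ptrace_fst (f x))"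
  "ptrace_fst (cscale c M) = cscale c (ptrace_fst M)"
  "ptrace_fst (M - N) = ptrace_fst M - ptrace_fst N"
    apply (rule vec2_eqI, simp add: ptrace_fst_def cmat_sum_component, rule sum.swap)
   apply (rule vec2_eqI, simp add: ptrace_fst_def cscale_def sum_distrib_left)
  apply (rule vec2_eqI, simp add: ptrace_fst_def sum_subtractf)
  done

lemma ptrace_snd_linear:
  "ptrace_snd (sum f S) = (\<Sum>x\<in>S. ptrace_snd (f x))"
  "ptrace_snd (cscale c M) = cscale c (ptrace_snd M)"
  "ptrace_snd (M - N) = ptrace_snd M - ptrace_snd N"
    apply (rule vec2_eqI, simp add: ptrace_snd_def cmat_sum_component, rule sum.swap)
   apply (rule vec2_eqI, simp add: ptrace_snd_def cscale_def sum_distrib_left)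
  apply (rule vec2_eqI, simp add: ptrace_snd_def sum_subtractf)
  done

lemma cscale_zero [simp]: "cscale 0 M = 0" "cscale c 0 = 0"
  by (auto intro!: vec2_eqI simp: cscale_def)

lemma cscale_sum_left: "cscale (\<Sum>x\<in>S. f x) M = (\<Sum>x\<in>S. cscale (f x) M)"
  by (rule vec2_eqI) (simp add: cscale_def cmat_sum_component sum_distrib_right)

lemma cscale_sum_right: "cscale c (\<Sum>x\<in>S. f x) = (\<Sum>x\<in>S. cscale c (f x))"
  by (rule vec2_eqI) (simp add: cscale_def cmat_sum_component sum_distrib_left)

lemma cscale_cscale: "cscale c (cscale d M) = cscale (c * d) M"
  by (rule vec2_eqI) (simp add: cscale_def)

text \<open>The no-signalling condition speaks of product inputs, but
  \<open>\<Gamma>1 (kron \<rho> \<sigma>)\<close> is in general no product. Off-diagonal matrix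
  units have trace zero and diagonal ones differ by trace zero, so the marginal of
  \<open>\<Gamma> M\<close> is a linear function of \<open>ptrace_fst M\<close>.\<close>

lemma qns_ptrace_fst:
  fixes \<Gamma> :: "('x::finite \<times> 'y::finite) cmat \<Rightarrow> ('a::finite \<times> 'b::finite) cmat"
  assumes "qns \<Gamma>" "ptrace_fst M = 0"
  shows "ptrace_fst (\<Gamma> M) = 0"
proof -
  have lin: "clinear_map \<Gamma>" using assms(1) by (simp add: qns_def quantum_channel_clinear)
  define x0 :: 'x where "x0 = undefined"
  define N where "N S = ptrace_fst (\<Gamma> (kron (munit x0 x0) S))" for S
  have k: "ptrace_fst (\<Gamma> (kron (munit x x') S)) = (if x = x' then N S else 0)" for x x' S
  proof (cases "x = x'")
    case True
    have "ptrace_fst (\<Gamma> (kron (munit x x - munit x0 x0) S)) = 0"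
      using assms(1) by (simp add: qns_def trace_diff trace_munit)
    then show ?thesis
      using True by (simp add: N_def kron_diff_left clinear_mapD[OF lin] ptrace_fst_linear)
  next
    case False
    then show ?thesis using assms(1) by (simp add: qns_def trace_munit)
  qed
  have "ptrace_fst (\<Gamma> M) = (\<Sum>x\<in>UNIV. \<Sum>x'\<in>UNIV. \<Sum>y\<in>UNIV. \<Sum>y'\<in>UNIV.
     cscale (M $ (x, y) $ (x', y')) (if x = x' then N (munit y y') else 0))"
    by (subst clinear_map_expand[OF lin]) (simp add: ptrace_fst_linear k)
  also have "\<dots> = (\<Sum>x\<in>UNIV. \<Sum>x'\<in>UNIV. if x' = x then \<Sum>y\<in>UNIV. \<Sum>y'\<in>UNIV.
     cscale (M $ (x, y) $ (x, y')) (N (munit y y')) else 0)"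
    by (intro sum.cong refl) auto
  also have "\<dots> = (\<Sum>x\<in>UNIV. \<Sum>y\<in>UNIV. \<Sum>y'\<in>UNIV. cscale (M $ (x, y) $ (x, y')) (N (munit y y')))"
    by simp
  also have "\<dots> = (\<Sum>y\<in>UNIV. \<Sum>x\<in>UNIV. \<Sum>y'\<in>UNIV. cscale (M $ (x, y) $ (x, y')) (N (munit y y')))"
    by (rule sum.swap)
  also have "\<dots> = (\<Sum>y\<in>UNIV. \<Sum>y'\<in>UNIV. cscale (ptrace_fst M $ y $ y') (N (munit y y')))"
    by (intro sum.cong refl, subst sum.swap) (simp add: ptrace_fst_def cscale_sum_left)
  finally show ?thesis by (simp add: assms(2))
qed

lemma qns_ptrace_snd:
  fixes \<Gamma> :: "('x::finite \<times> 'y::finite) cmat \<Rightarrow> ('a::finite \<times> 'b::finite) cmat"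
  assumes "qns \<Gamma>" "ptrace_snd M = 0"
  shows "ptrace_snd (\<Gamma> M) = 0"
proof -
  have lin: "clinear_map \<Gamma>" using assms(1) by (simp add: qns_def quantum_channel_clinear)
  define y0 :: 'y where "y0 = undefined"
  define N where "N R = ptrace_snd (\<Gamma> (kron R (munit y0 y0)))" for R
  have k: "ptrace_snd (\<Gamma> (kron R (munit y y'))) = (if y' = y then N R else 0)" for y y' R
  proof (cases "y = y'")
    case True
    have "ptrace_snd (\<Gamma> (kron R (munit y y - munit y0 y0))) = 0"
      using assms(1) by (simp add: qns_def trace_diff trace_munit)
    then show ?thesis
      using True by (simp add: N_def kron_diff_right clinear_mapD[OF lin] ptrace_snd_linear)
  next
    case False
    then show ?thesis using assms(1) by (simp add: qns_def trace_munit)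
  qed
  have "ptrace_snd (\<Gamma> M) = (\<Sum>x\<in>UNIV. \<Sum>x'\<in>UNIV. \<Sum>y\<in>UNIV. \<Sum>y'\<in>UNIV.
     cscale (M $ (x, y) $ (x', y')) (if y' = y then N (munit x x') else 0))"
    by (subst clinear_map_expand[OF lin]) (simp add: ptrace_snd_linear k)
  also have "\<dots> = (\<Sum>x\<in>UNIV. \<Sum>x'\<in>UNIV. \<Sum>y\<in>UNIV. \<Sum>y'\<in>UNIV. if y' = y then
     cscale (M $ (x, y) $ (x', y)) (N (munit x x')) else 0)"
    by (intro sum.cong refl) auto
  also have "\<dots> = (\<Sum>x\<in>UNIV. \<Sum>x'\<in>UNIV. cscale (ptrace_snd M $ x $ x') (N (munit x x')))"
    by (simp add: ptrace_snd_def cscale_sum_left)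
  finally show ?thesis by (simp add: assms(2))
qed

lemma qns_compose:
  assumes "qns \<Gamma>1" "qns \<Gamma>2"
  shows "qns (\<Gamma>2 \<circ> \<Gamma>1)"
  using assms quantum_channel_compose[of \<Gamma>1 \<Gamma>2] qns_ptrace_fst[OF assms(2)] qns_ptrace_snd[OF assms(2)]
  unfolding qns_def by simp

lemma qgame_compose:
  fixes \<phi>1 :: "'m::finite cmat \<Rightarrow> 'n::finite cmat"
  assumes "qgame \<phi>1" "qgame \<phi>2"
  shows "qgame (\<phi>2 \<circ> \<phi>1)"
  unfolding qgame_def
proof (intro conjI ballI allI impI)
  fix S :: "'m cmat set" assume S: "S \<subseteq> projections"
  then have "\<phi>1 ` S \<subseteq> projections" using assms(1) by (auto simp: qgame_def)
  then show "(\<phi>2 \<circ> \<phi>1) (\<Squnion>\<^bsub>proj_lattice\<^esub> S) = \<Squnion>\<^bsub>proj_lattice\<^esub> ((\<phi>2 \<circ> \<phi>1) ` S)"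
    using assms S by (simp add: qgame_def image_comp)
qed (use assms in \<open>auto simp: qgame_def\<close>)

section \<open>Positive matrices and perfectness\<close>

definition positive_matrix :: "'m::finite cmat \<Rightarrow> bool" where
  "positive_matrix M \<longleftrightarrow> psd_on UNIV (\<lambda>k l. M $ k $ l)"

lemma cdot_quadratic: "cdot (M *v v) v = (\<Sum>k\<in>UNIV. \<Sum>l\<in>UNIV. M $ k $ l * v $ l * cnj (v $ k))"
  by (simp add: cdot_def matrix_vector_mult_def sum_distrib_right)

lemma positive_matrix_iff: "positive_matrix M \<longleftrightarrow> (\<forall>v. cdot (M *v v) v \<in> \<real>\<^sub>\<ge>\<^sub>0)"
  unfolding positive_matrix_def psd_on_def cdot_quadratic
proof safe
  fix v :: "complex^'a"
  assume "\<forall>v. (\<Sum>k\<in>UNIV. \<Sum>l\<in>UNIV. M $ k $ l * v l * cnj (v k)) \<in> \<real>\<^sub>\<ge>\<^sub>0"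
  from this[THEN spec, of "\<lambda>k. v $ k"]
  show "(\<Sum>k\<in>UNIV. \<Sum>l\<in>UNIV. M $ k $ l * v $ l * cnj (v $ k)) \<in> \<real>\<^sub>\<ge>\<^sub>0" .
next
  fix w :: "'a \<Rightarrow> complex"
  assume "\<forall>v. (\<Sum>k\<in>UNIV. \<Sum>l\<in>UNIV. M $ k $ l * v $ l * cnj (v $ k)) \<in> \<real>\<^sub>\<ge>\<^sub>0"
  from this[THEN spec, of "\<chi> i. w i"]
  show "(\<Sum>k\<in>UNIV. \<Sum>l\<in>UNIV. M $ k $ l * w l * cnj (w k)) \<in> \<real>\<^sub>\<ge>\<^sub>0" by simp
qed

lemma completely_positive_positive:
  assumes "completely_positive \<Gamma>" "positive_matrix M"
  shows "positive_matrix (\<Gamma> M)"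
proof -
  have "block_positive 1 (\<lambda>i j. M)" using assms(2) by (simp add: block_positive_def positive_matrix_iff)
  then have "block_positive 1 (\<lambda>i j. \<Gamma> M)" using assms(1) by (simp add: completely_positive_def)
  then have "cdot (\<Gamma> M *v v) v \<in> \<real>\<^sub>\<ge>\<^sub>0" for v
    unfolding block_positive_def by (auto dest!: spec[of _ "\<lambda>_. v"])
  then show ?thesis by (simp add: positive_matrix_iff)
qed

lemma projection_component:
  assumes "P \<in> projections"
  shows "P $ k $ l = (\<Sum>m\<in>UNIV. P $ k $ m * cnj (P $ l $ m))" "cnj (P $ l $ k) = P $ k $ l"
proof -
  have P: "P ** P = P" "adj P = P" using assms by (auto simp: projections_def)
  have "adj P $ k $ l = cnj (P $ l $ k)" for k l by (simp add: adj_def)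
  from this[unfolded P(2), symmetric] have h: "cnj (P $ l $ k) = P $ k $ l" for k l .
  then show "cnj (P $ l $ k) = P $ k $ l" .
  have "(P ** P) $ k $ l = (\<Sum>m\<in>UNIV. P $ k $ m * P $ m $ l)" by (simp add: matrix_matrix_mult_def)
  then show "P $ k $ l = (\<Sum>m\<in>UNIV. P $ k $ m * cnj (P $ l $ m))" unfolding P(1) h .
qed

lemma complement_component:
  assumes "P \<in> projections"
  shows "(mat 1 - P) $ k $ l = (\<Sum>m\<in>UNIV. (mat 1 - P) $ k $ m * cnj ((mat 1 - P) $ l $ m))"
proof -
  have m: "(mat 1 :: 'a cmat) $ i $ j = (if j = i then 1 else 0)" for i j by (simp add: mat_def)
  have "(\<Sum>m\<in>UNIV. (mat 1 - P) $ k $ m * cnj ((mat 1 - P) $ l $ m)) =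
    (\<Sum>m\<in>UNIV. (if m = k then (if m = l then 1 else 0) - cnj (P $ l $ m) else 0)
       - (if m = l then P $ k $ m else 0) + P $ k $ m * cnj (P $ l $ m))"
    by (intro sum.cong refl) (auto simp: m algebra_simps)
  also have "\<dots> = (if k = l then 1 else 0) - cnj (P $ l $ k) - P $ k $ l + P $ k $ l"
    by (simp add: sum.distrib sum_subtractf projection_component(1)[OF assms, symmetric])
  finally show ?thesis by (simp add: m projection_component(2)[OF assms])
qed

text \<open>Since I - P is its own Gram matrix, the trace is a sum of quadratic forms of
  \<open>T\<close> at the columns of I - P. For positive \<open>T\<close> this gives non-negativity,
  and a vanishing trace gives information on every single column.\<close>

lemma trace_complement:
  assumes "P \<in> projections"
  shows "trace (T ** (mat 1 - P)) =
    (\<Sum>m\<in>UNIV. \<Sum>k\<in>UNIV. \<Sum>l\<in>UNIV. T $ k $ l * (mat 1 - P) $ l $ m * cnj ((mat 1 - P) $ k $ m))"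
proof -
  have "trace (T ** (mat 1 - P)) = (\<Sum>k\<in>UNIV. \<Sum>l\<in>UNIV. T $ k $ l * (mat 1 - P) $ l $ k)"
    by (simp add: trace_def matrix_matrix_mult_def)
  also have "\<dots> = (\<Sum>k\<in>UNIV. \<Sum>l\<in>UNIV. \<Sum>m\<in>UNIV. T $ k $ l * (mat 1 - P) $ l $ m * cnj ((mat 1 - P) $ k $ m))"
    by (subst complement_component[OF assms]) (simp only: sum_distrib_left mult.assoc)
  also have "\<dots> = (\<Sum>k\<in>UNIV. \<Sum>m\<in>UNIV. \<Sum>l\<in>UNIV. T $ k $ l * (mat 1 - P) $ l $ m * cnj ((mat 1 - P) $ k $ m))"
    by (intro sum.cong refl sum.swap)
  also have "\<dots> = (\<Sum>m\<in>UNIV. \<Sum>k\<in>UNIV. \<Sum>l\<in>UNIV. T $ k $ l * (mat 1 - P) $ l $ m * cnj ((mat 1 - P) $ k $ m))"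
    by (rule sum.swap)
  finally show ?thesis .
qed

lemma trace_complement_nonneg:
  assumes "P \<in> projections" "positive_matrix T"
  shows "trace (T ** (mat 1 - P)) \<in> \<real>\<^sub>\<ge>\<^sub>0"
  unfolding trace_complement[OF assms(1)]
  by (rule nonneg_Reals_sum, rule assms(2)[unfolded positive_matrix_def psd_on_def, rule_format])

lemma quadratic_gram:
  fixes n :: nat
  assumes "\<And>k l. M k l = (\<Sum>j<n. w j k * cnj (w j l))"
  shows "(\<Sum>k\<in>(UNIV::'k::finite set). \<Sum>l\<in>UNIV. M k l * v l * cnj (v k)) =
    complex_of_real (\<Sum>j<n. (cmod (\<Sum>k\<in>UNIV. v k * cnj (w j k)))\<^sup>2)"
proof -
  have "(\<Sum>k\<in>UNIV. \<Sum>l\<in>UNIV. M k l * v l * cnj (v k)) =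
      (\<Sum>k\<in>UNIV. \<Sum>l\<in>UNIV. \<Sum>j<n. (v l * cnj (w j l)) * cnj (v k * cnj (w j k)))"
    unfolding assms by (simp add: sum_distrib_left sum_distrib_right algebra_simps)
  also have "\<dots> = (\<Sum>j<n. \<Sum>k\<in>UNIV. \<Sum>l\<in>UNIV. (v l * cnj (w j l)) * cnj (v k * cnj (w j k)))"
    by (subst sum.swap[of _ "{..<n}"]) (intro sum.cong refl sum.swap)
  also have "\<dots> = (\<Sum>j<n. (\<Sum>k\<in>UNIV. v k * cnj (w j k)) * cnj (\<Sum>k\<in>UNIV. v k * cnj (w j k)))"
    by (intro sum.cong refl, subst cnj_sum, subst sum_product, subst sum.swap) (rule refl)
  finally show ?thesis by (simp only: mult_cnj_cmod of_real_sum)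
qed

text \<open>Write R as a sum of rank one terms w w^*. The vanishing trace makes every w orthogonal
  to the columns of I - Q, so pairing v with w is the same as pairing Qv with w. Cauchy-Schwarz
  gives the bound with c the sum of the squared norms of the w, that is, the trace of R.\<close>

lemma dominated_by_support:
  fixes R Q :: "'m::finite cmat"
  assumes "positive_matrix R" "Q \<in> projections" "trace (R ** (mat 1 - Q)) = 0"
  shows "\<exists>c\<ge>0. positive_matrix (cscale (complex_of_real c) Q - R)"
proof -
  obtain n w where w: "\<And>k l. R $ k $ l = (\<Sum>j<n::nat. w j k * cnj (w j l))"
    by (rule psd_on_gram[OF assms(1)[unfolded positive_matrix_def]]) auto
  define D where "D = mat 1 - Q"
  have "complex_of_real (\<Sum>m\<in>UNIV. \<Sum>j<n. (cmod (\<Sum>k\<in>UNIV. D $ k $ m * cnj (w j k)))\<^sup>2) = 0"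
    unfolding assms(3)[symmetric]
    by (simp only: trace_complement[OF assms(2)] quadratic_gram[OF w] D_def of_real_sum)
  then have "(\<Sum>m\<in>UNIV. \<Sum>j<n. (cmod (\<Sum>k\<in>UNIV. D $ k $ m * cnj (w j k)))\<^sup>2) = 0"
    using of_real_eq_0_iff by blast
  then have D: "(\<Sum>k\<in>UNIV. D $ k $ m * cnj (w j k)) = 0" if "j < n" for m j
    using that by (simp add: sum_nonneg_eq_0_iff sum_nonneg)
  have wD: "(\<Sum>k\<in>UNIV. v k * cnj (w j k)) = (\<Sum>k\<in>UNIV. (\<Sum>m\<in>UNIV. Q $ k $ m * v m) * cnj (w j k))"
    if "j < n" for v j
  proof -
    have "(\<Sum>k\<in>UNIV. (\<Sum>m\<in>UNIV. D $ k $ m * v m) * cnj (w j k)) = (\<Sum>k\<in>UNIV. \<Sum>m\<in>UNIV. v m * (D $ k $ m * cnj (w j k)))"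
      by (simp add: sum_distrib_left sum_distrib_right algebra_simps)
    also have "\<dots> = (\<Sum>m\<in>UNIV. v m * (\<Sum>k\<in>UNIV. D $ k $ m * cnj (w j k)))"
      by (subst sum.swap) (simp add: sum_distrib_left)
    finally have "(\<Sum>k\<in>UNIV. (\<Sum>m\<in>UNIV. D $ k $ m * v m) * cnj (w j k)) = 0" by (simp add: D[OF that])
    moreover have "(\<Sum>m\<in>UNIV. D $ k $ m * v m) = v k - (\<Sum>m\<in>UNIV. Q $ k $ m * v m)" for k
    proof -
      have "(\<Sum>m\<in>UNIV. D $ k $ m * v m) = (\<Sum>m\<in>UNIV. (if m = k then v m else 0) - Q $ k $ m * v m)"
        by (intro sum.cong refl) (auto simp: D_def mat_def algebra_simps)
      then show ?thesis by (simp add: sum_subtractf)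
    qed
    ultimately show ?thesis by (simp only: left_diff_distrib sum_subtractf right_minus_eq)
  qed
  define c where "c = (\<Sum>j<n. \<Sum>k\<in>UNIV. (cmod (w j k))\<^sup>2)"
  have "positive_matrix (cscale (complex_of_real c) Q - R)"
    unfolding positive_matrix_def psd_on_def
  proof
    fix v :: "'m \<Rightarrow> complex"
    define q where "q k = (\<Sum>m\<in>UNIV. Q $ k $ m * v m)" for k
    have Qv: "(\<Sum>k\<in>UNIV. \<Sum>l\<in>UNIV. Q $ k $ l * v l * cnj (v k)) = complex_of_real (\<Sum>k\<in>UNIV. (cmod (q k))\<^sup>2)"
    proof -
      have "(\<Sum>k\<in>UNIV. \<Sum>l\<in>UNIV. Q $ k $ l * v l * cnj (v k)) =
        (\<Sum>k\<in>UNIV. \<Sum>l\<in>UNIV. \<Sum>m\<in>UNIV. (cnj (Q $ m $ k) * cnj (v k)) * (Q $ m $ l * v l))"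
        by (subst projection_component(1)[OF assms(2)])
          (simp add: projection_component(2)[OF assms(2)] sum_distrib_left sum_distrib_right algebra_simps)
      also have "\<dots> = (\<Sum>k\<in>UNIV. \<Sum>m\<in>UNIV. \<Sum>l\<in>UNIV. (cnj (Q $ m $ k) * cnj (v k)) * (Q $ m $ l * v l))"
        by (intro sum.cong refl sum.swap)
      also have "\<dots> = (\<Sum>m\<in>UNIV. \<Sum>k\<in>UNIV. \<Sum>l\<in>UNIV. (cnj (Q $ m $ k) * cnj (v k)) * (Q $ m $ l * v l))"
        by (rule sum.swap)
      also have "\<dots> = (\<Sum>m\<in>UNIV. q m * cnj (q m))"
        unfolding q_def by (intro sum.cong refl, subst mult.commute) (simp add: sum_product)
      finally show ?thesis by (simp only: mult_cnj_cmod of_real_sum)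
    qed
    have "(\<Sum>j<n. (cmod (\<Sum>k\<in>UNIV. v k * cnj (w j k)))\<^sup>2) \<le>
        (\<Sum>j<n. (\<Sum>k\<in>UNIV. (cmod (q k))\<^sup>2) * (\<Sum>k\<in>UNIV. (cmod (w j k))\<^sup>2))"
    proof (rule sum_mono)
      fix j assume "j \<in> {..<n}"
      then have "cmod (\<Sum>k\<in>UNIV. v k * cnj (w j k)) \<le> (\<Sum>k\<in>UNIV. cmod (q k) * cmod (w j k))"
        unfolding wD[of j v, unfolded q_def[symmetric], simplified lessThan_iff]
        by (subst wD) (auto simp: q_def[symmetric] norm_mult intro!: order_trans[OF norm_sum])
      then have "(cmod (\<Sum>k\<in>UNIV. v k * cnj (w j k)))\<^sup>2 \<le> (\<Sum>k\<in>UNIV. cmod (q k) * cmod (w j k))\<^sup>2"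
        by (rule power_mono) simp
      also have "\<dots> \<le> (\<Sum>k\<in>UNIV. (cmod (q k))\<^sup>2) * (\<Sum>k\<in>UNIV. (cmod (w j k))\<^sup>2)"
        by (rule Cauchy_Schwarz_ineq_sum)
      finally show "(cmod (\<Sum>k\<in>UNIV. v k * cnj (w j k)))\<^sup>2 \<le>
        (\<Sum>k\<in>UNIV. (cmod (q k))\<^sup>2) * (\<Sum>k\<in>UNIV. (cmod (w j k))\<^sup>2)" .
    qed
    also have "\<dots> = c * (\<Sum>k\<in>UNIV. (cmod (q k))\<^sup>2)"
      by (simp add: c_def sum_distrib_left mult.commute)
    finally have le: "(\<Sum>j<n. (cmod (\<Sum>k\<in>UNIV. v k * cnj (w j k)))\<^sup>2) \<le> c * (\<Sum>k\<in>UNIV. (cmod (q k))\<^sup>2)" .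
    have "(\<Sum>k\<in>UNIV. \<Sum>l\<in>UNIV. (cscale (complex_of_real c) Q - R) $ k $ l * v l * cnj (v k)) =
        complex_of_real c * (\<Sum>k\<in>UNIV. \<Sum>l\<in>UNIV. Q $ k $ l * v l * cnj (v k)) -
        (\<Sum>k\<in>UNIV. \<Sum>l\<in>UNIV. R $ k $ l * v l * cnj (v k))"
      by (simp add: cscale_def algebra_simps sum_subtractf sum_distrib_left)
    also have "\<dots> = complex_of_real (c * (\<Sum>k\<in>UNIV. (cmod (q k))\<^sup>2) - (\<Sum>j<n. (cmod (\<Sum>k\<in>UNIV. v k * cnj (w j k)))\<^sup>2))"
      unfolding Qv quadratic_gram[OF w] by simp
    also have "\<dots> \<in> \<real>\<^sub>\<ge>\<^sub>0"
      using le by (simp add: nonneg_Reals_of_real_iff del: of_real_diff)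
    finally show "(\<Sum>k\<in>UNIV. \<Sum>l\<in>UNIV. (cscale (complex_of_real c) Q - R) $ k $ l * v l * cnj (v k)) \<in> \<real>\<^sub>\<ge>\<^sub>0" .
  qed
  moreover have "0 \<le> c" by (simp add: c_def sum_nonneg)
  ultimately show ?thesis by blast
qed

lemma projection_positive:
  assumes "P \<in> projections"
  shows "positive_matrix P"
  unfolding positive_matrix_def
  by (rule psd_on_gramI[where P = UNIV and w = "\<lambda>m k. P $ k $ m"]) (rule projection_component(1)[OF assms])

lemma trace_combination: "trace ((cscale c A - B) ** D) = c * trace (A ** D) - trace (B ** D)"
  by (simp add: trace_def matrix_matrix_mult_def cscale_def left_diff_distrib sum_subtractf
      sum_distrib_left mult.assoc)

lemma perfect_strategy_compose:
  assumes "perfect_strategy \<phi>1 \<Gamma>1" "perfect_strategy \<phi>2 \<Gamma>2"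
  shows "perfect_strategy (\<phi>2 \<circ> \<phi>1) (\<Gamma>2 \<circ> \<Gamma>1)"
  unfolding perfect_strategy_def
proof (intro conjI ballI)
  have g: "qgame \<phi>1" "qgame \<phi>2" and q: "qns \<Gamma>1" "qns \<Gamma>2"
    and t1: "\<And>P. P \<in> projections \<Longrightarrow> trace (\<Gamma>1 P ** (mat 1 - \<phi>1 P)) = 0"
    and t2: "\<And>P. P \<in> projections \<Longrightarrow> trace (\<Gamma>2 P ** (mat 1 - \<phi>2 P)) = 0"
    using assms by (auto simp: perfect_strategy_def)
  show "qgame (\<phi>2 \<circ> \<phi>1)" by (rule qgame_compose[OF g])
  show "qns (\<Gamma>2 \<circ> \<Gamma>1)" by (rule qns_compose[OF q])
  fix P :: "('a \<times> 'b) cmat" assume P: "P \<in> projections"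
  have cp: "completely_positive \<Gamma>1" "completely_positive \<Gamma>2"
    using q by (auto simp: qns_def quantum_channel_def)
  have lin: "clinear_map \<Gamma>2" using cp(2) by (simp add: completely_positive_def)
  have Q: "\<phi>1 P \<in> projections" using g(1) P by (simp add: qgame_def)
  then have Q2: "\<phi>2 (\<phi>1 P) \<in> projections" using g(2) by (simp add: qgame_def)
  have R: "positive_matrix (\<Gamma>1 P)"
    by (rule completely_positive_positive[OF cp(1) projection_positive[OF P]])
  obtain c where "0 \<le> c" and c: "positive_matrix (cscale (complex_of_real c) (\<phi>1 P) - \<Gamma>1 P)"
    using dominated_by_support[OF R Q t1[OF P]] by blast
  let ?D = "mat 1 - \<phi>2 (\<phi>1 P)"
  have "trace (\<Gamma>2 (cscale (complex_of_real c) (\<phi>1 P) - \<Gamma>1 P) ** ?D) =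
      complex_of_real c * trace (\<Gamma>2 (\<phi>1 P) ** ?D) - trace (\<Gamma>2 (\<Gamma>1 P) ** ?D)"
    unfolding clinear_mapD[OF lin]
    by (rule trace_combination)
  \<comment> \<open>The multiple of \<open>\<phi>1 P\<close> drops out because
    \<open>\<Gamma>2\<close> is perfect at the projection \<open>\<phi>1 P\<close>; the remaining
    trace is non-negative together with its negative.\<close>
  then have "- trace (\<Gamma>2 (\<Gamma>1 P) ** ?D) \<in> \<real>\<^sub>\<ge>\<^sub>0"
    using trace_complement_nonneg[OF Q2 completely_positive_positive[OF cp(2) c]] by (simp add: t2[OF Q])
  moreover have "trace (\<Gamma>2 (\<Gamma>1 P) ** ?D) \<in> \<real>\<^sub>\<ge>\<^sub>0"
    by (rule trace_complement_nonneg[OF Q2 completely_positive_positive[OF cp(2) R]])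
  ultimately show "trace ((\<Gamma>2 \<circ> \<Gamma>1) P ** (mat 1 - (\<phi>2 \<circ> \<phi>1) P)) = 0"
    by (auto simp: complex_nonneg_Reals_iff complex_eq_iff)
qed

section \<open>Local correlations\<close>

lemma kron_sum: "kron (sum f A) (sum g B) = (\<Sum>i\<in>A. \<Sum>j\<in>B. kron (f i) (g j))"
  by (rule vec2_eqI) (simp add: kron_def cmat_sum_component sum_product)

lemma kron_cscale: "kron (cscale c R) (cscale d S) = cscale (c * d) (kron R S)"
  by (rule vec2_eqI) (simp add: kron_def cscale_def)

lemma munit_expand: "M = (\<Sum>x\<in>UNIV. \<Sum>x'\<in>UNIV. cscale (M $ x $ x') (munit x x'))"
proof (rule vec2_eqI)
  fix p q :: 'a
  have "(\<Sum>x\<in>UNIV. \<Sum>x'\<in>UNIV. cscale (M $ x $ x') (munit x x')) $ p $ q =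
     (\<Sum>x\<in>UNIV. \<Sum>x'\<in>UNIV. if x' = q then (if x = p then M $ x $ x' else 0) else 0)"
    unfolding cmat_sum_component by (intro sum.cong refl) (auto simp: cscale_def munit_def)
  then show "M $ p $ q = (\<Sum>x\<in>UNIV. \<Sum>x'\<in>UNIV. cscale (M $ x $ x') (munit x x')) $ p $ q" by simp
qed

lemma clinear_tensor_map: "clinear_map (tensor_map \<Phi> \<Psi>)"
proof (rule clinear_mapI)
  show "tensor_map \<Phi> \<Psi> (M + N) = tensor_map \<Phi> \<Psi> M + tensor_map \<Phi> \<Psi> N" for M N
    by (rule vec2_eqI) (simp add: tensor_map_def cmat_sum_component cscale_def sum.distrib algebra_simps)
  show "tensor_map \<Phi> \<Psi> (cscale c M) = cscale c (tensor_map \<Phi> \<Psi> M)" for c M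
    by (rule vec2_eqI) (simp add: tensor_map_def cmat_sum_component cscale_def sum_distrib_left algebra_simps)
qed

lemma tensor_map_kron:
  assumes "clinear_map \<Phi>" "clinear_map \<Psi>"
  shows "tensor_map \<Phi> \<Psi> (kron R S) = kron (\<Phi> R) (\<Psi> S)"
proof -
  have \<Phi>: "\<Phi> R = (\<Sum>p\<in>UNIV. cscale (R $ fst p $ snd p) (\<Phi> (munit (fst p) (snd p))))"
    by (subst munit_expand[of R]) (simp add: clinear_mapD[OF assms(1)] sum.cartesian_product case_prod_unfold)
  have \<Psi>: "\<Psi> S = (\<Sum>p\<in>UNIV. cscale (S $ fst p $ snd p) (\<Psi> (munit (fst p) (snd p))))"
    by (subst munit_expand[of S]) (simp add: clinear_mapD[OF assms(2)] sum.cartesian_product case_prod_unfold)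
  have "kron (\<Phi> R) (\<Psi> S) = (\<Sum>p\<in>UNIV \<times> UNIV. \<Sum>q\<in>UNIV \<times> UNIV. cscale (R $ fst p $ snd p * S $ fst q $ snd q)
     (kron (\<Phi> (munit (fst p) (snd p))) (\<Psi> (munit (fst q) (snd q)))))"
    by (simp add: \<Phi> \<Psi> kron_sum kron_cscale)
  also have "\<dots> = tensor_map \<Phi> \<Psi> (kron R S)"
    unfolding sum.cartesian_product' tensor_map_def by (simp add: kron_def)
  finally show ?thesis ..
qed

lemma tensor_map_compose:
  assumes "clinear_map \<Phi>1" "clinear_map \<Psi>1" "clinear_map \<Phi>2" "clinear_map \<Psi>2"
  shows "tensor_map \<Phi>2 \<Psi>2 (tensor_map \<Phi>1 \<Psi>1 M) = tensor_map (\<Phi>2 \<circ> \<Phi>1) (\<Psi>2 \<circ> \<Psi>1) M"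
  unfolding tensor_map_def[of \<Phi>1 \<Psi>1]
  by (simp add: clinear_mapD[OF clinear_tensor_map] tensor_map_kron[OF assms(3,4)])
    (simp add: tensor_map_def)

lemma scaleR_cscale: "r *\<^sub>R M = cscale (complex_of_real r) M"
  by (rule vec2_eqI)
    (simp only: cscale_def vector_scaleR_component vec_lambda_beta, simp only: scaleR_conv_of_real)

lemma Q_loc_compose:
  fixes \<Gamma>1 :: "('x::finite \<times> 'y::finite) cmat \<Rightarrow> ('a::finite \<times> 'b::finite) cmat"
    and \<Gamma>2 :: "('a \<times> 'b) cmat \<Rightarrow> ('z::finite \<times> 'w::finite) cmat"
  assumes "\<Gamma>1 \<in> Q_loc" "\<Gamma>2 \<in> Q_loc"
  shows "\<Gamma>2 \<circ> \<Gamma>1 \<in> Q_loc"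
proof -
  obtain m p \<Phi>1 \<Psi>1 where 1: "\<And>k. k < m \<Longrightarrow> 0 \<le> p k \<and> quantum_channel (\<Phi>1 k) \<and> quantum_channel (\<Psi>1 k)"
    "(\<Sum>k<m::nat. p k) = 1" "\<And>M. \<Gamma>1 M = (\<Sum>k<m. p k *\<^sub>R tensor_map (\<Phi>1 k) (\<Psi>1 k) M)"
    using assms(1) unfolding Q_loc_def by blast
  obtain n q \<Phi>2 \<Psi>2 where 2: "\<And>k. k < n \<Longrightarrow> 0 \<le> q k \<and> quantum_channel (\<Phi>2 k) \<and> quantum_channel (\<Psi>2 k)"
    "(\<Sum>k<n::nat. q k) = 1" "\<And>M. \<Gamma>2 M = (\<Sum>k<n. q k *\<^sub>R tensor_map (\<Phi>2 k) (\<Psi>2 k) M)"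
    using assms(2) unfolding Q_loc_def by blast
  let ?I = "{..<n} \<times> {..<m}"
  \<comment> \<open>Pairs of labels, enumerated as an initial segment; the weights multiply as for
    independent random choices.\<close>
  obtain g where g: "bij_betw g {0..<card ?I} ?I"
    using ex_bij_betw_nat_finite[of ?I] by auto
  note g = g[unfolded atLeast0LessThan]
  have sg: "(\<Sum>i<card ?I. f (g i)) = sum f ?I" for f :: "nat \<times> nat \<Rightarrow> 'c::comm_monoid_add"
    by (rule sum.reindex_bij_betw[OF g])
  have gI: "fst (g k) < n" "snd (g k) < m" if "k < card ?I" for k
    using bij_betwE[OF g, THEN bspec, of k] that by auto
  have prod: "(\<Sum>k<card ?I. q (fst (g k)) * p (snd (g k))) = 1"
    by (subst sg) (simp add: sum.cartesian_product'[symmetric] sum_product[symmetric] 1(2) 2(2) sum.cartesian_product')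
  have comp: "(\<Gamma>2 \<circ> \<Gamma>1) M = (\<Sum>k<card ?I. (q (fst (g k)) * p (snd (g k))) *\<^sub>R
      tensor_map (\<Phi>2 (fst (g k)) \<circ> \<Phi>1 (snd (g k))) (\<Psi>2 (fst (g k)) \<circ> \<Psi>1 (snd (g k))) M)" for M
  proof -
    have "(\<Gamma>2 \<circ> \<Gamma>1) M = (\<Sum>k<n. \<Sum>l<m. (q k * p l) *\<^sub>R tensor_map (\<Phi>2 k) (\<Psi>2 k) (tensor_map (\<Phi>1 l) (\<Psi>1 l) M))"
      unfolding o_def 2(3) 1(3)
      by (simp add: clinear_mapD[OF clinear_tensor_map] scaleR_cscale cscale_sum_right cscale_cscale)
    also have "\<dots> = (\<Sum>k<n. \<Sum>l<m. (q k * p l) *\<^sub>R tensor_map (\<Phi>2 k \<circ> \<Phi>1 l) (\<Psi>2 k \<circ> \<Psi>1 l) M)"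
      using 1(1) 2(1) by (intro sum.cong refl arg_cong[of _ _ "scaleR _"] tensor_map_compose)
        (auto intro: quantum_channel_clinear)
    finally show ?thesis by (subst sg) (simp add: sum.cartesian_product')
  qed
  show ?thesis
    unfolding Q_loc_def
  proof (intro CollectI exI conjI allI impI)
    show "(\<Sum>k<card ?I. q (fst (g k)) * p (snd (g k))) = 1" by (rule prod)
    show "0 \<le> q (fst (g k)) * p (snd (g k))" if "k < card ?I" for k
      using 1(1) 2(1) gI[OF that] by simp
    show "quantum_channel (\<Phi>2 (fst (g k)) \<circ> \<Phi>1 (snd (g k)))" if "k < card ?I" for k
      using 1(1) 2(1) gI[OF that] by (simp add: quantum_channel_compose)
    show "quantum_channel (\<Psi>2 (fst (g k)) \<circ> \<Psi>1 (snd (g k)))" if "k < card ?I" for k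
      using 1(1) 2(1) gI[OF that] by (simp add: quantum_channel_compose)
  qed (rule comp)
qed

section \<open>Transport of complex vector spaces to carriers\<close>

lemma cring_complex_scalars: "cring complex_scalars"
proof (rule cringI)
  show "abelian_group complex_scalars"
    by (rule abelian_groupI) (auto simp: complex_scalars_def intro: exI[of _ "- _"] left_minus)
  show "comm_monoid complex_scalars"
    by (rule comm_monoidI) (auto simp: complex_scalars_def)
qed (auto simp: complex_scalars_def algebra_simps)

text \<open>The carriers of both the Hilbert spaces and the C*-algebras are images, under an
  injection, of subsets of a type that already is an abelian group. The module laws are moved along
  \<open>e\<close> once for both uses.\<close>

locale transported =
  fixes W :: "'w::ab_group_add set" and scale :: "complex \<Rightarrow> 'w \<Rightarrow> 'w" and e :: "'w \<Rightarrow> 'v"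
    and R :: "(complex, 'v, 'm) module_scheme"
  assumes inj: "inj_on e W"
    and W0: "0 \<in> W" and W_add: "x \<in> W \<Longrightarrow> y \<in> W \<Longrightarrow> x + y \<in> W"
    and W_scale: "x \<in> W \<Longrightarrow> scale c x \<in> W"
    and scale_add_left: "x \<in> W \<Longrightarrow> scale (c + d) x = scale c x + scale d x"
    and scale_add_right: "x \<in> W \<Longrightarrow> y \<in> W \<Longrightarrow> scale c (x + y) = scale c x + scale c y"
    and scale_scale: "x \<in> W \<Longrightarrow> scale (c * d) x = scale c (scale d x)"
    and scale_1: "x \<in> W \<Longrightarrow> scale 1 x = x"
    and carrier_R: "carrier R = e ` W"
    and add_R: "x \<in> W \<Longrightarrow> y \<in> W \<Longrightarrow> e x \<oplus>\<^bsub>R\<^esub> e y = e (x + y)"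
    and zero_R: "\<zero>\<^bsub>R\<^esub> = e 0"
    and smult_R: "x \<in> W \<Longrightarrow> c \<odot>\<^bsub>R\<^esub> e x = e (scale c x)"
begin

lemma carrierE:
  assumes "u \<in> carrier R"
  obtains x where "x \<in> W" "u = e x"
  using assms by (auto simp: carrier_R)

lemma e_closed: "x \<in> W \<Longrightarrow> e x \<in> carrier R"
  by (simp add: carrier_R)

lemma scale_minus_1: "x \<in> W \<Longrightarrow> scale (- 1) x = - x"
proof -
  assume x: "x \<in> W"
  have "scale 0 x = scale 0 x + scale 0 x" using scale_add_left[OF x, of 0 0] by simp
  then have "scale 0 x = 0" by simp
  then have "scale (- 1) x + x = 0" using scale_add_left[OF x, of "- 1" 1] scale_1[OF x] by simp
  then show ?thesis by (rule eq_neg_iff_add_eq_0[THEN iffD2])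
qed

lemma W_minus: "x \<in> W \<Longrightarrow> - x \<in> W"
  using W_scale[of x "- 1"] scale_minus_1 by simp

lemma W_diff: "x \<in> W \<Longrightarrow> y \<in> W \<Longrightarrow> x - y \<in> W"
  using W_add[OF _ W_minus] by (simp only: diff_conv_add_uminus)

lemma abelian_group_R: "abelian_group R"
proof (rule abelian_groupI)
  fix u assume "u \<in> carrier R"
  then obtain x where x: "x \<in> W" "u = e x" by (rule carrierE)
  then show "\<exists>v\<in>carrier R. v \<oplus>\<^bsub>R\<^esub> u = \<zero>\<^bsub>R\<^esub>"
    by (intro bexI[of _ "e (- x)"]) (simp_all add: add_R W_minus zero_R e_closed)
qed (auto elim!: carrierE simp: add_R W_add e_closed zero_R W0 ac_simps)

sublocale abelian_group R by (rule abelian_group_R)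

lemma module_R: "Module.module complex_scalars R"
  by (rule moduleI[OF cring_complex_scalars abelian_group_R])
    (auto elim!: carrierE simp: complex_scalars_def smult_R add_R W_add W_scale e_closed
      scale_add_left scale_add_right scale_scale scale_1)

lemma minus_R:
  assumes "x \<in> W" "y \<in> W"
  shows "e x \<ominus>\<^bsub>R\<^esub> e y = e (x - y)"
proof -
  have "\<ominus>\<^bsub>R\<^esub> e y = e (- y)"
    by (rule minus_equality) (simp_all add: assms add_R W_minus zero_R e_closed)
  then show ?thesis by (simp add: a_minus_def add_R assms W_minus)
qed

lemma finsum_R:
  "finite S \<Longrightarrow> (\<And>i. i \<in> S \<Longrightarrow> f i \<in> W) \<Longrightarrow> (\<Oplus>\<^bsub>R\<^esub>i\<in>S. e (f i)) = e (\<Sum>i\<in>S. f i) \<and> (\<Sum>i\<in>S. f i) \<in> W"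
proof (induction S rule: finite_induct)
  case empty
  then show ?case by (simp add: zero_R W0)
next
  case (insert i S)
  then have "(\<Oplus>\<^bsub>R\<^esub>i\<in>insert i S. e (f i)) = e (f i) \<oplus>\<^bsub>R\<^esub> (\<Oplus>\<^bsub>R\<^esub>i\<in>S. e (f i))"
    by (intro finsum_insert) (auto simp: e_closed)
  with insert show ?case by (simp add: add_R W_add)
qed

end

section \<open>Quantum commuting correlations\<close>

definition quadratic :: "('x::finite \<Rightarrow> 'x \<Rightarrow> 'a::finite \<Rightarrow> 'a \<Rightarrow> 'i ell2 \<Rightarrow> 'i ell2) \<Rightarrow> ('x \<Rightarrow> 'a \<Rightarrow> 'i ell2) \<Rightarrow> complex" where
  "quadratic E v = (\<Sum>x\<in>UNIV. \<Sum>x'\<in>UNIV. \<Sum>a\<in>UNIV. \<Sum>a'\<in>UNIV. cip (E x x' a a' (v x' a')) (v x a))"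

lemma cip_op_sum_ket:
  assumes "bclin T"
  shows "cip (T (\<Sum>j\<in>I. cs (\<alpha> j) (ket j))) (\<Sum>i\<in>I. cs (\<beta> i) (ket i)) =
    (\<Sum>i\<in>I. \<Sum>j\<in>I. coef (T (ket j)) i * \<alpha> j * cnj (\<beta> i))"
  by (simp add: bclinD[OF assms] cip_sum_left cip_sum_right cip_cs_left cip_cs_right
      sum_distrib_left algebra_simps)

lemma quadratic_pos_on:
  assumes "\<And>x x' a a'. bclin (E x x' a a')" "\<And>v. quadratic E v \<in> \<real>\<^sub>\<ge>\<^sub>0"
  shows "pos_on I (\<lambda>x x' a a' i j. coef (E x x' a a' (ket j)) i)"
  unfolding pos_on_iff
proof
  fix v
  show "(\<Sum>x\<in>UNIV. \<Sum>x'\<in>UNIV. \<Sum>a\<in>UNIV. \<Sum>a'\<in>UNIV. \<Sum>i\<in>I. \<Sum>j\<in>I.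
        coef (E x x' a a' (ket j)) i * v x' a' j * cnj (v x a i)) \<in> \<real>\<^sub>\<ge>\<^sub>0"
    using assms(2)[of "\<lambda>x a. \<Sum>i\<in>I. cs (v x a i) (ket i)", unfolded quadratic_def cip_op_sum_ket[OF assms(1)]] .
qed

text \<open>Truncations to finitely many coordinates converge, and the non-negative reals are
  closed. Hence positivity of an operator family is a property of its finite matrix blocks, to which
  \<open>pos_on_compose\<close> applies.\<close>

lemma quadratic_nonnegI:
  fixes E :: "'x::finite \<Rightarrow> 'x \<Rightarrow> 'a::finite \<Rightarrow> 'a \<Rightarrow> 'i ell2 \<Rightarrow> 'i ell2"
  assumes E: "\<And>x x' a a'. bclin (E x x' a a')"
    and pos: "\<And>I. finite I \<Longrightarrow> pos_on I (\<lambda>x x' a a' i j. coef (E x x' a a' (ket j)) i)"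
  shows "quadratic E v \<in> \<real>\<^sub>\<ge>\<^sub>0"
proof -
  let ?v = "\<lambda>I x a. \<Sum>i\<in>I. cs (coef (v x a) i) (ket i)"
  have lim: "((\<lambda>I. ?v I x a) \<longlongrightarrow> v x a) (finite_subsets_at_top UNIV)" for x a
    using ket_expansion[of "v x a"] by (simp add: has_sum_def)
  have "((\<lambda>I. quadratic E (?v I)) \<longlongrightarrow> quadratic E v) (finite_subsets_at_top UNIV)"
    unfolding quadratic_def
    by (intro tendsto_sum tendsto_cip bounded_linear.tendsto[OF bclinD(8)[OF E]] lim)
  then show ?thesis
  proof (rule Lim_in_closed_set[OF closed_nonneg_Reals_complex, rotated 2])
    have "quadratic E (?v I) \<in> \<real>\<^sub>\<ge>\<^sub>0" if "finite I" for I
      using pos[OF that, unfolded pos_on_iff, THEN spec, of "\<lambda>x a i. coef (v x a) i"]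
      unfolding quadratic_def cip_op_sum_ket[OF E] .
    then show "\<forall>\<^sub>F I in finite_subsets_at_top UNIV. quadratic E (?v I) \<in> \<real>\<^sub>\<ge>\<^sub>0"
      by (intro eventually_finite_subsets_at_top_weakI)
  qed simp
qed

text \<open>\<open>P\<close> is a bounded idempotent whose range is the Hilbert space of the model;
  all entries map into that range, and the traces give \<open>P\<close> instead of the identity.
  Carrying \<open>P\<close> along avoids choosing new coordinates for the range.\<close>

locale qc_model =
  fixes P :: "'i ell2 \<Rightarrow> 'i ell2"
    and E :: "'x::finite \<Rightarrow> 'x \<Rightarrow> 'a::finite \<Rightarrow> 'a \<Rightarrow> 'i ell2 \<Rightarrow> 'i ell2"
    and F :: "'y::finite \<Rightarrow> 'y \<Rightarrow> 'b::finite \<Rightarrow> 'b \<Rightarrow> 'i ell2 \<Rightarrow> 'i ell2"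
    and \<xi> :: "'i ell2" and \<Gamma> :: "('x \<times> 'y) cmat \<Rightarrow> ('a \<times> 'b) cmat"
  assumes P: "bclin P" "P (P f) = P f"
    and E: "bclin (E x x' a a')" "P (E x x' a a' f) = E x x' a a' f"
    and F: "bclin (F y y' b b')" "P (F y y' b b' f) = F y y' b b' f"
    and trace_E: "(\<Sum>a\<in>UNIV. E x x' a a f) = (if x = x' then P f else 0)"
    and trace_F: "(\<Sum>b\<in>UNIV. F y y' b b f) = (if y = y' then P f else 0)"
    and quadratic_E: "quadratic E v \<in> \<real>\<^sub>\<ge>\<^sub>0" and quadratic_F: "quadratic F w \<in> \<real>\<^sub>\<ge>\<^sub>0"
    and E_F_commute: "E x x' a a' (F y y' b b' f) = F y y' b b' (E x x' a a' f)"
    and \<xi>: "P \<xi> = \<xi>" "cip \<xi> \<xi> = 1"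
    and kernel: "\<Gamma> (kron (munit x x') (munit y y')) $ (a, b) $ (a', b') =
        cip (E x x' a a' (F y y' b b' \<xi>)) \<xi>"

section \<open>Tensor composition of commuting models\<close>

definition comp_op :: "('x \<Rightarrow> 'x \<Rightarrow> 'a::finite \<Rightarrow> 'a \<Rightarrow> 'i ell2 \<Rightarrow> 'i ell2) \<Rightarrow> ('a \<Rightarrow> 'a \<Rightarrow> 'z \<Rightarrow> 'z \<Rightarrow> 'j ell2 \<Rightarrow> 'j ell2) \<Rightarrow>
    'x \<Rightarrow> 'x \<Rightarrow> 'z \<Rightarrow> 'z \<Rightarrow> ('i \<times> 'j) ell2 \<Rightarrow> ('i \<times> 'j) ell2" where
  "comp_op E1 E2 x x' z z' f = (\<Sum>a\<in>UNIV. \<Sum>a'\<in>UNIV. tenop (E1 x x' a a') (E2 a a' z z') f)"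

lemma bclin_comp_op:
  assumes "\<And>x x' a a'. bclin (E1 x x' a a')" "\<And>x x' a a'. bclin (E2 x x' a a')"
  shows "bclin (comp_op E1 E2 x x' z z')"
  unfolding comp_op_def[abs_def] by (intro bclin_sum bclin_tenop assms)

lemma comp_op_ten:
  assumes "\<And>x x' a a'. bclin (E1 x x' a a')" "\<And>x x' a a'. bclin (E2 x x' a a')"
  shows "comp_op E1 E2 x x' z z' (ten f g) = (\<Sum>a\<in>UNIV. \<Sum>a'\<in>UNIV. ten (E1 x x' a a' f) (E2 a a' z z' g))"
  unfolding comp_op_def by (simp add: tenop_ten assms)

lemma comp_op_trace:
  assumes E: "\<And>x x' a a'. bclin (E1 x x' a a')" "\<And>x x' a a'. bclin (E2 x x' a a')" and P: "bclin P1" "bclin P2"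
    and E1: "\<And>x x' f. (\<Sum>a\<in>UNIV. E1 x x' a a f) = (if x = x' then P1 f else 0)"
    and E2: "\<And>a a' f. (\<Sum>z\<in>(UNIV :: 'z::finite set). E2 a a' z z f) = (if a = a' then P2 f else 0)"
  shows "(\<Sum>z\<in>UNIV. comp_op E1 E2 x x' z z f) = (if x = x' then tenop P1 P2 f else 0)"
proof (rule bclin2_eqI[where f = f])
  show "bclin (\<lambda>f. \<Sum>z\<in>UNIV. comp_op E1 E2 x x' z z f)"
    by (intro bclin_sum bclin_comp_op E)
  show "bclin (\<lambda>f. if x = x' then tenop P1 P2 f else 0)"
    by (cases "x = x'") (simp_all add: bclin_tenop P bclin_zero)
  fix i j
  have "(\<Sum>z\<in>UNIV. comp_op E1 E2 x x' z z (ten (ket i) (ket j))) =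
      (\<Sum>a\<in>UNIV. \<Sum>z\<in>UNIV. \<Sum>a'\<in>UNIV. ten (E1 x x' a a' (ket i)) (E2 a a' z z (ket j)))"
    unfolding comp_op_ten[OF E] by (rule sum.swap)
  also have "\<dots> = (\<Sum>a\<in>UNIV. \<Sum>a'\<in>UNIV. ten (E1 x x' a a' (ket i)) (\<Sum>z\<in>UNIV. E2 a a' z z (ket j)))"
    unfolding ten_right by (intro sum.cong refl sum.swap)
  also have "\<dots> = (\<Sum>a\<in>UNIV. \<Sum>a'\<in>UNIV. if a' = a then ten (E1 x x' a a (ket i)) (P2 (ket j)) else 0)"
    unfolding E2 by (intro sum.cong refl) (auto simp: ten_right)
  also have "\<dots> = ten (\<Sum>a\<in>UNIV. E1 x x' a a (ket i)) (P2 (ket j))"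
    by (simp add: ten_left)
  also have "\<dots> = (if x = x' then tenop P1 P2 (ten (ket i) (ket j)) else 0)"
    by (simp add: E1 tenop_ten P ten_left)
  finally show "(\<Sum>z\<in>UNIV. comp_op E1 E2 x x' z z (ten (ket i) (ket j))) =
      (if x = x' then tenop P1 P2 (ten (ket i) (ket j)) else 0)" .
qed

text \<open>Matrix entries of the composed family are products contracted over a and a', so the
  finite Gram argument applies on the box spanned by \<open>I\<close> and is then restricted to
  \<open>I\<close>.\<close>

lemma comp_op_quadratic:
  fixes E1 :: "'x::finite \<Rightarrow> 'x \<Rightarrow> 'a::finite \<Rightarrow> 'a \<Rightarrow> 'i ell2 \<Rightarrow> 'i ell2"
    and E2 :: "'a \<Rightarrow> 'a \<Rightarrow> 'z::finite \<Rightarrow> 'z \<Rightarrow> 'j ell2 \<Rightarrow> 'j ell2"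
  assumes E: "\<And>x x' a a'. bclin (E1 x x' a a')" "\<And>x x' a a'. bclin (E2 x x' a a')"
    and pos: "\<And>v. quadratic E1 v \<in> \<real>\<^sub>\<ge>\<^sub>0" "\<And>v. quadratic E2 v \<in> \<real>\<^sub>\<ge>\<^sub>0"
  shows "quadratic (comp_op E1 E2) v \<in> \<real>\<^sub>\<ge>\<^sub>0"
proof (rule quadratic_nonnegI[OF bclin_comp_op[OF E]])
  fix I :: "('i \<times> 'j) set" assume I: "finite I"
  have c: "coef (comp_op E1 E2 x x' z z' (ket q)) p =
     (\<Sum>a\<in>UNIV. \<Sum>a'\<in>UNIV. coef (E1 x x' a a' (ket (fst q))) (fst p) * coef (E2 a a' z z' (ket (snd q))) (snd p))"
    for x x' z z' p q
    by (cases q) (simp add: ten_ket[symmetric] comp_op_ten[OF E])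
  have "pos_on (fst ` I \<times> snd ` I) (\<lambda>x x' z z' p q. coef (comp_op E1 E2 x x' z z' (ket q)) p)"
    unfolding c using I by (intro pos_on_compose quadratic_pos_on E pos finite_imageI)
  then show "pos_on I (\<lambda>x x' z z' p q. coef (comp_op E1 E2 x x' z z' (ket q)) p)"
    by (rule pos_on_mono) (use I in \<open>auto simp: rev_image_eqI\<close>)
qed

lemma comp_op_commute:
  assumes E: "\<And>x x' a a'. bclin (E1 x x' a a')" "\<And>x x' a a'. bclin (E2 x x' a a')"
    and F: "\<And>x x' a a'. bclin (F1 x x' a a')" "\<And>x x' a a'. bclin (F2 x x' a a')"
    and EF1: "\<And>x x' a a' y y' b b' f. E1 x x' a a' (F1 y y' b b' f) = F1 y y' b b' (E1 x x' a a' f)"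
    and EF2: "\<And>x x' a a' y y' b b' f. E2 x x' a a' (F2 y y' b b' f) = F2 y y' b b' (E2 x x' a a' f)"
  shows "comp_op E1 E2 x x' z z' (comp_op F1 F2 y y' w w' f) = comp_op F1 F2 y y' w w' (comp_op E1 E2 x x' z z' f)"
proof (rule bclin2_eqI[where f = f])
  show "bclin (\<lambda>f. comp_op E1 E2 x x' z z' (comp_op F1 F2 y y' w w' f))"
    by (rule bclin_compose[OF bclin_comp_op[OF E] bclin_comp_op[OF F]])
  show "bclin (\<lambda>f. comp_op F1 F2 y y' w w' (comp_op E1 E2 x x' z z' f))"
    by (rule bclin_compose[OF bclin_comp_op[OF F] bclin_comp_op[OF E]])
  fix i j
  have "comp_op E1 E2 x x' z z' (comp_op F1 F2 y y' w w' (ten (ket i) (ket j))) =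
    (\<Sum>b\<in>UNIV. \<Sum>b'\<in>UNIV. \<Sum>a\<in>UNIV. \<Sum>a'\<in>UNIV. ten (E1 x x' a a' (F1 y y' b b' (ket i))) (E2 a a' z z' (F2 b b' w w' (ket j))))"
    by (simp only: comp_op_ten[OF F] comp_op_ten[OF E] bclinD(7)[OF bclin_comp_op[OF E]])
  also have "\<dots> = (\<Sum>p\<in>UNIV \<times> UNIV. \<Sum>q\<in>UNIV \<times> UNIV. ten (F1 y y' (fst p) (snd p) (E1 x x' (fst q) (snd q) (ket i)))
      (F2 (fst p) (snd p) w w' (E2 (fst q) (snd q) z z' (ket j))))"
    by (simp only: sum.cartesian_product' fst_conv snd_conv EF1 EF2)
  also have "\<dots> = (\<Sum>q\<in>UNIV \<times> UNIV. \<Sum>p\<in>UNIV \<times> UNIV. ten (F1 y y' (fst p) (snd p) (E1 x x' (fst q) (snd q) (ket i)))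
      (F2 (fst p) (snd p) w w' (E2 (fst q) (snd q) z z' (ket j))))"
    by (rule sum.swap)
  also have "\<dots> = comp_op F1 F2 y y' w w' (comp_op E1 E2 x x' z z' (ten (ket i) (ket j)))"
    by (simp only: comp_op_ten[OF F] comp_op_ten[OF E] bclinD(7)[OF bclin_comp_op[OF F]]
      sum.cartesian_product' fst_conv snd_conv)
  finally show "comp_op E1 E2 x x' z z' (comp_op F1 F2 y y' w w' (ten (ket i) (ket j))) =
      comp_op F1 F2 y y' w w' (comp_op E1 E2 x x' z z' (ten (ket i) (ket j)))" .
qed

lemma comp_op_range:
  assumes E: "\<And>x x' a a'. bclin (E1 x x' a a')" "\<And>x x' a a'. bclin (E2 x x' a a')" and P: "bclin P1" "bclin P2"
    and PE: "\<And>x x' a a' f. P1 (E1 x x' a a' f) = E1 x x' a a' f" "\<And>x x' a a' f. P2 (E2 x x' a a' f) = E2 x x' a a' f"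
  shows "tenop P1 P2 (comp_op E1 E2 x x' z z' f) = comp_op E1 E2 x x' z z' f"
proof (rule bclin2_eqI[OF bclin_compose[OF bclin_tenop[OF P] bclin_comp_op[OF E]] bclin_comp_op[OF E]])
  show "tenop P1 P2 (comp_op E1 E2 x x' z z' (ten (ket i) (ket j))) = comp_op E1 E2 x x' z z' (ten (ket i) (ket j))" for i j
    by (simp add: comp_op_ten[OF E] bclinD[OF bclin_tenop[OF P]] tenop_ten[OF P] PE)
qed

lemma qc_model_compose:
  fixes \<Gamma>1 :: "('x::finite \<times> 'y::finite) cmat \<Rightarrow> ('a::finite \<times> 'b::finite) cmat"
    and \<Gamma>2 :: "('a \<times> 'b) cmat \<Rightarrow> ('z::finite \<times> 'w::finite) cmat"
  assumes 1: "qc_model P1 E1 F1 \<xi>1 \<Gamma>1" and 2: "qc_model P2 E2 F2 \<xi>2 \<Gamma>2" and lin: "clinear_map \<Gamma>2"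
  shows "qc_model (tenop P1 P2) (comp_op E1 E2) (comp_op F1 F2) (ten \<xi>1 \<xi>2) (\<Gamma>2 \<circ> \<Gamma>1)"
proof -
  interpret m1: qc_model P1 E1 F1 \<xi>1 \<Gamma>1 by (rule 1)
  interpret m2: qc_model P2 E2 F2 \<xi>2 \<Gamma>2 by (rule 2)
  note P = m1.P(1) m2.P(1) and E = m1.E(1) m2.E(1) and F = m1.F(1) m2.F(1)
  show ?thesis
  proof
    show "bclin (tenop P1 P2)" by (rule bclin_tenop[OF P])
    show "tenop P1 P2 (tenop P1 P2 f) = tenop P1 P2 f" for f
      unfolding tenop_compose[OF P P] m1.P(2) m2.P(2) ..
    show "bclin (comp_op E1 E2 x x' z z')" for x x' z z' by (rule bclin_comp_op[OF E])
    show "bclin (comp_op F1 F2 x x' z z')" for x x' z z' by (rule bclin_comp_op[OF F])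
    show "tenop P1 P2 (comp_op E1 E2 x x' z z' f) = comp_op E1 E2 x x' z z' f" for x x' z z' f
      by (rule comp_op_range) (rule E P m1.E(2) m2.E(2))+
    show "tenop P1 P2 (comp_op F1 F2 x x' z z' f) = comp_op F1 F2 x x' z z' f" for x x' z z' f
      by (rule comp_op_range) (rule F P m1.F(2) m2.F(2))+
    show "(\<Sum>z\<in>UNIV. comp_op E1 E2 x x' z z f) = (if x = x' then tenop P1 P2 f else 0)" for x x' f
      by (rule comp_op_trace) (rule E P m1.trace_E m2.trace_E)+
    show "(\<Sum>z\<in>UNIV. comp_op F1 F2 x x' z z f) = (if x = x' then tenop P1 P2 f else 0)" for x x' f
      by (rule comp_op_trace) (rule F P m1.trace_F m2.trace_F)+
    show "quadratic (comp_op E1 E2) v \<in> \<real>\<^sub>\<ge>\<^sub>0" for v by (rule comp_op_quadratic) (rule E m1.quadratic_E m2.quadratic_E)+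
    show "quadratic (comp_op F1 F2) v \<in> \<real>\<^sub>\<ge>\<^sub>0" for v by (rule comp_op_quadratic) (rule F m1.quadratic_F m2.quadratic_F)+
    show "comp_op E1 E2 x x' z z' (comp_op F1 F2 y y' w w' f) = comp_op F1 F2 y y' w w' (comp_op E1 E2 x x' z z' f)"
      for x x' z z' y y' w w' f by (rule comp_op_commute) (rule E F m1.E_F_commute m2.E_F_commute)+
    show "tenop P1 P2 (ten \<xi>1 \<xi>2) = ten \<xi>1 \<xi>2" by (simp add: tenop_ten[OF P] m1.\<xi> m2.\<xi>)
    show "cip (ten \<xi>1 \<xi>2) (ten \<xi>1 \<xi>2) = 1" by (simp add: cip_ten m1.\<xi> m2.\<xi>)
    fix x x' y y' z z' w w'
    have "cip (comp_op E1 E2 x x' z z' (comp_op F1 F2 y y' w w' (ten \<xi>1 \<xi>2))) (ten \<xi>1 \<xi>2) =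
      (\<Sum>q\<in>UNIV \<times> UNIV. \<Sum>p\<in>UNIV \<times> UNIV. cip (E1 x x' (fst p) (snd p) (F1 y y' (fst q) (snd q) \<xi>1)) \<xi>1 *
        cip (E2 (fst p) (snd p) z z' (F2 (fst q) (snd q) w w' \<xi>2)) \<xi>2)"
      by (simp only: comp_op_ten[OF F] comp_op_ten[OF E] bclinD(7)[OF bclin_comp_op[OF E]] cip_sum_left cip_ten
        sum.cartesian_product' fst_conv snd_conv)
    also have "\<dots> = (\<Sum>p\<in>UNIV \<times> UNIV. \<Sum>q\<in>UNIV \<times> UNIV. cip (E1 x x' (fst p) (snd p) (F1 y y' (fst q) (snd q) \<xi>1)) \<xi>1 *
        cip (E2 (fst p) (snd p) z z' (F2 (fst q) (snd q) w w' \<xi>2)) \<xi>2)"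
      by (rule sum.swap)
    also have "\<dots> = (\<Gamma>2 \<circ> \<Gamma>1) (kron (munit x x') (munit y y')) $ (z, w) $ (z', w')"
      by (simp only: kernel_compose[OF lin] m1.kernel m2.kernel sum.cartesian_product' fst_conv snd_conv)
    finally show "(\<Gamma>2 \<circ> \<Gamma>1) (kron (munit x x') (munit y y')) $ (z, w) $ (z', w') =
      cip (comp_op E1 E2 x x' z z' (comp_op F1 F2 y y' w w' (ten \<xi>1 \<xi>2))) (ten \<xi>1 \<xi>2)" ..
  qed
qed

section \<open>From an arbitrary Hilbert space to coordinates\<close>

context semi_inner
begin

lemma form_lc_right:
  "(\<And>k. k < n \<Longrightarrow> f k \<in> V) \<Longrightarrow> v \<in> V \<Longrightarrow> form v (lc n a f) = (\<Sum>k<n. cnj (a k) * form v (f k))"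
  by (induction n) (auto simp: form_add_right form_sm_right lc_closed)

text \<open>Positivity of a finite block of the matrices of \<open>hat (E x x' a a')\<close> is the
  hypothesis tested on linear combinations of the \<open>b k\<close>.\<close>

lemma quadratic_hat:
  fixes E :: "'x::finite \<Rightarrow> 'x \<Rightarrow> 'a::finite \<Rightarrow> 'a \<Rightarrow> 'v \<Rightarrow> 'v"
  assumes good: "\<And>x x' a a'. good (B x x' a a') (E x x' a a')"
    and pos: "\<And>v. (\<And>x a. v x a \<in> V) \<Longrightarrow>
      (\<Sum>x\<in>UNIV. \<Sum>x'\<in>UNIV. \<Sum>a\<in>UNIV. \<Sum>a'\<in>UNIV. form (E x x' a a' (v x' a')) (v x a)) \<in> \<real>\<^sub>\<ge>\<^sub>0"
  shows "quadratic (\<lambda>x x' a a'. hat (E x x' a a')) w \<in> \<real>\<^sub>\<ge>\<^sub>0"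
proof (rule quadratic_nonnegI[OF bclin_hat[OF good]])
  fix I :: "nat set" assume "finite I"
  then obtain n where n: "I \<subseteq> {..<n}" using finite_nat_iff_bounded by blast
  have c: "coef (hat (E x x' a a') (ket j)) i = form (E x x' a a' (b j)) (b i)" for x x' a a' i j
    by (simp add: hat_ket[OF good] good_closed[OF good])
  have "pos_on {..<n} (\<lambda>x x' a a' i j. coef (hat (E x x' a a') (ket j)) i)"
    unfolding pos_on_iff c
  proof
    fix v :: "'x \<Rightarrow> 'a \<Rightarrow> nat \<Rightarrow> complex"
    have lcV: "lc n (v x a) b \<in> V" for x a by (intro lc_closed b_closed)
    have "form (E x x' a a' (lc n (v x' a') b)) (lc n (v x a) b) =
        (\<Sum>i<n. \<Sum>j<n. form (E x x' a a' (b j)) (b i) * v x' a' j * cnj (v x a i))" for x x' a a'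
    proof -
      have "form (E x x' a a' (lc n (v x' a') b)) (lc n (v x a) b) =
          form (lc n (v x' a') (\<lambda>k. E x x' a a' (b k))) (lc n (v x a) b)"
        by (intro good_lc[OF good] b_closed lcV)
      also have "\<dots> = (\<Sum>i<n. cnj (v x a i) * form (lc n (v x' a') (\<lambda>k. E x x' a a' (b k))) (b i))"
        by (intro form_lc_right b_closed lc_closed good_closed[OF good])
      also have "\<dots> = (\<Sum>i<n. cnj (v x a i) * (\<Sum>j<n. v x' a' j * form (E x x' a a' (b j)) (b i)))"
        by (intro sum.cong refl arg_cong[of _ _ "(*) _"] form_lc good_closed[OF good] b_closed)
      finally show ?thesis by (simp add: sum_distrib_left algebra_simps)
    qed
    from pos[of "\<lambda>x a. lc n (v x a) b", OF lcV, unfolded this]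
    show "(\<Sum>x\<in>UNIV. \<Sum>x'\<in>UNIV. \<Sum>a\<in>UNIV. \<Sum>a'\<in>UNIV. \<Sum>i<n. \<Sum>j<n.
        form (E x x' a a' (b j)) (b i) * v x' a' j * cnj (v x a i)) \<in> \<real>\<^sub>\<ge>\<^sub>0" .
  qed
  then show "pos_on I (\<lambda>x x' a a' i j. coef (hat (E x x' a a') (ket j)) i)"
    by (rule pos_on_mono[OF _ n]) simp
qed

text \<open>An identity known only through \<open>form\<close> becomes an equality of operators in
  coordinates. It is applied to the trace conditions, with \<open>c\<close> equal to 1 or 0.\<close>

lemma good_hat_sum:
  assumes good: "\<And>i. good (B i) (T i)" and S: "\<And>u w. u \<in> V \<Longrightarrow> w \<in> V \<Longrightarrow> (\<Sum>i\<in>I. form (T i u) w) = c * form u w"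
  shows "(\<Sum>i\<in>I. hat (T i) f) = cs c (hat (\<lambda>u. u) f)"
proof (rule bclin_eqI[where f = f])
  show "bclin (\<lambda>f. \<Sum>i\<in>I. hat (T i) f)" by (intro bclin_sum bclin_hat[OF good])
  show "bclin (\<lambda>f. cs c (hat (\<lambda>u. u) f))" by (intro bclin_cs bclin_hat[OF good_id])
  fix k
  show "(\<Sum>i\<in>I. hat (T i) (ket k)) = cs c (hat (\<lambda>u. u) (ket k))"
    by (rule coef_inject_ext) (simp add: hat_ket[OF good] hat_ket[OF good_id] good_closed[OF good] S)
qed

end

context complex_hilbert_space
begin

lemma smult_closed' [simp]: "u \<in> carrier H \<Longrightarrow> c \<odot> u \<in> carrier H"
  using smult_closed[of c u] by (simp add: complex_scalars_def)

lemma ip_zero: "w \<in> carrier H \<Longrightarrow> ip H \<zero> w = 0"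
  using ip_add[of \<zero> \<zero> w] by simp

lemma ip_finsum:
  assumes "finite S" "\<And>i. i \<in> S \<Longrightarrow> f i \<in> carrier H" "w \<in> carrier H"
  shows "ip H (\<Oplus>i\<in>S. f i) w = (\<Sum>i\<in>S. ip H (f i) w)"
  using assms(1,2)
proof (induction S rule: finite_induct)
  case (insert i S)
  then show ?case by (simp add: finsum_insert Pi_def ip_add assms(3))
qed (simp add: ip_zero assms(3))

lemma semi_inner_ip: "(\<And>n. s n \<in> carrier H) \<Longrightarrow> semi_inner (carrier H) (\<oplus>) (\<odot>) (ip H) s"
  by (unfold_locales) (simp_all add: ip_add ip_smult ip_nonneg ip_cnj[symmetric])

lemma good_bounded_operator:
  assumes s: "\<And>n. s n \<in> carrier H" and T: "T \<in> bounded_operators H" and "\<And>n. T (s n) \<in> range s"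
  shows "\<exists>B. semi_inner.good (carrier H) (\<oplus>) (\<odot>) (ip H) s B T"
proof -
  interpret semi_inner "carrier H" "(\<oplus>)" "(\<odot>)" "ip H" s by (rule semi_inner_ip[OF s])
  obtain K where "\<forall>u\<in>carrier H. ip_norm H (T u) \<le> K * ip_norm H u"
    using T unfolding bounded_operators_def by blast
  note K = bspec[OF this]
  have Tc: "u \<in> carrier H \<Longrightarrow> T u \<in> carrier H" for u using T by (simp add: bounded_operators_def)
  have n: "(ip_norm H u)\<^sup>2 = Re (ip H u u)" "0 \<le> ip_norm H u" if "u \<in> carrier H" for u
    using form_self_nonneg[OF that] by (simp_all add: ip_norm_def)
  \<comment> \<open>The given bound \<open>K\<close> carries no sign condition, while
    \<open>good\<close> asks for a non-negative one.\<close>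
  have "good \<bar>K\<bar> T"
    unfolding good_def
  proof (intro conjI ballI allI)
    fix u assume u: "u \<in> carrier H"
    have "ip_norm H (T u) \<le> \<bar>K\<bar> * ip_norm H u"
      using K[OF u] n(2)[OF u] mult_right_mono[of K "\<bar>K\<bar>" "ip_norm H u"] by linarith
    then have "(ip_norm H (T u))\<^sup>2 \<le> (\<bar>K\<bar> * ip_norm H u)\<^sup>2"
      by (rule power_mono) (rule n(2)[OF Tc[OF u]])
    then show "Re (ip H (T u) (T u)) \<le> \<bar>K\<bar>\<^sup>2 * Re (ip H u u)"
      by (simp add: power_mult_distrib n(1)[OF u] n(1)[OF Tc[OF u]])
  next
    fix n
    obtain m where "T (s n) = s m" using assms(3)[of n] by blast
    then show "inM (T (s n))" using inM_s[of m] by simp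
  qed (use T in \<open>auto simp: bounded_operators_def ip_add ip_smult\<close>)
  then show ?thesis by blast
qed

end

text \<open>The vector state sees only what the entries of \<open>E\<close> and \<open>F\<close>
  generate from \<open>\<xi>\<close>. A countable set \<open>D\<close> containing
  \<open>\<xi>\<close> and invariant under these finitely many operators is enumerated as
  \<open>s\<close>; its Gram-Schmidt coordinates keep commutation, positivity, the trace conditions
  and the values at \<open>\<xi>\<close>.\<close>

lemma qc_model_exists:
  fixes H :: "('v, 'm) inner_space_scheme"
    and E :: "'x::finite \<Rightarrow> 'x \<Rightarrow> 'a::finite \<Rightarrow> 'a \<Rightarrow> 'v \<Rightarrow> 'v"
    and F :: "'y::finite \<Rightarrow> 'y \<Rightarrow> 'b::finite \<Rightarrow> 'b \<Rightarrow> 'v \<Rightarrow> 'v"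
  assumes H: "complex_hilbert_space H"
    and E: "stochastic_operator_matrix H E" and F: "stochastic_operator_matrix H F"
    and EF: "\<And>x x' a a' y y' b b' u. u \<in> carrier H \<Longrightarrow> E x x' a a' (F y y' b b' u) = F y y' b b' (E x x' a a' u)"
    and \<xi>: "\<xi> \<in> carrier H" "ip H \<xi> \<xi> = 1"
    and \<Gamma>: "\<And>x x' y y' a a' b b'. \<Gamma> (kron (munit x x') (munit y y')) $ (a, b) $ (a', b') = ip H (E x x' a a' (F y y' b b' \<xi>)) \<xi>"
  shows "\<exists>(P :: nat ell2 \<Rightarrow> nat ell2) E F \<xi>. qc_model P E F \<xi> \<Gamma>"
proof -
  interpret complex_hilbert_space H by (rule H)
  have Eb: "E x x' a a' \<in> bounded_operators H" for x x' a a' using E by (simp add: stochastic_operator_matrix_def)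
  have Fb: "F y y' b b' \<in> bounded_operators H" for y y' b b' using F by (simp add: stochastic_operator_matrix_def)
  have closed: "T u \<in> carrier H" if "T \<in> bounded_operators H" "u \<in> carrier H" for T u
    using that by (simp add: bounded_operators_def)
  let ?G = "range (\<lambda>(x, x', a, a') u v. E x x' a a' u) \<union> range (\<lambda>(y, y', b, b') u v. F y y' b b' u)"
  obtain D where D: "countable D" "{\<xi>} \<subseteq> D" "D \<subseteq> carrier H"
    and DG: "\<And>f u v. f \<in> ?G \<Longrightarrow> u \<in> D \<Longrightarrow> v \<in> D \<Longrightarrow> f u v \<in> D"
  proof (rule countable_closure[of ?G "{\<xi>}" "carrier H"])
    show "countable ?G" by (intro countable_Un countable_image) (rule countable_finite, simp)+
    show "f u v \<in> carrier H" if "f \<in> ?G" "u \<in> carrier H" for f u v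
      using that closed[OF Eb] closed[OF Fb] by auto
  qed (use \<xi> in auto)
  have DE: "E x x' a a' u \<in> D" if "u \<in> D" for x x' a a' u
  proof (rule DG[of "\<lambda>u v. E x x' a a' u", OF _ that that])
    show "(\<lambda>u v. E x x' a a' u) \<in> ?G" by (rule UnI1, rule range_eqI[of _ _ "(x, x', a, a')"]) simp
  qed
  have DF: "F y y' b b' u \<in> D" if "u \<in> D" for y y' b b' u
  proof (rule DG[of "\<lambda>u v. F y y' b b' u", OF _ that that])
    show "(\<lambda>u v. F y y' b b' u) \<in> ?G" by (rule UnI2, rule range_eqI[of _ _ "(y, y', b, b')"]) simp
  qed
  define s where "s = from_nat_into D"
  have s: "range s = D" unfolding s_def using D(1,2) by (intro range_from_nat_into) auto
  have sD: "s n \<in> D" for n using s by auto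
  have sH: "s n \<in> carrier H" for n using sD D(3) by blast
  interpret semi_inner "carrier H" "(\<oplus>\<^bsub>H\<^esub>)" "(\<odot>\<^bsub>H\<^esub>)" "ip H" s by (rule semi_inner_ip[OF sH])
  have "\<exists>B. good B (E x x' a a')" for x x' a a'
    by (rule good_bounded_operator[where s = s, OF sH Eb]) (simp add: s DE sD)
  then obtain BE where gE: "\<And>x x' a a'. good (BE x x' a a') (E x x' a a')" by metis
  have "\<exists>B. good B (F y y' b b')" for y y' b b'
    by (rule good_bounded_operator[where s = s, OF sH Fb]) (simp add: s DF sD)
  then obtain BF where gF: "\<And>y y' b b'. good (BF y y' b b') (F y y' b b')" by metis
  have M\<xi>: "inM \<xi>"
    using D(2) s inM_s by (metis insert_subset rangeE)
  have sumE: "(\<Sum>a\<in>UNIV. ip H (E x x' a a u) w) = (if x = x' then 1 else 0) * ip H u w"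
    if "u \<in> carrier H" "w \<in> carrier H" for x x' u w
  proof -
    have "(\<Oplus>\<^bsub>H\<^esub>a\<in>UNIV. E x x' a a u) = (if x = x' then u else \<zero>\<^bsub>H\<^esub>)"
      using E that(1) by (simp add: stochastic_operator_matrix_def)
    moreover have "ip H (\<Oplus>\<^bsub>H\<^esub>a\<in>UNIV. E x x' a a u) w = (\<Sum>a\<in>UNIV. ip H (E x x' a a u) w)"
      by (intro ip_finsum closed[OF Eb] that) simp
    ultimately show ?thesis using that by (simp add: ip_zero split: if_splits)
  qed
  have sumF: "(\<Sum>b\<in>UNIV. ip H (F y y' b b u) w) = (if y = y' then 1 else 0) * ip H u w"
    if "u \<in> carrier H" "w \<in> carrier H" for y y' u w
  proof -
    have "(\<Oplus>\<^bsub>H\<^esub>b\<in>UNIV. F y y' b b u) = (if y = y' then u else \<zero>\<^bsub>H\<^esub>)"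
      using F that(1) by (simp add: stochastic_operator_matrix_def)
    moreover have "ip H (\<Oplus>\<^bsub>H\<^esub>b\<in>UNIV. F y y' b b u) w = (\<Sum>b\<in>UNIV. ip H (F y y' b b u) w)"
      by (intro ip_finsum closed[OF Fb] that) simp
    ultimately show ?thesis using that by (simp add: ip_zero split: if_splits)
  qed
  have "qc_model (hat (\<lambda>u. u)) (\<lambda>x x' a a'. hat (E x x' a a')) (\<lambda>y y' b b'. hat (F y y' b b')) (U \<xi>) \<Gamma>"
  proof
    show "bclin (hat (\<lambda>u. u))" by (rule bclin_hat[OF good_id])
    show "hat (\<lambda>u. u) (hat (\<lambda>u. u) f) = hat (\<lambda>u. u) f" for f by (rule hat_id[OF good_id])
    show "bclin (hat (E x x' a a'))" for x x' a a' by (rule bclin_hat[OF gE])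
    show "bclin (hat (F x x' a a'))" for x x' a a' by (rule bclin_hat[OF gF])
    show "hat (\<lambda>u. u) (hat (E x x' a a') f) = hat (E x x' a a') f" for x x' a a' f by (rule hat_id[OF gE])
    show "hat (\<lambda>u. u) (hat (F x x' a a') f) = hat (F x x' a a') f" for x x' a a' f by (rule hat_id[OF gF])
    show "(\<Sum>a\<in>UNIV. hat (E x x' a a) f) = (if x = x' then hat (\<lambda>u. u) f else 0)" for x x' f
      using good_hat_sum[of "\<lambda>a. BE x x' a a" "\<lambda>a. E x x' a a", OF gE sumE]
      by (cases "x = x'") (auto simp: cs_algebra)
    show "(\<Sum>a\<in>UNIV. hat (F x x' a a) f) = (if x = x' then hat (\<lambda>u. u) f else 0)" for x x' f
      using good_hat_sum[of "\<lambda>a. BF x x' a a" "\<lambda>a. F x x' a a", OF gF sumF]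
      by (cases "x = x'") (auto simp: cs_algebra)
    show "quadratic (\<lambda>x x' a a'. hat (E x x' a a')) v \<in> \<real>\<^sub>\<ge>\<^sub>0" for v
      by (rule quadratic_hat[OF gE]) (use E in \<open>simp add: stochastic_operator_matrix_def\<close>)
    show "quadratic (\<lambda>x x' a a'. hat (F x x' a a')) v \<in> \<real>\<^sub>\<ge>\<^sub>0" for v
      by (rule quadratic_hat[OF gF]) (use F in \<open>simp add: stochastic_operator_matrix_def\<close>)
    show "hat (E x x' a a') (hat (F y y' b b') f) = hat (F y y' b b') (hat (E x x' a a') f)" for x x' a a' y y' b b' f
      by (rule hat_commute[OF gE gF]) (rule EF)
    show "hat (\<lambda>u. u) (U \<xi>) = U \<xi>" by (rule hat_U[OF good_id M\<xi>])
    show "cip (U \<xi>) (U \<xi>) = 1" using cip_U[OF M\<xi> \<xi>(1)] \<xi>(2) by simp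
    show "\<Gamma> (kron (munit x x') (munit y y')) $ (a, b) $ (a', b') =
        cip (hat (E x x' a a') (hat (F y y' b b') (U \<xi>))) (U \<xi>)" for x x' y y' a a' b b'
      using cip_U[OF inM_good[OF gE inM_good[OF gF M\<xi>]] \<xi>(1)]
      by (simp add: hat_U[OF gF M\<xi>] hat_U[OF gE inM_good[OF gF M\<xi>]] \<Gamma>)
  qed
  then show ?thesis by blast
qed

lemma Q_qc_model_exists:
  assumes "\<Gamma> \<in> Q_qc TYPE('u)"
  shows "\<exists>(P :: nat ell2 \<Rightarrow> nat ell2) E F \<xi>. qc_model P E F \<xi> \<Gamma>"
  using assms unfolding Q_qc_def mem_Collect_eq
proof (elim conjE exE)
  fix H :: "'u universe inner_space" and E F \<xi>
  assume 1: "complex_hilbert_space H" "stochastic_operator_matrix H E" "stochastic_operator_matrix H F"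
    and 2: "\<forall>x x' a a' y y' b b'. \<forall>u\<in>carrier H. E x x' a a' (F y y' b b' u) = F y y' b b' (E x x' a a' u)"
    and 3: "\<xi> \<in> carrier H" "ip H \<xi> \<xi> = 1"
    and 4: "\<forall>x x' y y' a a' b b'. \<Gamma> (kron (munit x x') (munit y y')) $ (a, b) $ (a', b') =
      ip H (E x x' a a' (F y y' b b' \<xi>)) \<xi>"
  show ?thesis
    by (rule qc_model_exists[OF 1 _ 3]) (rule 2[rule_format] 4[rule_format]; assumption?)+
qed

section \<open>Models on countable l^2 spaces as carriers in the universe\<close>

definition encode :: "'i::countable ell2 \<Rightarrow> 'u universe" where
  "encode f = Inr (\<lambda>n. coef f (from_nat n))"

lemma encode_eq_iff: "encode f = encode g \<longleftrightarrow> f = g"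
  unfolding encode_def by (metis Inr_inject coef_inject_ext from_nat_to_nat)

definition decode :: "'u universe \<Rightarrow> 'i::countable ell2" where
  "decode = inv_into UNIV encode"

lemma decode_encode [simp]: "decode (encode f) = f"
  unfolding decode_def by (rule inv_f_f) (simp add: inj_on_def encode_eq_iff)

definition range_space :: "('i::countable ell2 \<Rightarrow> 'i ell2) \<Rightarrow> 'u universe inner_space" where
  "range_space P = \<lparr>carrier = encode ` {f. P f = f}, mult = (\<lambda>u v. u), one = encode (0 :: 'i ell2),
     zero = encode (0 :: 'i ell2), add = (\<lambda>u v. encode (decode u + decode v :: 'i ell2)),
     smult = (\<lambda>c u. encode (cs c (decode u :: 'i ell2))), ip = (\<lambda>u v. cip (decode u :: 'i ell2) (decode v))\<rparr>"

lemma transported_range_space: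
  assumes "bclin P"
  shows "transported {f. P f = f} cs encode (range_space P :: 'u universe inner_space)"
  by standard
    (auto simp: range_space_def inj_on_def encode_eq_iff cs_algebra bclinD[OF assms])

lemma hilbert_range_space:
  fixes P :: "'i::countable ell2 \<Rightarrow> 'i ell2"
  assumes P: "bclin P"
  shows "complex_hilbert_space (range_space P :: 'u universe inner_space)"
proof -
  let ?H = "range_space P :: 'u universe inner_space"
  interpret transported "{f. P f = f}" cs encode ?H by (rule transported_range_space[OF P])
  have ip: "ip ?H (encode f) (encode g) = cip f g" for f g :: "'i ell2" by (simp add: range_space_def)
  have n: "ip_norm ?H (encode f) = norm f" for f :: "'i ell2" by (simp add: ip_norm_def ip Re_cip_self)
  show ?thesis
  proof (intro complex_hilbert_space.intro complex_hilbert_space_axioms.intro module_R)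
    fix s :: "nat \<Rightarrow> 'u universe"
    assume s: "\<forall>n. s n \<in> carrier ?H" and C: "\<forall>e>0. \<exists>N. \<forall>m\<ge>N. \<forall>n\<ge>N. ip_norm ?H (s m \<ominus>\<^bsub>?H\<^esub> s n) < e"
    have "\<forall>n. \<exists>f. P f = f \<and> s n = encode f" using s by (auto simp: carrier_R)
    then obtain f where f: "\<And>n. P (f n) = f n" "\<And>n. s n = encode (f n)" by metis
    have d: "ip_norm ?H (s m \<ominus>\<^bsub>?H\<^esub> encode g) = norm (f m - g)" if "P g = g" for m g
      unfolding f(2) by (subst minus_R) (simp_all add: f(1) that n)
    have "Cauchy f"
    proof (rule metric_CauchyI)
      fix e :: real assume "e > 0"
      then obtain N where "\<forall>m\<ge>N. \<forall>n\<ge>N. ip_norm ?H (s m \<ominus>\<^bsub>?H\<^esub> s n) < e" using C by blast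
      then show "\<exists>N. \<forall>m\<ge>N. \<forall>n\<ge>N. dist (f m) (f n) < e"
        using d[OF f(1)] f(2) by (auto simp: dist_norm)
    qed
    then obtain l where l: "f \<longlonglongrightarrow> l" using Cauchy_convergent convergentD by blast
    \<comment> \<open>Completeness of the range: a limit of fixed points of the continuous map
      \<open>P\<close> is a fixed point.\<close>
    have "(\<lambda>n. P (f n)) \<longlonglongrightarrow> P l" by (rule bounded_linear.tendsto[OF bclinD(8)[OF P] l])
    then have Pl: "P l = l" unfolding f(1) using l by (rule LIMSEQ_unique)
    show "\<exists>l\<in>carrier ?H. (\<lambda>n. ip_norm ?H (s n \<ominus>\<^bsub>?H\<^esub> l)) \<longlonglongrightarrow> 0"
    proof (rule bexI[of _ "encode l"])
      show "(\<lambda>n. ip_norm ?H (s n \<ominus>\<^bsub>?H\<^esub> encode l)) \<longlonglongrightarrow> 0"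
        unfolding d[OF Pl] using l by (intro tendsto_norm_zero) (simp add: LIM_zero)
      show "encode l \<in> carrier ?H" by (intro e_closed) (simp add: Pl)
    qed
  next
    fix u assume "u \<in> carrier ?H" "ip ?H u u = 0"
    then obtain f :: "'i ell2" where "u = encode f" "cip f f = 0" by (metis carrierE ip)
    then show "u = \<zero>\<^bsub>?H\<^esub>" using cip_self_eq_0[of f] by (simp add: zero_R)
  next
    fix u assume "u \<in> carrier ?H"
    then show "ip ?H u u \<in> \<real>\<^sub>\<ge>\<^sub>0" by (auto elim!: carrierE simp: ip cip_self simp del: of_real_power)
  next
    fix u v assume "u \<in> carrier ?H" "v \<in> carrier ?H"
    then show "ip ?H v u = cnj (ip ?H u v)" by (auto elim!: carrierE simp: ip cip_commute)
  qed (auto elim!: carrierE simp: ip add_R smult_R cip_add_left cip_cs_left)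
qed

lemma Q_qc_model:
  fixes P :: "'i::countable ell2 \<Rightarrow> 'i ell2"
  assumes lin: "clinear_map \<Gamma>" and m: "qc_model P E F \<xi> \<Gamma>"
  shows "\<Gamma> \<in> Q_qc TYPE('u)"
proof -
  let ?H = "range_space P :: 'u universe inner_space"
  interpret qc_model P E F \<xi> \<Gamma> by (rule m)
  interpret transported "{f. P f = f}" cs encode ?H by (rule transported_range_space[OF P(1)])
  have ip: "ip ?H (encode f) (encode g) = cip f g" for f g :: "'i ell2" by (simp add: range_space_def)
  have n: "ip_norm ?H (encode f) = norm f" for f :: "'i ell2" by (simp add: ip_norm_def ip Re_cip_self)
  define op :: "('i ell2 \<Rightarrow> 'i ell2) \<Rightarrow> 'u universe \<Rightarrow> 'u universe" where "op T u = encode (T (decode u))" for T u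
  have op: "op T (encode f) = encode (T f)" for T f by (simp add: op_def)
  have bounded: "op T \<in> bounded_operators ?H" if T: "bclin T" "\<And>f. P (T f) = T f" for T
  proof -
    obtain K where K: "\<And>f. norm (T f) \<le> K * norm f" using bclin_norm_le[OF T(1)] by blast
    show ?thesis
      unfolding bounded_operators_def
    proof (intro CollectI conjI)
      show "\<exists>K. \<forall>u\<in>carrier ?H. ip_norm ?H (op T u) \<le> K * ip_norm ?H u"
        using K by (intro exI[of _ K]) (auto elim!: carrierE simp: op n)
    qed (auto elim!: carrierE simp: op e_closed T(2) add_R smult_R bclinD[OF T(1)] bclinD[OF P(1)])
  qed
  have stoch: "stochastic_operator_matrix ?H (\<lambda>x x' a a'. op (G x x' a a'))"
    if G: "\<And>x x' a a'. bclin (G x x' a a')" "\<And>x x' a a' f. P (G x x' a a' f) = G x x' a a' f"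
      and tr: "\<And>x x' f. (\<Sum>a\<in>UNIV. G x x' a a f) = (if x = x' then P f else 0)"
      and q: "\<And>v. quadratic G v \<in> \<real>\<^sub>\<ge>\<^sub>0"
    for G :: "'k::finite \<Rightarrow> 'k \<Rightarrow> 'l::finite \<Rightarrow> 'l \<Rightarrow> 'i ell2 \<Rightarrow> 'i ell2"
    unfolding stochastic_operator_matrix_def
  proof (intro conjI allI impI ballI)
    show "op (G x x' a a') \<in> bounded_operators ?H" for x x' a a' by (rule bounded[OF G])
  next
    fix v :: "'k \<Rightarrow> 'l \<Rightarrow> 'u universe" assume v: "\<forall>x a. v x a \<in> carrier ?H"
    then have "\<forall>x a. \<exists>f. v x a = encode (f :: 'i ell2)" by (auto simp: carrier_R)
    then obtain f where "\<And>x a. v x a = encode (f x a :: 'i ell2)" by metis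
    then show "(\<Sum>x\<in>UNIV. \<Sum>x'\<in>UNIV. \<Sum>a\<in>UNIV. \<Sum>a'\<in>UNIV. ip ?H (op (G x x' a a') (v x' a')) (v x a)) \<in> \<real>\<^sub>\<ge>\<^sub>0"
      using q[of f] by (simp add: op ip quadratic_def)
  next
    fix x x' u assume "u \<in> carrier ?H"
    then obtain f where f: "P f = f" "u = encode f" by (auto elim: carrierE)
    then show "(\<Oplus>\<^bsub>?H\<^esub>a\<in>UNIV. op (G x x' a a) u) = (if x = x' then u else \<zero>\<^bsub>?H\<^esub>)"
      using finsum_R[of UNIV "\<lambda>a. G x x' a a f"] by (simp add: op G tr zero_R)
  qed
  have hil: "complex_hilbert_space ?H" by (rule hilbert_range_space[OF P(1)])
  have \<xi>c: "encode \<xi> \<in> carrier ?H" by (rule e_closed) (simp add: \<xi>)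
  show ?thesis
    unfolding Q_qc_def
  proof (intro CollectI conjI lin exI[of _ ?H] exI[of _ "\<lambda>x x' a a'. op (E x x' a a')"]
      exI[of _ "\<lambda>y y' b b'. op (F y y' b b')"] exI[of _ "encode \<xi>"] hil \<xi>c)
    show "stochastic_operator_matrix ?H (\<lambda>x x' a a'. op (E x x' a a'))"
      by (rule stoch) (rule E trace_E quadratic_E)+
    show "stochastic_operator_matrix ?H (\<lambda>x x' a a'. op (F x x' a a'))"
      by (rule stoch) (rule F trace_F quadratic_F)+
  qed (auto elim!: carrierE simp: op ip \<xi> E_F_commute kernel)
qed

text \<open>Both models live on \<open>nat ell2\<close>, so the composed one lives over
  \<open>nat \<times> nat\<close>. Countability of this index type is what permits the return to
  \<open>'u universe\<close>.\<close>

lemma Q_qc_compose: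
  fixes \<Gamma>1 :: "('x::finite \<times> 'y::finite) cmat \<Rightarrow> ('a::finite \<times> 'b::finite) cmat"
    and \<Gamma>2 :: "('a \<times> 'b) cmat \<Rightarrow> ('z::finite \<times> 'w::finite) cmat"
  assumes "\<Gamma>1 \<in> Q_qc TYPE('u)" "\<Gamma>2 \<in> Q_qc TYPE('u)"
  shows "\<Gamma>2 \<circ> \<Gamma>1 \<in> Q_qc TYPE('u)"
proof -
  have lin: "clinear_map \<Gamma>1" "clinear_map \<Gamma>2" using assms by (simp_all add: Q_qc_def)
  obtain P1 :: "nat ell2 \<Rightarrow> nat ell2" and E1 F1 \<xi>1 where 1: "qc_model P1 E1 F1 \<xi>1 \<Gamma>1"
    using Q_qc_model_exists[OF assms(1)] by blast
  obtain P2 :: "nat ell2 \<Rightarrow> nat ell2" and E2 F2 \<xi>2 where 2: "qc_model P2 E2 F2 \<xi>2 \<Gamma>2"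
    using Q_qc_model_exists[OF assms(2)] by blast
  show ?thesis
    by (rule Q_qc_model[OF clinear_map_compose[OF lin] qc_model_compose[OF 1 2 lin(2)]])
qed

section \<open>Square roots of positive operators\<close>

text \<open>The iteration of \<open>sqrt_iter\<close> for the scalar c = 1. Its increments dominate
  those of the operator iteration for contractions, and it converges because it is increasing and at
  most 1.\<close>

primrec sqrt_majorant :: "nat \<Rightarrow> real" where
  "sqrt_majorant 0 = 0"
| "sqrt_majorant (Suc n) = (1 + (sqrt_majorant n)\<^sup>2) / 2"

lemma sqrt_majorant_bounds: "0 \<le> sqrt_majorant n" "sqrt_majorant n \<le> 1"
proof -
  have "0 \<le> sqrt_majorant n \<and> sqrt_majorant n \<le> 1"
    by (induction n) (auto simp: power_le_one)
  then show "0 \<le> sqrt_majorant n" "sqrt_majorant n \<le> 1" by auto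
qed

lemma sqrt_majorant_mono: "sqrt_majorant n \<le> sqrt_majorant (Suc n)"
  using sum_squares_bound[of 1 "sqrt_majorant n"] by simp

lemma convergent_sqrt_majorant: "convergent sqrt_majorant"
  by (rule Bseq_mono_convergent)
    (auto intro!: BseqI'[of _ 1] lift_Suc_mono_le[of sqrt_majorant, OF sqrt_majorant_mono]
      simp: sqrt_majorant_bounds)

context
  fixes c :: "'k ell2 \<Rightarrow>\<^sub>L 'k ell2"
begin

text \<open>A fixed point y satisfies 2y = c + y^2, that is (1 - y)^2 = 1 - c, so 1 - y is a square
  root of 1 - c.\<close>

primrec sqrt_iter :: "nat \<Rightarrow> 'k ell2 \<Rightarrow>\<^sub>L 'k ell2" where
  "sqrt_iter 0 = 0"
| "sqrt_iter (Suc n) = (1 / 2) *\<^sub>R (c + (sqrt_iter n o\<^sub>L sqrt_iter n))"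

lemma sqrt_iter_commute:
  assumes "\<And>f. X (blinfun_apply c f) = blinfun_apply c (X f)" "bclin X"
  shows "X (sqrt_iter n f) = sqrt_iter n (X f)"
  by (induction n arbitrary: f)
    (simp_all add: blinfun.bilinear_simps bclinD[OF assms(2)] assms(1))

lemma sqrt_iter_commute_iter: "sqrt_iter m o\<^sub>L sqrt_iter n = sqrt_iter n o\<^sub>L sqrt_iter m"
proof -
  have c: "c o\<^sub>L sqrt_iter n = sqrt_iter n o\<^sub>L c" for n
  proof (induction n)
    case (Suc n)
    have "blinfun_apply c (sqrt_iter n f) = sqrt_iter n (c f)" for f
      using Suc by (metis blinfun_apply_blinfun_compose)
    then show ?case by (intro blinfun_eqI) (simp add: blinfun.bilinear_simps)
  qed simp
  show ?thesis
  proof (induction m)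
    case (Suc m)
    have 1: "blinfun_apply c (sqrt_iter n f) = sqrt_iter n (c f)" for f
      using c[of n] by (metis blinfun_apply_blinfun_compose)
    have 2: "sqrt_iter m (sqrt_iter n f) = sqrt_iter n (sqrt_iter m f)" for f
      using Suc by (metis blinfun_apply_blinfun_compose)
    show ?case by (intro blinfun_eqI) (simp add: blinfun.bilinear_simps 1 2)
  qed simp
qed

text \<open>The iterates commute, hence a difference of their squares factors, and each increment is
  bounded by the corresponding increment of the scalar majorant.\<close>

lemma sqrt_iter_norm:
  assumes "norm c \<le> 1"
  shows "norm (sqrt_iter n) \<le> sqrt_majorant n"
    "norm (sqrt_iter (Suc n) - sqrt_iter n) \<le> sqrt_majorant (Suc n) - sqrt_majorant n"
proof -
  show le: "norm (sqrt_iter n) \<le> sqrt_majorant n" for n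
  proof (induction n)
    case (Suc n)
    have "norm (sqrt_iter n o\<^sub>L sqrt_iter n) \<le> (sqrt_majorant n)\<^sup>2"
      using order_trans[OF norm_blinfun_compose mult_mono[OF Suc Suc]] sqrt_majorant_bounds[of n]
      by (simp add: power2_eq_square)
    then have "norm (c + (sqrt_iter n o\<^sub>L sqrt_iter n)) \<le> 1 + (sqrt_majorant n)\<^sup>2"
      using norm_triangle_ineq[of c "sqrt_iter n o\<^sub>L sqrt_iter n"] assms by linarith
    then show ?case by simp
  qed simp
  show "norm (sqrt_iter (Suc n) - sqrt_iter n) \<le> sqrt_majorant (Suc n) - sqrt_majorant n"
  proof (induction n)
    case 0
    then show ?case using le[of "Suc 0"] by simp
  next
    case (Suc n)
    let ?y = "sqrt_iter (Suc n)" and ?x = "sqrt_iter n"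
    let ?t = "sqrt_majorant (Suc n)" and ?s = "sqrt_majorant n"
    have "sqrt_iter (Suc (Suc n)) - ?y = (1 / 2) *\<^sub>R ((?y o\<^sub>L ?y) - (?x o\<^sub>L ?x))"
      by (simp add: algebra_simps)
    also have "(?y o\<^sub>L ?y) - (?x o\<^sub>L ?x) = ((?y + ?x) o\<^sub>L (?y - ?x))"
    proof (rule blinfun_eqI)
      fix f
      have "?y (?x f) = ?x (?y f)"
        using sqrt_iter_commute_iter[of "Suc n" n] by (metis blinfun_apply_blinfun_compose)
      then show "((?y o\<^sub>L ?y) - (?x o\<^sub>L ?x)) f = ((?y + ?x) o\<^sub>L (?y - ?x)) f"
        by (simp add: blinfun.bilinear_simps del: sqrt_iter.simps)
    qed
    finally have "norm (sqrt_iter (Suc (Suc n)) - ?y) \<le> 1 / 2 * (norm (?y + ?x) * norm (?y - ?x))"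
      using norm_blinfun_compose[of "?y + ?x" "?y - ?x"] by (simp del: sqrt_iter.simps)
    also have "\<dots> \<le> 1 / 2 * ((?t + ?s) * (?t - ?s))"
    proof -
      have "norm (?y + ?x) \<le> ?t + ?s"
        using norm_triangle_ineq[of ?y ?x] le[of "Suc n"] le[of n] by linarith
      then have "norm (?y + ?x) * norm (?y - ?x) \<le> (?t + ?s) * (?t - ?s)"
        using Suc sqrt_majorant_bounds(1)[of n] sqrt_majorant_bounds(1)[of "Suc n"]
        by (intro mult_mono) auto
      then show ?thesis by simp
    qed
    also have "\<dots> = sqrt_majorant (Suc (Suc n)) - ?t"
      unfolding sqrt_majorant.simps(2)[of "Suc n"] unfolding sqrt_majorant.simps(2)[of n]
      by (simp add: algebra_simps power2_eq_square)
    finally show ?case .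
  qed
qed

lemma sqrt_iter_convergent:
  assumes "norm c \<le> 1"
  shows "convergent sqrt_iter"
proof -
  have d: "norm (sqrt_iter (n + k) - sqrt_iter n) \<le> sqrt_majorant (n + k) - sqrt_majorant n" for n k
  proof (induction k)
    case (Suc k)
    have "norm (sqrt_iter (n + Suc k) - sqrt_iter n) \<le>
        norm (sqrt_iter (Suc (n + k)) - sqrt_iter (n + k)) + norm (sqrt_iter (n + k) - sqrt_iter n)"
      using norm_triangle_ineq[of "sqrt_iter (Suc (n + k)) - sqrt_iter (n + k)" "sqrt_iter (n + k) - sqrt_iter n"]
      by simp
    then show ?case using Suc sqrt_iter_norm(2)[OF assms, of "n + k"] by (simp del: sqrt_iter.simps sqrt_majorant.simps)
  qed simp
  have "Cauchy sqrt_iter"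
  proof (rule CauchyI')
    fix e :: real assume "e > 0"
    then obtain N where N: "\<And>m n. m \<ge> N \<Longrightarrow> n \<ge> N \<Longrightarrow> dist (sqrt_majorant m) (sqrt_majorant n) < e"
      using convergent_Cauchy[OF convergent_sqrt_majorant] unfolding Cauchy_def by blast
    show "\<exists>M. \<forall>m\<ge>M. \<forall>n>m. dist (sqrt_iter m) (sqrt_iter n) < e"
    proof (intro exI[of _ N] allI impI)
      fix m n assume "m \<ge> N" "n > m"
      then have "norm (sqrt_iter n - sqrt_iter m) \<le> sqrt_majorant n - sqrt_majorant m"
        using d[of m "n - m"] by simp
      then show "dist (sqrt_iter m) (sqrt_iter n) < e"
        using N[of n m] \<open>m \<ge> N\<close> \<open>n > m\<close> by (simp add: dist_norm dist_real_def norm_minus_commute)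
    qed
  qed
  then show ?thesis by (rule Cauchy_convergent)
qed

lemma sqrt_iter_adjoint:
  assumes "adjoint_pair (blinfun_apply c) (blinfun_apply c)"
  shows "adjoint_pair (blinfun_apply (sqrt_iter n)) (blinfun_apply (sqrt_iter n))"
proof (induction n)
  case 0
  then show ?case by (simp add: adjoint_pair_def)
next
  case (Suc n)
  then show ?case
    using assms by (auto simp: adjoint_pair_def blinfun.bilinear_simps scaleR_cs cip_cs_left cip_cs_right
        cip_add_left cip_add_right)
qed

end

section \<open>Existence of the square root\<close>

lemma blinfun_apply_bclin:
  "bclin T \<Longrightarrow> blinfun_apply (Blinfun T) = T"
  by (simp add: bclin_def bounded_linear_Blinfun_apply)

lemma bclin_blinfun_apply: "clin (blinfun_apply T) \<Longrightarrow> bclin (blinfun_apply T)"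
  by (simp add: bclin_def blinfun.bounded_linear_right)

lemma cs_uminus: "cs (- c) f = - cs c f"
  by (rule coef_inject_ext) simp

text \<open>The identity c - c^2 = c(1 - c)c + (1 - c)c(1 - c) has a non-negative right-hand side in
  the sense of forms. So the squared norm of \<open>c f\<close> is at most
  \<open>Re (cip (c f) f)\<close>, hence at most that of \<open>f\<close>.\<close>

lemma contraction_of_bounded:
  assumes c: "adjoint_pair c c" "bclin c" and pos: "\<And>f. 0 \<le> Re (cip (c f) f)" "\<And>f. Re (cip (c f) f) \<le> (norm f)\<^sup>2"
  shows "norm (c f) \<le> norm f"
proof -
  let ?u = "c f"
  let ?v = "f - ?u"
  have "cip (c ?u) f = cip ?u ?u" using c(1) by (simp add: adjoint_pair_def)
  then have "cip (?u - c ?u) ?u + cip (c ?v) ?v = cip ?u f - cip ?u ?u"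
    by (simp add: cip_minus_left cip_minus_right bclinD[OF c(2)])
  from arg_cong[OF this, of Re]
  have "Re (cip (?u - c ?u) ?u) + Re (cip (c ?v) ?v) = Re (cip ?u f) - Re (cip ?u ?u)"
    by (simp only: plus_complex.simps minus_complex.simps)
  moreover have "0 \<le> Re (cip (?u - c ?u) ?u)"
    using pos(2)[of ?u] by (simp add: cip_minus_left Re_cip_self)
  ultimately have "Re (cip ?u ?u) \<le> Re (cip ?u f)"
    using pos(1)[of ?v] by linarith
  then have "(norm ?u)\<^sup>2 \<le> (norm f)\<^sup>2" using pos(2)[of f] unfolding Re_cip_self by (rule order_trans)
  then show ?thesis by (rule power2_le_imp_le) simp
qed

text \<open>Rescaling gives d = 1 - G/M with 0 \<le> d \<le> 1, so the iteration converges to some y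
  with (1 - y)^2 = G/M, and h is \<open>sqrt M\<close> times 1 - y. The last clause holds because
  every iterate is a polynomial in d; it is what puts the blocks of the root into a
  commutant.\<close>

lemma operator_sqrt:
  assumes G: "bclin G" "adjoint_pair G G" and M: "0 < M"
    and pos: "\<And>f. 0 \<le> Re (cip (G f) f)" "\<And>f. Re (cip (G f) f) \<le> M * (norm f)\<^sup>2"
  shows "\<exists>h. bclin h \<and> adjoint_pair h h \<and> (\<forall>f. h (h f) = G f) \<and>
    (\<forall>X. bclin X \<and> (\<forall>f. X (G f) = G (X f)) \<longrightarrow> (\<forall>f. X (h f) = h (X f)))"
proof -
  define d where "d f = f - (1 / M) *\<^sub>R G f" for f
  have d: "bclin d"
    unfolding d_def[abs_def] using bclin_add[OF bclin_ident bclin_cs[OF G(1), of "- complex_of_real (1 / M)"]]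
    by (simp add: scaleR_cs[of "1 / M"] cs_uminus)
  have adj: "adjoint_pair d d"
    using G(2) by (simp add: adjoint_pair_def d_def cip_minus_left cip_minus_right scaleR_cs cip_cs_left cip_cs_right)
  have cd: "Re (cip (d f) f) = (norm f)\<^sup>2 - Re (cip (G f) f) / M" for f
    by (simp add: d_def cip_minus_left scaleR_cs cip_cs_left Re_cip_self)
  have "norm (d f) \<le> norm f" for f
  proof (rule contraction_of_bounded[OF adj d])
    show "0 \<le> Re (cip (d f) f)" for f
      using pos(2)[of f] M by (simp add: cd divide_le_eq mult.commute)
    show "Re (cip (d f) f) \<le> (norm f)\<^sup>2" for f
      using pos(1)[of f] M by (simp add: cd)
  qed
  define c where "c = Blinfun d"
  have c: "blinfun_apply c = d" by (simp add: c_def blinfun_apply_bclin[OF d])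
  have "norm c \<le> 1"
    by (rule norm_blinfun_bound) (simp_all add: c \<open>\<And>f. norm (d f) \<le> norm f\<close>)
  then obtain y where y: "sqrt_iter c \<longlonglongrightarrow> y" using sqrt_iter_convergent convergentD by blast
  have lim: "(\<lambda>n. sqrt_iter c n f) \<longlonglongrightarrow> y f" for f
    by (intro tendsto_intros y)
  have "(\<lambda>n. sqrt_iter c (Suc n)) \<longlonglongrightarrow> y" using y by (rule LIMSEQ_Suc)
  moreover have "(\<lambda>n. sqrt_iter c (Suc n)) \<longlonglongrightarrow> (1 / 2) *\<^sub>R (c + (y o\<^sub>L y))"
    unfolding sqrt_iter.simps
    by (intro tendsto_scaleR tendsto_add tendsto_const bounded_bilinear.tendsto[OF bounded_bilinear_blinfun_compose] y)
  ultimately have "y = (1 / 2) *\<^sub>R (c + (y o\<^sub>L y))" by (rule LIMSEQ_unique)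
  have yy: "2 *\<^sub>R y f = d f + y (y f)" for f
    using arg_cong[OF \<open>y = _\<close>, of "\<lambda>T. 2 *\<^sub>R blinfun_apply T f"] by (simp add: blinfun.bilinear_simps c)
  have yadj: "adjoint_pair (blinfun_apply y) (blinfun_apply y)"
    unfolding adjoint_pair_def
  proof (intro allI)
    fix f g
    have "(\<lambda>n. cip (sqrt_iter c n f) g) \<longlonglongrightarrow> cip (y f) g" by (intro tendsto_cip lim tendsto_const)
    moreover have "(\<lambda>n. cip f (sqrt_iter c n g)) \<longlonglongrightarrow> cip f (y g)" by (intro tendsto_cip lim tendsto_const)
    moreover have "cip (sqrt_iter c n f) g = cip f (sqrt_iter c n g)" for n
      using sqrt_iter_adjoint[of c n] adj unfolding c by (simp add: adjoint_pair_def)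
    ultimately show "cip (y f) g = cip f (y g)" using LIMSEQ_unique by simp
  qed
  define h where "h f = sqrt M *\<^sub>R (f - y f)" for f
  have y_bclin: "bclin (blinfun_apply y)" by (rule bclin_blinfun_apply[OF adjoint_pair_clin[OF yadj]])
  show ?thesis
  proof (intro exI conjI allI impI)
    show "bclin h"
      unfolding h_def[abs_def] scaleR_cs
      using bclin_cs[OF bclin_add[OF bclin_ident bclin_cs[OF y_bclin, of "- 1"]], of "complex_of_real (sqrt M)"]
      by (simp add: cs_uminus cs_algebra)
    show "adjoint_pair h h"
      using yadj by (simp add: adjoint_pair_def h_def scaleR_cs cip_cs_left cip_cs_right cip_minus_left cip_minus_right)
    show "h (h f) = G f" for f
    proof -
      have "h (h f) = M *\<^sub>R (f - 2 *\<^sub>R y f + y (y f))"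
        using M by (simp add: h_def blinfun.bilinear_simps scaleR_2 algebra_simps)
      also have "\<dots> = M *\<^sub>R (f - d f)" by (simp add: yy)
      also have "\<dots> = G f" using M by (simp add: d_def)
      finally show ?thesis .
    qed
    fix X f assume X: "bclin X \<and> (\<forall>f. X (G f) = G (X f))"
    then have Xb: "bclin X" by blast
    have Xd: "X (d f) = d (X f)" for f using X by (simp add: d_def bclinD[OF Xb])
    have "(\<lambda>n. X (sqrt_iter c n f)) \<longlonglongrightarrow> X (y f)" by (rule bounded_linear.tendsto[OF bclinD(8)[OF Xb] lim])
    moreover have "X (sqrt_iter c n f) = sqrt_iter c n (X f)" for n
      by (rule sqrt_iter_commute[OF _ Xb]) (simp add: c Xd)
    ultimately have "X (y f) = y (X f)" using lim[of "X f"] LIMSEQ_unique by simp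
    then show "X (h f) = h (X f)" by (simp add: h_def bclinD[OF Xb])
  qed
qed

subsection \<open>Block decomposition\<close>

text \<open>The adjoint of \<open>ten (ket p)\<close> (see \<open>adjoint_pair_block\<close>): a
  vector over pairs is read as a direct sum of blocks, and the block with index \<open>p\<close> is
  extracted.\<close>

definition block_proj :: "'n \<Rightarrow> ('n \<times> 'i) ell2 \<Rightarrow> 'i ell2" where
  "block_proj p = ext (\<lambda>q. if fst q = p then ket (snd q) else 0)"

lemma bessel_bound_block_proj: "bessel_bound 1 (\<lambda>q. if fst q = p then ket (snd q) else 0)"
  unfolding bessel_bound_def
proof (intro conjI allI impI)
  fix F :: "('a \<times> 'b) set" and a :: "'a \<times> 'b \<Rightarrow> complex" assume F: "finite F"
  let ?F = "{q \<in> F. fst q = p}"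
  have inj: "inj_on snd ?F" by (auto simp: inj_on_def prod_eq_iff)
  have "(\<Sum>q\<in>F. cs (a q) (if fst q = p then ket (snd q) else 0)) = (\<Sum>q\<in>?F. cs (a q) (ket (snd q)))"
    using F by (intro sum.mono_neutral_cong_right) (auto simp: cs_algebra)
  also have "\<dots> = (\<Sum>q\<in>?F. cs (a (p, snd q)) (ket (snd q)))"
    by (intro sum.cong refl) (metis (mono_tags) mem_Collect_eq prod.collapse)
  also have "\<dots> = (\<Sum>i\<in>snd ` ?F. cs (a (p, i)) (ket i))"
    using inj by (simp add: sum.reindex)
  finally have "(norm (\<Sum>q\<in>F. cs (a q) (if fst q = p then ket (snd q) else 0)))\<^sup>2 =
      (\<Sum>i\<in>snd ` ?F. (cmod (a (p, i)))\<^sup>2)"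
    using F by (simp add: norm_sum_ket)
  also have "\<dots> = (\<Sum>q\<in>?F. (cmod (a (p, snd q)))\<^sup>2)"
    using inj by (simp add: sum.reindex)
  also have "\<dots> = (\<Sum>q\<in>?F. (cmod (a q))\<^sup>2)"
    by (intro sum.cong refl) (metis (mono_tags) mem_Collect_eq prod.collapse)
  also have "\<dots> \<le> (\<Sum>q\<in>F. (cmod (a q))\<^sup>2)"
    using F by (intro sum_mono2) auto
  finally show "(norm (\<Sum>q\<in>F. cs (a q) (if fst q = p then ket (snd q) else 0)))\<^sup>2 \<le> 1\<^sup>2 * (\<Sum>q\<in>F. (cmod (a q))\<^sup>2)"
    by simp
qed simp

lemma bclin_block_proj: "bclin (block_proj p)"
  unfolding block_proj_def by (rule bclin_ext[OF bessel_bound_block_proj])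

lemma block_proj_ten: "block_proj p (ten (ket q) g) = (if q = p then g else 0)"
proof -
  have "block_proj p (ten (ket q) (ket i)) = (if q = p then ket i else 0)" for i
    unfolding block_proj_def ten_ket ext_ket[OF bessel_bound_block_proj] by simp
  moreover have "bclin (\<lambda>g. if q = p then g else 0)"
    by (cases "q = p") (simp_all add: bclin_ident bclin_zero)
  ultimately show ?thesis
    by (intro bclin_eqI[where f = g, OF bclin_compose[OF bclin_block_proj bclin_ten_right]]) auto
qed

lemma sum_block_proj: "(\<Sum>p\<in>(UNIV :: 'n::finite set). ten (ket p) (block_proj p f)) = f"
proof (rule bclin2_eqI[where f = f])
  show "bclin (\<lambda>f. \<Sum>p\<in>UNIV. ten (ket p) (block_proj p f))"
    by (intro bclin_sum bclin_compose[OF bclin_ten_right bclin_block_proj])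
  have "(\<Sum>p\<in>UNIV. ten (ket p) (block_proj p (ten (ket i) (ket j)))) =
      (\<Sum>p\<in>UNIV. if p = i then ten (ket p) (ket j) else 0)" for i :: 'n and j :: 'b
    by (intro sum.cong refl) (auto simp: block_proj_ten ten_right)
  then show "(\<Sum>p\<in>UNIV. ten (ket p) (block_proj p (ten (ket i) (ket j)))) = ten (ket i) (ket j)" for i :: 'n and j :: 'b
    by simp
qed (rule bclin_ident)

lemma adjoint_pair_block: "adjoint_pair (ten (ket p)) (block_proj p)"
proof (rule adjoint_pair_ket)
  show "bclin (ten (ket p))" by (rule bclin_ten_right)
  show "coef (ten (ket p) (ket i)) j = cnj (coef (block_proj p (ket j)) i)" for i j
    by (cases j) (auto simp: ten_ket[symmetric] block_proj_ten)
qed (rule bclin_block_proj)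

section \<open>Finite von Neumann algebras in standard form\<close>

text \<open>The complex span; \<open>span\<close> on this type is the real one.\<close>

definition cspan :: "('w \<Rightarrow> 'i ell2) \<Rightarrow> 'i ell2 set" where
  "cspan c = {f. \<exists>F \<alpha>. finite F \<and> f = (\<Sum>w\<in>F. cs (\<alpha> w) (c w))}"

lemma cspan_base: "c w \<in> cspan c"
  unfolding cspan_def by (intro CollectI exI[of _ "{w}"] exI[of _ "\<lambda>_. 1"]) (simp add: cs_algebra)

lemma cspan_zero: "0 \<in> cspan c"
  unfolding cspan_def by (intro CollectI exI[of _ "{}"]) simp

lemma cspan_cs: "f \<in> cspan c \<Longrightarrow> cs a f \<in> cspan c"
  unfolding cspan_def mem_Collect_eq
proof (elim exE conjE)
  fix F \<alpha> assume "finite F" "f = (\<Sum>w\<in>F. cs (\<alpha> w) (c w))"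
  then show "\<exists>F \<alpha>. finite F \<and> cs a f = (\<Sum>w\<in>F. cs (\<alpha> w) (c w))"
    by (intro exI[of _ F] exI[of _ "\<lambda>w. a * \<alpha> w"]) (simp add: cs_sum cs_algebra)
qed

lemma cspan_add:
  assumes "f \<in> cspan c" "g \<in> cspan c"
  shows "f + g \<in> cspan c"
proof -
  obtain F \<alpha> where 1: "finite F" "f = (\<Sum>w\<in>F. cs (\<alpha> w) (c w))" using assms(1) by (auto simp: cspan_def)
  obtain G \<beta> where 2: "finite G" "g = (\<Sum>w\<in>G. cs (\<beta> w) (c w))" using assms(2) by (auto simp: cspan_def)
  have "f = (\<Sum>w\<in>F \<union> G. cs (if w \<in> F then \<alpha> w else 0) (c w))"
    unfolding 1(2) using 1 2 by (intro sum.mono_neutral_cong_left) (auto simp: cs_algebra)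
  moreover have "g = (\<Sum>w\<in>F \<union> G. cs (if w \<in> G then \<beta> w else 0) (c w))"
    unfolding 2(2) using 1 2 by (intro sum.mono_neutral_cong_left) (auto simp: cs_algebra)
  ultimately have "f + g = (\<Sum>w\<in>F \<union> G. cs ((if w \<in> F then \<alpha> w else 0) + (if w \<in> G then \<beta> w else 0)) (c w))"
    by (simp add: cs_algebra sum.distrib)
  then show ?thesis
    unfolding cspan_def using 1(1) 2(1)
    by (intro CollectI exI[of _ "F \<union> G"] exI[of _ "\<lambda>w. (if w \<in> F then \<alpha> w else 0) + (if w \<in> G then \<beta> w else 0)"]) simp
qed

lemma cspan_sum: "(\<And>x. x \<in> A \<Longrightarrow> f x \<in> cspan c) \<Longrightarrow> (\<Sum>x\<in>A. f x) \<in> cspan c"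
  by (induction A rule: infinite_finite_induct) (auto simp: cspan_zero cspan_add)

lemma cspan_ten:
  assumes "f \<in> cspan c" "g \<in> cspan d"
  shows "ten f g \<in> cspan (\<lambda>w. ten (c (fst w)) (d (snd w)))"
proof -
  obtain F \<alpha> where 1: "f = (\<Sum>w\<in>F. cs (\<alpha> w) (c w))" using assms(1) by (auto simp: cspan_def)
  obtain G \<beta> where 2: "g = (\<Sum>w\<in>G. cs (\<beta> w) (d w))" using assms(2) by (auto simp: cspan_def)
  have "ten (c w) (d v) \<in> cspan (\<lambda>w. ten (c (fst w)) (d (snd w)))" for w v
    using cspan_base[of "\<lambda>w. ten (c (fst w)) (d (snd w))" "(w, v)"] by simp
  then show ?thesis
    unfolding 1 2 by (simp only: ten_left ten_right) (intro cspan_sum cspan_cs)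
qed

text \<open>The operators \<open>R w\<close> play the role of right multiplications on the \<open>L\<^sup>2\<close>-space of a trace with
  trace vector \<open>\<Omega>\<close>; the algebra consists of the operators on the range of \<open>P\<close> that commute with
  them. The trace property of the vector state of \<open>\<Omega>\<close> on this commutant is a consequence.\<close>

locale tracial_rep =
  fixes P :: "'i ell2 \<Rightarrow> 'i ell2" and \<Omega> :: "'i ell2" and R Rs :: "'w \<Rightarrow> 'i ell2 \<Rightarrow> 'i ell2"
  assumes bclin_P: "bclin P" and P_adjoint: "adjoint_pair P P" and P_P: "P (P f) = P f"
    and P_\<Omega>: "P \<Omega> = \<Omega>" and unit_\<Omega>: "cip \<Omega> \<Omega> = 1"
    and bclin_R: "bclin (R w)" "bclin (Rs w)" and R_adjoint: "adjoint_pair (R w) (Rs w)"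
    and P_R: "P (R w f) = R w f" "P (Rs w f) = Rs w f"
    and R_flip: "cip (Rs w \<Omega>) (Rs v \<Omega>) = cip (R v \<Omega>) (R w \<Omega>)"
    and P_ket: "P (ket i) \<in> cspan (\<lambda>w. R w \<Omega>)"

text \<open>Every axiom is a condition on operators, an identity of inner products at the trace
  vector, or a span condition on basis vectors, and each of these passes to tensor products factor
  by factor.\<close>

lemma tracial_rep_tensor:
  assumes "tracial_rep P1 \<Omega>1 R1 Rs1" "tracial_rep P2 \<Omega>2 R2 Rs2"
  shows "tracial_rep (tenop P1 P2) (ten \<Omega>1 \<Omega>2)
    (\<lambda>w. tenop (R1 (fst w)) (R2 (snd w))) (\<lambda>w. tenop (Rs1 (fst w)) (Rs2 (snd w)))"
proof -
  interpret r1: tracial_rep P1 \<Omega>1 R1 Rs1 by (rule assms)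
  interpret r2: tracial_rep P2 \<Omega>2 R2 Rs2 by (rule assms)
  note P = r1.bclin_P r2.bclin_P and R = r1.bclin_R r2.bclin_R
  show ?thesis
  proof
    show "bclin (tenop P1 P2)" by (rule bclin_tenop[OF P])
    show "adjoint_pair (tenop P1 P2) (tenop P1 P2)"
      by (rule adjoint_pair_tenop[OF P P r1.P_adjoint r2.P_adjoint])
    show "tenop P1 P2 (tenop P1 P2 f) = tenop P1 P2 f" for f
      unfolding tenop_compose[OF P P] r1.P_P r2.P_P ..
    show "tenop P1 P2 (ten \<Omega>1 \<Omega>2) = ten \<Omega>1 \<Omega>2" by (simp add: tenop_ten P r1.P_\<Omega> r2.P_\<Omega>)
    show "cip (ten \<Omega>1 \<Omega>2) (ten \<Omega>1 \<Omega>2) = 1" by (simp add: cip_ten r1.unit_\<Omega> r2.unit_\<Omega>)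
    show "bclin (tenop (R1 (fst w)) (R2 (snd w)))" for w by (intro bclin_tenop R)
    show "bclin (tenop (Rs1 (fst w)) (Rs2 (snd w)))" for w by (intro bclin_tenop R)
    show "adjoint_pair (tenop (R1 (fst w)) (R2 (snd w))) (tenop (Rs1 (fst w)) (Rs2 (snd w)))" for w
      by (intro adjoint_pair_tenop R r1.R_adjoint r2.R_adjoint)
    show "tenop P1 P2 (tenop (R1 (fst w)) (R2 (snd w)) f) = tenop (R1 (fst w)) (R2 (snd w)) f" for w f
      unfolding tenop_compose[OF P R(1,3)] r1.P_R r2.P_R ..
    show "tenop P1 P2 (tenop (Rs1 (fst w)) (Rs2 (snd w)) f) = tenop (Rs1 (fst w)) (Rs2 (snd w)) f" for w f
      unfolding tenop_compose[OF P R(2,4)] r1.P_R r2.P_R ..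
    show "cip (tenop (Rs1 (fst w)) (Rs2 (snd w)) (ten \<Omega>1 \<Omega>2)) (tenop (Rs1 (fst v)) (Rs2 (snd v)) (ten \<Omega>1 \<Omega>2)) =
        cip (tenop (R1 (fst v)) (R2 (snd v)) (ten \<Omega>1 \<Omega>2)) (tenop (R1 (fst w)) (R2 (snd w)) (ten \<Omega>1 \<Omega>2))" for v w
      by (simp add: tenop_ten R cip_ten r1.R_flip[of "fst w"] r2.R_flip[of "snd w"])
    show "tenop P1 P2 (ket i) \<in> cspan (\<lambda>w. tenop (R1 (fst w)) (R2 (snd w)) (ten \<Omega>1 \<Omega>2))" for i
      using cspan_ten[OF r1.P_ket r2.P_ket, of "fst i" "snd i"]
      by (cases i) (simp add: tenop_ten R P flip: ten_ket)
  qed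
qed

section \<open>The commutant and the trace on it\<close>

context tracial_rep
begin

text \<open>The adjoint \<open>S\<close> is a second argument, and both operators are required to
  commute with all \<open>R w\<close>; commutation with \<open>Rs w\<close> follows by taking
  adjoints (\<open>alg_Rs\<close>). Requiring ranges inside that of \<open>P\<close> for both
  confines the pair to the range of \<open>P\<close>.\<close>

definition alg :: "('i ell2 \<Rightarrow> 'i ell2) \<Rightarrow> ('i ell2 \<Rightarrow> 'i ell2) \<Rightarrow> bool" where
  "alg T S \<longleftrightarrow> bclin T \<and> bclin S \<and> adjoint_pair T S \<and>
     (\<forall>f. P (T f) = T f \<and> P (S f) = S f) \<and> (\<forall>w f. T (R w f) = R w (T f) \<and> S (R w f) = R w (S f))"

lemma alg_sym: "alg T S \<Longrightarrow> alg S T"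
  by (auto simp: alg_def adjoint_pair_sym)

lemma algD:
  assumes "alg T S"
  shows "bclin T" "bclin S" "cip (T f) g = cip f (S g)" "cip (S f) g = cip f (T g)"
    "P (T f) = T f" "P (S f) = S f" "T (R w f) = R w (T f)" "S (R w f) = R w (S f)"
  using assms adjoint_pair_sym[of T S] by (auto simp: alg_def adjoint_pair_def)

lemma algI:
  assumes "bclin T" "bclin S" "adjoint_pair T S" "\<And>f. P (T f) = T f" "\<And>f. P (S f) = S f"
    "\<And>w f. T (R w f) = R w (T f)" "\<And>w f. S (R w f) = R w (S f)"
  shows "alg T S"
  using assms by (simp add: alg_def)

lemma alg_P_right:
  assumes "alg T S"
  shows "T (P f) = T f"
proof (rule cip_eqI)
  fix g
  show "cip (T (P f)) g = cip (T f) g"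
    using P_adjoint by (simp add: algD(3)[OF assms] adjoint_pair_def algD(6)[OF assms])
qed

lemma alg_Rs:
  assumes "alg T S"
  shows "T (Rs w f) = Rs w (T f)"
proof (rule cip_eqI)
  fix g
  have "cip (T (Rs w f)) g = cip f (R w (S g))"
    using adjoint_pair_sym[OF R_adjoint[of w]] by (simp add: algD(3)[OF assms] adjoint_pair_def)
  also have "\<dots> = cip (Rs w (T f)) g"
    using adjoint_pair_sym[OF R_adjoint[of w]] by (simp add: algD(3,8)[OF assms] adjoint_pair_def flip: algD(8)[OF assms])
  finally show "cip (T (Rs w f)) g = cip (Rs w (T f)) g" .
qed

lemma R_P: "R w (P f) = R w f"
proof (rule cip_eqI)
  fix g
  show "cip (R w (P f)) g = cip (R w f) g"
    using R_adjoint[of w] P_adjoint by (simp add: adjoint_pair_def P_R)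
qed

lemma alg_compose: "alg T S \<Longrightarrow> alg T' S' \<Longrightarrow> alg (\<lambda>f. T (T' f)) (\<lambda>f. S' (S f))"
  by (rule algI) (auto intro: bclin_compose simp: algD adjoint_pair_def)

lemma alg_add: "alg T S \<Longrightarrow> alg T' S' \<Longrightarrow> alg (\<lambda>f. T f + T' f) (\<lambda>f. S f + S' f)"
  by (rule algI)
    (auto intro: bclin_add simp: algD adjoint_pair_def cip_add_left cip_add_right bclinD[OF bclin_P] bclinD[OF bclin_R(1)])

lemma alg_zero: "alg (\<lambda>f. 0) (\<lambda>f. 0)"
  by (rule algI) (auto simp: bclin_zero adjoint_pair_def bclinD[OF bclin_P] bclinD[OF bclin_R(1)])

lemma alg_sum: "(\<And>x. x \<in> A \<Longrightarrow> alg (T x) (S x)) \<Longrightarrow> alg (\<lambda>f. \<Sum>x\<in>A. T x f) (\<lambda>f. \<Sum>x\<in>A. S x f)"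
  by (induction A rule: infinite_finite_induct) (auto simp: alg_zero alg_add)

lemma alg_cs: "alg T S \<Longrightarrow> alg (\<lambda>f. cs c (T f)) (\<lambda>f. cs (cnj c) (S f))"
  by (rule algI)
    (auto intro: bclin_cs simp: algD adjoint_pair_def cip_cs_left cip_cs_right bclinD[OF bclin_P] bclinD[OF bclin_R(1)])

lemma alg_P: "alg P P"
  by (rule algI) (auto simp: bclin_P P_adjoint P_P P_R R_P)

text \<open>The Gram matrix of \<open>g\<close> is the transpose of that of the projected basis
  vectors \<open>P (ket i)\<close>, so the norm of a combination of the \<open>g i\<close> is at
  most the l^2 norm of its coefficients. Pairing \<open>u\<close> with the combination with
  coefficients \<open>?\<beta>\<close> gives the sum on the left, and Cauchy-Schwarz
  finishes.\<close>

lemma bessel_flip: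
  assumes F: "finite F" and g: "\<And>i j. cip (g i) (g j) = cip (P (ket j)) (P (ket i))"
  shows "(\<Sum>i\<in>F. (cmod (cip (g i) u))\<^sup>2) \<le> (norm u)\<^sup>2"
proof -
  let ?\<beta> = "\<lambda>i. cnj (cip (g i) u)"
  let ?s = "\<Sum>i\<in>F. (cmod (cip (g i) u))\<^sup>2"
  have s0: "0 \<le> ?s" by (simp add: sum_nonneg)
  have "cip (\<Sum>i\<in>F. cs (?\<beta> i) (g i)) (\<Sum>i\<in>F. cs (?\<beta> i) (g i)) =
      cip (P (\<Sum>i\<in>F. cs (cnj (?\<beta> i)) (ket i))) (P (\<Sum>i\<in>F. cs (cnj (?\<beta> i)) (ket i)))"
    by (simp add: cip_sum_left cip_sum_right cip_cs_left cip_cs_right g bclinD[OF bclin_P] sum_distrib_left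
        mult.assoc mult.left_commute) (rule sum.swap)
  also have "\<dots> = cip (P (\<Sum>i\<in>F. cs (cnj (?\<beta> i)) (ket i))) (\<Sum>i\<in>F. cs (cnj (?\<beta> i)) (ket i))"
    using P_adjoint by (simp add: adjoint_pair_def P_P)
  finally have 1: "(norm (\<Sum>i\<in>F. cs (?\<beta> i) (g i)))\<^sup>2 = Re (cip (P (\<Sum>i\<in>F. cs (cnj (?\<beta> i)) (ket i))) (\<Sum>i\<in>F. cs (cnj (?\<beta> i)) (ket i)))"
    by (simp only: Re_cip_self[symmetric])
  have P_le: "Re (cip (P v) v) \<le> (norm v)\<^sup>2" for v
  proof -
    have "(norm (P v))\<^sup>2 = Re (cip (P v) v)"
      using P_adjoint by (simp add: Re_cip_self[symmetric] adjoint_pair_def P_P)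
    moreover have "Re (cip (P v) v) \<le> norm (P v) * norm v"
      using cmod_cip_le[of "P v" v] complex_Re_le_cmod order_trans by blast
    ultimately have "norm (P v) * norm (P v) \<le> norm (P v) * norm v" by (simp add: power2_eq_square)
    then have "norm (P v) \<le> norm v" by (cases "P v = 0") auto
    then show ?thesis using \<open>(norm (P v))\<^sup>2 = _\<close> by (metis norm_ge_zero power_mono)
  qed
  have "(norm (\<Sum>i\<in>F. cs (?\<beta> i) (g i)))\<^sup>2 \<le> ?s"
    unfolding 1 using P_le[of "\<Sum>i\<in>F. cs (cnj (?\<beta> i)) (ket i)"] norm_sum_ket[OF F, of "\<lambda>i. cnj (?\<beta> i)"] by simp
  then have 2: "norm (\<Sum>i\<in>F. cs (?\<beta> i) (g i)) \<le> sqrt ?s" by (rule real_le_rsqrt)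
  have "complex_of_real ?s = cip (\<Sum>i\<in>F. cs (?\<beta> i) (g i)) u"
    unfolding cip_sum_left cip_cs_left of_real_sum mult_cnj_cmod[symmetric] by (simp add: mult.commute)
  from arg_cong[OF this, of cmod]
  have "?s = cmod (cip (\<Sum>i\<in>F. cs (?\<beta> i) (g i)) u)"
    unfolding norm_of_real abs_of_nonneg[OF s0] .
  also have "\<dots> \<le> sqrt ?s * norm u"
    using cmod_cip_le[of "\<Sum>i\<in>F. cs (?\<beta> i) (g i)" u] mult_right_mono[OF 2, of "norm u"] by simp
  finally have 3: "?s \<le> sqrt ?s * norm u" .
  show ?thesis
  proof (cases "?s = 0")
    case False
    then have "sqrt ?s * sqrt ?s \<le> sqrt ?s * norm u" "0 < sqrt ?s" using 3 s0 by auto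
    then have "sqrt ?s \<le> norm u" by (rule mult_left_le_imp_le)
    then have "(sqrt ?s)\<^sup>2 \<le> (norm u)\<^sup>2" by (intro power_mono) (auto simp: s0)
    then show ?thesis using s0 by simp
  qed simp
qed

text \<open>By \<open>R_flip\<close>, the assignment
  \<open>R w \<Omega> \<mapsto> Rs w \<Omega>\<close> preserves inner products up to conjugation, so
  it has an antilinear isometric extension, which carries \<open>P (ket i)\<close> to
  \<open>g i\<close>. Since \<open>T\<close> commutes with \<open>R w\<close>, the coordinates of
  \<open>S \<Omega>\<close> are the inner products of the \<open>g i\<close> with
  \<open>T \<Omega>\<close>, and \<open>bessel_flip\<close> bounds the norm.\<close>

lemma alg_norm_adjoint_le:
  assumes T: "alg T S"
  shows "(norm (S \<Omega>))\<^sup>2 \<le> (norm (T \<Omega>))\<^sup>2"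
proof -
  have "\<forall>i. \<exists>F \<alpha>. finite F \<and> P (ket i) = (\<Sum>w\<in>F. cs (\<alpha> w) (R w \<Omega>))"
    using P_ket by (simp add: cspan_def)
  then obtain F \<alpha> where F: "\<And>i. finite (F i)" and \<alpha>: "\<And>i. P (ket i) = (\<Sum>w\<in>F i. cs (\<alpha> i w) (R w \<Omega>))"
    by metis
  define g where "g i = (\<Sum>w\<in>F i. cs (cnj (\<alpha> i w)) (Rs w \<Omega>))" for i
  have g: "cip (g i) (g j) = cip (P (ket j)) (P (ket i))" for i j
    unfolding g_def \<alpha> by (simp add: cip_sum_left cip_sum_right cip_cs_left cip_cs_right R_flip sum_distrib_left
        mult.left_commute) (rule sum.swap)
  have coef: "coef (S \<Omega>) i = cip (g i) (T \<Omega>)" for i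
  proof -
    have "coef (S \<Omega>) i = cip (S \<Omega>) (P (ket i))"
      using P_adjoint algD(6)[OF T, of \<Omega>] by (metis adjoint_pair_def cip_ket_right)
    also have "\<dots> = (\<Sum>w\<in>F i. cnj (\<alpha> i w) * cip \<Omega> (R w (T \<Omega>)))"
      unfolding \<alpha> by (simp add: cip_sum_right cip_cs_right algD(4,7)[OF T])
    also have "\<dots> = cip (g i) (T \<Omega>)"
      unfolding g_def using adjoint_pair_sym[OF R_adjoint] by (simp add: cip_sum_left cip_cs_left adjoint_pair_def)
    finally show ?thesis .
  qed
  show ?thesis
    by (rule has_sum_le_finite_sums[OF norm_square_has_sum]) (simp add: coef bessel_flip[OF _ g])
qed

lemma alg_norm_adjoint: "alg T S \<Longrightarrow> cip (S \<Omega>) (S \<Omega>) = cip (T \<Omega>) (T \<Omega>)"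
  unfolding cip_self using alg_norm_adjoint_le[of T S] alg_norm_adjoint_le[OF alg_sym, of T S] by simp

text \<open>Polarization of \<open>alg_norm_adjoint\<close>: the equality for T + cnj c S' at c = 1
  and c = i separates the two mixed terms and yields \<open>cip (T' \<Omega>) (S \<Omega>) = cip (T
  \<Omega>) (S' \<Omega>)\<close>.\<close>

lemma alg_trace:
  assumes T: "alg T S" and T': "alg T' S'"
  shows "cip (T (T' \<Omega>)) \<Omega> = cip (T' (T \<Omega>)) \<Omega>"
proof -
  let ?q = "\<lambda>c. cip (S \<Omega> + cs c (T' \<Omega>)) (S \<Omega> + cs c (T' \<Omega>)) = cip (T \<Omega> + cs (cnj c) (S' \<Omega>)) (T \<Omega> + cs (cnj c) (S' \<Omega>))"
  have q: "?q c" for c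
  proof -
    have "alg (\<lambda>f. T f + cs (cnj c) (S' f)) (\<lambda>f. S f + cs c (T' f))"
      using alg_add[OF T alg_cs[OF alg_sym[OF T'], of "cnj c"]] by simp
    from alg_norm_adjoint[OF this] show ?thesis .
  qed
  have n: "cip (S \<Omega>) (S \<Omega>) = cip (T \<Omega>) (T \<Omega>)" "cip (S' \<Omega>) (S' \<Omega>) = cip (T' \<Omega>) (T' \<Omega>)"
    using alg_norm_adjoint[OF T] alg_norm_adjoint[OF T'] by auto
  define x where "x = cip (T' \<Omega>) (S \<Omega>)"
  define x' where "x' = cip (S \<Omega>) (T' \<Omega>)"
  define y where "y = cip (S' \<Omega>) (T \<Omega>)"
  define y' where "y' = cip (T \<Omega>) (S' \<Omega>)"
  have e: "cnj c * x' + c * x = c * y' + cnj c * y" if "cnj c * c = 1" for c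
    using q[of c] that
    by (simp add: cip_add_left cip_add_right cip_cs_left cip_cs_right n x_def x'_def y_def y'_def algebra_simps)
  have "x' + x = y' + y" using e[of 1] by simp
  moreover have "- \<i> * x' + \<i> * x = \<i> * y' - \<i> * y" using e[of \<i>] by simp
  then have "\<i> * (x - x') = \<i> * (y' - y)" by (simp add: algebra_simps)
  then have "x - x' = y' - y" by simp
  ultimately have "x = y'" by (simp add: algebra_simps complex_eq_iff)
  then have "cip (T' \<Omega>) (S \<Omega>) = cip (T \<Omega>) (S' \<Omega>)" by (simp add: x_def y'_def)
  then show ?thesis by (simp add: algD(3)[OF T] algD(3)[OF T'])
qed

text \<open>Positivity over an algebra is defined by a factor with as many rows as columns, while
  composition produces rows indexed by \<open>'q\<close>. The block operator \<open>G\<close> built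
  from K^* K on the direct sum has a self-adjoint root \<open>h\<close>. As \<open>G\<close>
  commutes with the diagonal copies of \<open>R w\<close> and \<open>P\<close>, so does
  \<open>h\<close>, and its blocks, compressed by \<open>P\<close>, lie in the commutant.\<close>

lemma alg_square:
  fixes K Ks :: "'q::finite \<Rightarrow> 'n::finite \<Rightarrow> 'i ell2 \<Rightarrow> 'i ell2"
  assumes K: "\<And>q p. alg (K q p) (Ks q p)"
  shows "\<exists>h hs. (\<forall>r p. alg (h r p) (hs r p)) \<and>
    (\<forall>p p' f. (\<Sum>r\<in>(UNIV :: 'n set). hs r p (h r p' f)) = (\<Sum>q\<in>UNIV. Ks q p (K q p' f)))"
proof -
  define g where "g p p' f = (\<Sum>q\<in>UNIV. Ks q p (K q p' f))" for p p' f
  have g: "alg (g p p') (g p' p)" for p p'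
    unfolding g_def[abs_def] by (rule alg_sum) (rule alg_compose[OF alg_sym[OF K] K])
  define G where "G f = (\<Sum>p\<in>UNIV. \<Sum>p'\<in>UNIV. ten (ket p) (g p p' (block_proj p' f)))" for f :: "('n \<times> 'i) ell2"
  define k where "k q f = (\<Sum>p\<in>UNIV. K q p (block_proj p f))" for q f
  have G_bclin: "bclin G"
    unfolding G_def[abs_def]
    by (intro bclin_sum bclin_compose[OF bclin_ten_right] bclin_compose[OF algD(1)[OF g]] bclin_block_proj)
  have G_adj: "adjoint_pair G G"
  proof -
    have "adjoint_pair (\<lambda>f. ten (ket p) (g p p' (block_proj p' f))) (\<lambda>f. ten (ket p') (g p' p (block_proj p f)))" for p p'
      using adjoint_pair_compose[OF adjoint_pair_block adjoint_pair_compose[OF _ adjoint_pair_sym[OF adjoint_pair_block]], of "g p p'" "g p' p"]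
        g[of p p'] by (simp add: alg_def)
    then have "adjoint_pair G (\<lambda>f. \<Sum>p\<in>UNIV. \<Sum>p'\<in>UNIV. ten (ket p') (g p' p (block_proj p f)))"
      unfolding G_def[abs_def] by (intro adjoint_pair_sum)
    moreover have "(\<Sum>p\<in>UNIV. \<Sum>p'\<in>UNIV. ten (ket p') (g p' p (block_proj p f))) = G f" for f
      unfolding G_def by (rule sum.swap)
    ultimately show ?thesis by simp
  qed
  have G_quad: "cip (G f) f = (\<Sum>q\<in>UNIV. cip (k q f) (k q f))" for f
  proof -
    have b: "cip (ten (ket p) u) f = cip u (block_proj p f)" for p u
      by (rule adjoint_pairD[OF adjoint_pair_block])
    have "cip (G f) f = (\<Sum>p\<in>UNIV. \<Sum>p'\<in>UNIV. \<Sum>q\<in>UNIV. cip (K q p' (block_proj p' f)) (K q p (block_proj p f)))"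
      unfolding G_def g_def by (simp add: cip_sum_left b algD(4)[OF K])
    also have "\<dots> = (\<Sum>p\<in>UNIV. \<Sum>q\<in>UNIV. \<Sum>p'\<in>UNIV. cip (K q p' (block_proj p' f)) (K q p (block_proj p f)))"
      by (intro sum.cong refl sum.swap)
    also have "\<dots> = (\<Sum>q\<in>UNIV. \<Sum>p\<in>UNIV. \<Sum>p'\<in>UNIV. cip (K q p' (block_proj p' f)) (K q p (block_proj p f)))"
      by (rule sum.swap)
    also have "\<dots> = (\<Sum>q\<in>UNIV. cip (k q f) (k q f))"
      unfolding k_def by (simp add: cip_sum_left cip_sum_right)
    finally show ?thesis .
  qed
  have "\<forall>q. \<exists>B\<ge>0. \<forall>f. norm (k q f) \<le> B * norm f"
  proof
    fix q
    have "bclin (k q)"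
      unfolding k_def[abs_def] by (intro bclin_sum bclin_compose[OF algD(1)[OF K]] bclin_block_proj)
    then show "\<exists>B\<ge>0. \<forall>f. norm (k q f) \<le> B * norm f" by (rule bclin_norm_le) blast
  qed
  then obtain B where B: "\<And>q. B q \<ge> 0" "\<And>q f. norm (k q f) \<le> B q * norm f" by metis
  \<comment> \<open>The added 1 makes \<open>M\<close> positive, as the rescaling in
    \<open>operator_sqrt\<close> requires.\<close>
  define M where "M = 1 + (\<Sum>q\<in>UNIV. (B q)\<^sup>2)"
  have M: "0 < M" unfolding M_def by (intro add_pos_nonneg sum_nonneg) auto
  have G_re: "Re (cip (G f) f) = (\<Sum>q\<in>UNIV. (norm (k q f))\<^sup>2)" for f
    by (simp add: G_quad Re_cip_self)
  have "\<exists>h. bclin h \<and> adjoint_pair h h \<and> (\<forall>f. h (h f) = G f) \<and>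
    (\<forall>X. bclin X \<and> (\<forall>f. X (G f) = G (X f)) \<longrightarrow> (\<forall>f. X (h f) = h (X f)))"
  proof (rule operator_sqrt[OF G_bclin G_adj M])
    fix f
    show "0 \<le> Re (cip (G f) f)" by (simp add: G_re sum_nonneg)
    have "(\<Sum>q\<in>UNIV. (norm (k q f))\<^sup>2) \<le> (\<Sum>q\<in>UNIV. (B q)\<^sup>2 * (norm f)\<^sup>2)"
      by (intro sum_mono) (metis B(2) norm_ge_zero power_mono power_mult_distrib)
    also have "\<dots> \<le> M * (norm f)\<^sup>2"
      by (simp add: M_def sum_distrib_right distrib_right)
    finally show "Re (cip (G f) f) \<le> M * (norm f)\<^sup>2" by (simp add: G_re)
  qed
  then obtain h where h: "bclin h" "adjoint_pair h h" "\<And>f. h (h f) = G f"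
    and hX: "\<And>X f. bclin X \<Longrightarrow> (\<And>f. X (G f) = G (X f)) \<Longrightarrow> X (h f) = h (X f)"
    by blast
  have diag_block: "block_proj p (tenop (\<lambda>f. f) X f) = X (block_proj p f)"
    if X: "bclin X" for p X f
  proof (rule bclin2_eqI[where f = f])
    show "bclin (\<lambda>f. block_proj p (tenop (\<lambda>f. f) X f))"
      by (rule bclin_compose[OF bclin_block_proj bclin_tenop[OF bclin_ident X]])
    show "bclin (\<lambda>f. X (block_proj p f))" by (rule bclin_compose[OF X bclin_block_proj])
  qed (simp add: tenop_ten bclin_ident X block_proj_ten bclinD[OF X])
  have diag_h: "tenop (\<lambda>f. f) X (h f) = h (tenop (\<lambda>f. f) X f)"
    if X: "bclin X" "\<And>p p' f. X (g p p' f) = g p p' (X f)" for X f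
  proof (rule hX[OF bclin_tenop[OF bclin_ident X(1)]])
    show "tenop (\<lambda>f. f) X (G f) = G (tenop (\<lambda>f. f) X f)" for f
      unfolding G_def
      by (simp add: bclinD[OF bclin_tenop[OF bclin_ident X(1)]] tenop_ten bclin_ident X diag_block)
  qed
  have h_block: "block_proj r (h (ten (ket p) (X f))) = X (block_proj r (h (ten (ket p) f)))"
    if X: "bclin X" "\<And>p p' f. X (g p p' f) = g p p' (X f)" for X r p f
    using diag_h[OF X, of "ten (ket p) f"] diag_block[OF X(1), of r "h (ten (ket p) f)"]
    by (simp add: tenop_ten bclin_ident X(1))
  have PX: "P (g p p' f) = g p p' (P f)" for p p' f
    using algD(5)[OF g] alg_P_right[OF g] by simp
  have RX: "R w (g p p' f) = g p p' (R w f)" for w p p' f using algD(7)[OF g] by simp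
  \<comment> \<open>\<open>P\<close> is inserted on the right of a block and on the left of its
    adjoint, so that both have range in that of \<open>P\<close>; for \<open>h'\<close> this uses
    that \<open>h\<close> commutes with the diagonal copy of \<open>P\<close>.\<close>
  define h' where "h' r p f = block_proj r (h (ten (ket p) (P f)))" for r p f
  define hs' where "hs' r p f = P (block_proj p (h (ten (ket r) f)))" for r p f
  have "alg (h' r p) (hs' r p)" for r p
  proof (rule algI)
    show "bclin (h' r p)" unfolding h'_def[abs_def]
      by (intro bclin_compose[OF bclin_block_proj] bclin_compose[OF h(1)] bclin_compose[OF bclin_ten_right] bclin_P)
    show "bclin (hs' r p)" unfolding hs'_def[abs_def]
      by (intro bclin_compose[OF bclin_P] bclin_compose[OF bclin_block_proj] bclin_compose[OF h(1)] bclin_ten_right)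
    show "adjoint_pair (h' r p) (hs' r p)"
      unfolding adjoint_pair_def h'_def hs'_def
      by (simp add: adjoint_pairD[OF adjoint_pair_block] adjoint_pairD[OF adjoint_pair_sym[OF adjoint_pair_block]]
          adjoint_pairD[OF h(2)] adjoint_pairD[OF P_adjoint])
    show "P (h' r p f) = h' r p f" for f
      unfolding h'_def h_block[OF bclin_P PX] P_P ..
    show "P (hs' r p f) = hs' r p f" for f
      unfolding hs'_def P_P ..
    show "h' r p (R w f) = R w (h' r p f)" for w f
      unfolding h'_def P_R h_block[OF bclin_P PX] h_block[OF bclin_R(1) RX] R_P ..
    show "hs' r p (R w f) = R w (hs' r p f)" for w f
      unfolding hs'_def h_block[OF bclin_R(1) RX] R_P P_R ..
  qed
  moreover have "(\<Sum>r\<in>UNIV. hs' r p (h' r p' f)) = (\<Sum>q\<in>UNIV. Ks q p (K q p' f))" for p p' f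
  proof -
    have "(\<Sum>r\<in>UNIV. hs' r p (h' r p' f)) = P (block_proj p (h (\<Sum>r\<in>UNIV. ten (ket r) (block_proj r (h (ten (ket p') (P f)))))))"
      unfolding h'_def hs'_def
      by (simp add: bclinD[OF bclin_P] bclinD[OF bclin_block_proj] bclinD[OF h(1)])
    also have "\<dots> = P (block_proj p (G (ten (ket p') (P f))))" by (simp only: sum_block_proj h(3))
    also have "G (ten (ket p') (P f)) = (\<Sum>r\<in>UNIV. ten (ket r) (g r p' (P f)))"
      unfolding G_def block_proj_ten
      by (intro sum.cong refl) (simp add: if_distrib[of "g _ _"] if_distrib[of "ten _"] bclinD[OF algD(1)[OF g]] ten_right cong: if_cong)
    also have "block_proj p \<dots> = g p p' (P f)"
      by (simp add: bclinD[OF bclin_block_proj] block_proj_ten)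
    also have "P \<dots> = g p p' f" by (simp only: algD(5)[OF g] alg_P_right[OF g])
    finally show ?thesis by (simp add: g_def)
  qed
  ultimately show ?thesis by blast
qed

section \<open>The separating trace vector and the commutative case\<close>

lemma alg_eqI:
  assumes T: "alg T S" and T': "alg T' S'" and eq: "\<And>w. T (R w \<Omega>) = T' (R w \<Omega>)"
  shows "T f = T' f"
proof (rule bclin_eqI[OF algD(1)[OF T] algD(1)[OF T']])
  fix i
  obtain F \<alpha> where "P (ket i) = (\<Sum>w\<in>F. cs (\<alpha> w) (R w \<Omega>))" using P_ket[of i] by (auto simp: cspan_def)
  then have "T (P (ket i)) = T' (P (ket i))"
    by (simp add: bclinD[OF algD(1)[OF T]] bclinD[OF algD(1)[OF T']] eq)
  then show "T (ket i) = T' (ket i)" by (simp only: alg_P_right[OF T] alg_P_right[OF T'])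
qed

text \<open>\<open>\<Omega>\<close> is separating for the commutant: the span of the vectors
  \<open>R w \<Omega>\<close> contains all \<open>P (ket i)\<close>, so the hypothesis determines
  \<open>T \<Omega>\<close>, and commuting with \<open>R w\<close> then determines \<open>T\<close>
  on the same spanning vectors.\<close>

lemma alg_eq_\<Omega>:
  assumes T: "alg T S" and T': "alg T' S'" and eq: "\<And>w. cip (T \<Omega>) (R w \<Omega>) = cip (T' \<Omega>) (R w \<Omega>)"
  shows "T f = T' f"
proof (rule alg_eqI[OF T T'])
  have "T \<Omega> = T' \<Omega>"
  proof (rule coef_inject_ext)
    fix i
    obtain F \<alpha> where a: "P (ket i) = (\<Sum>w\<in>F. cs (\<alpha> w) (R w \<Omega>))" using P_ket[of i] by (auto simp: cspan_def)
    have "cip (T \<Omega>) (P (ket i)) = cip (T' \<Omega>) (P (ket i))"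
      unfolding a by (simp add: cip_sum_right cip_cs_right eq)
    moreover have "cip (T \<Omega>) (P (ket i)) = cip (P (T \<Omega>)) (ket i)" "cip (T' \<Omega>) (P (ket i)) = cip (P (T' \<Omega>)) (ket i)"
      using P_adjoint by (simp_all only: adjoint_pair_def)
    ultimately show "coef (T \<Omega>) i = coef (T' \<Omega>) i" by (simp add: algD(5)[OF T] algD(5)[OF T'])
  qed
  then show "T (R w \<Omega>) = T' (R w \<Omega>)" for w by (simp only: algD(7)[OF T] algD(7)[OF T'])
qed

text \<open>If the right multiplications commute with each other and with the adjoints, then
  \<open>Rs w\<close> itself belongs to the algebra. After moving \<open>R w\<close> to the other
  side as \<open>Rs w\<close>, the trace property exchanges \<open>T\<close> and \<open>T'\<close>
  in the inner products with the spanning vectors.\<close>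

lemma alg_commute:
  assumes comm: "\<And>w v f. R w (R v f) = R v (R w f)" "\<And>w v f. R w (Rs v f) = Rs v (R w f)"
    and T: "alg T S" and T': "alg T' S'"
  shows "T (T' f) = T' (T f)"
proof (rule alg_eq_\<Omega>[OF alg_compose[OF T T'] alg_compose[OF T' T]])
  fix w
  have Rw: "alg (Rs w) (R w)"
  proof (rule algI)
    show "Rs w (R v f) = R v (Rs w f)" "R w (R v f) = R v (R w f)" for v f by (simp_all only: comm)
  qed (simp_all add: bclin_R P_R adjoint_pair_sym[OF R_adjoint])
  have e: "cip u (R w \<Omega>) = cip (Rs w u) \<Omega>" for u
    using adjoint_pair_sym[OF R_adjoint[of w]] by (simp add: adjoint_pair_def)
  have "cip (T (T' \<Omega>)) (R w \<Omega>) = cip (Rs w (T (T' \<Omega>))) \<Omega>" by (rule e)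
  also have "\<dots> = cip (T' (Rs w (T \<Omega>))) \<Omega>"
    by (rule alg_trace[OF alg_compose[OF Rw T] T'])
  also have "\<dots> = cip (Rs w (T' (T \<Omega>))) \<Omega>" by (simp only: alg_Rs[OF T'])
  also have "\<dots> = cip (T' (T \<Omega>)) (R w \<Omega>)" by (rule e[symmetric])
  finally show "cip (T (T' \<Omega>)) (R w \<Omega>) = cip (T' (T \<Omega>)) (R w \<Omega>)" .
qed

end

section \<open>The C*-algebra of a tracial representation\<close>

text \<open>The type of bounded operators is a real vector space, so its complex structure is
  supplied here.\<close>

definition bscale :: "complex \<Rightarrow> ('i ell2 \<Rightarrow>\<^sub>L 'i ell2) \<Rightarrow> 'i ell2 \<Rightarrow>\<^sub>L 'i ell2" where
  "bscale c T = Blinfun (\<lambda>f. cs c (T f))"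

lemma bscale_apply [simp]: "blinfun_apply (bscale c T) f = cs c (T f)"
  unfolding bscale_def
  by (subst bounded_linear_Blinfun_apply)
    (auto intro: bounded_linear_compose[OF bounded_linear_cs blinfun.bounded_linear_right])

text \<open>Matrix entries determine complex linear operators only; injectivity is therefore stated
  on the set \<open>A\<close> (\<open>inj_encode_op\<close>), and decoding inverts the map
  there.\<close>

definition encode_op :: "('i::countable ell2 \<Rightarrow>\<^sub>L 'i ell2) \<Rightarrow> 'u universe" where
  "encode_op T = Inr (\<lambda>n. coef (T (ket (from_nat (fst (prod_decode n))))) (from_nat (snd (prod_decode n))))"

lemma encode_op_coef:
  assumes "encode_op T = encode_op T'"
  shows "coef (T (ket i)) j = coef (T' (ket i)) j"
proof -
  have "(\<lambda>n. coef (T (ket (from_nat (fst (prod_decode n))))) (from_nat (snd (prod_decode n)))) =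
    (\<lambda>n. coef (T' (ket (from_nat (fst (prod_decode n))))) (from_nat (snd (prod_decode n))))"
    using assms unfolding encode_op_def by (rule Inr_inject)
  from fun_cong[OF this, of "prod_encode (to_nat i, to_nat j)"] show ?thesis by simp
qed

lemma blinfun_compose_associative: "(S o\<^sub>L T) o\<^sub>L X = S o\<^sub>L (T o\<^sub>L X)"
  by (rule blinfun_eqI) simp

locale countable_tracial_rep = tracial_rep P \<Omega> R Rs
  for P :: "'i::countable ell2 \<Rightarrow> 'i ell2" and \<Omega> and R Rs :: "'w \<Rightarrow> 'i ell2 \<Rightarrow> 'i ell2"
begin

definition A :: "('i ell2 \<Rightarrow>\<^sub>L 'i ell2) set" where
  "A = {T. \<exists>S. alg (blinfun_apply T) (blinfun_apply S)}"

definition adjb :: "('i ell2 \<Rightarrow>\<^sub>L 'i ell2) \<Rightarrow> 'i ell2 \<Rightarrow>\<^sub>L 'i ell2" where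
  "adjb T = (SOME S. alg (blinfun_apply T) (blinfun_apply S))"

lemma alg_adjb: "T \<in> A \<Longrightarrow> alg (blinfun_apply T) (blinfun_apply (adjb T))"
  unfolding A_def adjb_def by (auto intro: someI_ex)

lemma adjb_in_A: "T \<in> A \<Longrightarrow> adjb T \<in> A"
  using alg_sym[OF alg_adjb] by (auto simp: A_def)

lemma adjb_eqI:
  assumes "alg (blinfun_apply T) (blinfun_apply S)"
  shows "adjb T = S"
proof -
  have T: "T \<in> A" using assms by (auto simp: A_def)
  show ?thesis
    by (rule blinfun_eqI, rule adjoint_unique[of "blinfun_apply T"])
      (use alg_adjb[OF T] assms in \<open>auto simp: alg_def\<close>)
qed

lemma AI: "alg (blinfun_apply T) (blinfun_apply S) \<Longrightarrow> T \<in> A"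
  by (auto simp: A_def)

lemma alg_blinfun_add: "T \<in> A \<Longrightarrow> T' \<in> A \<Longrightarrow> alg (blinfun_apply (T + T')) (blinfun_apply (adjb T + adjb T'))"
  using alg_add[OF alg_adjb alg_adjb, of T T'] by (simp add: plus_blinfun.rep_eq)

lemma alg_blinfun_scale: "T \<in> A \<Longrightarrow> alg (blinfun_apply (bscale c T)) (blinfun_apply (bscale (cnj c) (adjb T)))"
  using alg_cs[OF alg_adjb, of T c] by (simp flip: bscale_apply)

lemma alg_blinfun_compose: "T \<in> A \<Longrightarrow> T' \<in> A \<Longrightarrow> alg (blinfun_apply (T o\<^sub>L T')) (blinfun_apply (adjb T' o\<^sub>L adjb T))"
  using alg_compose[OF alg_adjb alg_adjb, of T T'] by (simp flip: blinfun_apply_blinfun_compose)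

lemma alg_Blinfun:
  assumes "alg T S"
  shows "alg (blinfun_apply (Blinfun T)) (blinfun_apply (Blinfun S))"
  by (simp only: blinfun_apply_bclin algD(1,2)[OF assms] assms)

lemma zero_in_A: "0 \<in> A"
  using alg_zero by (intro AI[of 0 0]) (simp add: zero_blinfun.rep_eq[abs_def] zero_blinfun.rep_eq)

definition dec :: "'u universe \<Rightarrow> 'i ell2 \<Rightarrow>\<^sub>L 'i ell2" where
  "dec = inv_into A encode_op"

definition star_alg :: "'u universe star_algebra" where
  "star_alg = \<lparr>carrier = encode_op ` A, mult = (\<lambda>u v. encode_op (dec u o\<^sub>L dec v)), one = encode_op (Blinfun P),
     zero = encode_op (0 :: 'i ell2 \<Rightarrow>\<^sub>L 'i ell2), add = (\<lambda>u v. encode_op (dec u + dec v)),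
     smult = (\<lambda>c u. encode_op (bscale c (dec u))),
     star = (\<lambda>u. encode_op (adjb (dec u))), anorm = (\<lambda>u. norm (dec u))\<rparr>"

lemma inj_encode_op: "inj_on encode_op A"
proof (rule inj_onI)
  fix T T' :: "'i ell2 \<Rightarrow>\<^sub>L 'i ell2"
  assume T: "T \<in> A" "T' \<in> A" and eq: "(encode_op T :: 'u universe) = encode_op T'"
  show "T = T'"
    by (rule blinfun_eqI, rule bclin_eqI[OF algD(1)[OF alg_adjb[OF T(1)]] algD(1)[OF alg_adjb[OF T(2)]]],
        rule coef_inject_ext) (rule encode_op_coef[OF eq])
qed

lemma dec_encode: "T \<in> A \<Longrightarrow> dec (encode_op T) = T"
  unfolding dec_def by (rule inv_into_f_f[OF inj_encode_op])

lemma transported_star_alg: "transported A bscale encode_op (star_alg :: 'u universe star_algebra)"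
proof
  show "T + T' \<in> A" if "T \<in> A" "T' \<in> A" for T T' by (rule AI[OF alg_blinfun_add[OF that]])
  show "bscale c T \<in> A" if "T \<in> A" for c T by (rule AI[OF alg_blinfun_scale[OF that]])
qed (auto simp: star_alg_def dec_encode inj_encode_op zero_in_A cs_algebra blinfun.bilinear_simps intro!: blinfun_eqI)

lemma mult_star_alg: "T \<in> A \<Longrightarrow> T' \<in> A \<Longrightarrow> encode_op T \<otimes>\<^bsub>star_alg\<^esub> encode_op T' = encode_op (T o\<^sub>L T')"
  by (simp add: star_alg_def dec_encode)

lemma one_star_alg: "\<one>\<^bsub>star_alg\<^esub> = encode_op (Blinfun P)"
  by (simp add: star_alg_def)

lemma star_star_alg: "T \<in> A \<Longrightarrow> star star_alg (encode_op T) = encode_op (adjb T)"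
  by (simp add: star_alg_def dec_encode)

lemma anorm_star_alg: "T \<in> A \<Longrightarrow> anorm star_alg (encode_op T) = norm T"
  by (simp add: star_alg_def dec_encode)

lemma compose_in_A: "T \<in> A \<Longrightarrow> T' \<in> A \<Longrightarrow> T o\<^sub>L T' \<in> A"
  by (rule AI[OF alg_blinfun_compose])

lemma P_in_A: "Blinfun P \<in> A"
  by (rule AI[OF alg_Blinfun[OF alg_P]])

lemma P_compose: "T \<in> A \<Longrightarrow> Blinfun P o\<^sub>L T = T" "T \<in> A \<Longrightarrow> T o\<^sub>L Blinfun P = T"
  by (auto intro!: blinfun_eqI simp: blinfun_apply_bclin bclin_P algD(5)[OF alg_adjb] alg_P_right[OF alg_adjb])

lemma norm_adjb_le:
  assumes "T \<in> A"
  shows "norm (adjb T) \<le> norm T"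
proof (rule norm_blinfun_bound)
  fix f
  let ?u = "adjb T f"
  have "complex_of_real ((norm ?u)\<^sup>2) = cip (T ?u) f"
    unfolding cip_self[symmetric] by (rule algD(3)[OF alg_adjb[OF assms], symmetric])
  from arg_cong[OF this, of cmod] have "(norm ?u)\<^sup>2 = cmod (cip (T ?u) f)" by (simp del: of_real_power)
  also have "\<dots> \<le> norm (T ?u) * norm f" by (rule cmod_cip_le)
  also have "\<dots> \<le> norm T * norm ?u * norm f" by (intro mult_right_mono norm_blinfun) simp
  finally have "norm ?u * norm ?u \<le> norm ?u * (norm T * norm f)" by (simp add: power2_eq_square algebra_simps)
  then show "norm ?u \<le> norm T * norm f"
    by (cases "norm ?u = 0") (auto dest: mult_left_le_imp_le)
qed simp

lemma norm_adjb_compose: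
  assumes "T \<in> A"
  shows "norm (adjb T o\<^sub>L T) = (norm T)\<^sup>2"
proof (rule antisym)
  show "norm (adjb T o\<^sub>L T) \<le> (norm T)\<^sup>2"
    using order_trans[OF norm_blinfun_compose[of "adjb T" T] mult_right_mono[OF norm_adjb_le[OF assms] norm_ge_zero]]
    by (simp add: power2_eq_square)
  have "norm T \<le> sqrt (norm (adjb T o\<^sub>L T))"
  proof (rule norm_blinfun_bound)
    fix f
    have "complex_of_real ((norm (T f))\<^sup>2) = cip (adjb T (T f)) f"
      unfolding cip_self[symmetric] by (rule algD(4)[OF alg_adjb[OF assms], symmetric])
    from arg_cong[OF this, of cmod] have "(norm (T f))\<^sup>2 = cmod (cip (adjb T (T f)) f)" by (simp del: of_real_power)
    also have "\<dots> \<le> norm ((adjb T o\<^sub>L T) f) * norm f" using cmod_cip_le[of "adjb T (T f)" f] by simp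
    also have "\<dots> \<le> norm (adjb T o\<^sub>L T) * norm f * norm f" by (intro mult_right_mono norm_blinfun) simp
    also have "\<dots> = (sqrt (norm (adjb T o\<^sub>L T)) * norm f)\<^sup>2" by (simp add: power_mult_distrib power2_eq_square)
    finally show "norm (T f) \<le> sqrt (norm (adjb T o\<^sub>L T)) * norm f" by (rule power2_le_imp_le) simp
  qed simp
  then have "(norm T)\<^sup>2 \<le> (sqrt (norm (adjb T o\<^sub>L T)))\<^sup>2" by (rule power_mono) simp
  then show "(norm T)\<^sup>2 \<le> norm (adjb T o\<^sub>L T)" by simp
qed

lemma norm_bscale:
  fixes T :: "'i ell2 \<Rightarrow>\<^sub>L 'i ell2"
  shows "norm (bscale c T) = cmod c * norm T"
proof (rule antisym)
  have le: "norm (bscale c T) \<le> cmod c * norm T" for c and T :: "'i ell2 \<Rightarrow>\<^sub>L 'i ell2"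
    by (rule norm_blinfun_bound) (simp_all add: mult.assoc mult_left_mono norm_blinfun)
  show "norm (bscale c T) \<le> cmod c * norm T" by (rule le)
  show "cmod c * norm T \<le> norm (bscale c T)"
  proof (cases "c = 0")
    case False
    have "bscale (1 / c) (bscale c T) = T"
      by (rule blinfun_eqI) (simp add: cs_algebra False)
    then have "norm T \<le> cmod (1 / c) * norm (bscale c T)" using le[of "1 / c" "bscale c T"] by simp
    then show ?thesis using False by (simp add: norm_divide field_simps)
  qed simp
qed

text \<open>Taking adjoints does not increase norms on \<open>A\<close>, so the adjoints of a Cauchy
  sequence converge as well, and the defining relations of \<open>alg\<close> pass to the pair of
  limits. Their complex linearity comes from being mutually adjoint.\<close>

lemma A_complete:
  assumes X: "\<And>n. X n \<in> A" and C: "Cauchy X"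
  obtains L where "L \<in> A" "X \<longlonglongrightarrow> L"
proof -
  have W_diff: "X m - X n \<in> A" for m n
  proof -
    interpret transported A bscale encode_op "star_alg :: 'u universe star_algebra" by (rule transported_star_alg)
    show ?thesis by (rule W_diff[OF X X])
  qed
  have adj_diff: "adjb (X m) - adjb (X n) = adjb (X m - X n)" for m n
  proof -
    have "X m = X m - X n + X n" by simp
    then have "adjb (X m) = adjb (X m - X n) + adjb (X n)"
      using adjb_eqI[OF alg_blinfun_add[OF W_diff[of m n] X[of n]]] by simp
    then show ?thesis by simp
  qed
  obtain L where L: "X \<longlonglongrightarrow> L" using C Cauchy_convergent convergentD by blast
  have "Cauchy (\<lambda>n. adjb (X n))"
  proof (rule metric_CauchyI)
    fix e :: real assume "e > 0"
    then obtain N where N: "\<And>m n. m \<ge> N \<Longrightarrow> n \<ge> N \<Longrightarrow> dist (X m) (X n) < e"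
      using C unfolding Cauchy_def by blast
    show "\<exists>N. \<forall>m\<ge>N. \<forall>n\<ge>N. dist (adjb (X m)) (adjb (X n)) < e"
    proof (intro exI[of _ N] allI impI)
      fix m n assume "m \<ge> N" "n \<ge> N"
      then show "dist (adjb (X m)) (adjb (X n)) < e"
        using N[of m n] norm_adjb_le[OF W_diff[of m n]] unfolding dist_norm adj_diff by linarith
    qed
  qed
  then obtain M where M: "(\<lambda>n. adjb (X n)) \<longlonglongrightarrow> M" using Cauchy_convergent convergentD by blast
  have l: "(\<lambda>n. X n f) \<longlonglongrightarrow> L f" "(\<lambda>n. adjb (X n) f) \<longlonglongrightarrow> M f" for f
    by (intro tendsto_intros L M)+
  have adj: "adjoint_pair (blinfun_apply L) (blinfun_apply M)"
    unfolding adjoint_pair_def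
  proof (intro allI)
    fix f g
    have "(\<lambda>n. cip (X n f) g) \<longlonglongrightarrow> cip (L f) g" by (intro tendsto_cip l tendsto_const)
    moreover have "(\<lambda>n. cip f (adjb (X n) g)) \<longlonglongrightarrow> cip f (M g)" by (intro tendsto_cip l tendsto_const)
    ultimately show "cip (L f) g = cip f (M g)"
      unfolding algD(3)[OF alg_adjb[OF X]] by (rule LIMSEQ_unique)
  qed
  have lim_P: "(\<lambda>n. P (Y n)) \<longlonglongrightarrow> P y" if "Y \<longlonglongrightarrow> y" for Y y
    by (rule bounded_linear.tendsto[OF bclinD(8)[OF bclin_P] that])
  have lim_R: "(\<lambda>n. R w (Y n)) \<longlonglongrightarrow> R w y" if "Y \<longlonglongrightarrow> y" for w Y y
    by (rule bounded_linear.tendsto[OF bclinD(8)[OF bclin_R(1)] that])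
  have "alg (blinfun_apply L) (blinfun_apply M)"
  proof (rule algI[OF _ _ adj])
    show "bclin (blinfun_apply L)" by (rule bclin_blinfun_apply[OF adjoint_pair_clin[OF adj]])
    show "bclin (blinfun_apply M)" by (rule bclin_blinfun_apply[OF adjoint_pair_clin[OF adjoint_pair_sym[OF adj]]])
    show "P (L f) = L f" for f
      using lim_P[OF l(1)] l(1) unfolding algD(5)[OF alg_adjb[OF X]] by (rule LIMSEQ_unique)
    show "P (M f) = M f" for f
      using lim_P[OF l(2)] l(2) unfolding algD(6)[OF alg_adjb[OF X]] by (rule LIMSEQ_unique)
    show "L (R w f) = R w (L f)" for w f
      using l(1) lim_R[OF l(1)] unfolding algD(7)[OF alg_adjb[OF X], symmetric] by (rule LIMSEQ_unique)
    show "M (R w f) = R w (M f)" for w f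
      using l(2) lim_R[OF l(2)] unfolding algD(8)[OF alg_adjb[OF X], symmetric] by (rule LIMSEQ_unique)
  qed
  then show ?thesis using that[OF AI L] by blast
qed

lemma unital_cstar_star_alg: "unital_cstar_algebra (star_alg :: 'u universe star_algebra)"
proof -
  let ?A = "star_alg :: 'u universe star_algebra"
  interpret transported A bscale encode_op ?A by (rule transported_star_alg)
  note S = mult_star_alg star_star_alg anorm_star_alg add_R smult_R e_closed compose_in_A adjb_in_A W_add W_scale
  have ring: "Ring.ring ?A"
  proof (rule ringI)
    show "abelian_group ?A" by (rule abelian_group_R)
    show "monoid ?A"
      by (rule monoidI) (auto elim!: carrierE simp: S one_star_alg P_in_A P_compose blinfun_compose_associative)
  qed (auto elim!: carrierE intro!: arg_cong[of _ _ encode_op] blinfun_eqI simp: S blinfun.bilinear_simps)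
  have sL: "bscale c T o\<^sub>L T' = bscale c (T o\<^sub>L T')" for c T T'
    by (rule blinfun_eqI) simp
  have sR: "T o\<^sub>L bscale c T' = bscale c (T o\<^sub>L T')" if "T \<in> A" for c T T'
    by (rule blinfun_eqI) (simp add: bclinD(4)[OF algD(1)[OF alg_adjb[OF that]]])
  show ?thesis
  proof (intro unital_cstar_algebra.intro unital_cstar_algebra_axioms.intro module_R ring)
    fix s :: "nat \<Rightarrow> 'u universe"
    assume s: "\<forall>n. s n \<in> carrier ?A" and C: "\<forall>e>0. \<exists>N. \<forall>m\<ge>N. \<forall>n\<ge>N. anorm ?A (s m \<ominus>\<^bsub>?A\<^esub> s n) < e"
    have "\<forall>n. \<exists>X. X \<in> A \<and> s n = encode_op X" using s by (auto simp: carrier_R)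
    then obtain X where X: "\<And>n. X n \<in> A" "\<And>n. s n = encode_op (X n)" by metis
    have d: "anorm ?A (s m \<ominus>\<^bsub>?A\<^esub> encode_op T) = norm (X m - T)" if "T \<in> A" for m T
      unfolding X(2) minus_R[OF X(1) that] by (rule anorm_star_alg[OF W_diff[OF X(1) that]])
    have "Cauchy X"
    proof (rule metric_CauchyI)
      fix e :: real assume "e > 0"
      then obtain N where "\<forall>m\<ge>N. \<forall>n\<ge>N. anorm ?A (s m \<ominus>\<^bsub>?A\<^esub> s n) < e" using C by blast
      then show "\<exists>N. \<forall>m\<ge>N. \<forall>n\<ge>N. dist (X m) (X n) < e"
        using d[OF X(1)] X(2) by (auto simp: dist_norm)
    qed
    from A_complete[OF X(1) this] obtain L where L: "L \<in> A" "X \<longlonglongrightarrow> L" by blast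
    show "\<exists>l\<in>carrier ?A. (\<lambda>n. anorm ?A (s n \<ominus>\<^bsub>?A\<^esub> l)) \<longlonglongrightarrow> 0"
    proof (rule bexI[of _ "encode_op L"])
      show "(\<lambda>n. anorm ?A (s n \<ominus>\<^bsub>?A\<^esub> encode_op L)) \<longlonglongrightarrow> 0"
        unfolding d[OF L(1)] using L(2) by (intro tendsto_norm_zero) (simp add: LIM_zero)
    qed (rule e_closed[OF L(1)])
  next
    fix u v assume "u \<in> carrier ?A" "v \<in> carrier ?A"
    then obtain T T' where T: "T \<in> A" "u = encode_op T" "T' \<in> A" "v = encode_op T'" by (metis carrierE)
    show "anorm ?A (u \<oplus>\<^bsub>?A\<^esub> v) \<le> anorm ?A u + anorm ?A v" by (simp add: T S norm_triangle_ineq)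
    show "anorm ?A (u \<otimes>\<^bsub>?A\<^esub> v) \<le> anorm ?A u * anorm ?A v" by (simp add: T S norm_blinfun_compose)
    show "star ?A (u \<oplus>\<^bsub>?A\<^esub> v) = star ?A u \<oplus>\<^bsub>?A\<^esub> star ?A v"
      by (simp add: T S adjb_eqI[OF alg_blinfun_add])
    show "star ?A (u \<otimes>\<^bsub>?A\<^esub> v) = star ?A v \<otimes>\<^bsub>?A\<^esub> star ?A u"
      by (simp add: T S adjb_eqI[OF alg_blinfun_compose])
    show "(c \<odot>\<^bsub>?A\<^esub> u) \<otimes>\<^bsub>?A\<^esub> v = c \<odot>\<^bsub>?A\<^esub> (u \<otimes>\<^bsub>?A\<^esub> v)" for c by (simp add: T S sL)
    show "u \<otimes>\<^bsub>?A\<^esub> (c \<odot>\<^bsub>?A\<^esub> v) = c \<odot>\<^bsub>?A\<^esub> (u \<otimes>\<^bsub>?A\<^esub> v)" for c by (simp add: T S sR)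
  next
    fix u assume "u \<in> carrier ?A"
    then obtain T where T: "T \<in> A" "u = encode_op T" by (rule carrierE)
    show "star ?A u \<in> carrier ?A" by (simp add: T S)
    show "star ?A (star ?A u) = u" by (simp add: T S adjb_eqI[OF alg_sym[OF alg_adjb]])
    show "star ?A (c \<odot>\<^bsub>?A\<^esub> u) = cnj c \<odot>\<^bsub>?A\<^esub> star ?A u" for c by (simp add: T S adjb_eqI[OF alg_blinfun_scale])
    show "0 \<le> anorm ?A u" by (simp add: T S)
    show "u = \<zero>\<^bsub>?A\<^esub>" if "anorm ?A u = 0" using that by (simp add: T S zero_R)
    show "anorm ?A (c \<odot>\<^bsub>?A\<^esub> u) = cmod c * anorm ?A u" for c by (simp add: T S norm_bscale)
    show "anorm ?A (star ?A u \<otimes>\<^bsub>?A\<^esub> u) = (anorm ?A u)\<^sup>2" by (simp add: T S norm_adjb_compose)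
  qed
qed

section \<open>The trace state and stochastic matrices over the algebra\<close>

definition trace_state :: "'u universe \<Rightarrow> complex" where
  "trace_state u = cip (dec u \<Omega>) \<Omega>"

lemma trace_state_encode: "T \<in> A \<Longrightarrow> trace_state (encode_op T) = cip (T \<Omega>) \<Omega>"
  by (simp add: trace_state_def dec_encode)

lemma tracial_state_star_alg: "tracial_state (star_alg :: 'u universe star_algebra) trace_state"
proof -
  let ?A = "star_alg :: 'u universe star_algebra"
  interpret transported A bscale encode_op ?A by (rule transported_star_alg)
  note S = mult_star_alg star_star_alg add_R smult_R compose_in_A adjb_in_A W_add W_scale trace_state_encode
  show ?thesis
    unfolding tracial_state_def
  proof (intro conjI ballI allI)
    fix u v assume "u \<in> carrier ?A" "v \<in> carrier ?A"
    then obtain T T' where T: "T \<in> A" "u = encode_op T" "T' \<in> A" "v = encode_op T'" by (metis carrierE)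
    show "trace_state (u \<oplus>\<^bsub>?A\<^esub> v) = trace_state u + trace_state v"
      by (simp add: T S blinfun.bilinear_simps cip_add_left)
    show "trace_state (u \<otimes>\<^bsub>?A\<^esub> v) = trace_state (v \<otimes>\<^bsub>?A\<^esub> u)"
      by (simp add: T S alg_trace[OF alg_adjb alg_adjb])
  next
    fix u assume "u \<in> carrier ?A"
    then obtain T where T: "T \<in> A" "u = encode_op T" by (rule carrierE)
    show "trace_state (c \<odot>\<^bsub>?A\<^esub> u) = c * trace_state u" for c by (simp add: T S cip_cs_left)
    show "trace_state (star ?A u \<otimes>\<^bsub>?A\<^esub> u) \<in> \<real>\<^sub>\<ge>\<^sub>0"
      by (simp add: T S algD(4)[OF alg_adjb] cip_self del: of_real_power)
  next
    show "trace_state \<one>\<^bsub>?A\<^esub> = 1"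
      by (simp add: one_star_alg trace_state_encode P_in_A blinfun_apply_bclin bclin_P P_\<Omega> unit_\<Omega>)
  qed
qed

text \<open>\<open>alg_square\<close> is applied with rows \<open>'q\<close> and columns
  \<open>'x \<times> 'z\<close>; its result is the square factor that
  \<open>stochastic_algebra_matrix\<close> asks for.\<close>

lemma tracial_over_star_alg:
  fixes K Ks :: "'q::finite \<Rightarrow> 'x::finite \<times> 'z::finite \<Rightarrow> 'i ell2 \<Rightarrow> 'i ell2"
    and G :: "'x \<Rightarrow> 'x \<Rightarrow> 'z \<Rightarrow> 'z \<Rightarrow> 'i ell2 \<Rightarrow> 'i ell2"
  assumes lin: "clinear_map \<Gamma>" and K: "\<And>q p. alg (K q p) (Ks q p)"
    and G: "\<And>x x' z z' f. G x x' z z' f = (\<Sum>q\<in>UNIV. Ks q (x, z) (K q (x', z') f))"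
    and tr: "\<And>x x' f. (\<Sum>z\<in>UNIV. G x x' z z f) = (if x = x' then P f else 0)"
    and \<Gamma>: "\<And>x x' y y' z z' w w'. \<Gamma> (kron (munit x x') (munit y y')) $ (z, w) $ (z', w') =
        cip (G x x' z z' (G y' y w' w \<Omega>)) \<Omega>"
  shows "tracial_over (star_alg :: 'u universe star_algebra) \<Gamma>"
proof -
  let ?A = "star_alg :: 'u universe star_algebra"
  interpret transported A bscale encode_op ?A by (rule transported_star_alg)
  have algG: "alg (G x x' z z') (G x' x z' z)" for x x' z z'
    unfolding G[abs_def] by (rule alg_sum) (rule alg_compose[OF alg_sym[OF K] K])
  let ?b = "\<lambda>T. Blinfun T"
  let ?g = "\<lambda>x x' z z'. encode_op (?b (G x x' z z')) :: 'u universe"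
  have GA: "?b (G x x' z z') \<in> A" for x x' z z' by (rule AI[OF alg_Blinfun[OF algG]])
  have Gb: "blinfun_apply (?b (G x x' z z')) = G x x' z z'" for x x' z z' by (rule blinfun_apply_bclin[OF algD(1)[OF algG]])
  obtain h hs :: "'x \<times> 'z \<Rightarrow> 'x \<times> 'z \<Rightarrow> 'i ell2 \<Rightarrow> 'i ell2" where h: "\<And>r p. alg (h r p) (hs r p)"
    and hG: "\<And>p p' f. (\<Sum>r\<in>UNIV. hs r p (h r p' f)) = (\<Sum>q\<in>UNIV. Ks q p (K q p' f))"
    using alg_square[of K Ks, OF K] by blast
  have hA: "?b (h r p) \<in> A" "?b (hs r p) \<in> A" for r p
    by (rule AI[OF alg_Blinfun[OF h]], rule AI[OF alg_Blinfun[OF alg_sym[OF h]]])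
  have hb: "blinfun_apply (?b (h r p)) = h r p" "blinfun_apply (?b (hs r p)) = hs r p" for r p
    by (simp_all add: blinfun_apply_bclin algD[OF h])
  have "stochastic_algebra_matrix ?A ?g"
    unfolding stochastic_algebra_matrix_def
  proof (intro conjI exI[of _ "\<lambda>s x t z. encode_op (?b (h (s, t) (x, z))) :: 'u universe"] allI)
    show "encode_op (?b (h (s, t) (x, z))) \<in> carrier ?A" for s x t z by (rule e_closed[OF hA(1)])
    fix x x' z z'
    have "star ?A (encode_op (?b (h p (x, z)))) \<otimes>\<^bsub>?A\<^esub> encode_op (?b (h p (x', z'))) =
        encode_op (?b (hs p (x, z)) o\<^sub>L ?b (h p (x', z')))" for p
      by (simp add: star_star_alg hA adjb_eqI[OF alg_Blinfun[OF h]] mult_star_alg)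
    then have "(\<Oplus>\<^bsub>?A\<^esub>p\<in>UNIV. star ?A (encode_op (?b (h (fst p, snd p) (x, z)))) \<otimes>\<^bsub>?A\<^esub> encode_op (?b (h (fst p, snd p) (x', z')))) =
        encode_op (\<Sum>p\<in>UNIV. ?b (hs p (x, z)) o\<^sub>L ?b (h p (x', z')))"
      using finsum_R[of UNIV "\<lambda>p. ?b (hs p (x, z)) o\<^sub>L ?b (h p (x', z'))"] hA compose_in_A by simp
    also have "(\<Sum>p\<in>UNIV. ?b (hs p (x, z)) o\<^sub>L ?b (h p (x', z'))) = ?b (G x x' z z')"
      by (rule blinfun_eqI) (simp add: blinfun.sum_left hb Gb hG G)
    finally show "?g x x' z z' = (\<Oplus>\<^bsub>?A\<^esub>p\<in>UNIV. star ?A (encode_op (?b (h (fst p, snd p) (x, z)))) \<otimes>\<^bsub>?A\<^esub> encode_op (?b (h (fst p, snd p) (x', z'))))" ..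
  next
    fix x x'
    have "(\<Sum>z\<in>UNIV. ?b (G x x' z z)) = (if x = x' then ?b P else 0)"
      by (rule blinfun_eqI) (simp add: blinfun.sum_left Gb tr blinfun_apply_bclin bclin_P)
    then show "(\<Oplus>\<^bsub>?A\<^esub>z\<in>UNIV. ?g x x' z z) = (if x = x' then \<one>\<^bsub>?A\<^esub> else \<zero>\<^bsub>?A\<^esub>)"
      using finsum_R[of UNIV "\<lambda>z. ?b (G x x' z z)"] GA by (simp add: one_star_alg zero_R)
  qed
  moreover have "\<Gamma> (kron (munit x x') (munit y y')) $ (z, w) $ (z', w') =
      trace_state (?g x x' z z' \<otimes>\<^bsub>?A\<^esub> ?g y' y w' w)" for x x' y y' z z' w w'
    by (simp add: mult_star_alg GA trace_state_encode compose_in_A Gb \<Gamma>)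
  ultimately show ?thesis
    unfolding tracial_over_def using lin tracial_state_star_alg
    by (intro conjI exI[of _ trace_state] exI[of _ ?g]) simp_all
qed

section \<open>Commutative and finite-dimensional algebras\<close>

lemma abelian_star_alg:
  assumes "\<And>w v f. R w (R v f) = R v (R w f)" "\<And>w v f. R w (Rs v f) = Rs v (R w f)"
  shows "abelian (star_alg :: 'u universe star_algebra)"
proof -
  let ?A = "star_alg :: 'u universe star_algebra"
  interpret transported A bscale encode_op ?A by (rule transported_star_alg)
  show ?thesis
    unfolding abelian_def
  proof (intro ballI)
    fix u v assume "u \<in> carrier ?A" "v \<in> carrier ?A"
    then obtain T T' where T: "T \<in> A" "u = encode_op T" "T' \<in> A" "v = encode_op T'" by (metis carrierE)
    have "T o\<^sub>L T' = T' o\<^sub>L T"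
      by (rule blinfun_eqI) (simp add: alg_commute[OF assms alg_adjb[OF T(1)] alg_adjb[OF T(3)]])
    then show "u \<otimes>\<^bsub>?A\<^esub> v = v \<otimes>\<^bsub>?A\<^esub> u" by (simp add: T mult_star_alg)
  qed
qed

text \<open>An operator in \<open>A\<close> has its matrix supported on \<open>J \<times> J\<close>,
  so \<open>A\<close> lies in the span of finitely many rank one operators. These need not belong to
  \<open>A\<close>; a finite generating set inside \<open>A\<close> is obtained as a maximal
  independent subset of \<open>A\<close>.\<close>

lemma finite_dimensional_star_alg:
  assumes J: "finite J" "\<And>i. i \<notin> J \<Longrightarrow> P (ket i) = 0"
  shows "finite_dimensional (star_alg :: 'u universe star_algebra)"
proof -
  let ?A = "star_alg :: 'u universe star_algebra"
  interpret transported A bscale encode_op ?A by (rule transported_star_alg)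
  define D where "D p = Blinfun (\<lambda>f. cs (coef f (fst p)) (ket (snd p)))" for p :: "'i \<times> 'i"
  have D: "blinfun_apply (D p) f = cs (coef f (fst p)) (ket (snd p))" for p f
  proof -
    have "bounded_linear (\<lambda>f. cs (coef f (fst p)) (ket (snd p)) :: 'i ell2)"
      by (rule bounded_linear_intro[of _ 1]) (auto intro!: coef_inject_ext simp: algebra_simps coef_le_norm)
    then show ?thesis by (simp add: D_def bounded_linear_Blinfun_apply)
  qed
  \<comment> \<open>The rank one operators together with their multiples by i, since
    \<open>span\<close> is taken over the reals.\<close>
  let ?T = "D ` (J \<times> J) \<union> (\<lambda>p. bscale \<i> (D p)) ` (J \<times> J)"
  have "A \<subseteq> span ?T"
  proof
    fix T assume T: "T \<in> A"
    note a = alg_adjb[OF T]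
    have z: "T (ket i) = 0" if "i \<notin> J" for i
      using alg_P_right[OF a, of "ket i"] J(2)[OF that] by (simp add: blinfun.bilinear_simps)
    have z': "coef (T (ket i)) j = 0" if "j \<notin> J" for i j
    proof -
      have "coef (T (ket i)) j = cip (P (T (ket i))) (ket j)" by (simp add: algD(5)[OF a])
      also have "\<dots> = cip (T (ket i)) (P (ket j))" by (rule adjoint_pairD[OF P_adjoint])
      finally show ?thesis by (simp add: J(2)[OF that])
    qed
    have expand: "T = (\<Sum>p\<in>J \<times> J. bscale (coef (T (ket (fst p))) (snd p)) (D p))"
    proof (rule blinfun_eqI, rule bclin_eqI[OF algD(1)[OF a]])
      show "bclin (blinfun_apply (\<Sum>p\<in>J \<times> J. bscale (coef (T (ket (fst p))) (snd p)) (D p)))"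
        by (rule bclin_blinfun_apply) (simp add: clin_def blinfun.sum_left D cs_sum cs_algebra algebra_simps)
      fix i
      show "T (ket i) = blinfun_apply (\<Sum>p\<in>J \<times> J. bscale (coef (T (ket (fst p))) (snd p)) (D p)) (ket i)"
      proof (rule coef_inject_ext)
        fix j
        have "coef (blinfun_apply (\<Sum>p\<in>J \<times> J. bscale (coef (T (ket (fst p))) (snd p)) (D p)) (ket i)) j =
            (\<Sum>p\<in>J \<times> J. if p = (i, j) then coef (T (ket (fst p))) (snd p) else 0)"
          unfolding blinfun.sum_left coef_sum by (intro sum.cong refl) (auto simp: D)
        also have "\<dots> = coef (T (ket i)) j"
          using J(1) z z' by (auto simp: sum.delta)
        finally show "coef (T (ket i)) j = coef (blinfun_apply (\<Sum>p\<in>J \<times> J. bscale (coef (T (ket (fst p))) (snd p)) (D p)) (ket i)) j" ..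
      qed
    qed
    have "bscale c (D p) \<in> span ?T" if "p \<in> J \<times> J" for c p
    proof -
      have "bscale c (D p) = Re c *\<^sub>R D p + Im c *\<^sub>R bscale \<i> (D p)"
        by (rule blinfun_eqI, rule coef_inject_ext)
          (simp add: blinfun.bilinear_simps D complex_eq_iff)
      moreover have "D p \<in> span ?T" "bscale \<i> (D p) \<in> span ?T"
        using that by (auto simp del: mem_Times_iff intro!: span_base)
      ultimately show ?thesis by (simp add: span_add span_scale)
    qed
    then have "(\<Sum>p\<in>J \<times> J. bscale (coef (T (ket (fst p))) (snd p)) (D p)) \<in> span ?T" by (rule span_sum)
    with expand show "T \<in> span ?T" by (rule ssubst[where P = "\<lambda>x. x \<in> span ?T"])
  qed
  obtain B where B: "B \<subseteq> A" "independent B" "A \<subseteq> span B"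
    using maximal_independent_subset[of A] by blast
  have "finite ?T" using J(1) by simp
  then have "finite B"
    using independent_span_bound[OF _ B(2), of ?T] B(1) \<open>A \<subseteq> span ?T\<close> by blast
  have bs: "bscale (complex_of_real r) T = r *\<^sub>R T" for r T
    by (rule blinfun_eqI) (simp add: scaleR_cs blinfun.bilinear_simps)
  show ?thesis
    unfolding finite_dimensional_def
  proof (intro exI[of _ "encode_op ` B"] conjI ballI)
    show "finite (encode_op ` B :: 'u universe set)" using \<open>finite B\<close> by simp
    show "encode_op ` B \<subseteq> carrier ?A" using B(1) e_closed by auto
    fix a assume "a \<in> carrier ?A"
    then obtain T where T: "T \<in> A" "a = encode_op T" by (rule carrierE)
    obtain r where r: "T = (\<Sum>v\<in>B. r v *\<^sub>R v)"
      using T(1) B(3) span_finite[OF \<open>finite B\<close>] by auto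
    let ?c = "\<lambda>s. complex_of_real (r (dec s))"
    have dB: "dec s \<in> A" "encode_op (dec s) = s" if s: "s \<in> encode_op ` B" for s :: "'u universe"
    proof -
      obtain T where "T \<in> A" "s = encode_op T" using s B(1) by blast
      then show "dec s \<in> A" "encode_op (dec s) = s" by (simp_all add: dec_encode)
    qed
    have "(\<Oplus>\<^bsub>?A\<^esub>s\<in>encode_op ` B. ?c s \<odot>\<^bsub>?A\<^esub> s) = (\<Oplus>\<^bsub>?A\<^esub>s\<in>(encode_op ` B :: 'u universe set). encode_op (bscale (?c s) (dec s)))"
      using smult_R[OF dB(1)] dB W_scale by (intro finsum_cong') (auto simp: e_closed)
    also have "\<dots> = encode_op (\<Sum>s\<in>encode_op ` B. bscale (?c s) (dec (s :: 'u universe)))"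
      using finsum_R[of "encode_op ` B :: 'u universe set" "\<lambda>s. bscale (?c s) (dec s)"] \<open>finite B\<close> dB W_scale by simp
    also have "(\<Sum>s\<in>encode_op ` B. bscale (?c s) (dec (s :: 'u universe))) = (\<Sum>v\<in>B. r v *\<^sub>R v)"
      using inj_on_subset[OF inj_encode_op B(1)] subsetD[OF B(1)]
      by (subst sum.reindex) (auto simp: bs dec_encode intro!: sum.cong)
    finally have "a = (\<Oplus>\<^bsub>?A\<^esub>s\<in>encode_op ` B. ?c s \<odot>\<^bsub>?A\<^esub> s)" by (simp add: T(2) r)
    then show "\<exists>c. a = (\<Oplus>\<^bsub>?A\<^esub>s\<in>encode_op ` B. c s \<odot>\<^bsub>?A\<^esub> s)" by (rule exI[of _ ?c])
  qed
qed

end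

section \<open>Models of tracial correlations\<close>

text \<open>The factorization of \<open>G\<close> through \<open>K\<close> has a free row index
  \<open>'q\<close>, because composition multiplies the row indices; a square factor is produced
  only at the end, by \<open>alg_square\<close>.\<close>

locale tracial_model = tracial_rep P \<Omega> R Rs
  for P :: "'i ell2 \<Rightarrow> 'i ell2" and \<Omega> and R Rs :: "'w \<Rightarrow> 'i ell2 \<Rightarrow> 'i ell2" +
  fixes K Ks :: "'q::finite \<Rightarrow> 'x::finite \<times> 'a::finite \<Rightarrow> 'i ell2 \<Rightarrow> 'i ell2"
    and G :: "'x \<Rightarrow> 'x \<Rightarrow> 'a \<Rightarrow> 'a \<Rightarrow> 'i ell2 \<Rightarrow> 'i ell2"
    and \<Gamma> :: "('x \<times> 'x) cmat \<Rightarrow> ('a \<times> 'a) cmat"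
  assumes alg_K: "alg (K q p) (Ks q p)"
    and G: "G x x' a a' f = (\<Sum>q\<in>UNIV. Ks q (x, a) (K q (x', a') f))"
    and trace_G: "(\<Sum>a\<in>UNIV. G x x' a a f) = (if x = x' then P f else 0)"
    and kernel: "\<Gamma> (kron (munit x x') (munit y y')) $ (a, b) $ (a', b') =
        cip (G x x' a a' (G y' y b' b \<Omega>)) \<Omega>"
begin

lemma alg_G: "alg (G x x' a a') (G x' x a' a)"
  unfolding G[abs_def] by (rule alg_sum) (rule alg_compose[OF alg_sym[OF alg_K] alg_K])

end

text \<open>Phrased by basis vectors, so that it passes to tensor products at once. For the
  projection \<open>hat (\<lambda>u. u)\<close> it says that only finitely many Gram-Schmidt vectors
  are not null.\<close>

definition finite_rank :: "('i ell2 \<Rightarrow> 'i ell2) \<Rightarrow> bool" where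
  "finite_rank P \<longleftrightarrow> (\<exists>J. finite J \<and> (\<forall>i. i \<notin> J \<longrightarrow> P (ket i) = 0))"

definition commuting_family :: "('w \<Rightarrow> 'i ell2 \<Rightarrow> 'i ell2) \<Rightarrow> ('w \<Rightarrow> 'i ell2 \<Rightarrow> 'i ell2) \<Rightarrow> bool" where
  "commuting_family R Rs \<longleftrightarrow> (\<forall>w v f. R w (R v f) = R v (R w f) \<and> R w (Rs v f) = Rs v (R w f))"

lemma finite_rank_tenop:
  assumes "bclin P1" "bclin P2" "finite_rank P1" "finite_rank P2"
  shows "finite_rank (tenop P1 P2)"
proof -
  obtain J1 where 1: "finite J1" "\<And>i. i \<notin> J1 \<Longrightarrow> P1 (ket i) = 0" using assms(3) by (auto simp: finite_rank_def)
  obtain J2 where 2: "finite J2" "\<And>i. i \<notin> J2 \<Longrightarrow> P2 (ket i) = 0" using assms(4) by (auto simp: finite_rank_def)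
  have "tenop P1 P2 (ket p) = 0" if "p \<notin> J1 \<times> J2" for p
    using that 1(2) 2(2) by (cases p) (auto simp: ten_left ten_right tenop_ten[OF assms(1,2)] simp flip: ten_ket)
  then show ?thesis using 1(1) 2(1) unfolding finite_rank_def by (intro exI[of _ "J1 \<times> J2"]) auto
qed

lemma commuting_family_tenop:
  assumes "\<And>w. bclin (R1 w)" "\<And>w. bclin (Rs1 w)" "\<And>w. bclin (R2 w)" "\<And>w. bclin (Rs2 w)"
    and c1: "commuting_family R1 Rs1" and c2: "commuting_family R2 Rs2"
  shows "commuting_family (\<lambda>w. tenop (R1 (fst w)) (R2 (snd w))) (\<lambda>w. tenop (Rs1 (fst w)) (Rs2 (snd w)))"
  unfolding commuting_family_def
proof (intro allI conjI)
  fix w v f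
  have c: "(\<lambda>f. R1 w (R1 v f)) = (\<lambda>f. R1 v (R1 w f))" "(\<lambda>f. R1 w (Rs1 v f)) = (\<lambda>f. Rs1 v (R1 w f))" for w v
    using c1 unfolding commuting_family_def by blast+
  have d: "(\<lambda>f. R2 w (R2 v f)) = (\<lambda>f. R2 v (R2 w f))" "(\<lambda>f. R2 w (Rs2 v f)) = (\<lambda>f. Rs2 v (R2 w f))" for w v
    using c2 unfolding commuting_family_def by blast+
  show "tenop (R1 (fst w)) (R2 (snd w)) (tenop (R1 (fst v)) (R2 (snd v)) f) =
      tenop (R1 (fst v)) (R2 (snd v)) (tenop (R1 (fst w)) (R2 (snd w)) f)"
    unfolding tenop_compose[OF assms(1,3,1,3)] c(1)[of "fst w" "fst v"] d(1)[of "snd w" "snd v"] ..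
  show "tenop (R1 (fst w)) (R2 (snd w)) (tenop (Rs1 (fst v)) (Rs2 (snd v)) f) =
      tenop (Rs1 (fst v)) (Rs2 (snd v)) (tenop (R1 (fst w)) (R2 (snd w)) f)"
    unfolding tenop_compose[OF assms(1,3,2,4)] tenop_compose[OF assms(2,4,1,3)] c(2)[of "fst w" "fst v"] d(2)[of "snd w" "snd v"] ..
qed

lemma tracial_over_model:
  fixes P :: "'i::countable ell2 \<Rightarrow> 'i ell2"
  assumes lin: "clinear_map \<Gamma>" and m: "tracial_model P \<Omega> R Rs K Ks G \<Gamma>"
  shows "tracial TYPE('u) \<Gamma>" "finite_rank P \<Longrightarrow> quantum_tracial TYPE('u) \<Gamma>"
    "commuting_family R Rs \<Longrightarrow> locally_tracial TYPE('u) \<Gamma>"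
proof -
  interpret tracial_model P \<Omega> R Rs K Ks G \<Gamma> by (rule m)
  interpret countable_tracial_rep P \<Omega> R Rs by unfold_locales
  have t: "tracial_over (star_alg :: 'u universe star_algebra) \<Gamma>"
    by (rule tracial_over_star_alg[OF lin alg_K G trace_G kernel])
  have u: "unital_cstar_algebra (star_alg :: 'u universe star_algebra)"
    by (rule unital_cstar_star_alg)
  show "tracial TYPE('u) \<Gamma>" unfolding tracial_def using t u by blast
  show "quantum_tracial TYPE('u) \<Gamma>" if "finite_rank P"
  proof -
    obtain J where "finite J" "\<And>i. i \<notin> J \<Longrightarrow> P (ket i) = 0" using \<open>finite_rank P\<close> by (auto simp: finite_rank_def)
    then have "finite_dimensional (star_alg :: 'u universe star_algebra)"
      by (rule finite_dimensional_star_alg)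
    then show ?thesis unfolding quantum_tracial_def using t u by blast
  qed
  show "locally_tracial TYPE('u) \<Gamma>" if "commuting_family R Rs"
  proof -
    have "abelian (star_alg :: 'u universe star_algebra)"
      by (rule abelian_star_alg) (use that in \<open>auto simp: commuting_family_def\<close>)
    then show ?thesis unfolding locally_tracial_def using t u by blast
  qed
qed

text \<open>The factor of the composition is the sum over a of \<open>K1\<close> at (x, a) tensored
  with \<open>K2\<close> at (a, z), with rows indexed by pairs: multiplying it by its adjoint gives
  the double sum over a and a' in \<open>comp_op\<close>.\<close>

lemma tracial_model_compose:
  fixes \<Gamma>1 :: "('x::finite \<times> 'x) cmat \<Rightarrow> ('a::finite \<times> 'a) cmat"
    and \<Gamma>2 :: "('a \<times> 'a) cmat \<Rightarrow> ('z::finite \<times> 'z) cmat"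
  assumes 1: "tracial_model P1 \<Omega>1 R1 Rs1 K1 Ks1 G1 \<Gamma>1" and 2: "tracial_model P2 \<Omega>2 R2 Rs2 K2 Ks2 G2 \<Gamma>2"
    and lin: "clinear_map \<Gamma>2"
  shows "tracial_model (tenop P1 P2) (ten \<Omega>1 \<Omega>2)
    (\<lambda>w. tenop (R1 (fst w)) (R2 (snd w))) (\<lambda>w. tenop (Rs1 (fst w)) (Rs2 (snd w)))
    (\<lambda>q p f. \<Sum>a\<in>UNIV. tenop (K1 (fst q) (fst p, a)) (K2 (snd q) (a, snd p)) f)
    (\<lambda>q p f. \<Sum>a\<in>UNIV. tenop (Ks1 (fst q) (fst p, a)) (Ks2 (snd q) (a, snd p)) f)
    (comp_op G1 G2) (\<Gamma>2 \<circ> \<Gamma>1)"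
proof -
  interpret m1: tracial_model P1 \<Omega>1 R1 Rs1 K1 Ks1 G1 \<Gamma>1 by (rule 1)
  interpret m2: tracial_model P2 \<Omega>2 R2 Rs2 K2 Ks2 G2 \<Gamma>2 by (rule 2)
  interpret tracial_rep "tenop P1 P2" "ten \<Omega>1 \<Omega>2"
    "\<lambda>w. tenop (R1 (fst w)) (R2 (snd w))" "\<lambda>w. tenop (Rs1 (fst w)) (Rs2 (snd w))"
    by (rule tracial_rep_tensor) unfold_locales
  note K1 = m1.algD[OF m1.alg_K] and K2 = m2.algD[OF m2.alg_K]
  note G1 = m1.algD[OF m1.alg_G] and G2 = m2.algD[OF m2.alg_G]
  note G = G1(1) G2(1)
  \<comment> \<open>The easy half of the commutation theorem: tensors of members of the two
    commutants commute with the tensor family.\<close>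
  have alg_ten: "alg (tenop T T') (tenop S S')" if T: "m1.alg T S" "m2.alg T' S'" for T S T' S'
  proof -
    note a = m1.algD[OF T(1)] and b = m2.algD[OF T(2)]
    have c: "(\<lambda>f. T (R1 w f)) = (\<lambda>f. R1 w (T f))" "(\<lambda>f. S (R1 w f)) = (\<lambda>f. R1 w (S f))"
      "(\<lambda>f. T' (R2 v f)) = (\<lambda>f. R2 v (T' f))" "(\<lambda>f. S' (R2 v f)) = (\<lambda>f. R2 v (S' f))" for w v
      by (simp_all only: a b)
    show ?thesis
    proof (rule algI)
      show "bclin (tenop T T')" "bclin (tenop S S')" by (intro bclin_tenop a b)+
      show "adjoint_pair (tenop T T') (tenop S S')"
        using T by (intro adjoint_pair_tenop a b) (simp_all add: m1.alg_def m2.alg_def)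
      show "tenop P1 P2 (tenop T T' f) = tenop T T' f" for f
        unfolding tenop_compose[OF m1.bclin_P m2.bclin_P a(1) b(1)] a b ..
      show "tenop P1 P2 (tenop S S' f) = tenop S S' f" for f
        unfolding tenop_compose[OF m1.bclin_P m2.bclin_P a(2) b(2)] a b ..
      show "tenop T T' (tenop (R1 (fst w)) (R2 (snd w)) f) = tenop (R1 (fst w)) (R2 (snd w)) (tenop T T' f)" for w f
        unfolding tenop_compose[OF a(1) b(1) m1.bclin_R(1) m2.bclin_R(1)] tenop_compose[OF m1.bclin_R(1) m2.bclin_R(1) a(1) b(1)] c ..
      show "tenop S S' (tenop (R1 (fst w)) (R2 (snd w)) f) = tenop (R1 (fst w)) (R2 (snd w)) (tenop S S' f)" for w f
        unfolding tenop_compose[OF a(2) b(2) m1.bclin_R(1) m2.bclin_R(1)] tenop_compose[OF m1.bclin_R(1) m2.bclin_R(1) a(2) b(2)] c ..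
    qed
  qed
  show ?thesis
  proof
    show algK: "alg (\<lambda>f. \<Sum>a\<in>UNIV. tenop (K1 (fst q) (fst p, a)) (K2 (snd q) (a, snd p)) f)
        (\<lambda>f. \<Sum>a\<in>UNIV. tenop (Ks1 (fst q) (fst p, a)) (Ks2 (snd q) (a, snd p)) f)" for q p
      by (rule alg_sum) (rule alg_ten[OF m1.alg_K m2.alg_K])
    show "comp_op G1 G2 x x' z z' f = (\<Sum>q\<in>UNIV. \<Sum>a\<in>UNIV. tenop (Ks1 (fst q) (fst (x, z), a)) (Ks2 (snd q) (a, snd (x, z)))
        (\<Sum>a'\<in>UNIV. tenop (K1 (fst q) (fst (x', z'), a')) (K2 (snd q) (a', snd (x', z'))) f))" for x x' z z' f
    proof (rule bclin2_eqI[where f = f])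
      show "bclin (comp_op G1 G2 x x' z z')" by (rule bclin_comp_op[OF G])
      show "bclin (\<lambda>f. \<Sum>q\<in>UNIV. \<Sum>a\<in>UNIV. tenop (Ks1 (fst q) (fst (x, z), a)) (Ks2 (snd q) (a, snd (x, z)))
        (\<Sum>a'\<in>UNIV. tenop (K1 (fst q) (fst (x', z'), a')) (K2 (snd q) (a', snd (x', z'))) f))"
        by (intro bclin_sum bclin_compose[OF bclin_tenop[OF K1(2) K2(2)]] bclin_tenop[OF K1(1) K2(1)])
      fix i j
      let ?t = "\<lambda>a a' q q'. ten (Ks1 q (x, a) (K1 q (x', a') (ket i))) (Ks2 q' (a, z) (K2 q' (a', z') (ket j)))"
      have "(\<Sum>q\<in>UNIV. \<Sum>a\<in>UNIV. tenop (Ks1 (fst q) (fst (x, z), a)) (Ks2 (snd q) (a, snd (x, z)))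
        (\<Sum>a'\<in>UNIV. tenop (K1 (fst q) (fst (x', z'), a')) (K2 (snd q) (a', snd (x', z'))) (ten (ket i) (ket j)))) =
        (\<Sum>q\<in>UNIV. \<Sum>p\<in>UNIV \<times> UNIV. ?t (fst p) (snd p) (fst q) (snd q))"
        by (simp add: tenop_ten K1 K2 bclinD[OF bclin_tenop[OF K1(2) K2(2)]] sum.cartesian_product' del: UNIV_Times_UNIV)
      also have "\<dots> = (\<Sum>p\<in>UNIV \<times> UNIV. \<Sum>q\<in>UNIV. ?t (fst p) (snd p) (fst q) (snd q))"
        by (rule sum.swap)
      also have "\<dots> = (\<Sum>p\<in>UNIV \<times> UNIV. \<Sum>q\<in>UNIV \<times> UNIV. ?t (fst p) (snd p) (fst q) (snd q))"
        by (simp only: UNIV_Times_UNIV)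
      also have "\<dots> = comp_op G1 G2 x x' z z' (ten (ket i) (ket j))"
        unfolding comp_op_ten[OF G] m1.G m2.G ten_left by (simp only: ten_right sum.cartesian_product' fst_conv snd_conv)
      finally show "comp_op G1 G2 x x' z z' (ten (ket i) (ket j)) =
        (\<Sum>q\<in>UNIV. \<Sum>a\<in>UNIV. tenop (Ks1 (fst q) (fst (x, z), a)) (Ks2 (snd q) (a, snd (x, z)))
        (\<Sum>a'\<in>UNIV. tenop (K1 (fst q) (fst (x', z'), a')) (K2 (snd q) (a', snd (x', z'))) (ten (ket i) (ket j))))" ..
    qed
    show "(\<Sum>z\<in>UNIV. comp_op G1 G2 x x' z z f) = (if x = x' then tenop P1 P2 f else 0)" for x x' f
      by (rule comp_op_trace) (rule G m1.bclin_P m2.bclin_P m1.trace_G m2.trace_G)+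
    fix x x' y y' z z' w w'
    let ?k = "\<lambda>a a' b b'. cip (G1 x x' a a' (G1 y' y b' b \<Omega>1)) \<Omega>1 * cip (G2 a a' z z' (G2 b' b w' w \<Omega>2)) \<Omega>2"
    have "cip (comp_op G1 G2 x x' z z' (comp_op G1 G2 y' y w' w (ten \<Omega>1 \<Omega>2))) (ten \<Omega>1 \<Omega>2) =
      (\<Sum>b'\<in>UNIV. \<Sum>b\<in>UNIV. \<Sum>p\<in>UNIV \<times> UNIV. ?k (fst p) (snd p) b b')"
      by (simp only: comp_op_ten[OF G] bclinD(7)[OF bclin_comp_op[OF G]] cip_sum_left cip_ten
        sum.cartesian_product' fst_conv snd_conv)
    also have "\<dots> = (\<Sum>b\<in>UNIV. \<Sum>b'\<in>UNIV. \<Sum>p\<in>UNIV \<times> UNIV. ?k (fst p) (snd p) b b')"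
      by (rule sum.swap)
    also have "\<dots> = (\<Sum>q\<in>UNIV \<times> UNIV. \<Sum>p\<in>UNIV \<times> UNIV. ?k (fst p) (snd p) (fst q) (snd q))"
      by (simp only: sum.cartesian_product' fst_conv snd_conv)
    also have "\<dots> = (\<Sum>p\<in>UNIV \<times> UNIV. \<Sum>q\<in>UNIV \<times> UNIV. ?k (fst p) (snd p) (fst q) (snd q))"
      by (rule sum.swap)
    also have "\<dots> = (\<Gamma>2 \<circ> \<Gamma>1) (kron (munit x x') (munit y y')) $ (z, w) $ (z', w')"
      by (simp only: kernel_compose[OF lin] m1.kernel m2.kernel sum.cartesian_product' fst_conv snd_conv)
    finally show "(\<Gamma>2 \<circ> \<Gamma>1) (kron (munit x x') (munit y y')) $ (z, w) $ (z', w') =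
      cip (comp_op G1 G2 x x' z z' (comp_op G1 G2 y' y w' w (ten \<Omega>1 \<Omega>2))) (ten \<Omega>1 \<Omega>2)" ..
  qed
qed

section \<open>The GNS construction of a tracial state\<close>

context semi_inner
begin

text \<open>The recursion stays inside the span of the generators. This supplies the axiom
  \<open>P_ket\<close> of \<open>tracial_rep\<close> for the GNS model.\<close>

lemma U_b_cspan: "U (b n) \<in> cspan (\<lambda>m. U (s m))"
proof (induction n rule: less_induct)
  case (less n)
  let ?c = "complex_of_real (1 / sqrt (Re (form (residual n b) (residual n b))))"
  have "U (b n) = cs ?c (U (s n) + (\<Sum>k<n. cs (- form (s n) (b k)) (U (b k))))"
    by (subst b_unfold) (simp only: normalize_def residual_def U_sm U_add U_lc lc_closed add_closed b_closed s_closed)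
  also have "\<dots> \<in> cspan (\<lambda>m. U (s m))"
    using less by (intro cspan_cs cspan_add cspan_sum cspan_base) auto
  finally show ?case .
qed

lemma independent_kets: "independent (ket ` {k. form (b k) (b k) \<noteq> 0} :: nat ell2 set)"
proof (rule pairwise_orthogonal_independent)
  show "pairwise orthogonal (ket ` {k. form (b k) (b k) \<noteq> 0} :: nat ell2 set)"
    by (auto simp: pairwise_def orthogonal_def inner_ell2_def)
  show "0 \<notin> (ket ` {k. form (b k) (b k) \<noteq> 0} :: nat ell2 set)"
    using norm_ket by (metis imageE norm_zero zero_neq_one)
qed

lemma U_b: "form (b k) (b k) \<noteq> 0 \<Longrightarrow> U (b k) = ket k"
  using form_b_self[of k] orthogonal[of _ k] by (intro coef_inject_ext) (auto split: if_splits)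

lemma U_b_null: "form (b k) (b k) = 0 \<Longrightarrow> U (b k) = 0"
  by (rule coef_inject_ext) (simp add: null_left)

text \<open>Each non-null \<open>b k\<close> yields the basis vector \<open>ket k\<close>, and all
  of these lie in the real span of the vectors \<open>U v\<close> and their multiples by i, for
  \<open>v\<close> in \<open>S\<close>. An independent set in such a span is finite.\<close>

lemma finite_rank_hat_id:
  assumes "finite S" "S \<subseteq> V" and sp: "\<And>u. u \<in> V \<Longrightarrow> \<exists>c. U u = (\<Sum>v\<in>S. cs (c v) (U v))"
  shows "finite_rank (hat (\<lambda>u. u))"
proof -
  let ?J = "{k. form (b k) (b k) \<noteq> 0}"
  let ?T = "U ` S \<union> (\<lambda>v. cs \<i> (U v)) ` S"
  have "ket ` ?J \<subseteq> span ?T"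
  proof
    fix f :: "nat ell2" assume "f \<in> ket ` ?J"
    then obtain k where k: "form (b k) (b k) \<noteq> 0" "f = ket k" by blast
    have f: "f = U (b k)" unfolding U_b[OF k(1)] by (rule k(2))
    obtain c where c: "U (b k) = (\<Sum>v\<in>S. cs (c v) (U v))" using sp[OF b_closed[of k]] by (elim exE)
    have "cs a (U v) \<in> span ?T" if "v \<in> S" for a v
    proof -
      have "cs a (U v) = Re a *\<^sub>R U v + Im a *\<^sub>R cs \<i> (U v)"
        by (rule coef_inject_ext) (simp add: complex_eq_iff)
      moreover have "U v \<in> span ?T" "cs \<i> (U v) \<in> span ?T" using that by (auto intro!: span_base)
      ultimately show ?thesis by (simp add: span_add span_scale)
    qed
    then show "f \<in> span ?T" unfolding f c by (rule span_sum)
  qed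
  then have "finite (ket ` ?J :: nat ell2 set)"
    using independent_span_bound[OF _ independent_kets, of ?T] assms(1) by blast
  moreover have "inj_on (ket :: nat \<Rightarrow> nat ell2) ?J"
    by (rule inj_onI) (metis coef_ket zero_neq_one)
  ultimately have "finite ?J" by (rule finite_imageD)
  then show ?thesis
    unfolding finite_rank_def by (intro exI[of _ ?J]) (auto simp: hat_ket[OF good_id] U_b_null)
qed

end

section \<open>The GNS form of a trace and bounded multiplications\<close>

locale tracial_cstar = unital_cstar_algebra A
  for A :: "('v, 'm) star_algebra_scheme" (structure) +
  fixes \<tau> :: "'v \<Rightarrow> complex"
  assumes tracial: "tracial_state A \<tau>"
begin

lemma \<tau>_add: "a \<in> carrier A \<Longrightarrow> b \<in> carrier A \<Longrightarrow> \<tau> (a \<oplus> b) = \<tau> a + \<tau> b"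
  and \<tau>_smult: "a \<in> carrier A \<Longrightarrow> \<tau> (c \<odot> a) = c * \<tau> a"
  and \<tau>_pos: "a \<in> carrier A \<Longrightarrow> \<tau> (star A a \<otimes> a) \<in> \<real>\<^sub>\<ge>\<^sub>0"
  and \<tau>_one: "\<tau> \<one> = 1"
  and \<tau>_trace: "a \<in> carrier A \<Longrightarrow> b \<in> carrier A \<Longrightarrow> \<tau> (a \<otimes> b) = \<tau> (b \<otimes> a)"
  using tracial by (auto simp: tracial_state_def)

lemma scalar_closed [simp]: "a \<in> carrier A \<Longrightarrow> c \<odot> a \<in> carrier A"
  using smult_closed[of c a] by (simp add: complex_scalars_def)

declare star_closed [simp]

lemma A_ring: "Ring.ring A"
  by unfold_locales

text \<open>Restated, because in the locale the names of these laws refer to the ring of scalars.\<close>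

lemmas A_m_assoc = monoid.m_assoc[OF ring.is_monoid[OF A_ring]]
lemmas A_m_closed [simp] = monoid.m_closed[OF ring.is_monoid[OF A_ring]]
lemmas A_l_one [simp] = monoid.l_one[OF ring.is_monoid[OF A_ring]]
lemmas A_r_one [simp] = monoid.r_one[OF ring.is_monoid[OF A_ring]]
lemmas A_one_closed [simp] = monoid.one_closed[OF ring.is_monoid[OF A_ring]]
lemmas A_finsum_insert = abelian_monoid.finsum_insert[OF abelian_group.axioms(1)[OF ring.is_abelian_group[OF A_ring]]]
lemmas A_l_distr = ringE(3)[OF A_ring]
lemmas A_r_distr = ringE(4)[OF A_ring]

lemma \<tau>_zero: "\<tau> \<zero> = 0"
  using \<tau>_add[of \<zero> \<zero>] by simp

lemma star_one: "star A \<one> = \<one>"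
  by (metis A_one_closed A_r_one star_closed star_mult star_star A_l_one)

text \<open>Positivity at a + c 1 makes the expanded expression real; c = 1 and c = i then relate
  the imaginary and the real parts of the two values.\<close>

lemma \<tau>_star:
  assumes a: "a \<in> carrier A"
  shows "\<tau> (star A a) = cnj (\<tau> a)"
proof -
  have q: "\<tau> (star A (a \<oplus> c \<odot> \<one>) \<otimes> (a \<oplus> c \<odot> \<one>)) = \<tau> (star A a \<otimes> a) + c * \<tau> (star A a) + (cnj c * \<tau> a + cnj c * c)" for c
    using a by (simp add: star_add star_smult star_one A_l_distr A_r_distr smult_mult_left smult_mult_right
      \<tau>_add \<tau>_smult \<tau>_one algebra_simps)
  have r: "Im (\<tau> (star A (a \<oplus> c \<odot> \<one>) \<otimes> (a \<oplus> c \<odot> \<one>))) = 0" "Im (\<tau> (star A a \<otimes> a)) = 0" for c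
    using \<tau>_pos[of "a \<oplus> c \<odot> \<one>"] \<tau>_pos[of a] a by (auto simp: complex_nonneg_Reals_iff)
  have "Im (\<tau> (star A a)) + Im (\<tau> a) = 0" using r(1)[of 1, unfolded q] r(2) by simp
  moreover have "Re (\<tau> (star A a)) - Re (\<tau> a) = 0" using r(1)[of \<i>, unfolded q] r(2) by simp
  ultimately show ?thesis by (simp add: complex_eq_iff)
qed

definition form :: "'v \<Rightarrow> 'v \<Rightarrow> complex" where
  "form u v = \<tau> (star A v \<otimes> u)"

lemma semi_inner_form:
  assumes "\<And>n. s n \<in> carrier A"
  shows "semi_inner (carrier A) (\<oplus>) (\<odot>) form s"
proof
  fix u v assume u: "u \<in> carrier A" "v \<in> carrier A"
  have "cnj (form u v) = \<tau> (star A (star A v \<otimes> u))"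
    using u by (simp add: form_def \<tau>_star)
  then show "form v u = cnj (form u v)"
    using u by (simp add: form_def star_mult star_star)
qed (auto simp: form_def A_r_distr \<tau>_add \<tau>_smult smult_mult_right \<tau>_pos assms)

lemma form_left: "a \<in> carrier A \<Longrightarrow> u \<in> carrier A \<Longrightarrow> v \<in> carrier A \<Longrightarrow> form (a \<otimes> u) v = form u (star A a \<otimes> v)"
  by (simp add: form_def star_mult star_star A_m_assoc)

lemma form_right: "a \<in> carrier A \<Longrightarrow> u \<in> carrier A \<Longrightarrow> v \<in> carrier A \<Longrightarrow> form (u \<otimes> a) v = form u (v \<otimes> star A a)"
  using \<tau>_trace[of "star A v \<otimes> u" a] by (simp add: form_def star_mult star_star A_m_assoc)

text \<open>The trace property makes the involution antiunitary for the GNS form; this is the source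
  of the axiom \<open>R_flip\<close>.\<close>

lemma form_star: "u \<in> carrier A \<Longrightarrow> v \<in> carrier A \<Longrightarrow> form (star A u) (star A v) = form v u"
  using \<tau>_trace[of v "star A u"] by (simp add: form_def star_star)

lemma form_finsum:
  assumes "finite S" "\<And>i. i \<in> S \<Longrightarrow> f i \<in> carrier A" "u \<in> carrier A" "v \<in> carrier A"
  shows "form ((\<Oplus>i\<in>S. f i) \<otimes> u) v = (\<Sum>i\<in>S. form (f i \<otimes> u) v)"
  using assms(1,2)
proof (induction S rule: finite_induct)
  case empty
  then show ?case using assms by (simp add: form_def \<tau>_zero)
next
  case (insert i S)
  then show ?case using assms(3,4) by (simp add: A_finsum_insert Pi_def A_l_distr form_def A_r_distr \<tau>_add)
qed

text \<open>Boundedness of left multiplication in the GNS seminorm. Bounds are normalized to be at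
  least 1, so that a multiple of their product dominates their sum, as in
  \<open>left_bounded_add\<close>.\<close>

definition lbound :: "real \<Rightarrow> 'v \<Rightarrow> bool" where
  "lbound B a \<longleftrightarrow> 1 \<le> B \<and> (\<forall>u\<in>carrier A. Re (form (a \<otimes> u) (a \<otimes> u)) \<le> B\<^sup>2 * Re (form u u))"

definition left_bounded :: "'v set" where
  "left_bounded = {a \<in> carrier A. \<exists>B. lbound B a}"

lemma form_nonneg_Re: "u \<in> carrier A \<Longrightarrow> 0 \<le> Re (form u u)"
  using \<tau>_pos[of u] by (simp add: form_def complex_nonneg_Reals_iff)

lemma form_zero: "form \<zero> \<zero> = 0"
  by (simp add: form_def \<tau>_zero)

lemma left_bounded_one: "\<one> \<in> left_bounded"
  unfolding left_bounded_def lbound_def by (auto intro!: exI[of _ 1])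

lemma left_bounded_zero: "\<zero> \<in> left_bounded"
  unfolding left_bounded_def lbound_def by (auto intro!: exI[of _ 1] simp: form_zero form_nonneg_Re)

lemma left_bounded_mult:
  assumes "a \<in> left_bounded" "b \<in> left_bounded"
  shows "a \<otimes> b \<in> left_bounded"
proof -
  obtain B B' where a: "a \<in> carrier A" "lbound B a" and b: "b \<in> carrier A" "lbound B' b"
    using assms by (auto simp: left_bounded_def)
  have "1 * 1 \<le> B * B'" using a b by (intro mult_mono) (auto simp: lbound_def)
  moreover have "Re (form (a \<otimes> b \<otimes> u) (a \<otimes> b \<otimes> u)) \<le> (B * B')\<^sup>2 * Re (form u u)" if u: "u \<in> carrier A" for u
  proof -
    have "Re (form (a \<otimes> (b \<otimes> u)) (a \<otimes> (b \<otimes> u))) \<le> B\<^sup>2 * Re (form (b \<otimes> u) (b \<otimes> u))"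
      using a b u by (simp add: lbound_def)
    also have "\<dots> \<le> B\<^sup>2 * (B'\<^sup>2 * Re (form u u))"
      using b u by (intro mult_left_mono) (simp_all add: lbound_def)
    finally show ?thesis using a b u by (simp add: A_m_assoc power_mult_distrib mult.assoc)
  qed
  ultimately show ?thesis using a b unfolding left_bounded_def lbound_def by auto
qed

lemma left_bounded_add:
  assumes "a \<in> left_bounded" "b \<in> left_bounded"
  shows "a \<oplus> b \<in> left_bounded"
proof -
  interpret semi_inner "carrier A" "(\<oplus>)" "(\<odot>)" form "\<lambda>_. \<zero>" by (rule semi_inner_form) simp
  obtain B B' where a: "a \<in> carrier A" "lbound B a" and b: "b \<in> carrier A" "lbound B' b"
    using assms by (auto simp: left_bounded_def)
  have B: "1 \<le> B" "1 \<le> B'" using a b by (auto simp: lbound_def)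
  have "1 * 1 \<le> B * B'" using B by (intro mult_mono) auto
  moreover have "Re (form ((a \<oplus> b) \<otimes> u) ((a \<oplus> b) \<otimes> u)) \<le> (2 * (B * B'))\<^sup>2 * Re (form u u)" if u: "u \<in> carrier A" for u
  proof -
    let ?x = "a \<otimes> u" and ?y = "b \<otimes> u" and ?n = "Re (form u u)"
    have c: "?x \<in> carrier A" "?y \<in> carrier A" using a b u by auto
    \<comment> \<open>Parallelogram law: the form at the difference is non-negative and may be
      dropped.\<close>
    let ?d = "?x \<oplus> (- 1) \<odot> ?y"
    have "Re (form (?x \<oplus> ?y) (?x \<oplus> ?y)) + Re (form ?d ?d) = 2 * Re (form ?x ?x) + 2 * Re (form ?y ?y)"
      using c by (simp add: form_add form_add_right form_sm form_sm_right)
    moreover have "0 \<le> Re (form ?d ?d)" using c by (intro form_nonneg_Re) simp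
    moreover have "Re (form ?x ?x) \<le> B\<^sup>2 * ?n" "Re (form ?y ?y) \<le> B'\<^sup>2 * ?n"
      using a b u by (simp_all add: lbound_def)
    ultimately have "Re (form (?x \<oplus> ?y) (?x \<oplus> ?y)) \<le> 2 * (B\<^sup>2 * ?n) + 2 * (B'\<^sup>2 * ?n)" by linarith
    also have "\<dots> = (2 * B\<^sup>2 + 2 * B'\<^sup>2) * ?n" by (simp add: algebra_simps)
    also have "\<dots> \<le> (2 * (B * B'))\<^sup>2 * ?n"
    proof (rule mult_right_mono[OF _ form_nonneg_Re[OF u]])
      have "1 \<le> B\<^sup>2" "1 \<le> B'\<^sup>2" using B by (simp_all add: one_le_power)
      \<comment> \<open>Expanding the first product gives B^2 + B'^2 \<le> 1 + B^2 B'^2, and the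
        second inequality absorbs the 1.\<close>
      then have "0 \<le> (B\<^sup>2 - 1) * (B'\<^sup>2 - 1)" "1 * 1 \<le> B\<^sup>2 * B'\<^sup>2" by (intro mult_nonneg_nonneg mult_mono; simp)+
      then show "2 * B\<^sup>2 + 2 * B'\<^sup>2 \<le> (2 * (B * B'))\<^sup>2" by (simp add: power_mult_distrib algebra_simps)
    qed
    finally show ?thesis using a b u by (simp add: A_l_distr)
  qed
  ultimately show ?thesis using a b unfolding left_bounded_def lbound_def by (auto intro!: exI[of _ "2 * (B * B')"])
qed

text \<open>Non-negativity of the form at a a^* u - B^2 u, combined with the bound of
  \<open>a\<close> at a^* u, gives the claimed inequality multiplied by B^2.\<close>

lemma lbound_star:
  assumes a: "a \<in> carrier A" "lbound B a"
  shows "lbound B (star A a)"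
  unfolding lbound_def
proof (intro conjI ballI)
  interpret semi_inner "carrier A" "(\<oplus>)" "(\<odot>)" form "\<lambda>_. \<zero>" by (rule semi_inner_form) simp
  show B: "1 \<le> B" using a(2) by (simp add: lbound_def)
  fix u assume u: "u \<in> carrier A"
  let ?x = "star A a \<otimes> u"
  let ?l = "complex_of_real (B\<^sup>2)"
  let ?d = "a \<otimes> ?x \<oplus> (- ?l) \<odot> u"
  have c: "?x \<in> carrier A" "a \<otimes> ?x \<in> carrier A" using a u by auto
  have x: "form (a \<otimes> ?x) u = form ?x ?x" by (rule form_left[OF a(1) c(1) u])
  have x': "form u (a \<otimes> ?x) = form ?x ?x"
    using form_herm[OF c(2) u] form_herm[OF c(1) c(1)] x by simp
  have "form ?d ?d = form (a \<otimes> ?x) (a \<otimes> ?x) - ?l * form ?x ?x - ?l * form ?x ?x + ?l * ?l * form u u"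
    using c u by (simp add: form_add form_add_right form_sm form_sm_right x x' algebra_simps)
  moreover have "0 \<le> Re (form ?d ?d)" using c u by (intro form_nonneg_Re) simp
  ultimately have "0 \<le> Re (form (a \<otimes> ?x) (a \<otimes> ?x)) - 2 * B\<^sup>2 * Re (form ?x ?x) + B\<^sup>2 * B\<^sup>2 * Re (form u u)"
    by (simp flip: of_real_mult of_real_power)
  moreover have "Re (form (a \<otimes> ?x) (a \<otimes> ?x)) \<le> B\<^sup>2 * Re (form ?x ?x)"
    using a c by (simp add: lbound_def)
  ultimately have "B\<^sup>2 * Re (form ?x ?x) \<le> B\<^sup>2 * (B\<^sup>2 * Re (form u u))" by (simp add: algebra_simps)
  moreover have "0 < B\<^sup>2" using B by simp
  ultimately show "Re (form ?x ?x) \<le> B\<^sup>2 * Re (form u u)" by (rule mult_left_le_imp_le)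
qed

lemma left_bounded_star: "a \<in> left_bounded \<Longrightarrow> star A a \<in> left_bounded"
  using lbound_star by (auto simp: left_bounded_def)

text \<open>The involution turns right multiplication by \<open>a\<close> into left multiplication
  by its adjoint, and by the trace property it preserves the seminorm.\<close>

lemma right_bound:
  assumes a: "a \<in> carrier A" "lbound B a" and u: "u \<in> carrier A"
  shows "Re (form (u \<otimes> a) (u \<otimes> a)) \<le> B\<^sup>2 * Re (form u u)"
proof -
  have "form (u \<otimes> a) (u \<otimes> a) = form (star A (u \<otimes> a)) (star A (u \<otimes> a))"
    using a u by (simp add: form_star)
  also have "star A (u \<otimes> a) = star A a \<otimes> star A u" using a u by (simp add: star_mult)
  finally have "Re (form (u \<otimes> a) (u \<otimes> a)) \<le> B\<^sup>2 * Re (form (star A u) (star A u))"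
    using lbound_star[OF a] u by (simp add: lbound_def)
  then show ?thesis using u by (simp add: form_star)
qed

text \<open>The blocks of a stochastic matrix \<open>h\<^sup>* h\<close> act as contractions, because their squares sum to
  the identity; hence no estimate involving the norm of the algebra is needed.\<close>

lemma stochastic_left_bounded:
  fixes h :: "'x::finite \<Rightarrow> 'x \<Rightarrow> 'a::finite \<Rightarrow> 'a \<Rightarrow> 'v"
  assumes h: "\<And>x x' a a'. h x x' a a' \<in> carrier A"
    and one: "\<And>x. (\<Oplus>a\<in>UNIV. \<Oplus>p\<in>UNIV. star A (h (fst p) x (snd p) a) \<otimes> h (fst p) x (snd p) a) = \<one>"
  shows "h y x b a \<in> left_bounded"
proof -
  have "Re (form (h y x b a \<otimes> u) (h y x b a \<otimes> u)) \<le> Re (form u u)" if u: "u \<in> carrier A" for u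
  proof -
    have c: "star A (h (fst p) x (snd p) a) \<otimes> h (fst p) x (snd p) a \<in> carrier A" for p a using h by simp
    have sq: "form (star A (h (fst p) x (snd p) a) \<otimes> h (fst p) x (snd p) a \<otimes> u) u =
        form (h (fst p) x (snd p) a \<otimes> u) (h (fst p) x (snd p) a \<otimes> u)" for p a
      using form_left[of "star A (h (fst p) x (snd p) a)" "h (fst p) x (snd p) a \<otimes> u" u] h u
      by (simp add: A_m_assoc star_star)
    have "form u u = form (\<one> \<otimes> u) u" using u by simp
    also have "\<dots> = (\<Sum>a\<in>UNIV. form ((\<Oplus>p\<in>UNIV. star A (h (fst p) x (snd p) a) \<otimes> h (fst p) x (snd p) a) \<otimes> u) u)"
      unfolding one[of x, symmetric] by (rule form_finsum) (use u c in auto)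
    also have "\<dots> = (\<Sum>a\<in>UNIV. \<Sum>p\<in>UNIV. form (h (fst p) x (snd p) a \<otimes> u) (h (fst p) x (snd p) a \<otimes> u))"
      unfolding sq[symmetric] by (intro sum.cong refl form_finsum) (use u c in auto)
    finally have "Re (form u u) = (\<Sum>a\<in>UNIV. \<Sum>p\<in>UNIV. Re (form (h (fst p) x (snd p) a \<otimes> u) (h (fst p) x (snd p) a \<otimes> u)))"
      by simp
    also have "\<dots> \<ge> (\<Sum>p\<in>UNIV. Re (form (h (fst p) x (snd p) a \<otimes> u) (h (fst p) x (snd p) a \<otimes> u)))"
      by (rule member_le_sum) (auto intro!: sum_nonneg form_nonneg_Re A_m_closed h u)
    finally have 1: "(\<Sum>p\<in>UNIV. Re (form (h (fst p) x (snd p) a \<otimes> u) (h (fst p) x (snd p) a \<otimes> u))) \<le> Re (form u u)" .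
    have "Re (form (h (fst (y, b)) x (snd (y, b)) a \<otimes> u) (h (fst (y, b)) x (snd (y, b)) a \<otimes> u)) \<le>
        (\<Sum>p\<in>UNIV. Re (form (h (fst p) x (snd p) a \<otimes> u) (h (fst p) x (snd p) a \<otimes> u)))"
      by (rule member_le_sum) (auto intro!: form_nonneg_Re A_m_closed h u)
    with 1 show ?thesis by simp
  qed
  then show ?thesis using h unfolding left_bounded_def lbound_def by (auto intro!: exI[of _ 1])
qed

text \<open>\<open>D\<close> is a countable set of left bounded elements containing 0, 1 and the
  entries of \<open>h\<close>, closed under sums, products and the involution. On its Gram-Schmidt
  coordinates the left multiplications \<open>L\<close> carry the stochastic matrix, and the right
  multiplications \<open>Q\<close> by members of \<open>D\<close> are the family whose commutant
  becomes the new algebra; associativity makes the two commute.\<close>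

lemma tracial_model_exists:
  fixes g :: "'x::finite \<Rightarrow> 'x \<Rightarrow> 'a::finite \<Rightarrow> 'a \<Rightarrow> 'v"
  assumes g: "stochastic_algebra_matrix A g"
    and \<Gamma>: "\<And>x x' y y' a a' b b'. \<Gamma> (kron (munit x x') (munit y y')) $ (a, b) $ (a', b') =
        \<tau> (g x x' a a' \<otimes> g y' y b' b)"
  shows "\<exists>(P :: nat ell2 \<Rightarrow> nat ell2) \<Omega> (R :: nat \<Rightarrow> nat ell2 \<Rightarrow> nat ell2) Rs (K :: 'x \<times> 'a \<Rightarrow> 'x \<times> 'a \<Rightarrow> nat ell2 \<Rightarrow> nat ell2) Ks G.
    tracial_model P \<Omega> R Rs K Ks G \<Gamma> \<and> (finite_dimensional A \<longrightarrow> finite_rank P) \<and>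
    (abelian A \<longrightarrow> commuting_family R Rs)"
proof -
  obtain h :: "'x \<Rightarrow> 'x \<Rightarrow> 'a \<Rightarrow> 'a \<Rightarrow> 'v" where hh: "\<forall>x x' a a'. h x x' a a' \<in> carrier A"
      "\<forall>x x' a a'. g x x' a a' = (\<Oplus>p\<in>UNIV. star A (h (fst p) x (snd p) a) \<otimes> h (fst p) x' (snd p) a')"
    and gg: "\<forall>x x'. (\<Oplus>a\<in>UNIV. g x x' a a) = (if x = x' then \<one> else \<zero>)"
    using g unfolding stochastic_algebra_matrix_def by (elim conjE exE) (rule that)
  note h = hh(1)[rule_format] and gh = hh(2)[rule_format] and g1 = gg[rule_format]
  have hb: "h y x b a \<in> left_bounded" for y x b a
    by (rule stochastic_left_bounded[of h]) (use h g1 in \<open>simp_all add: gh[symmetric]\<close>)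
  let ?F = "{(\<oplus>), (\<otimes>), \<lambda>u v. star A u}"
  let ?S = "{\<zero>, \<one>} \<union> range (\<lambda>(x, x', a, a'). h x x' a a')"
  obtain D where D: "countable D" "?S \<subseteq> D" "D \<subseteq> left_bounded"
    and DF: "\<And>f u v. f \<in> ?F \<Longrightarrow> u \<in> D \<Longrightarrow> v \<in> D \<Longrightarrow> f u v \<in> D"
  proof (rule countable_closure[of ?F ?S left_bounded])
    show "countable ?F" by (rule countable_finite) simp
    show "countable ?S" by (rule countable_finite) simp
    show "?S \<subseteq> left_bounded" using hb left_bounded_zero left_bounded_one by auto
    show "f u v \<in> left_bounded" if "f \<in> ?F" "u \<in> left_bounded" "v \<in> left_bounded" for f u v
      using that left_bounded_add left_bounded_mult left_bounded_star by auto
  qed blast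
  have D0: "\<zero> \<in> D" and D1: "\<one> \<in> D" using D(2) by auto
  have Dh: "h x x' a a' \<in> D" for x x' a a'
    by (rule subsetD[OF D(2)], rule UnI2, rule range_eqI[of _ _ "(x, x', a, a')"]) simp
  have Dadd: "u \<oplus> v \<in> D" if "u \<in> D" "v \<in> D" for u v using DF[OF _ that, of "(\<oplus>)"] by simp
  have Dmult: "u \<otimes> v \<in> D" if "u \<in> D" "v \<in> D" for u v using DF[OF _ that, of "(\<otimes>)"] by simp
  have Dstar: "star A u \<in> D" if "u \<in> D" for u using DF[OF _ that that, of "\<lambda>u v. star A u"] by simp
  have DA: "u \<in> carrier A" if "u \<in> D" for u using that D(3) by (auto simp: left_bounded_def)
  have Dsum: "finite S \<Longrightarrow> (\<And>i. i \<in> S \<Longrightarrow> f i \<in> D) \<Longrightarrow> (\<Oplus>i\<in>S. f i) \<in> D" for S and f :: "'x \<times> 'a \<Rightarrow> 'v"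
  proof (induction S rule: finite_induct)
    case (insert i S)
    have "(\<Oplus>i\<in>insert i S. f i) = f i \<oplus> (\<Oplus>i\<in>S. f i)"
      using insert DA by (intro A_finsum_insert) auto
    then show ?case using insert by (simp add: Dadd)
  qed (simp add: D0)
  define s where "s = from_nat_into D"
  have s: "range s = D" unfolding s_def using D(1) D0 by (intro range_from_nat_into) auto
  have sD: "s n \<in> D" for n using s by auto
  have sA: "s n \<in> carrier A" for n using sD DA by blast
  interpret semi_inner "carrier A" "(\<oplus>)" "(\<odot>)" form s by (rule semi_inner_form[OF sA])
  have MD: "inM u" if u: "u \<in> D" for u
  proof -
    obtain n where "u = s n" using u unfolding s[symmetric] by blast
    then show ?thesis using inM_s by simp
  qed
  define L where "L d = hat (\<lambda>u. d \<otimes> u)" for d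
  define Q where "Q d = hat (\<lambda>u. u \<otimes> d)" for d
  have gL: "\<exists>B. good B (\<lambda>u. d \<otimes> u)" if d: "d \<in> D" for d
  proof -
    obtain B where B: "lbound B d" using d D(3) by (auto simp: left_bounded_def)
    have "good B (\<lambda>u. d \<otimes> u)"
      unfolding good_def
    proof (intro conjI ballI allI)
      show "inM (d \<otimes> s n)" for n by (rule MD[OF Dmult[OF d sD]])
    qed (use B DA[OF d] in \<open>auto simp: lbound_def A_r_distr form_add smult_mult_right form_sm\<close>)
    then show ?thesis by blast
  qed
  have gQ: "\<exists>B. good B (\<lambda>u. u \<otimes> d)" if d: "d \<in> D" for d
  proof -
    obtain B where B: "lbound B d" using d D(3) by (auto simp: left_bounded_def)
    have "good B (\<lambda>u. u \<otimes> d)"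
      unfolding good_def
    proof (intro conjI ballI allI)
      show "inM (s n \<otimes> d)" for n by (rule MD[OF Dmult[OF sD d]])
      show "Re (form (u \<otimes> d) (u \<otimes> d)) \<le> B\<^sup>2 * Re (form u u)" if "u \<in> carrier A" for u
        by (rule right_bound[OF DA[OF d] B that])
    qed (use B DA[OF d] in \<open>auto simp: lbound_def A_l_distr form_add smult_mult_left form_sm\<close>)
    then show ?thesis by blast
  qed
  have bL: "bclin (L d)" if "d \<in> D" for d unfolding L_def using gL[OF that] bclin_hat by blast
  have bQ: "bclin (Q d)" if "d \<in> D" for d unfolding Q_def using gQ[OF that] bclin_hat by blast
  have adL: "adjoint_pair (L d) (L (star A d))" if d: "d \<in> D" for d
  proof -
    obtain B B' where "good B (\<lambda>u. d \<otimes> u)" "good B' (\<lambda>u. star A d \<otimes> u)" using gL[OF d] gL[OF Dstar[OF d]] by blast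
    then show ?thesis unfolding L_def by (rule adjoint_pair_hat) (rule form_left[OF DA[OF d]])
  qed
  have adQ: "adjoint_pair (Q d) (Q (star A d))" if d: "d \<in> D" for d
  proof -
    obtain B B' where "good B (\<lambda>u. u \<otimes> d)" "good B' (\<lambda>u. u \<otimes> star A d)" using gQ[OF d] gQ[OF Dstar[OF d]] by blast
    then show ?thesis unfolding Q_def by (rule adjoint_pair_hat) (rule form_right[OF DA[OF d]])
  qed
  have PL: "hat (\<lambda>u. u) (L d f) = L d f" if "d \<in> D" for d f unfolding L_def using gL[OF that] hat_id(2) by blast
  have PQ: "hat (\<lambda>u. u) (Q d f) = Q d f" if "d \<in> D" for d f unfolding Q_def using gQ[OF that] hat_id(2) by blast
  have LQ: "L d (Q e f) = Q e (L d f)" if d: "d \<in> D" and e: "e \<in> D" for d e f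
  proof -
    obtain B B' where "good B (\<lambda>u. d \<otimes> u)" "good B' (\<lambda>u. u \<otimes> e)" using gL[OF d] gQ[OF e] by blast
    then show ?thesis unfolding L_def Q_def by (rule hat_commute) (simp add: A_m_assoc DA[OF d] DA[OF e])
  qed
  have LU: "L d (U u) = U (d \<otimes> u)" if "d \<in> D" "u \<in> D" for d u
    unfolding L_def using gL[OF that(1)] hat_U[OF _ MD[OF that(2)]] by blast
  have Q1: "Q d (U \<one>) = U d" if d: "d \<in> D" for d
  proof -
    have "Q d (U \<one>) = U (\<one> \<otimes> d)" unfolding Q_def using gQ[OF d] hat_U[OF _ MD[OF D1]] by blast
    then show ?thesis using DA[OF d] by simp
  qed
  have cU: "cip (U u) (U v) = form u v" if "u \<in> D" "v \<in> D" for u v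
    by (rule cip_U[OF MD[OF that(1)] DA[OF that(2)]])
  let ?P = "hat (\<lambda>u. u)" and ?\<Omega> = "U \<one>" and ?R = "\<lambda>n. Q (s n)" and ?Rs = "\<lambda>n. Q (star A (s n))"
  interpret tracial_rep ?P ?\<Omega> ?R ?Rs
  proof
    show "bclin ?P" by (rule bclin_hat[OF good_id])
    show "adjoint_pair ?P ?P" by (rule adjoint_pair_hat[OF good_id good_id]) (rule refl)
    show "?P (?P f) = ?P f" for f by (rule hat_id[OF good_id])
    show "?P ?\<Omega> = ?\<Omega>" by (rule hat_U[OF good_id MD[OF D1]])
    show "cip ?\<Omega> ?\<Omega> = 1" unfolding cU[OF D1 D1] by (simp add: form_def star_one \<tau>_one)
    show "bclin (?R w)" "bclin (?Rs w)" for w by (intro bQ sD Dstar)+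
    show "adjoint_pair (?R w) (?Rs w)" for w by (rule adQ[OF sD])
    show "?P (?R w f) = ?R w f" "?P (?Rs w f) = ?Rs w f" for w f by (intro PQ sD Dstar)+
    show "cip (?Rs w ?\<Omega>) (?Rs v ?\<Omega>) = cip (?R v ?\<Omega>) (?R w ?\<Omega>)" for v w
      by (simp add: Q1 sD Dstar cU form_star sA)
    show "?P (ket i) \<in> cspan (\<lambda>w. ?R w ?\<Omega>)" for i
      unfolding hat_ket[OF good_id] Q1[OF sD] by (rule U_b_cspan)
  qed
  have algL: "alg (L d) (L (star A d))" if d: "d \<in> D" for d
    by (rule algI) (intro bL adL PL LQ d Dstar sD)+
  have Dg: "g x x' a a' \<in> D" for x x' a a'
    unfolding gh by (intro Dsum Dmult Dstar Dh) simp
  \<comment> \<open>Sums in the carrier become sums of operators: the equality is tested on matrix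
    entries, where \<open>form_finsum\<close> applies.\<close>
  have Lg: "L (g x x' a a') f = (\<Sum>p\<in>UNIV. L (star A (h (fst p) x (snd p) a)) (L (h (fst p) x' (snd p) a') f))"
    for x x' a a' f
  proof (rule bclin_eqI[where f = f])
    show "bclin (L (g x x' a a'))" by (rule bL[OF Dg])
    show "bclin (\<lambda>f. \<Sum>p\<in>UNIV. L (star A (h (fst p) x (snd p) a)) (L (h (fst p) x' (snd p) a') f))"
      by (intro bclin_sum bclin_compose[OF bL bL] Dstar Dh)
    fix i
    have 1: "L d (ket i) = U (d \<otimes> b i)" if "d \<in> D" for d
      unfolding L_def using gL[OF that] hat_ket by blast
    have 2: "L d (L e (ket i)) = U (d \<otimes> (e \<otimes> b i))" if "d \<in> D" "e \<in> D" for d e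
      unfolding L_def using gL[OF that(1)] gL[OF that(2)] hat_hat_ket by blast
    show "L (g x x' a a') (ket i) = (\<Sum>p\<in>UNIV. L (star A (h (fst p) x (snd p) a)) (L (h (fst p) x' (snd p) a') (ket i)))"
    proof (rule coef_inject_ext)
      fix j
      have "coef (L (g x x' a a') (ket i)) j = form (g x x' a a' \<otimes> b i) (b j)"
        by (simp add: 1 Dg DA)
      also have "\<dots> = (\<Sum>p\<in>UNIV. form (star A (h (fst p) x (snd p) a) \<otimes> h (fst p) x' (snd p) a' \<otimes> b i) (b j))"
        unfolding gh by (rule form_finsum) (simp_all add: h)
      finally show "coef (L (g x x' a a') (ket i)) j =
          coef (\<Sum>p\<in>UNIV. L (star A (h (fst p) x (snd p) a)) (L (h (fst p) x' (snd p) a') (ket i))) j"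
        by (simp add: 2 Dh Dstar h A_m_assoc)
    qed
  qed
  let ?K = "\<lambda>q p. L (h (fst q) (fst p) (snd q) (snd p))"
  let ?Ks = "\<lambda>q p. L (star A (h (fst q) (fst p) (snd q) (snd p)))"
  let ?G = "\<lambda>x x' a a'. L (g x x' a a')"
  have model: "tracial_model ?P ?\<Omega> ?R ?Rs ?K ?Ks ?G \<Gamma>"
  proof
    show "alg (?K q p) (?Ks q p)" for q p by (rule algL[OF Dh])
    show "?G x x' a a' f = (\<Sum>q\<in>UNIV. ?Ks q (x, a) (?K q (x', a') f))" for x x' a a' f
      unfolding Lg by simp
    show "(\<Sum>a\<in>UNIV. ?G x x' a a f) = (if x = x' then ?P f else 0)" for x x' f
    proof -
      have "\<forall>a. \<exists>B. good B (\<lambda>u. g x x' a a \<otimes> u)" using gL[OF Dg] by blast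
      then obtain B where B: "\<And>a. good (B a) (\<lambda>u. g x x' a a \<otimes> u)" by metis
      have "(\<Sum>a\<in>UNIV. form (g x x' a a \<otimes> u) w) = (if x = x' then 1 else 0) * form u w"
        if u: "u \<in> carrier A" "w \<in> carrier A" for u w
      proof -
        have "(\<Sum>a\<in>UNIV. form (g x x' a a \<otimes> u) w) = form ((\<Oplus>a\<in>UNIV. g x x' a a) \<otimes> u) w"
          by (rule form_finsum[symmetric]) (use u DA[OF Dg] in auto)
        then show ?thesis using u by (simp add: g1 form_def \<tau>_zero)
      qed
      from good_hat_sum[of B "\<lambda>a u. g x x' a a \<otimes> u", OF B this]
      show ?thesis unfolding L_def by (cases "x = x'") (auto simp: cs_algebra)
    qed
    show "\<Gamma> (kron (munit x x') (munit y y')) $ (a, b) $ (a', b') = cip (?G x x' a a' (?G y' y b' b ?\<Omega>)) ?\<Omega>"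
      for x x' y y' a a' b b'
    proof -
      have "cip (?G x x' a a' (?G y' y b' b ?\<Omega>)) ?\<Omega> = form (g x x' a a' \<otimes> (g y' y b' b \<otimes> \<one>)) \<one>"
        by (simp add: LU Dg D1 Dmult cU del: A_r_one)
      then show ?thesis using DA[OF Dg] by (simp add: \<Gamma> form_def star_one)
    qed
  qed
  moreover have "finite_rank ?P" if "finite_dimensional A"
  proof -
    obtain S where S: "finite S" "S \<subseteq> carrier A" and sp: "\<And>a. a \<in> carrier A \<Longrightarrow> \<exists>c. a = (\<Oplus>v\<in>S. c v \<odot> v)"
      using \<open>finite_dimensional A\<close> unfolding finite_dimensional_def by blast
    have US: "finite T \<Longrightarrow> T \<subseteq> carrier A \<Longrightarrow> U (\<Oplus>v\<in>T. c v \<odot> v) = (\<Sum>v\<in>T. cs (c v) (U v))" for T c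
    proof (induction T rule: finite_induct)
      case empty
      have "form \<zero> v = 0" if "v \<in> carrier A" for v using that by (simp add: form_def \<tau>_zero)
      then show ?case by (intro coef_inject_ext) simp
    next
      case (insert v T)
      then show ?case by (subst A_finsum_insert) (auto simp: U_add U_sm finsum_closed Pi_def subset_iff)
    qed
    show ?thesis
    proof (rule finite_rank_hat_id[OF S])
      fix u assume "u \<in> carrier A"
      then obtain c where c: "u = (\<Oplus>v\<in>S. c v \<odot> v)" using sp by blast
      show "\<exists>c. U u = (\<Sum>v\<in>S. cs (c v) (U v))"
        unfolding c by (rule exI[of _ c]) (rule US[OF S])
    qed
  qed
  moreover have "commuting_family ?R ?Rs" if "abelian A"
  proof -
    have "Q d (Q e f) = Q e (Q d f)" if d: "d \<in> D" and e: "e \<in> D" for d e f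
    proof -
      obtain B B' where "good B (\<lambda>u. u \<otimes> d)" "good B' (\<lambda>u. u \<otimes> e)" using gQ[OF d] gQ[OF e] by blast
      moreover have "d \<otimes> e = e \<otimes> d" using \<open>abelian A\<close> DA[OF d] DA[OF e] by (simp add: abelian_def)
      ultimately show ?thesis
        unfolding Q_def by (intro hat_commute) (simp_all add: A_m_assoc DA[OF d] DA[OF e])
    qed
    then show ?thesis unfolding commuting_family_def using sD Dstar by blast
  qed
  ultimately show ?thesis by blast
qed

end

section \<open>Composition of tracial correlations\<close>

lemma tracial_over_model_exists:
  fixes \<Gamma> :: "('x::finite \<times> 'x) cmat \<Rightarrow> ('a::finite \<times> 'a) cmat"
  assumes "unital_cstar_algebra A" "tracial_over A \<Gamma>"
  shows "\<exists>(P :: nat ell2 \<Rightarrow> nat ell2) \<Omega> (R :: nat \<Rightarrow> nat ell2 \<Rightarrow> nat ell2) Rs (K :: 'x \<times> 'a \<Rightarrow> 'x \<times> 'a \<Rightarrow> nat ell2 \<Rightarrow> nat ell2) Ks G.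
    tracial_model P \<Omega> R Rs K Ks G \<Gamma> \<and> (finite_dimensional A \<longrightarrow> finite_rank P) \<and>
    (abelian A \<longrightarrow> commuting_family R Rs)"
proof -
  obtain \<tau> g where \<tau>: "tracial_state A \<tau>" and g: "stochastic_algebra_matrix A g"
    and \<Gamma>: "\<forall>x x' y y' a a' b b'. \<Gamma> (kron (munit x x') (munit y y')) $ (a, b) $ (a', b') =
        \<tau> (g x x' a a' \<otimes>\<^bsub>A\<^esub> g y' y b' b)"
    using assms(2) unfolding tracial_over_def by blast
  interpret tracial_cstar A \<tau>
    by (intro tracial_cstar.intro tracial_cstar_axioms.intro assms \<tau>)
  show ?thesis by (rule tracial_model_exists[OF g]) (use \<Gamma> in blast)
qed

lemma tracial_over_compose:
  fixes \<Gamma>1 :: "('x::finite \<times> 'x) cmat \<Rightarrow> ('a::finite \<times> 'a) cmat"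
    and \<Gamma>2 :: "('a \<times> 'a) cmat \<Rightarrow> ('z::finite \<times> 'z) cmat"
  assumes "unital_cstar_algebra A1" "tracial_over A1 \<Gamma>1" "unital_cstar_algebra A2" "tracial_over A2 \<Gamma>2"
  shows "tracial TYPE('u) (\<Gamma>2 \<circ> \<Gamma>1)"
    "finite_dimensional A1 \<Longrightarrow> finite_dimensional A2 \<Longrightarrow> quantum_tracial TYPE('u) (\<Gamma>2 \<circ> \<Gamma>1)"
    "abelian A1 \<Longrightarrow> abelian A2 \<Longrightarrow> locally_tracial TYPE('u) (\<Gamma>2 \<circ> \<Gamma>1)"
proof -
  have lin: "clinear_map \<Gamma>1" "clinear_map \<Gamma>2" using assms(2,4) by (simp_all add: tracial_over_def)
  obtain P1 \<Omega>1 R1 Rs1 K1 Ks1 G1 where 1: "tracial_model (P1 :: nat ell2 \<Rightarrow> nat ell2) \<Omega>1 (R1 :: nat \<Rightarrow> _) Rs1 (K1 :: 'x \<times> 'a \<Rightarrow> _) Ks1 G1 \<Gamma>1"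
    and f1: "finite_dimensional A1 \<Longrightarrow> finite_rank P1" and c1: "abelian A1 \<Longrightarrow> commuting_family R1 Rs1"
    using tracial_over_model_exists[OF assms(1,2)] by blast
  obtain P2 \<Omega>2 R2 Rs2 K2 Ks2 G2 where 2: "tracial_model (P2 :: nat ell2 \<Rightarrow> nat ell2) \<Omega>2 (R2 :: nat \<Rightarrow> _) Rs2 (K2 :: 'a \<times> 'z \<Rightarrow> _) Ks2 G2 \<Gamma>2"
    and f2: "finite_dimensional A2 \<Longrightarrow> finite_rank P2" and c2: "abelian A2 \<Longrightarrow> commuting_family R2 Rs2"
    using tracial_over_model_exists[OF assms(3,4)] by blast
  interpret m1: tracial_model P1 \<Omega>1 R1 Rs1 K1 Ks1 G1 \<Gamma>1 by (rule 1)
  interpret m2: tracial_model P2 \<Omega>2 R2 Rs2 K2 Ks2 G2 \<Gamma>2 by (rule 2)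
  note m = tracial_over_model[OF clinear_map_compose[OF lin] tracial_model_compose[OF 1 2 lin(2)]]
  show "tracial TYPE('u) (\<Gamma>2 \<circ> \<Gamma>1)" by (rule m(1))
  show "quantum_tracial TYPE('u) (\<Gamma>2 \<circ> \<Gamma>1)" if "finite_dimensional A1" "finite_dimensional A2"
    by (rule m(2)) (rule finite_rank_tenop[OF m1.bclin_P m2.bclin_P f1[OF that(1)] f2[OF that(2)]])
  show "locally_tracial TYPE('u) (\<Gamma>2 \<circ> \<Gamma>1)" if "abelian A1" "abelian A2"
    by (rule m(3)) (rule commuting_family_tenop[OF m1.bclin_R m2.bclin_R c1[OF that(1)] c2[OF that(2)]])
qed

theorem theorem10p17:
  shows
   "(\<forall>(\<phi>1 :: ('x::finite \<times> 'y::finite) cmat \<Rightarrow> ('a::finite \<times> 'b::finite) cmat)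
      (\<phi>2 :: ('a \<times> 'b) cmat \<Rightarrow> ('z::finite \<times> 'w::finite) cmat) \<Gamma>1 \<Gamma>2 c.
       qgame \<phi>1 \<and> qgame \<phi>2 \<and>
       perfect_strategy \<phi>1 \<Gamma>1 \<and> \<Gamma>1 \<in> Q_class TYPE('u) c \<and>
       perfect_strategy \<phi>2 \<Gamma>2 \<and> \<Gamma>2 \<in> Q_class TYPE('u) c \<longrightarrow>
       perfect_strategy (\<phi>2 \<circ> \<phi>1) (\<Gamma>2 \<circ> \<Gamma>1) \<and> \<Gamma>2 \<circ> \<Gamma>1 \<in> Q_class TYPE('u) c)
    \<and>
    (\<forall>(\<phi>1 :: ('x \<times> 'x) cmat \<Rightarrow> ('a \<times> 'a) cmat)
      (\<phi>2 :: ('a \<times> 'a) cmat \<Rightarrow> ('z \<times> 'z) cmat) \<Gamma>1 \<Gamma>2.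
       qgame \<phi>1 \<and> qgame \<phi>2 \<and> perfect_strategy \<phi>1 \<Gamma>1 \<and> perfect_strategy \<phi>2 \<Gamma>2 \<longrightarrow>
       (tracial TYPE('u) \<Gamma>1 \<and> tracial TYPE('u) \<Gamma>2 \<longrightarrow>
          perfect_strategy (\<phi>2 \<circ> \<phi>1) (\<Gamma>2 \<circ> \<Gamma>1) \<and> tracial TYPE('u) (\<Gamma>2 \<circ> \<Gamma>1)) \<and>
       (quantum_tracial TYPE('u) \<Gamma>1 \<and> quantum_tracial TYPE('u) \<Gamma>2 \<longrightarrow>
          perfect_strategy (\<phi>2 \<circ> \<phi>1) (\<Gamma>2 \<circ> \<Gamma>1) \<and> quantum_tracial TYPE('u) (\<Gamma>2 \<circ> \<Gamma>1)) \<and>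
       (locally_tracial TYPE('u) \<Gamma>1 \<and> locally_tracial TYPE('u) \<Gamma>2 \<longrightarrow>
          perfect_strategy (\<phi>2 \<circ> \<phi>1) (\<Gamma>2 \<circ> \<Gamma>1) \<and> locally_tracial TYPE('u) (\<Gamma>2 \<circ> \<Gamma>1)))"
proof (intro conjI allI impI; elim conjE)
  fix \<phi>1 :: "('x \<times> 'y) cmat \<Rightarrow> ('a \<times> 'b) cmat" and \<phi>2 :: "('a \<times> 'b) cmat \<Rightarrow> ('z \<times> 'w) cmat"
    and \<Gamma>1 \<Gamma>2 c
  assume "perfect_strategy \<phi>1 \<Gamma>1" "perfect_strategy \<phi>2 \<Gamma>2"
  then show "perfect_strategy (\<phi>2 \<circ> \<phi>1) (\<Gamma>2 \<circ> \<Gamma>1)" by (rule perfect_strategy_compose)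
  assume "\<Gamma>1 \<in> Q_class TYPE('u) c" "\<Gamma>2 \<in> Q_class TYPE('u) c"
  then show "\<Gamma>2 \<circ> \<Gamma>1 \<in> Q_class TYPE('u) c"
    by (cases c) (simp_all only: Q_class.simps Q_loc_compose Q_q_compose Q_qa_compose Q_qc_compose,
      simp add: Q_ns_def qns_compose)
next
  fix \<phi>1 :: "('x \<times> 'x) cmat \<Rightarrow> ('a \<times> 'a) cmat" and \<phi>2 :: "('a \<times> 'a) cmat \<Rightarrow> ('z \<times> 'z) cmat"
    and \<Gamma>1 \<Gamma>2
  assume "perfect_strategy \<phi>1 \<Gamma>1" "perfect_strategy \<phi>2 \<Gamma>2"
  then show "perfect_strategy (\<phi>2 \<circ> \<phi>1) (\<Gamma>2 \<circ> \<Gamma>1)"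
      "perfect_strategy (\<phi>2 \<circ> \<phi>1) (\<Gamma>2 \<circ> \<Gamma>1)" "perfect_strategy (\<phi>2 \<circ> \<phi>1) (\<Gamma>2 \<circ> \<Gamma>1)"
    by (rule perfect_strategy_compose)+
  show "tracial TYPE('u) (\<Gamma>2 \<circ> \<Gamma>1)" if "tracial TYPE('u) \<Gamma>1" "tracial TYPE('u) \<Gamma>2"
    using that unfolding tracial_def[of _ \<Gamma>1] tracial_def[of _ \<Gamma>2]
    by (elim exE conjE) (rule tracial_over_compose(1))
  show "quantum_tracial TYPE('u) (\<Gamma>2 \<circ> \<Gamma>1)" if "quantum_tracial TYPE('u) \<Gamma>1" "quantum_tracial TYPE('u) \<Gamma>2"
    using that unfolding quantum_tracial_def[of _ \<Gamma>1] quantum_tracial_def[of _ \<Gamma>2]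
    by (elim exE conjE) (rule tracial_over_compose(2))
  show "locally_tracial TYPE('u) (\<Gamma>2 \<circ> \<Gamma>1)" if "locally_tracial TYPE('u) \<Gamma>1" "locally_tracial TYPE('u) \<Gamma>2"
    using that unfolding locally_tracial_def[of _ \<Gamma>1] locally_tracial_def[of _ \<Gamma>2]
    by (elim exE conjE) (rule tracial_over_compose(3))
qed

end
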